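(* Let $u\in V^{\Delta_x}_{0,\underline 0}$ be the exact solution of the heat problem with source $f\in L^2(Q)$ and zero initial data. Let $\lambda,\mu>0$. For any $v\in V^{\nabla_x\partial_t}_{0,\underline 0}$ and $\boldsymbol y\in H^{\mathrm{div}_x,1}(Q)$, and for any $\zeta\in[\tfrac12,+\infty)$, $\epsilon\in[1,+\infty)$ and $\alpha,\beta>0$, the error $e=u-v$ satisfies $$\Big(2-\frac1\zeta\Big)\Big(\lambda\|\nabla_x e\|_Q^2+\mu\|\partial_t e\|_Q^2\Big)+\mu\Big(1-\frac1\epsilon\Big)\|\nabla_x e\|_{\Sigma_T}^2+\lambda\|e\|_{\Sigma_T}^2$$ $$\le\;\epsilon\,\mu\,\|\mathbf r_{\mathrm d}\|_{\Sigma_T}^2+\zeta\Big(\lambda\Big((1+\alpha)\,\overline{\mathrm M}^{\mathrm I}(v,\boldsymbol y;\beta)+\Big(1+\frac1\alpha\Big)\frac{\mu^2}{\lambda^2}\|\partial_t\mathbf r_{\mathrm d}\|_Q^2\Big)+\mu\|\mathbf r_{\mathrm{eq}}\|_Q^2\Big),$$ where $$\overline{\mathrm M}^{\mathrm I}(v,\boldsymbol y;\beta):=(1+\beta)\|\mathbf r_{\mathrm d}\|_Q^2+\Big(1+\frac1\beta\Big)C_{\mathrm F}^2\|\mathbf r_{\mathrm{eq}}\|_Q^2,\qquad \mathbf r_{\mathrm{eq}}:=f-\partial_t v+\mathrm{div}_x\boldsymbol y,\qquad \mathbf r_{\mathrm d}:=\boldsymbol y-\nabla_x v .$$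
   Context: Let $\Omega\subset\mathbb R^d$, $d\in\{1,2,3\}$, be a bounded Lipschitz domain, $0<T<\infty$, $Q=\Omega\times(0,T)$, $\Sigma=\partial\Omega\times(0,T)$, $\Sigma_0=\Omega\times\{0\}$, $\Sigma_T=\Omega\times\{T\}$. The operators $\nabla_x,\Delta_x,\mathrm{div}_x$ act in the spatial variables only. $\|\cdot\|_Q$ and $\|\cdot\|_{\Sigma_T}$ are the $L^2(Q)$- and $L^2(\Sigma_T)$-norms (scalar or vector valued); on $\Sigma_T$ one takes the value at $t=T$. Function spaces (boundary values in the sense of traces): - $H^{1,0}_0(Q)=\{w\in L^2(Q): \nabla_x w\in[L^2(Q)]^d,\ w|_\Sigma=0\}$. - $V^1_0=\{w\in H^1(Q): w|_\Sigma=0\}$. - $V^{\Delta_x}_{0,\underline 0}=\{w\in V^1_0:\ \Delta_x w\in L^2(Q),\ w|_{\Sigma_0}=0\}$. For $w$ in this space the function $t\mapsto\|\nabla_x w(\cdot,t)\|_\Omega^2$ is absolutely continuous on $[0,T]$, so $\|\nabla_x w\|_{\Sigma_T}$ is well defined. - $V^{\nabla_x\partial_t}_{0,\underline 0}=\{w\in V^{\Delta_x}_{0,\underline 0}:\ \nabla_x\partial_t w\in [L^2(Q)]^d\}$. - $H^{\mathrm{div}_x,1}(Q)=\{\boldsymbol y\in[L^2(Q)]^d:\ \mathrm{div}_x\boldsymbol y\in L^2(Q),\ \partial_t\boldsymbol y\in[L^2(Q)]^d\}$. Exact solution: for given $f\in L^2(Q)$, $u\in V^{\Delta_x}_{0,\underline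 0}$ is the unique function with $\partial_t u-\Delta_x u=f$ in $Q$ (so $u=0$ on $\Sigma$ and $u=0$ on $\Sigma_0$). $C_{\mathrm F}>0$ is a constant in the Friedrichs inequality $\|w\|_Q\le C_{\mathrm F}\|\nabla_x w\|_Q$ for all $w\in H^{1,0}_0(Q)$. *)

theory Defs
  imports "HOL-Analysis.Analysis"
begin

section \<open>Domains and the space-time cylinder\<close>

text \<open>
  Locally, up to a choice of the ``vertical'' unit vector \<open>n\<close>, a Lipschitz domain is the set of
  points above the graph of a Lipschitz function defined on the hyperplane orthogonal to \<open>n\<close>.
\<close>

definition lipschitz_boundary :: "'a::euclidean_space set \<Rightarrow> bool" where
  "lipschitz_boundary \<Omega> \<longleftrightarrow>
     (\<forall>p\<in>frontier \<Omega>. \<exists>r>0. \<exists>n. \<exists>\<gamma>::'a \<Rightarrow> real. \<exists>L.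
        norm n = 1 \<and> L-lipschitz_on {z. z \<bullet> n = 0} \<gamma> \<and>
        (\<forall>z\<in>ball p r. z \<in> \<Omega> \<longleftrightarrow> z \<bullet> n > \<gamma> (z - (z \<bullet> n) *\<^sub>R n)))"

definition bounded_lipschitz_domain :: "'a::euclidean_space set \<Rightarrow> bool" where
  "bounded_lipschitz_domain \<Omega> \<longleftrightarrow>
     open \<Omega> \<and> connected \<Omega> \<and> \<Omega> \<noteq> {} \<and> bounded \<Omega> \<and> lipschitz_boundary \<Omega>"

definition cylinder :: "'a::euclidean_space set \<Rightarrow> real \<Rightarrow> ('a \<times> real) set" where
  "cylinder \<Omega> T = \<Omega> \<times> {0<..<T}"

definition lateral :: "'a::euclidean_space set \<Rightarrow> real \<Rightarrow> ('a \<times> real) set" where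
  "lateral \<Omega> T = frontier \<Omega> \<times> {0<..<T}"


section \<open>Square-integrable functions\<close>

text \<open>
  Elements of \<open>L\<^sup>2\<close> are represented by functions; all notions below depend only on their classes
  modulo equality almost everywhere.
\<close>

definition L2 :: "'m measure \<Rightarrow> ('m \<Rightarrow> 'b::euclidean_space) set" where
  "L2 M = {w \<in> borel_measurable M. integrable M (\<lambda>x. (norm (w x))\<^sup>2)}"

definition L2_norm :: "'m measure \<Rightarrow> ('m \<Rightarrow> 'b::euclidean_space) \<Rightarrow> real" where
  "L2_norm M w = sqrt (\<integral>x. (norm (w x))\<^sup>2 \<partial>M)"

definition L2_lim ::
  "'m measure \<Rightarrow> (nat \<Rightarrow> 'm \<Rightarrow> 'b::euclidean_space) \<Rightarrow> ('m \<Rightarrow> 'b) \<Rightarrow> bool" where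
  "L2_lim M \<phi> w \<longleftrightarrow>
     (\<forall>n. (\<lambda>x. \<phi> n x - w x) \<in> L2 M) \<and> (\<lambda>n. L2_norm M (\<lambda>x. \<phi> n x - w x)) \<longlonglongrightarrow> 0"


section \<open>Smooth functions and weak derivatives\<close>

definition dir_deriv ::
  "'e::euclidean_space \<Rightarrow> ('e \<Rightarrow> 'b::euclidean_space) \<Rightarrow> 'e \<Rightarrow> 'b" where
  "dir_deriv b \<phi> p = frechet_derivative \<phi> (at p) b"

primrec Ck :: "nat \<Rightarrow> ('e::euclidean_space \<Rightarrow> 'b::euclidean_space) \<Rightarrow> bool" where
  "Ck 0 \<phi> \<longleftrightarrow> continuous_on UNIV \<phi>"
| "Ck (Suc k) \<phi> \<longleftrightarrow> (\<forall>p. \<phi> differentiable (at p)) \<and> (\<forall>b\<in>Basis. Ck k (dir_deriv b \<phi>))"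

definition smooth :: "('e::euclidean_space \<Rightarrow> 'b::euclidean_space) \<Rightarrow> bool" where
  "smooth \<phi> \<longleftrightarrow> (\<forall>k. Ck k \<phi>)"

definition test_functions :: "'e::euclidean_space set \<Rightarrow> ('e \<Rightarrow> real) set" where
  "test_functions Q = {\<phi>. smooth \<phi> \<and> (\<exists>K. compact K \<and> K \<subseteq> Q \<and> (\<forall>p. p \<notin> K \<longrightarrow> \<phi> p = 0))}"

text \<open>
  In the relations below \<open>Q\<close> is an open subset of space-time and all functions are understood to be
  in \<open>L\<^sup>2(Q)\<close>, so that all integrals exist; a space-time vector \<open>(i, 0)\<close> is a spatial direction
  and \<open>(0, 1)\<close> is the direction of time.
\<close>

definition has_weak_dt ::
  "('a::euclidean_space \<times> real) set \<Rightarrow> ('a \<times> real \<Rightarrow> 'b::euclidean_space) \<Rightarrow>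
   ('a \<times> real \<Rightarrow> 'b) \<Rightarrow> bool" where
  "has_weak_dt Q w g \<longleftrightarrow>
     (\<forall>\<phi>\<in>test_functions Q.
        (\<integral>p. dir_deriv (0, 1) \<phi> p *\<^sub>R w p \<partial>lebesgue_on Q) = - (\<integral>p. \<phi> p *\<^sub>R g p \<partial>lebesgue_on Q))"

definition has_weak_grad_x ::
  "('a::euclidean_space \<times> real) set \<Rightarrow> ('a \<times> real \<Rightarrow> real) \<Rightarrow> ('a \<times> real \<Rightarrow> 'a) \<Rightarrow> bool" where
  "has_weak_grad_x Q w G \<longleftrightarrow>
     (\<forall>\<phi>\<in>test_functions Q. \<forall>i\<in>Basis.
        (\<integral>p. dir_deriv (i, 0) \<phi> p * w p \<partial>lebesgue_on Q) = - (\<integral>p. \<phi> p * (G p \<bullet> i) \<partial>lebesgue_on Q))"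

definition has_weak_div_x ::
  "('a::euclidean_space \<times> real) set \<Rightarrow> ('a \<times> real \<Rightarrow> 'a) \<Rightarrow> ('a \<times> real \<Rightarrow> real) \<Rightarrow> bool" where
  "has_weak_div_x Q y D \<longleftrightarrow>
     (\<forall>\<phi>\<in>test_functions Q.
        (\<integral>p. (\<Sum>i\<in>Basis. dir_deriv (i, 0) \<phi> p * (y p \<bullet> i)) \<partial>lebesgue_on Q) =
          - (\<integral>p. \<phi> p * D p \<partial>lebesgue_on Q))"

text \<open>
  The operators pick some representative of the weak derivative, which is unique up to equality
  almost everywhere; they are only meaningful where an \<open>L\<^sup>2\<close> weak derivative exists.
\<close>

definition dt ::
  "('a::euclidean_space \<times> real) set \<Rightarrow> ('a \<times> real \<Rightarrow> 'b::euclidean_space) \<Rightarrow> 'a \<times> real \<Rightarrow> 'b" where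
  "dt Q w = (SOME g. g \<in> L2 (lebesgue_on Q) \<and> has_weak_dt Q w g)"

definition grad_x ::
  "('a::euclidean_space \<times> real) set \<Rightarrow> ('a \<times> real \<Rightarrow> real) \<Rightarrow> 'a \<times> real \<Rightarrow> 'a" where
  "grad_x Q w = (SOME G. G \<in> L2 (lebesgue_on Q) \<and> has_weak_grad_x Q w G)"

definition div_x ::
  "('a::euclidean_space \<times> real) set \<Rightarrow> ('a \<times> real \<Rightarrow> 'a) \<Rightarrow> 'a \<times> real \<Rightarrow> real" where
  "div_x Q y = (SOME D. D \<in> L2 (lebesgue_on Q) \<and> has_weak_div_x Q y D)"

definition laplace_x ::
  "('a::euclidean_space \<times> real) set \<Rightarrow> ('a \<times> real \<Rightarrow> real) \<Rightarrow> 'a \<times> real \<Rightarrow> real" where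
  "laplace_x Q w = div_x Q (grad_x Q w)"

text \<open>The spaces \<open>{w \<in> L\<^sup>2(Q). \<partial>\<^sub>t w \<in> L\<^sup>2(Q)}\<close>, and likewise for the other operators.\<close>

definition H_dt ::
  "('a::euclidean_space \<times> real) set \<Rightarrow> ('a \<times> real \<Rightarrow> 'b::euclidean_space) set" where
  "H_dt Q = {w \<in> L2 (lebesgue_on Q). \<exists>g \<in> L2 (lebesgue_on Q). has_weak_dt Q w g}"

definition H_grad_x :: "('a::euclidean_space \<times> real) set \<Rightarrow> ('a \<times> real \<Rightarrow> real) set" where
  "H_grad_x Q = {w \<in> L2 (lebesgue_on Q). \<exists>G \<in> L2 (lebesgue_on Q). has_weak_grad_x Q w G}"

definition H_div_x :: "('a::euclidean_space \<times> real) set \<Rightarrow> ('a \<times> real \<Rightarrow> 'a) set" where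
  "H_div_x Q = {y \<in> L2 (lebesgue_on Q). \<exists>D \<in> L2 (lebesgue_on Q). has_weak_div_x Q y D}"


section \<open>Surface measure\<close>

text \<open>
  The \<open>s\<close>-dimensional Hausdorff measure, normalised so that it agrees with Lebesgue measure when
  \<open>s\<close> is the dimension of the space. Sets that are not admitted in a cover at scale \<open>\<delta>\<close> get
  weight \<open>\<infinity>\<close>. The library's \<^const>\<open>outer_measure\<close> uses disjoint covers only, which makes no
  difference here because the weight is monotone and every set may be used in a cover.
\<close>

definition hausdorff_weight :: "nat \<Rightarrow> real \<Rightarrow> 'e::euclidean_space set \<Rightarrow> ennreal" where
  "hausdorff_weight s \<delta> C =
     (if C = {} then 0
      else if bounded C \<and> diameter C \<le> \<delta> then ennreal (unit_ball_vol (real s) * (diameter C / 2) ^ s)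
      else \<infinity>)"

definition hausdorff_outer :: "nat \<Rightarrow> 'e::euclidean_space set \<Rightarrow> ennreal" where
  "hausdorff_outer s A = (SUP \<delta>\<in>{0<..}. outer_measure UNIV (hausdorff_weight s \<delta>) A)"

definition hausdorff_measure :: "nat \<Rightarrow> 'e::euclidean_space measure" where
  "hausdorff_measure s = measure_of UNIV (sets borel) (hausdorff_outer s)"

text \<open>The outer measure is a measure on the Borel sets (Caratheodory's criterion).\<close>

lemma unit_ball_weight_mono:
  assumes "0 \<le> a" "a \<le> b"
  shows "ennreal (unit_ball_vol (real s) * (a / 2) ^ s) \<le> ennreal (unit_ball_vol (real s) * (b / 2) ^ s)"
  using assms by (intro ennreal_leI mult_left_mono power_mono) (auto intro: less_imp_le)

lemma increasing_hausdorff_weight: "increasing UNIV (hausdorff_weight s \<delta>)"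
unfolding increasing_def
proof (intro ballI impI)
  fix A B :: "'e::euclidean_space set"
  assume AB: "A \<subseteq> B"
  show "hausdorff_weight s \<delta> A \<le> hausdorff_weight s \<delta> B"
  proof (cases "A \<noteq> {} \<and> bounded B \<and> diameter B \<le> \<delta>")
    case True
    then have "bounded A" "diameter A \<le> diameter B"
      using AB bounded_subset diameter_subset by blast+
    moreover have "hausdorff_weight s \<delta> A \<le> ennreal (unit_ball_vol (real s) * (diameter B / 2) ^ s)"
      using calculation True unit_ball_weight_mono[of "diameter A" "diameter B" s]
      by (auto simp: hausdorff_weight_def diameter_ge_0)
    ultimately show ?thesis
      using True AB by (auto simp: hausdorff_weight_def)
  qed (use AB in \<open>auto simp: hausdorff_weight_def\<close>)
qed

lemma hausdorff_weight_empty [simp]: "hausdorff_weight s \<delta> {} = 0"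
  by (simp add: hausdorff_weight_def)

lemma positive_hausdorff_weight: "positive UNIV (hausdorff_weight s \<delta>)"
  by (simp add: positive_def)

lemma outer_measure_space_hausdorff_premeasure:
  "outer_measure_space UNIV (outer_measure UNIV (hausdorff_weight s \<delta> :: 'e::euclidean_space set \<Rightarrow> _))"
proof -
  interpret ring_of_sets "UNIV :: 'e set" UNIV
    by (metis Pow_UNIV ring_of_sets_Pow)
  show ?thesis
    using outer_measure_space_outer_measure[OF positive_hausdorff_weight increasing_hausdorff_weight]
    by simp
qed

lemma hausdorff_premeasure_antimono:
  assumes "\<delta> \<le> \<delta>'"
  shows "outer_measure UNIV (hausdorff_weight s \<delta>') A \<le> outer_measure UNIV (hausdorff_weight s \<delta>) A"
  unfolding outer_measure_def
proof (intro INF_superset_mono suminf_le)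
  fix X :: "nat \<Rightarrow> 'a set" and n
  show "hausdorff_weight s \<delta>' (X n) \<le> hausdorff_weight s \<delta> (X n)"
    using assms by (auto simp: hausdorff_weight_def)
qed auto

lemma outer_measure_space_hausdorff_outer:
  "outer_measure_space UNIV (hausdorff_outer s :: 'e::euclidean_space set \<Rightarrow> _)"
proof -
  note pre = outer_measure_space_hausdorff_premeasure[unfolded outer_measure_space_def, of s]
  have "positive UNIV (hausdorff_outer s :: 'e set \<Rightarrow> _)"
    using pre unfolding positive_def hausdorff_outer_def by (auto intro!: SUP_eq_const)
  moreover have "increasing UNIV (hausdorff_outer s :: 'e set \<Rightarrow> _)"
    unfolding hausdorff_outer_def
    by (auto simp: increasing_def intro!: SUP_mono') (use pre in \<open>auto simp: increasing_def\<close>)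
  moreover have "countably_subadditive UNIV (hausdorff_outer s :: 'e set \<Rightarrow> _)"
    unfolding countably_subadditive_def
  proof (intro allI impI)
    fix A :: "nat \<Rightarrow> 'e set"
    assume dis: "disjoint_family A"
    show "hausdorff_outer s (\<Union>i. A i) \<le> (\<Sum>i. hausdorff_outer s (A i))"
      unfolding hausdorff_outer_def
    proof (intro SUP_least)
      fix \<delta> :: real
      assume "\<delta> \<in> {0<..}"
      have "outer_measure UNIV (hausdorff_weight s \<delta>) (\<Union>i. A i)
          \<le> (\<Sum>i. outer_measure UNIV (hausdorff_weight s \<delta>) (A i))"
        using pre[of \<delta>] dis unfolding countably_subadditive_def by auto
      also have "\<dots> \<le> (\<Sum>i. SUP \<delta>\<in>{0<..}. outer_measure UNIV (hausdorff_weight s \<delta>) (A i))"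
        using \<open>\<delta> \<in> {0<..}\<close> by (intro suminf_le SUP_upper) auto
      finally show "outer_measure UNIV (hausdorff_weight s \<delta>) (\<Union>i. A i) \<le> \<dots>" .
    qed
  qed
  ultimately show ?thesis
    by (simp add: outer_measure_space_def)
qed

lemma hausdorff_outer_mono: "A \<subseteq> B \<Longrightarrow> hausdorff_outer s A \<le> hausdorff_outer s B"
  using outer_measure_space_hausdorff_outer[of s]
  by (auto simp: outer_measure_space_def increasing_def)

lemma hausdorff_outer_empty [simp]: "hausdorff_outer s {} = 0"
  using outer_measure_space_hausdorff_outer[of s]
  by (auto simp: outer_measure_space_def positive_def)

lemma hausdorff_outer_Un: "hausdorff_outer s (A \<union> B) \<le> hausdorff_outer s A + hausdorff_outer s B"
proof -
  interpret ring_of_sets "UNIV :: 'a set" UNIV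
    by (metis Pow_UNIV ring_of_sets_Pow)
  have sub: "subadditive UNIV (hausdorff_outer s :: 'a set \<Rightarrow> _)"
    using outer_measure_space_hausdorff_outer[of s]
    by (intro countably_subadditive_subadditive) (auto simp: outer_measure_space_def)
  have "hausdorff_outer s (A \<union> (B - A)) \<le> hausdorff_outer s A + hausdorff_outer s (B - A)"
    using sub by (intro subadditiveD) auto
  also have "\<dots> \<le> hausdorff_outer s A + hausdorff_outer s B"
    by (intro add_left_mono hausdorff_outer_mono) auto
  finally show ?thesis by simp
qed

lemma hausdorff_outer_UN: "hausdorff_outer s (\<Union>i. A i) \<le> (\<Sum>i. hausdorff_outer s (A i))"
proof -
  have "hausdorff_outer s (\<Union>i. disjointed A i) \<le> (\<Sum>i. hausdorff_outer s (disjointed A i))"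
    using outer_measure_space_hausdorff_outer[of s] disjoint_family_disjointed[of A]
    unfolding outer_measure_space_def countably_subadditive_def by blast
  also have "\<dots> \<le> (\<Sum>i. hausdorff_outer s (A i))"
    by (intro suminf_le hausdorff_outer_mono disjointed_subset) auto
  finally show ?thesis by (simp add: UN_disjointed_eq)
qed

lemma hausdorff_outer_separated:
  fixes A B :: "'e::euclidean_space set"
  assumes r: "0 < r" and AB: "\<And>a b. a \<in> A \<Longrightarrow> b \<in> B \<Longrightarrow> r \<le> dist a b"
  shows "hausdorff_outer s A + hausdorff_outer s B \<le> hausdorff_outer s (A \<union> B)"
proof -
  interpret ring_of_sets "UNIV :: 'e set" UNIV
    by (metis Pow_UNIV ring_of_sets_Pow)
  let ?P = "\<lambda>\<delta>. outer_measure UNIV (hausdorff_weight s \<delta>) :: 'e set \<Rightarrow> _"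
  have small: "?P \<delta> A + ?P \<delta> B \<le> ?P \<delta> (A \<union> B)" if \<delta>: "0 < \<delta>" "\<delta> < r" for \<delta>
    unfolding outer_measure_def[of UNIV "hausdorff_weight s \<delta>" "A \<union> B"]
  proof (safe intro!: INF_greatest)
    fix X :: "nat \<Rightarrow> 'e set"
    assume X: "A \<union> B \<subseteq> (\<Union>i. X i)"
    have le: "hausdorff_weight s \<delta> (X i \<inter> A) + hausdorff_weight s \<delta> (X i \<inter> B) \<le> hausdorff_weight s \<delta> (X i)" for i
    proof (cases "X i \<inter> A = {} \<or> X i \<inter> B = {}")
      case True
      then show ?thesis
        using increasingD[OF increasing_hausdorff_weight[of s \<delta>], of "X i \<inter> A" "X i"]
          increasingD[OF increasing_hausdorff_weight[of s \<delta>], of "X i \<inter> B" "X i"] by auto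
    next
      case False
      then obtain a b where ab: "a \<in> X i" "a \<in> A" "b \<in> X i" "b \<in> B" by auto
      have "\<not> (bounded (X i) \<and> diameter (X i) \<le> \<delta>)"
        using diameter_bounded_bound[of "X i" a b] ab AB[of a b] \<delta> by force
      then show ?thesis
        using ab by (auto simp: hausdorff_weight_def)
    qed
    have "?P \<delta> A + ?P \<delta> B \<le> (\<Sum>i. hausdorff_weight s \<delta> (X i \<inter> A)) + (\<Sum>i. hausdorff_weight s \<delta> (X i \<inter> B))"
      using X by (intro add_mono outer_measure_le positive_hausdorff_weight increasing_hausdorff_weight) auto
    also have "\<dots> = (\<Sum>i. hausdorff_weight s \<delta> (X i \<inter> A) + hausdorff_weight s \<delta> (X i \<inter> B))"
      by (intro suminf_add) auto
    also have "\<dots> \<le> (\<Sum>i. hausdorff_weight s \<delta> (X i))"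
      by (intro suminf_le le) auto
    finally show "?P \<delta> A + ?P \<delta> B \<le> (\<Sum>i. hausdorff_weight s \<delta> (X i))" .
  qed
  have "?P \<delta> A + ?P \<delta>' B \<le> hausdorff_outer s (A \<union> B)" if "0 < \<delta>" "0 < \<delta>'" for \<delta> \<delta>'
  proof -
    define d where "d = min (r / 2) (min \<delta> \<delta>')"
    have d: "0 < d" "d < r" "d \<le> \<delta>" "d \<le> \<delta>'"
      using that r by (auto simp: d_def)
    have "?P \<delta> A + ?P \<delta>' B \<le> ?P d A + ?P d B"
      using d by (intro add_mono hausdorff_premeasure_antimono) auto
    also have "\<dots> \<le> ?P d (A \<union> B)"
      using small d by auto
    also have "\<dots> \<le> hausdorff_outer s (A \<union> B)"
      unfolding hausdorff_outer_def using d by (intro SUP_upper) auto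
    finally show ?thesis .
  qed
  then have "(SUP \<delta>\<in>{0<..}. SUP \<delta>'\<in>{0<..}. ?P \<delta> A + ?P \<delta>' B) \<le> hausdorff_outer s (A \<union> B)"
    by (intro SUP_least) auto
  also have "(SUP \<delta>\<in>{0<..}. SUP \<delta>'\<in>{0<..}. ?P \<delta> A + ?P \<delta>' B) = hausdorff_outer s A + hausdorff_outer s B"
    unfolding hausdorff_outer_def
    by (simp add: ennreal_SUP_add_right[symmetric] ennreal_SUP_add_left)
  finally show ?thesis .
qed

lemma hausdorff_outer_closed_le:
  fixes F X :: "'e::euclidean_space set"
  assumes F: "closed F" "F \<noteq> {}" and fin: "hausdorff_outer s X < \<infinity>"
  shows "hausdorff_outer s (X \<inter> F) + hausdorff_outer s (X - F) \<le> hausdorff_outer s X"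
proof -
  let ?H = "hausdorff_outer s :: 'e set \<Rightarrow> ennreal"
  define Y where "Y n = {x \<in> X. 1 / real (Suc n) \<le> infdist x F}" for n
  define R where "R n = Y (Suc n) - Y n" for n
  have Y_mono: "Y m \<subseteq> Y n" if "m \<le> n" for m n
  proof -
    have "1 / real (Suc n) \<le> 1 / real (Suc m)"
      using that by (intro divide_left_mono) auto
    then show ?thesis by (auto simp: Y_def)
  qed
  have XF: "X - F = (\<Union>n. Y n)"
  proof (intro set_eqI iffI)
    fix x assume x: "x \<in> X - F"
    then have "infdist x F > 0"
      using F in_closed_iff_infdist_zero[of F x] infdist_nonneg[of x F] by fastforce
    then obtain n where "1 / real (Suc n) < infdist x F"
      using nat_approx_posE by blast
    with x show "x \<in> (\<Union>n. Y n)" by (auto simp: Y_def intro!: exI[of _ n])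
  next
    fix x assume "x \<in> (\<Union>n. Y n)"
    then obtain n where "x \<in> X" and n: "1 / real (Suc n) \<le> infdist x F"
      by (auto simp: Y_def)
    have "0 < 1 / real (Suc n)" by simp
    with n have "infdist x F \<noteq> 0" by linarith
    with \<open>x \<in> X\<close> show "x \<in> X - F" by auto
  qed
  have Y_le: "?H (X \<inter> F) + ?H (Y n) \<le> ?H X" for n
  proof -
    have "?H (X \<inter> F) + ?H (Y n) \<le> ?H (X \<inter> F \<union> Y n)"
    proof (rule hausdorff_outer_separated[of "1 / real (Suc n)"])
      fix a b assume "a \<in> X \<inter> F" "b \<in> Y n"
      then show "1 / real (Suc n) \<le> dist a b"
        using infdist_le[of a F b] by (auto simp: Y_def dist_commute)
    qed auto
    also have "\<dots> \<le> ?H X"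
      by (intro hausdorff_outer_mono) (auto simp: Y_def)
    finally show ?thesis .
  qed
  have R_sep: "?H A + ?H (R n) \<le> ?H (A \<union> R n)" if A: "A \<subseteq> Y (n - 1)" "n \<noteq> 0" for A n
  proof (rule hausdorff_outer_separated[of "1 / real n - 1 / real (Suc n)"])
    show "0 < 1 / real n - 1 / real (Suc n)"
      using \<open>n \<noteq> 0\<close> by (simp add: divide_strict_left_mono)
    fix a b assume "a \<in> A" "b \<in> R n"
    then have "1 / real n \<le> infdist a F" "infdist b F < 1 / real (Suc n)"
      using A by (auto simp: Y_def R_def)
    moreover have "infdist a F \<le> infdist b F + dist a b"
      by (rule infdist_triangle)
    ultimately show "1 / real n - 1 / real (Suc n) \<le> dist a b" by linarith
  qed
  have sum_Un: "(\<Sum>k<n. ?H (R (2 * k + j))) \<le> ?H (\<Union>k<n. R (2 * k + j))" for n j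
  proof (induction n)
    case (Suc n)
    show ?case
    proof (cases "n = 0")
      case False
      have "R (2 * k + j) \<subseteq> Y (2 * n + j - 1)" if "k < n" for k
      proof -
        have "Suc (2 * k + j) \<le> 2 * n + j - 1" using that by linarith
        then show ?thesis using Y_mono by (auto simp: R_def)
      qed
      then have "?H (\<Union>k<n. R (2 * k + j)) + ?H (R (2 * n + j))
          \<le> ?H ((\<Union>k<n. R (2 * k + j)) \<union> R (2 * n + j))"
        using False by (intro R_sep) auto
      moreover have "(\<Union>k<Suc n. R (2 * k + j)) = (\<Union>k<n. R (2 * k + j)) \<union> R (2 * n + j)"
        by (auto simp: lessThan_Suc)
      ultimately show ?thesis
        using order_trans[OF add_right_mono[OF Suc.IH]] by (simp only: sum.lessThan_Suc)
    qed (auto simp: lessThan_Suc)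
  qed auto
  have sum_X: "(\<Sum>k<n. ?H (R (2 * k + j))) \<le> ?H X" for n j
    by (rule order_trans[OF sum_Un hausdorff_outer_mono]) (auto simp: R_def Y_def)
  have "(\<Sum>k<n. ?H (R k)) \<le> ?H X + ?H X" for n
  proof -
    have "(\<Sum>k<n. ?H (R k)) \<le> (\<Sum>k<2 * n. ?H (R k))"
      by (intro sum_mono2) auto
    also have "\<dots> = (\<Sum>k<n. ?H (R (2 * k + 0))) + (\<Sum>k<n. ?H (R (2 * k + 1)))"
      by (induction n) (auto simp: algebra_simps)
    also have "\<dots> \<le> ?H X + ?H X"
      by (intro add_mono sum_X)
    finally show ?thesis .
  qed
  then have "(\<Sum>k. ?H (R k)) \<le> ?H X + ?H X"
    by (intro suminf_le_const) auto
  then have sum_fin: "(\<Sum>k. ?H (R k)) \<noteq> \<infinity>"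
    using fin by (auto simp: top_unique)
  have R_fin: "?H (R k) \<noteq> \<infinity>" for k
  proof -
    have "R k \<subseteq> X" by (auto simp: R_def Y_def)
    then show ?thesis
      using fin hausdorff_outer_mono[of "R k" X s] by (auto simp: top_unique)
  qed
  define g where "g k = enn2real (?H (R k))" for k
  have g: "ennreal (g k) = ?H (R k)" "0 \<le> g k" for k
    using R_fin by (auto simp: g_def less_top)
  have "summable g"
    using g sum_fin by (intro summable_suminf_not_top) auto
  show ?thesis
  proof (rule ennreal_le_epsilon)
    fix \<epsilon> :: real assume "0 < \<epsilon>"
    then obtain n where n: "norm (\<Sum>i. g (i + n)) < \<epsilon>"
      using suminf_exist_split[OF _ \<open>summable g\<close>] by blast
    have "X - F \<subseteq> Y n \<union> (\<Union>i. R (i + n))"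
    proof
      fix x assume "x \<in> X - F"
      then have ex: "\<exists>m. x \<in> Y m" unfolding XF by auto
      define m where "m = (LEAST m. x \<in> Y m)"
      have m: "x \<in> Y m" "\<And>k. k < m \<Longrightarrow> x \<notin> Y k"
        using LeastI_ex[OF ex] not_less_Least by (auto simp: m_def)
      show "x \<in> Y n \<union> (\<Union>i. R (i + n))"
      proof (cases "m \<le> n")
        case True
        then show ?thesis using Y_mono m by blast
      next
        case False
        then have "x \<in> R (m - 1 - n + n)" using m by (auto simp: R_def)
        then show ?thesis by blast
      qed
    qed
    then have "?H (X - F) \<le> ?H (Y n) + ?H (\<Union>i. R (i + n))"
      by (rule order_trans[OF hausdorff_outer_mono hausdorff_outer_Un])
    also have "?H (\<Union>i. R (i + n)) \<le> (\<Sum>i. ?H (R (i + n)))"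
      by (rule hausdorff_outer_UN)
    also have "\<dots> = ennreal (\<Sum>i. g (i + n))"
      using \<open>summable g\<close> g by (subst suminf_ennreal2[symmetric]) auto
    also have "\<dots> \<le> ennreal \<epsilon>"
      using n by (intro ennreal_leI) auto
    finally have "?H (X - F) \<le> ?H (Y n) + ennreal \<epsilon>"
      by (auto simp: add_left_mono)
    then have "?H (X \<inter> F) + ?H (X - F) \<le> ?H (X \<inter> F) + ?H (Y n) + ennreal \<epsilon>"
      by (metis add.assoc add_left_mono)
    also have "\<dots> \<le> ?H X + ennreal \<epsilon>"
      by (intro add_right_mono Y_le)
    finally show "?H (X \<inter> F) + ?H (X - F) \<le> ?H X + ennreal \<epsilon>" .
  qed
qed

lemma measure_space_hausdorff: "measure_space UNIV (sets borel) (hausdorff_outer s)"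
proof -
  interpret sigma_algebra "UNIV :: 'a set" UNIV
    by (metis Pow_UNIV sigma_algebra_Pow)
  let ?L = "lambda_system UNIV UNIV (hausdorff_outer s :: 'a set \<Rightarrow> _)"
  have L: "measure_space UNIV ?L (hausdorff_outer s)"
    by (rule caratheodory_lemma[OF outer_measure_space_hausdorff_outer])
  have "F \<in> ?L" if F: "closed F" for F :: "'a set"
  proof -
    have "hausdorff_outer s (X \<inter> F) + hausdorff_outer s (X - F) = hausdorff_outer s X" for X
    proof (rule antisym)
      show "hausdorff_outer s (X \<inter> F) + hausdorff_outer s (X - F) \<le> hausdorff_outer s X"
        using hausdorff_outer_closed_le[OF F, of s X]
        by (cases "F = {}"; cases "hausdorff_outer s X = \<infinity>") (auto simp: less_top)
      show "hausdorff_outer s X \<le> hausdorff_outer s (X \<inter> F) + hausdorff_outer s (X - F)"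
        using hausdorff_outer_Un[of s "X \<inter> F" "X - F"] by (simp add: Int_Diff_Un)
    qed
    then show ?thesis
      by (simp add: lambda_system_eq)
  qed
  then have "sigma_sets UNIV (Collect closed) \<subseteq> ?L"
    using L by (intro sigma_algebra.sigma_sets_subset) (auto simp: measure_space_def)
  then have sub: "sets (borel :: 'a measure) \<subseteq> ?L"
    by (simp add: borel_eq_closed)
  show ?thesis
    using L sub sets.sigma_algebra_axioms[of "borel :: 'a measure"]
    unfolding measure_space_def positive_def countably_additive_def
    by (auto 4 4)
qed

lemma space_hausdorff_measure [simp]: "space (hausdorff_measure s) = UNIV"
  by (simp add: hausdorff_measure_def space_measure_of_conv)

lemma sets_hausdorff_measure [simp]: "sets (hausdorff_measure s) = sets borel"
  using sets.sigma_sets_eq[of borel] by (simp add: hausdorff_measure_def sets_measure_of_conv)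

lemma emeasure_hausdorff_measure:
  assumes "A \<in> sets borel"
  shows "emeasure (hausdorff_measure s) A = hausdorff_outer s A"
  using assms measure_space_hausdorff[of s]
  by (intro emeasure_measure_of[OF hausdorff_measure_def]) (auto simp: measure_space_def)

definition surface_measure :: "'a::euclidean_space set \<Rightarrow> real \<Rightarrow> ('a \<times> real) measure" where
  "surface_measure \<Omega> T =
     restrict_space (hausdorff_measure DIM('a)) (lateral \<Omega> T)"


section \<open>Traces\<close>

text \<open>
  The trace operators are the continuous extensions (in the graph norm of the derivatives involved)
  of the restriction of functions that are smooth up to the boundary: \<open>g\<close> is the trace of \<open>w\<close> iff
  some sequence of smooth functions converges to \<open>w\<close> and its restrictions converge to \<open>g\<close> in
  \<open>L\<^sup>2\<close> of the part of the boundary under consideration.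
\<close>

definition has_lateral_trace ::
  "'a::euclidean_space set \<Rightarrow> real \<Rightarrow> ('a \<times> real \<Rightarrow> real) \<Rightarrow> ('a \<times> real \<Rightarrow> real) \<Rightarrow> bool" where
  "has_lateral_trace \<Omega> T w g \<longleftrightarrow>
     g \<in> L2 (surface_measure \<Omega> T) \<and>
     (\<exists>\<phi>. (\<forall>n. smooth (\<phi> n)) \<and>
        L2_lim (lebesgue_on (cylinder \<Omega> T)) \<phi> w \<and>
        L2_lim (lebesgue_on (cylinder \<Omega> T))
          (\<lambda>n p. \<Sum>i\<in>Basis. dir_deriv (i, 0) (\<phi> n) p *\<^sub>R i) (grad_x (cylinder \<Omega> T) w) \<and>
        L2_lim (surface_measure \<Omega> T) \<phi> g)"

text \<open>
  Traces on the slice \<open>\<Omega> \<times> {s}\<close>, which is identified with \<open>\<Omega>\<close>.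
\<close>

definition has_time_trace ::
  "'a::euclidean_space set \<Rightarrow> real \<Rightarrow> real \<Rightarrow> ('a \<times> real \<Rightarrow> 'b::euclidean_space) \<Rightarrow> ('a \<Rightarrow> 'b) \<Rightarrow> bool"
  where
  "has_time_trace \<Omega> T s w g \<longleftrightarrow>
     g \<in> L2 (lebesgue_on \<Omega>) \<and>
     (\<exists>\<phi>. (\<forall>n. smooth (\<phi> n)) \<and>
        L2_lim (lebesgue_on (cylinder \<Omega> T)) \<phi> w \<and>
        L2_lim (lebesgue_on (cylinder \<Omega> T)) (\<lambda>n. dir_deriv (0, 1) (\<phi> n)) (dt (cylinder \<Omega> T) w) \<and>
        L2_lim (lebesgue_on \<Omega>) (\<lambda>n x. \<phi> n (x, s)) g)"

definition norm_Q ::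
  "'a::euclidean_space set \<Rightarrow> real \<Rightarrow> ('a \<times> real \<Rightarrow> 'b::euclidean_space) \<Rightarrow> real" where
  "norm_Q \<Omega> T w = L2_norm (lebesgue_on (cylinder \<Omega> T)) w"

definition norm_\<Sigma>T ::
  "'a::euclidean_space set \<Rightarrow> real \<Rightarrow> ('a \<times> real \<Rightarrow> 'b::euclidean_space) \<Rightarrow> real" where
  "norm_\<Sigma>T \<Omega> T w = L2_norm (lebesgue_on \<Omega>) (SOME g. has_time_trace \<Omega> T T w g)"

text \<open>
  \<open>grad_norm_\<Sigma>T\<close> is the norm on the final slice of the spatial gradient of a function \<open>w\<close> with
  square-integrable \<open>\<partial>\<^sub>t w\<close> and \<open>\<Delta>\<^sub>x w\<close>. The gradient itself need not have a weak time derivative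
  in \<open>L\<^sup>2\<close>, but the function mapping \<open>t\<close> to the squared norm of the gradient at time \<open>t\<close> is almost
  everywhere equal to an absolutely continuous function on \<open>[0, T]\<close>, the value of which is taken
  at \<open>T\<close>. As continuous representatives are unique, only continuity is mentioned.
\<close>

definition grad_norm_\<Sigma>T :: "'a::euclidean_space set \<Rightarrow> real \<Rightarrow> ('a \<times> real \<Rightarrow> real) \<Rightarrow> real" where
  "grad_norm_\<Sigma>T \<Omega> T w =
     sqrt (THE c. \<exists>N. continuous_on {0..T} N \<and>
       (AE t in lebesgue_on {0<..<T}.
          N t = (L2_norm (lebesgue_on \<Omega>) (\<lambda>x. grad_x (cylinder \<Omega> T) w (x, t)))\<^sup>2) \<and>
       c = N T)"


section \<open>Function spaces\<close>

definition H10_0 :: "'a::euclidean_space set \<Rightarrow> real \<Rightarrow> ('a \<times> real \<Rightarrow> real) set" where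
  "H10_0 \<Omega> T = {w \<in> H_grad_x (cylinder \<Omega> T). has_lateral_trace \<Omega> T w (\<lambda>_. 0)}"

definition V1_0 :: "'a::euclidean_space set \<Rightarrow> real \<Rightarrow> ('a \<times> real \<Rightarrow> real) set" where
  "V1_0 \<Omega> T =
     {w \<in> H_grad_x (cylinder \<Omega> T) \<inter> H_dt (cylinder \<Omega> T). has_lateral_trace \<Omega> T w (\<lambda>_. 0)}"

definition V_laplace :: "'a::euclidean_space set \<Rightarrow> real \<Rightarrow> ('a \<times> real \<Rightarrow> real) set" where
  "V_laplace \<Omega> T =
     {w \<in> V1_0 \<Omega> T. grad_x (cylinder \<Omega> T) w \<in> H_div_x (cylinder \<Omega> T) \<and>
        has_time_trace \<Omega> T 0 w (\<lambda>_. 0)}"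

definition V_grad_dt :: "'a::euclidean_space set \<Rightarrow> real \<Rightarrow> ('a \<times> real \<Rightarrow> real) set" where
  "V_grad_dt \<Omega> T = {w \<in> V_laplace \<Omega> T. dt (cylinder \<Omega> T) w \<in> H_grad_x (cylinder \<Omega> T)}"

definition H_div_1 :: "'a::euclidean_space set \<Rightarrow> real \<Rightarrow> ('a \<times> real \<Rightarrow> 'a) set" where
  "H_div_1 \<Omega> T = H_div_x (cylinder \<Omega> T) \<inter> H_dt (cylinder \<Omega> T)"


section \<open>The heat problem and the error majorant\<close>

definition heat_solution ::
  "'a::euclidean_space set \<Rightarrow> real \<Rightarrow> ('a \<times> real \<Rightarrow> real) \<Rightarrow> ('a \<times> real \<Rightarrow> real) \<Rightarrow> bool" where
  "heat_solution \<Omega> T f u \<longleftrightarrow>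
     u \<in> V_laplace \<Omega> T \<and>
     (AE p in lebesgue_on (cylinder \<Omega> T).
        dt (cylinder \<Omega> T) u p - laplace_x (cylinder \<Omega> T) u p = f p)"

definition friedrichs_constant :: "'a::euclidean_space set \<Rightarrow> real \<Rightarrow> real \<Rightarrow> bool" where
  "friedrichs_constant \<Omega> T C \<longleftrightarrow>
     C > 0 \<and> (\<forall>w\<in>H10_0 \<Omega> T. norm_Q \<Omega> T w \<le> C * norm_Q \<Omega> T (grad_x (cylinder \<Omega> T) w))"

definition r_eq ::
  "'a::euclidean_space set \<Rightarrow> real \<Rightarrow> ('a \<times> real \<Rightarrow> real) \<Rightarrow> ('a \<times> real \<Rightarrow> real) \<Rightarrow>
   ('a \<times> real \<Rightarrow> 'a) \<Rightarrow> 'a \<times> real \<Rightarrow> real" where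
  "r_eq \<Omega> T f v y = (\<lambda>p. f p - dt (cylinder \<Omega> T) v p + div_x (cylinder \<Omega> T) y p)"

definition r_d ::
  "'a::euclidean_space set \<Rightarrow> real \<Rightarrow> ('a \<times> real \<Rightarrow> real) \<Rightarrow> ('a \<times> real \<Rightarrow> 'a) \<Rightarrow> 'a \<times> real \<Rightarrow> 'a" where
  "r_d \<Omega> T v y = (\<lambda>p. y p - grad_x (cylinder \<Omega> T) v p)"

definition majorant ::
  "'a::euclidean_space set \<Rightarrow> real \<Rightarrow> real \<Rightarrow> ('a \<times> real \<Rightarrow> real) \<Rightarrow> ('a \<times> real \<Rightarrow> real) \<Rightarrow>
   ('a \<times> real \<Rightarrow> 'a) \<Rightarrow> real \<Rightarrow> real" where
  "majorant \<Omega> T C f v y \<beta> =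
     (1 + \<beta>) * (norm_Q \<Omega> T (r_d \<Omega> T v y))\<^sup>2 +
     (1 + 1 / \<beta>) * C\<^sup>2 * (norm_Q \<Omega> T (r_eq \<Omega> T f v y))\<^sup>2"

end

theory Submission
  imports Defs
begin

text \<open>
  Write \<open>e = u - v\<close>, \<open>g = \<partial>\<^sub>t e\<close>, \<open>G = \<nabla>\<^sub>x e\<close>, \<open>D = \<Delta>\<^sub>x e\<close> and \<open>Z = div\<^sub>x r\<^sub>d\<close>; then
  \<open>g - D = r\<^sub>e\<^sub>q - Z\<close>. Testing this with \<open>\<lambda> e + \<mu> g\<close> and applying Young's and Friedrichs' inequalities gives
  the estimate, once the products are integrated by parts. The function \<open>g\<close> need not have a
  spatial gradient in \<open>L\<^sup>2\<close>, so in the products with \<open>g\<close> the derivative is replaced by difference quotients of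
  \<open>e\<close>, to which Green's formula applies. For \<open>D\<close> this yields that \<open>\<parallel>G(t)\<parallel>\<^sup>2\<close> agrees almost everywhere with the
  continuous function \<open>-2 \<integral> D g\<close> over \<open>\<Omega> \<times> (0, t)\<close>, and for \<open>Z\<close> it leaves a boundary term which is the
  product of \<open>r\<^sub>d\<close> and \<open>G\<close> averaged over the times \<open>(T - h, T)\<close>.

  Green's formula is proved by cutting off near the boundary: by a local Hardy inequality a function with
  zero lateral trace is of order \<open>\<delta>\<close> in a layer of width \<open>\<delta>\<close>, where the gradient of the cutoff is of order
  \<open>1/\<delta>\<close>. Hardy's inequality is integrated from the boundary values along the vertical direction of a
  Lipschitz chart, and needs only that the Hausdorff measure dominates the volume of thin tubes over the boundary.
\<close>

section \<open>Square-integrable functions\<close>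

text \<open>Two features of the definitions shape the work. Traces are limits of functions smooth on
  the whole space, and norms on the final slice pass through \<open>SOME\<close> or
  \<open>THE\<close>; existence of traces and uniqueness of final values come before any use of
  these norms. Secondly, the increment of the accumulated gradient energy \<open>E \<tau>\<close>
  has to be found without a gradient of \<open>g\<close>: pairing \<open>D\<close> with a backward
  quotient of \<open>e\<close> on \<open>(0, \<tau>)\<close> and with a forward quotient on
  \<open>(0, \<tau> - h)\<close> produces the same mixed product of \<open>G\<close> with its shift,
  once with each sign, so the sum is the exact increment. The zero initial trace enters by extending
  \<open>e\<close> by zero to negative times, which makes backward quotients available from time 0
  on. As \<open>E\<close> is increasing, its derivative \<open>2 * P\<close> is nonnegative and can
  be identified with the slice energies as a density. Among the parameters, \<open>\<zeta>\<close>
  and \<open>\<epsilon>\<close> are Young weights for products inside the cylinder and on the final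
  slice; \<open>\<alpha>\<close> and \<open>\<beta>\<close> split the square of the sum of the three
  residual norms that multiply the norm of the gradient.\<close>

lemma L2_measurable [measurable_dest]: "f \<in> L2 M \<Longrightarrow> f \<in> borel_measurable M"
  by (simp add: L2_def)

lemma L2_integrable: "f \<in> L2 M \<Longrightarrow> integrable M (\<lambda>x. (norm (f x))\<^sup>2)"
  by (simp add: L2_def)

lemma L2_norm_nonneg [simp]: "0 \<le> L2_norm M f"
  by (simp add: L2_norm_def)

lemma L2_norm_square: "(L2_norm M f)\<^sup>2 = (\<integral>x. (norm (f x))\<^sup>2 \<partial>M)"
  by (simp add: L2_norm_def)

text \<open>An integrable majorant of the square yields membership and norm bound together, so that
  later estimates reduce to pointwise inequalities.\<close>

lemma L2_boundI:
  fixes f :: "'m \<Rightarrow> 'b::euclidean_space" and h :: "'m \<Rightarrow> real"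
  assumes "f \<in> borel_measurable M" "integrable M h" "AE x in M. (norm (f x))\<^sup>2 \<le> h x"
  shows "f \<in> L2 M" and "(L2_norm M f)\<^sup>2 \<le> (\<integral>x. h x \<partial>M)"
proof -
  have i: "integrable M (\<lambda>x. (norm (f x))\<^sup>2)"
    by (rule Bochner_Integration.integrable_bound[OF assms(2)]) (use assms in auto)
  then show "f \<in> L2 M"
    using assms by (simp add: L2_def)
  show "(L2_norm M f)\<^sup>2 \<le> (\<integral>x. h x \<partial>M)"
    unfolding L2_norm_square using i assms by (intro integral_mono_AE) auto
qed

lemma L2_cong:
  assumes "f \<in> L2 M" "g \<in> borel_measurable M" "AE x in M. f x = g x"
  shows "g \<in> L2 M" "L2_norm M g = L2_norm M f"
proof -
  show "g \<in> L2 M"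
    by (rule L2_boundI(1)[OF assms(2) L2_integrable[OF assms(1)]]) (use assms in auto)
  show "L2_norm M g = L2_norm M f"
    unfolding L2_norm_def using assms by (intro arg_cong[where f=sqrt] integral_cong_AE) (auto simp: L2_def)
qed

lemma L2_add:
  assumes "f \<in> L2 M" "g \<in> L2 M"
  shows "(\<lambda>x. f x + g x) \<in> L2 M"
proof (rule L2_boundI(1))
  show "integrable M (\<lambda>x. 2 * (norm (f x))\<^sup>2 + 2 * (norm (g x))\<^sup>2)"
    using assms by (auto simp: L2_def)
  show "AE x in M. (norm (f x + g x))\<^sup>2 \<le> 2 * (norm (f x))\<^sup>2 + 2 * (norm (g x))\<^sup>2"
  proof (intro AE_I2)
    fix x
    have "(norm (f x + g x))\<^sup>2 \<le> (norm (f x) + norm (g x))\<^sup>2"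
      by (intro power_mono norm_triangle_ineq) auto
    also have "\<dots> \<le> 2 * (norm (f x))\<^sup>2 + 2 * (norm (g x))\<^sup>2"
      using sum_squares_bound[of "norm (f x)" "norm (g x)"] by (simp add: power2_sum)
    finally show "(norm (f x + g x))\<^sup>2 \<le> \<dots>" .
  qed
qed (use assms in \<open>auto simp: L2_def\<close>)

lemma L2_scaleR: "f \<in> L2 M \<Longrightarrow> (\<lambda>x. c *\<^sub>R f x) \<in> L2 M"
  by (auto simp: L2_def power_mult_distrib)

lemma L2_mult: "f \<in> L2 M \<Longrightarrow> (\<lambda>x. c * f x :: real) \<in> L2 M"
  using L2_scaleR[of f M c] by simp

lemma L2_uminus: "f \<in> L2 M \<Longrightarrow> (\<lambda>x. - f x) \<in> L2 M"
  by (auto simp: L2_def)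

lemma L2_diff: "f \<in> L2 M \<Longrightarrow> g \<in> L2 M \<Longrightarrow> (\<lambda>x. f x - g x) \<in> L2 M"
  using L2_add[of f M "\<lambda>x. - g x"] L2_uminus[of g M] by simp

lemma L2_zero [simp]: "(\<lambda>x. 0) \<in> L2 M"
  by (simp add: L2_def)

lemma L2_norm_zero [simp]: "L2_norm M (\<lambda>x. 0) = 0"
  by (simp add: L2_norm_def)

lemma L2_sum: "(\<And>i. i \<in> I \<Longrightarrow> f i \<in> L2 M) \<Longrightarrow> (\<lambda>x. \<Sum>i\<in>I. f i x) \<in> L2 M"
  by (induction I rule: infinite_finite_induct) (auto intro: L2_add)

lemma L2_norm_scaleR: "L2_norm M (\<lambda>x. c *\<^sub>R f x) = \<bar>c\<bar> * L2_norm M f"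
  by (simp add: L2_norm_def power_mult_distrib real_sqrt_mult)

lemma L2_norm_uminus [simp]: "L2_norm M (\<lambda>x. - f x) = L2_norm M f"
  by (simp add: L2_norm_def)

lemma L2_norm_minus_commute: "L2_norm M (\<lambda>x. f x - g x) = L2_norm M (\<lambda>x. g x - f x)"
  by (simp add: L2_norm_def norm_minus_commute)

lemma L2_inner_integrable:
  assumes "f \<in> L2 M" "g \<in> L2 M"
  shows "integrable M (\<lambda>x. f x \<bullet> g x)"
proof (rule Bochner_Integration.integrable_bound)
  show "integrable M (\<lambda>x. (norm (f x))\<^sup>2 + (norm (g x))\<^sup>2)"
    using assms by (auto simp: L2_def)
  show "AE x in M. norm (f x \<bullet> g x) \<le> norm ((norm (f x))\<^sup>2 + (norm (g x))\<^sup>2)"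
  proof (intro AE_I2)
    fix x
    have "\<bar>f x \<bullet> g x\<bar> \<le> norm (f x) * norm (g x)" by (rule Cauchy_Schwarz_ineq2)
    also have "\<dots> \<le> (norm (f x))\<^sup>2 + (norm (g x))\<^sup>2"
      using sum_squares_bound[of "norm (f x)" "norm (g x)"]
        mult_nonneg_nonneg[OF norm_ge_zero norm_ge_zero, of "f x" "g x"] by linarith
    finally show "norm (f x \<bullet> g x) \<le> norm ((norm (f x))\<^sup>2 + (norm (g x))\<^sup>2)" by simp
  qed
qed (use assms in \<open>auto simp: L2_def\<close>)

lemma L2_mult_integrable:
  fixes f g :: "'m \<Rightarrow> real"
  shows "f \<in> L2 M \<Longrightarrow> g \<in> L2 M \<Longrightarrow> integrable M (\<lambda>x. f x * g x)"
  using L2_inner_integrable[of f M g] by simp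

lemma L2_norm_add_square:
  assumes "f \<in> L2 M" "g \<in> L2 M"
  shows "(L2_norm M (\<lambda>x. f x + g x))\<^sup>2
       = (L2_norm M f)\<^sup>2 + 2 * (\<integral>x. f x \<bullet> g x \<partial>M) + (L2_norm M g)\<^sup>2"
proof -
  have eq: "(norm (f x + g x))\<^sup>2 = (norm (f x))\<^sup>2 + 2 * (f x \<bullet> g x) + (norm (g x))\<^sup>2" for x
    by (simp add: power2_norm_eq_inner algebra_simps inner_commute)
  show ?thesis
    unfolding L2_norm_square eq
    using assms L2_inner_integrable[OF assms] by (simp add: L2_def)
qed

text \<open>The squared norm of \<open>s *\<^sub>R f x + g x\<close> is a nonnegative quadratic
  polynomial in \<open>s\<close>, so its discriminant is not positive. The case
  \<open>A = 0\<close>, where the polynomial is affine, is separate.\<close>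

lemma L2_Cauchy_Schwarz:
  assumes f: "f \<in> L2 M" and g: "g \<in> L2 M"
  shows "\<bar>\<integral>x. f x \<bullet> g x \<partial>M\<bar> \<le> L2_norm M f * L2_norm M g"
proof -
  define A B C where "A = (L2_norm M f)\<^sup>2" and "B = (\<integral>x. f x \<bullet> g x \<partial>M)" and "C = (L2_norm M g)\<^sup>2"
  have q: "0 \<le> s\<^sup>2 * A + 2 * s * B + C" for s
  proof -
    have "0 \<le> (L2_norm M (\<lambda>x. s *\<^sub>R f x + g x))\<^sup>2" by simp
    also have "\<dots> = s\<^sup>2 * A + 2 * s * B + C"
      using L2_norm_add_square[OF L2_scaleR[OF f, of s] g] L2_norm_scaleR[of M s f]
      by (simp add: A_def B_def C_def power_mult_distrib)
    finally show ?thesis .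
  qed
  have "B\<^sup>2 \<le> A * C"
  proof (cases "A = 0")
    case True
    have "B = 0"
    proof (rule ccontr)
      assume "B \<noteq> 0"
      \<comment> \<open>At this argument the affine polynomial would take the value -1.\<close>
      then show False using q[of "- (C + 1) / (2 * B)"] True by (simp add: field_simps)
    qed
    then show ?thesis using True by simp
  next
    case False
    then have "A > 0" by (simp add: A_def)
    \<comment> \<open>\<open>- B / A\<close> is the minimizer of the quadratic; the factor
      \<open>A\<close> clears the denominator.\<close>
    have "0 \<le> A * ((- B / A)\<^sup>2 * A + 2 * (- B / A) * B + C)"
      using q[of "- B / A"] \<open>A > 0\<close> by simp
    also have "\<dots> = A * C - B\<^sup>2"
      using \<open>A > 0\<close> by (simp add: field_simps power2_eq_square)
    finally show ?thesis by simp
  qed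
  then have "\<bar>B\<bar> \<le> sqrt (A * C)"
    using real_le_rsqrt[of "\<bar>B\<bar>" "A * C"] by simp
  then show ?thesis
    by (simp add: A_def B_def C_def real_sqrt_mult)
qed

lemma L2_Cauchy_Schwarz_mult:
  fixes f g :: "'m \<Rightarrow> real"
  shows "f \<in> L2 M \<Longrightarrow> g \<in> L2 M \<Longrightarrow> \<bar>\<integral>x. f x * g x \<partial>M\<bar> \<le> L2_norm M f * L2_norm M g"
  using L2_Cauchy_Schwarz[of f M g] by simp

lemma L2_norm_triangle:
  assumes "f \<in> L2 M" "g \<in> L2 M"
  shows "L2_norm M (\<lambda>x. f x + g x) \<le> L2_norm M f + L2_norm M g"
proof -
  have "(L2_norm M (\<lambda>x. f x + g x))\<^sup>2 \<le> (L2_norm M f + L2_norm M g)\<^sup>2"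
    using L2_norm_add_square[OF assms] L2_Cauchy_Schwarz[OF assms] by (simp add: power2_sum)
  then show ?thesis
    by (rule power2_le_imp_le) simp
qed

lemma L2_norm_triangle_diff:
  assumes "f \<in> L2 M" "g \<in> L2 M"
  shows "\<bar>L2_norm M f - L2_norm M g\<bar> \<le> L2_norm M (\<lambda>x. f x - g x)"
proof -
  have 1: "L2_norm M f \<le> L2_norm M (\<lambda>x. f x - g x) + L2_norm M g"
    using L2_norm_triangle[OF L2_diff[OF assms] assms(2)] by simp
  have "L2_norm M g \<le> L2_norm M (\<lambda>x. g x - f x) + L2_norm M f"
    using L2_norm_triangle[OF L2_diff[OF assms(2,1)] assms(1)] by simp
  with 1 show ?thesis
    unfolding L2_norm_minus_commute[of M g] by linarith
qed

lemma L2_norm_triangle3: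
  assumes "f \<in> L2 M" "g \<in> L2 M" "h \<in> L2 M"
  shows "L2_norm M (\<lambda>x. f x - h x) \<le> L2_norm M (\<lambda>x. f x - g x) + L2_norm M (\<lambda>x. g x - h x)"
  using L2_norm_triangle[OF L2_diff[OF assms(1,2)] L2_diff[OF assms(2,3)]] by simp

lemma L2_norm_eq_0:
  assumes "f \<in> L2 M" "L2_norm M f = 0"
  shows "AE x in M. f x = 0"
proof -
  have "(\<integral>x. (norm (f x))\<^sup>2 \<partial>M) = 0"
    using L2_norm_square[of M f] assms(2) by simp
  then have "AE x in M. (norm (f x))\<^sup>2 = 0"
    using integral_nonneg_eq_0_iff_AE[OF L2_integrable[OF assms(1)]] by auto
  then show ?thesis by simp
qed

lemma L2_dominated:
  fixes f :: "'m \<Rightarrow> 'b::euclidean_space" and g :: "'m \<Rightarrow> 'c::euclidean_space"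
  assumes "f \<in> borel_measurable M" "g \<in> L2 M" "0 \<le> c" "AE x in M. norm (f x) \<le> c * norm (g x)"
  shows "f \<in> L2 M" and "L2_norm M f \<le> c * L2_norm M g"
proof -
  have i: "integrable M (\<lambda>x. c\<^sup>2 * (norm (g x))\<^sup>2)"
    using L2_integrable[OF assms(2)] by simp
  have le: "AE x in M. (norm (f x))\<^sup>2 \<le> c\<^sup>2 * (norm (g x))\<^sup>2"
    using assms(4) by eventually_elim (metis norm_ge_zero power_mono power_mult_distrib)
  show "f \<in> L2 M"
    by (rule L2_boundI(1)[OF assms(1) i le])
  have "(L2_norm M f)\<^sup>2 \<le> (c * L2_norm M g)\<^sup>2"
    using L2_boundI(2)[OF assms(1) i le] by (simp add: power_mult_distrib L2_norm_square)
  then show "L2_norm M f \<le> c * L2_norm M g"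
    by (rule power2_le_imp_le) (use assms in simp)
qed

lemma L2_mult_bounded:
  fixes h :: "'m \<Rightarrow> real" and f :: "'m \<Rightarrow> 'b::euclidean_space"
  assumes "f \<in> L2 M" "h \<in> borel_measurable M" "0 \<le> c" "\<And>x. x \<in> space M \<Longrightarrow> \<bar>h x\<bar> \<le> c"
  shows "(\<lambda>x. h x *\<^sub>R f x) \<in> L2 M" "L2_norm M (\<lambda>x. h x *\<^sub>R f x) \<le> c * L2_norm M f"
  by (rule L2_dominated[OF _ assms(1) assms(3)];
      use assms in \<open>auto simp: L2_def intro!: AE_I2 mult_right_mono\<close>)+

lemma L2_inner_const: "f \<in> L2 M \<Longrightarrow> (\<lambda>x. f x \<bullet> i) \<in> L2 M"
  by (rule L2_dominated(1)[where c="norm i"])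
    (auto simp: L2_def mult.commute[of "norm i"] intro: Cauchy_Schwarz_ineq2)

lemma norm_square_components: "(norm (x::'b::euclidean_space))\<^sup>2 = (\<Sum>i\<in>Basis. (x \<bullet> i)\<^sup>2)"
  by (subst power2_norm_eq_inner, subst euclidean_inner) (simp add: power2_eq_square)

lemma L2_components_iff:
  fixes f :: "'m \<Rightarrow> 'b::euclidean_space"
  shows "f \<in> L2 M \<longleftrightarrow> (\<forall>i\<in>Basis. (\<lambda>x. f x \<bullet> i) \<in> L2 M)"
proof
  assume "\<forall>i\<in>Basis. (\<lambda>x. f x \<bullet> i) \<in> L2 M"
  then have a: "\<And>i. i \<in> Basis \<Longrightarrow> (\<lambda>x. f x \<bullet> i) \<in> L2 M" by auto
  have "f \<in> borel_measurable M"
    using a by (subst borel_measurable_euclidean_space) (auto simp: L2_def)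
  moreover have "integrable M (\<lambda>x. (norm (f x))\<^sup>2)"
    using a
    by (subst norm_square_components, intro Bochner_Integration.integrable_sum) (auto simp: L2_def)
  ultimately show "f \<in> L2 M" by (simp add: L2_def)
qed (auto intro: L2_inner_const)

lemma L2_norm_components:
  fixes f :: "'m \<Rightarrow> 'b::euclidean_space"
  assumes "f \<in> L2 M"
  shows "(L2_norm M f)\<^sup>2 = (\<Sum>i\<in>Basis. (L2_norm M (\<lambda>x. f x \<bullet> i))\<^sup>2)"
proof -
  have "(\<integral>x. (norm (f x))\<^sup>2 \<partial>M) = (\<integral>x. (\<Sum>i\<in>Basis. (f x \<bullet> i)\<^sup>2) \<partial>M)"
    by (intro Bochner_Integration.integral_cong refl norm_square_components)
  also have "\<dots> = (\<Sum>i\<in>Basis. \<integral>x. (f x \<bullet> i)\<^sup>2 \<partial>M)"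
    using L2_integrable[OF L2_inner_const[OF assms]] by (intro Bochner_Integration.integral_sum) auto
  finally show ?thesis
    by (simp add: L2_norm_square)
qed

lemma L2_integral_inner_components:
  fixes f g :: "'m \<Rightarrow> 'b::euclidean_space"
  assumes "f \<in> L2 M" "g \<in> L2 M"
  shows "(\<integral>x. f x \<bullet> g x \<partial>M) = (\<Sum>i\<in>Basis. \<integral>x. (f x \<bullet> i) * (g x \<bullet> i) \<partial>M)"
proof -
  have "(\<integral>x. f x \<bullet> g x \<partial>M) = (\<integral>x. (\<Sum>i\<in>Basis. (f x \<bullet> i) * (g x \<bullet> i)) \<partial>M)"
    by (intro Bochner_Integration.integral_cong refl) (rule euclidean_inner)
  also have "\<dots> = (\<Sum>i\<in>Basis. \<integral>x. (f x \<bullet> i) * (g x \<bullet> i) \<partial>M)"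
    using assms by (intro Bochner_Integration.integral_sum L2_mult_integrable L2_inner_const)
  finally show ?thesis .
qed

section \<open>Convergence in the mean square and passage to the limit in products\<close>

lemma L2_lim_I:
  assumes "\<And>n. \<phi> n \<in> L2 M" "w \<in> L2 M" "(\<lambda>n. L2_norm M (\<lambda>x. \<phi> n x - w x)) \<longlonglongrightarrow> 0"
  shows "L2_lim M \<phi> w"
  using assms by (auto simp: L2_lim_def intro: L2_diff)

text \<open>\<open>L2_lim\<close> constrains only the differences \<open>\<phi> n x - w x\<close>;
  membership of the approximations themselves is recovered from that of the limit.\<close>

lemma L2_lim_L2:
  assumes "L2_lim M \<phi> w" "w \<in> L2 M"
  shows "\<phi> n \<in> L2 M"
  using L2_add[of "\<lambda>x. \<phi> n x - w x" M w] assms by (simp add: L2_lim_def)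

lemma L2_lim_norm:
  assumes "L2_lim M \<phi> w" "w \<in> L2 M"
  shows "(\<lambda>n. L2_norm M (\<phi> n)) \<longlonglongrightarrow> L2_norm M w"
proof (rule LIM_zero_cancel, rule Lim_null_comparison)
  show "\<forall>\<^sub>F n in sequentially. norm (L2_norm M (\<phi> n) - L2_norm M w) \<le> L2_norm M (\<lambda>x. \<phi> n x - w x)"
    using L2_norm_triangle_diff[OF L2_lim_L2[OF assms] assms(2)] by simp
  show "(\<lambda>n. L2_norm M (\<lambda>x. \<phi> n x - w x)) \<longlonglongrightarrow> 0"
    using assms by (simp add: L2_lim_def)
qed

lemma L2_lim_inner:
  assumes f: "L2_lim M \<phi> f" "f \<in> L2 M" and g: "g \<in> L2 M"
  shows "(\<lambda>n. \<integral>x. \<phi> n x \<bullet> g x \<partial>M) \<longlonglongrightarrow> (\<integral>x. f x \<bullet> g x \<partial>M)"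
proof (rule LIM_zero_cancel, rule Lim_null_comparison)
  have "norm ((\<integral>x. \<phi> n x \<bullet> g x \<partial>M) - (\<integral>x. f x \<bullet> g x \<partial>M))
      \<le> L2_norm M (\<lambda>x. \<phi> n x - f x) * L2_norm M g" for n
  proof -
    have "(\<integral>x. \<phi> n x \<bullet> g x \<partial>M) - (\<integral>x. f x \<bullet> g x \<partial>M) = (\<integral>x. (\<phi> n x - f x) \<bullet> g x \<partial>M)"
      by (subst Bochner_Integration.integral_diff[symmetric])
         (auto intro!: L2_inner_integrable L2_lim_L2[OF f] f g simp: inner_diff_left)
    then show ?thesis
      using L2_Cauchy_Schwarz[OF _ g, of "\<lambda>x. \<phi> n x - f x"] f by (simp add: L2_lim_def)
  qed
  then show "\<forall>\<^sub>F n in sequentially. norm ((\<integral>x. \<phi> n x \<bullet> g x \<partial>M) - (\<integral>x. f x \<bullet> g x \<partial>M))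
      \<le> L2_norm M (\<lambda>x. \<phi> n x - f x) * L2_norm M g" by simp
  show "(\<lambda>n. L2_norm M (\<lambda>x. \<phi> n x - f x) * L2_norm M g) \<longlonglongrightarrow> 0"
    using f by (auto simp: L2_lim_def intro: tendsto_mult_left_zero)
qed

lemma L2_lim_mult:
  fixes f g :: "'m \<Rightarrow> real"
  shows "L2_lim M \<phi> f \<Longrightarrow> f \<in> L2 M \<Longrightarrow> g \<in> L2 M \<Longrightarrow>
    (\<lambda>n. \<integral>x. \<phi> n x * g x \<partial>M) \<longlonglongrightarrow> (\<integral>x. f x * g x \<partial>M)"
  using L2_lim_inner[of M \<phi> f g] by simp

text \<open>With \<open>g\<close> fixed the pairing converges already. Replacing \<open>g\<close> by
  \<open>\<psi> n\<close> costs at most the norm of \<open>\<phi> n\<close>, which converges, times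
  the distance of \<open>\<psi> n\<close> to \<open>g\<close>.\<close>

lemma L2_lim_mult2:
  fixes f g :: "'m \<Rightarrow> real"
  assumes f: "L2_lim M \<phi> f" "f \<in> L2 M" and g: "L2_lim M \<psi> g" "g \<in> L2 M"
  shows "(\<lambda>n. \<integral>x. \<phi> n x * \<psi> n x \<partial>M) \<longlonglongrightarrow> (\<integral>x. f x * g x \<partial>M)"
proof (rule Lim_transform2)
  show "(\<lambda>n. \<integral>x. \<phi> n x * g x \<partial>M) \<longlonglongrightarrow> (\<integral>x. f x * g x \<partial>M)"
    by (rule L2_lim_mult[OF f g(2)])
  show "(\<lambda>n. (\<integral>x. \<phi> n x * g x \<partial>M) - (\<integral>x. \<phi> n x * \<psi> n x \<partial>M)) \<longlonglongrightarrow> 0"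
  proof (rule Lim_null_comparison)
    have "norm ((\<integral>x. \<phi> n x * g x \<partial>M) - (\<integral>x. \<phi> n x * \<psi> n x \<partial>M))
        \<le> L2_norm M (\<phi> n) * L2_norm M (\<lambda>x. \<psi> n x - g x)" for n
    proof -
      have "(\<integral>x. \<phi> n x * g x \<partial>M) - (\<integral>x. \<phi> n x * \<psi> n x \<partial>M) = - (\<integral>x. \<phi> n x * (\<psi> n x - g x) \<partial>M)"
        by (simp add: right_diff_distrib L2_mult_integrable L2_lim_L2[OF f] L2_lim_L2[OF g] g)
      then show ?thesis
        using L2_Cauchy_Schwarz_mult[OF L2_lim_L2[OF f], of "\<lambda>x. \<psi> n x - g x" n] g
        by (simp add: L2_lim_def)
    qed
    then show "\<forall>\<^sub>F n in sequentially. norm ((\<integral>x. \<phi> n x * g x \<partial>M) - (\<integral>x. \<phi> n x * \<psi> n x \<partial>M))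
        \<le> L2_norm M (\<phi> n) * L2_norm M (\<lambda>x. \<psi> n x - g x)" by simp
    show "(\<lambda>n. L2_norm M (\<phi> n) * L2_norm M (\<lambda>x. \<psi> n x - g x)) \<longlonglongrightarrow> 0"
      using tendsto_mult[OF L2_lim_norm[OF f], of "\<lambda>n. L2_norm M (\<lambda>x. \<psi> n x - g x)" 0] g
      by (simp add: L2_lim_def)
  qed
qed

text \<open>Weak derivatives picked by \<open>SOME\<close> agree with computed ones only almost
  everywhere; this carries a limit from one representative to another.\<close>

lemma L2_lim_cong:
  assumes "L2_lim M \<phi> w" "v \<in> borel_measurable M" "w \<in> borel_measurable M"
    "\<And>n. \<phi> n \<in> borel_measurable M" "AE x in M. w x = v x"
  shows "L2_lim M \<phi> v"
proof -
  have "(\<lambda>x. \<phi> n x - v x) \<in> L2 M"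
    "L2_norm M (\<lambda>x. \<phi> n x - v x) = L2_norm M (\<lambda>x. \<phi> n x - w x)" for n
    by (rule L2_cong[of "\<lambda>x. \<phi> n x - w x"]; use assms in \<open>auto simp: L2_lim_def\<close>)+
  then show ?thesis
    using assms(1) by (simp add: L2_lim_def)
qed

lemma L2_lim_diff:
  assumes "L2_lim M \<phi> w" "L2_lim M \<psi> v"
  shows "L2_lim M (\<lambda>n x. \<phi> n x - \<psi> n x) (\<lambda>x. w x - v x)"
  unfolding L2_lim_def
proof (intro conjI allI)
  have eq: "(\<lambda>x. \<phi> n x - \<psi> n x - (w x - v x)) = (\<lambda>x. (\<phi> n x - w x) + - (\<psi> n x - v x))" for n
    by (auto simp: algebra_simps)
  have m: "(\<lambda>x. \<phi> n x - w x) \<in> L2 M" "(\<lambda>x. - (\<psi> n x - v x)) \<in> L2 M" for n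
    using assms L2_uminus[of "\<lambda>x. \<psi> n x - v x" M] by (auto simp: L2_lim_def)
  show "(\<lambda>x. \<phi> n x - \<psi> n x - (w x - v x)) \<in> L2 M" for n
    unfolding eq by (rule L2_add[OF m])
  show "(\<lambda>n. L2_norm M (\<lambda>x. \<phi> n x - \<psi> n x - (w x - v x))) \<longlonglongrightarrow> 0"
  proof (rule Lim_null_comparison)
    show "\<forall>\<^sub>F n in sequentially. norm (L2_norm M (\<lambda>x. \<phi> n x - \<psi> n x - (w x - v x)))
       \<le> L2_norm M (\<lambda>x. \<phi> n x - w x) + L2_norm M (\<lambda>x. \<psi> n x - v x)"
      unfolding eq using L2_norm_triangle[OF m] L2_norm_uminus[of M "\<lambda>x. \<psi> _ x - v x"] by auto
    show "(\<lambda>n. L2_norm M (\<lambda>x. \<phi> n x - w x) + L2_norm M (\<lambda>x. \<psi> n x - v x)) \<longlonglongrightarrow> 0"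
      using tendsto_add[of _ 0 sequentially _ 0] assms by (auto simp: L2_lim_def)
  qed
qed

lemma L2_lim_components:
  fixes \<phi> :: "nat \<Rightarrow> 'm \<Rightarrow> 'b::euclidean_space"
  shows "L2_lim M \<phi> w \<longleftrightarrow> (\<forall>i\<in>Basis. L2_lim M (\<lambda>n x. \<phi> n x \<bullet> i) (\<lambda>x. w x \<bullet> i))"
proof
  assume l: "L2_lim M \<phi> w"
  show "\<forall>i\<in>Basis. L2_lim M (\<lambda>n x. \<phi> n x \<bullet> i) (\<lambda>x. w x \<bullet> i)"
  proof
    fix i :: 'b assume i: "i \<in> Basis"
    have d: "(\<lambda>x. \<phi> n x - w x) \<in> L2 M" for n using l by (simp add: L2_lim_def)
    have "L2_norm M (\<lambda>x. (\<phi> n x - w x) \<bullet> i) \<le> 1 * L2_norm M (\<lambda>x. \<phi> n x - w x)" for n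
    proof (rule L2_dominated(2)[OF _ d])
      show "(\<lambda>x. (\<phi> n x - w x) \<bullet> i) \<in> borel_measurable M"
        by (rule L2_measurable[OF L2_inner_const[OF d]])
      show "AE x in M. norm ((\<phi> n x - w x) \<bullet> i) \<le> 1 * norm (\<phi> n x - w x)"
        using Basis_le_norm[OF i] by (intro AE_I2) simp
    qed simp
    then have "\<forall>\<^sub>F n in sequentially. norm (L2_norm M (\<lambda>x. (\<phi> n x - w x) \<bullet> i)) \<le> L2_norm M (\<lambda>x. \<phi> n x - w x)"
      by simp
    then have "(\<lambda>n. L2_norm M (\<lambda>x. (\<phi> n x - w x) \<bullet> i)) \<longlonglongrightarrow> 0"
      by (rule Lim_null_comparison) (use l in \<open>simp add: L2_lim_def\<close>)
    then show "L2_lim M (\<lambda>n x. \<phi> n x \<bullet> i) (\<lambda>x. w x \<bullet> i)"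
      using L2_inner_const[OF d] by (simp add: L2_lim_def inner_diff_left)
  qed
next
  assume "\<forall>i\<in>Basis. L2_lim M (\<lambda>n x. \<phi> n x \<bullet> i) (\<lambda>x. w x \<bullet> i)"
  then have a: "\<And>i. i \<in> Basis \<Longrightarrow> L2_lim M (\<lambda>n x. \<phi> n x \<bullet> i) (\<lambda>x. w x \<bullet> i)" by auto
  have d: "(\<lambda>x. \<phi> n x - w x) \<in> L2 M" for n
    using a by (subst L2_components_iff) (auto simp: L2_lim_def inner_diff_left)
  have "(\<lambda>n. sqrt (\<Sum>i\<in>Basis. (L2_norm M (\<lambda>x. (\<phi> n x - w x) \<bullet> i))\<^sup>2)) \<longlonglongrightarrow> sqrt (\<Sum>i\<in>(Basis::'b set). 0\<^sup>2)"
    using a by (intro tendsto_intros) (auto simp: L2_lim_def inner_diff_left)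
  then have "(\<lambda>n. L2_norm M (\<lambda>x. \<phi> n x - w x)) \<longlonglongrightarrow> 0"
    unfolding L2_norm_components[OF d, symmetric] by simp
  then show "L2_lim M \<phi> w" using d by (simp add: L2_lim_def)
qed

lemma L2_dominated_convergence:
  fixes f :: "'m \<Rightarrow> 'b::euclidean_space" and g :: "'m \<Rightarrow> real"
  assumes "\<And>n. \<phi> n \<in> borel_measurable M" "f \<in> borel_measurable M" "g \<in> L2 M"
    and "AE x in M. (\<lambda>n. \<phi> n x) \<longlonglongrightarrow> f x" "\<And>n. AE x in M. norm (\<phi> n x - f x) \<le> g x"
  shows "L2_lim M \<phi> f"
  unfolding L2_lim_def
proof (intro conjI allI)
  have le: "AE x in M. (norm (\<phi> n x - f x))\<^sup>2 \<le> (norm (g x))\<^sup>2" for n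
    using assms(5)[of n] by eventually_elim (auto intro!: power_mono)
  show "(\<lambda>x. \<phi> n x - f x) \<in> L2 M" for n
    by (rule L2_boundI(1)[OF _ L2_integrable[OF assms(3)] le]) (use assms in auto)
  have "(\<lambda>n. \<integral>x. (norm (\<phi> n x - f x))\<^sup>2 \<partial>M) \<longlonglongrightarrow> (\<integral>x. 0 \<partial>M)"
  proof (rule integral_dominated_convergence[where w="\<lambda>x. (norm (g x))\<^sup>2"])
    show "AE x in M. (\<lambda>n. (norm (\<phi> n x - f x))\<^sup>2) \<longlonglongrightarrow> 0"
      using assms(4) by eventually_elim (auto intro!: tendsto_eq_intros simp: LIM_zero_iff)
  qed (use assms le L2_integrable[OF assms(3)] in \<open>auto\<close>)
  then show "(\<lambda>n. L2_norm M (\<lambda>x. \<phi> n x - f x)) \<longlonglongrightarrow> 0"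
    using tendsto_real_sqrt[of _ 0] by (fastforce simp: L2_norm_def)
qed

section \<open>Smooth functions\<close>

lemma dir_deriv_eq: "(\<phi> has_derivative \<phi>') (at p) \<Longrightarrow> dir_deriv b \<phi> p = \<phi>' b"
  by (simp add: dir_deriv_def frechet_derivative_at[symmetric])

text \<open>\<open>Ck\<close> speaks about \<open>dir_deriv\<close>, which rests on the choice
  \<open>frechet_derivative\<close>. The rule replaces it by a derivative that has been computed
  explicitly.\<close>

lemma Ck_SucI:
  assumes "\<And>p. (\<phi> has_derivative \<phi>' p) (at p)" "\<And>b. b \<in> Basis \<Longrightarrow> Ck k (\<lambda>p. \<phi>' p b)"
  shows "Ck (Suc k) \<phi>"
proof -
  have "dir_deriv b \<phi> = (\<lambda>p. \<phi>' p b)" for b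
    using dir_deriv_eq[OF assms(1)] by auto
  then show ?thesis
    using assms by (auto simp: differentiable_def)
qed

lemma has_derivative_dir_deriv:
  fixes \<phi> :: "'e::euclidean_space \<Rightarrow> 'b::euclidean_space"
  assumes "\<phi> differentiable (at p)"
  shows "(\<phi> has_derivative (\<lambda>h. \<Sum>b\<in>Basis. (h \<bullet> b) *\<^sub>R dir_deriv b \<phi> p)) (at p)"
proof -
  obtain D where D: "(\<phi> has_derivative D) (at p)"
    using assms by (auto simp: differentiable_def)
  interpret bounded_linear D by (rule has_derivative_bounded_linear[OF D])
  have "D = (\<lambda>h. \<Sum>b\<in>Basis. (h \<bullet> b) *\<^sub>R dir_deriv b \<phi> p)"
  proof
    fix h
    have "D h = D (\<Sum>b\<in>Basis. (h \<bullet> b) *\<^sub>R b)" by (simp add: euclidean_representation)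
    also have "\<dots> = (\<Sum>b\<in>Basis. (h \<bullet> b) *\<^sub>R D b)" by (simp add: sum scale)
    finally show "D h = (\<Sum>b\<in>Basis. (h \<bullet> b) *\<^sub>R dir_deriv b \<phi> p)"
      by (simp add: dir_deriv_eq[OF D])
  qed
  with D show ?thesis by simp
qed

lemma Ck_has_derivative:
  "Ck (Suc k) \<phi> \<Longrightarrow> (\<phi> has_derivative (\<lambda>h. \<Sum>b\<in>Basis. (h \<bullet> b) *\<^sub>R dir_deriv b \<phi> p)) (at p)"
  by (auto intro: has_derivative_dir_deriv)

lemma Ck_pred: "Ck (Suc k) \<phi> \<Longrightarrow> Ck k \<phi>"
proof (induction k arbitrary: \<phi>)
  case 0
  then show ?case
    by (auto intro!: continuous_at_imp_continuous_on differentiable_imp_continuous_within)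
qed auto

lemma Ck_const: "Ck k (\<lambda>p. c)"
proof (induction k arbitrary: c)
  case (Suc k)
  show ?case
    by (rule Ck_SucI[where \<phi>'="\<lambda>_ _. 0"]) (auto intro: Suc)
qed simp

lemma Ck_linear: "bounded_linear f \<Longrightarrow> Ck k f"
proof (cases k)
  case (Suc m)
  assume "bounded_linear f"
  then show ?thesis
    unfolding Suc by (intro Ck_SucI[where \<phi>'="\<lambda>_. f"] bounded_linear_imp_has_derivative Ck_const)
qed (simp add: linear_continuous_on)

lemma Ck_add: "Ck k \<phi> \<Longrightarrow> Ck k \<psi> \<Longrightarrow> Ck k (\<lambda>p. \<phi> p + \<psi> p)"
proof (induction k arbitrary: \<phi> \<psi>)
  case 0 then show ?case by (auto intro: continuous_intros)
next
  case (Suc k)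
  show ?case
  proof (rule Ck_SucI)
    show "((\<lambda>p. \<phi> p + \<psi> p) has_derivative (\<lambda>h. frechet_derivative \<phi> (at p) h + frechet_derivative \<psi> (at p) h)) (at p)" for p
      using Suc.prems by (intro has_derivative_add) (auto simp: frechet_derivative_works[symmetric])
    show "Ck k (\<lambda>p. frechet_derivative \<phi> (at p) b + frechet_derivative \<psi> (at p) b)" if "b \<in> Basis" for b
      using Suc.IH[of "dir_deriv b \<phi>" "dir_deriv b \<psi>"] Suc.prems that by (simp add: dir_deriv_def[symmetric])
  qed
qed

lemma Ck_sum: "(\<And>i. i \<in> I \<Longrightarrow> Ck k (\<phi> i)) \<Longrightarrow> Ck k (\<lambda>p. \<Sum>i\<in>I. \<phi> i p)"
  by (induction I rule: infinite_finite_induct) (auto intro: Ck_add Ck_const)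

text \<open>Leibniz rule. Each summand of the derivative keeps one factor undifferentiated, which is
  why \<open>Ck_pred\<close> joins the induction. One proof covers products, scalar multiples and
  inner products.\<close>

lemma Ck_bilinear:
  fixes pr :: "'b::euclidean_space \<Rightarrow> 'c::euclidean_space \<Rightarrow> 'd::euclidean_space"
  assumes pr: "bounded_bilinear pr"
  shows "Ck k \<phi> \<Longrightarrow> Ck k \<psi> \<Longrightarrow> Ck k (\<lambda>p. pr (\<phi> p) (\<psi> p))"
proof (induction k arbitrary: \<phi> \<psi>)
  case 0 then show ?case by (auto intro: bounded_bilinear.continuous_on[OF pr])
next
  case (Suc k)
  show ?case
  proof (rule Ck_SucI)
    show "((\<lambda>p. pr (\<phi> p) (\<psi> p)) has_derivative
       (\<lambda>h. pr (\<phi> p) (frechet_derivative \<psi> (at p) h) + pr (frechet_derivative \<phi> (at p) h) (\<psi> p))) (at p)" for p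
      using Suc.prems by (intro bounded_bilinear.FDERIV[OF pr]) (auto simp: frechet_derivative_works[symmetric])
    show "Ck k (\<lambda>p. pr (\<phi> p) (frechet_derivative \<psi> (at p) b) + pr (frechet_derivative \<phi> (at p) b) (\<psi> p))"
      if "b \<in> Basis" for b
      using Suc.IH[of \<phi> "dir_deriv b \<psi>"] Suc.IH[of "dir_deriv b \<phi>" \<psi>] Ck_pred[of k \<phi>] Ck_pred[of k \<psi>] Suc.prems that
      by (intro Ck_add) (simp_all add: dir_deriv_def[symmetric])
  qed
qed

lemmas Ck_mult = Ck_bilinear[OF bounded_bilinear_mult]
lemmas Ck_scaleR = Ck_bilinear[OF bounded_bilinear_scaleR]
lemmas Ck_inner = Ck_bilinear[OF bounded_bilinear_inner]

lemma Ck_compose_affine: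
  fixes L :: "'d::euclidean_space \<Rightarrow> 'e::euclidean_space" and \<phi> :: "'e \<Rightarrow> 'b::euclidean_space"
  assumes "bounded_linear L"
  shows "Ck k \<phi> \<Longrightarrow> Ck k (\<lambda>p. \<phi> (L p + c))"
proof (induction k arbitrary: \<phi>)
  case 0
  then show ?case
    using linear_continuous_on[OF assms] by (auto intro!: continuous_on_compose2[of UNIV \<phi>] continuous_intros)
next
  case (Suc k)
  show ?case
  proof (rule Ck_SucI)
    show "((\<lambda>p. \<phi> (L p + c)) has_derivative
        (\<lambda>h. \<Sum>b\<in>Basis. (L h \<bullet> b) *\<^sub>R dir_deriv b \<phi> (L p + c))) (at p)" for p
      by (rule has_derivative_compose[of "\<lambda>p. L p + c", OF _ Ck_has_derivative[OF Suc.prems]])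
         (auto intro!: derivative_eq_intros bounded_linear_imp_has_derivative assms)
    show "Ck k (\<lambda>p. \<Sum>b\<in>Basis. (L h \<bullet> b) *\<^sub>R dir_deriv b \<phi> (L p + c))" for h
      using Suc by (intro Ck_sum Ck_scaleR Ck_const) auto
  qed
qed

lemma smooth_has_derivative:
  "smooth \<phi> \<Longrightarrow> (\<phi> has_derivative (\<lambda>h. \<Sum>b\<in>Basis. (h \<bullet> b) *\<^sub>R dir_deriv b \<phi> p)) (at p)"
  unfolding smooth_def by (intro Ck_has_derivative[of 0]) blast

lemma smooth_differentiable: "smooth \<phi> \<Longrightarrow> \<phi> differentiable (at p)"
  using smooth_has_derivative differentiable_def by blast

lemma smooth_dir_deriv: "smooth \<phi> \<Longrightarrow> b \<in> Basis \<Longrightarrow> smooth (dir_deriv b \<phi>)"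
  unfolding smooth_def
proof
  fix k assume "\<forall>k. Ck k \<phi>" "b \<in> Basis"
  then have "Ck (Suc k) \<phi>" by blast
  with \<open>b \<in> Basis\<close> show "Ck k (dir_deriv b \<phi>)" by simp
qed

lemma smooth_continuous: "smooth \<phi> \<Longrightarrow> continuous_on S \<phi>"
proof -
  assume "smooth \<phi>"
  then have "Ck 0 \<phi>" unfolding smooth_def by blast
  then show ?thesis by (auto intro: continuous_on_subset)
qed

lemma smooth_borel: "smooth \<phi> \<Longrightarrow> \<phi> \<in> borel_measurable borel"
  by (intro borel_measurable_continuous_onI smooth_continuous)

lemma smooth_const: "smooth (\<lambda>p. c)"
  by (simp add: smooth_def Ck_const)

lemma smooth_add: "smooth \<phi> \<Longrightarrow> smooth \<psi> \<Longrightarrow> smooth (\<lambda>p. \<phi> p + \<psi> p)"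
  by (simp add: smooth_def Ck_add)

lemma smooth_sum: "(\<And>i. i \<in> I \<Longrightarrow> smooth (\<phi> i)) \<Longrightarrow> smooth (\<lambda>p. \<Sum>i\<in>I. \<phi> i p)"
  by (simp add: smooth_def Ck_sum)

lemma smooth_mult: "smooth \<phi> \<Longrightarrow> smooth \<psi> \<Longrightarrow> smooth (\<lambda>p. \<phi> p * \<psi> p :: real)"
  by (simp add: smooth_def Ck_mult)

lemma smooth_scaleR: "smooth \<phi> \<Longrightarrow> smooth \<psi> \<Longrightarrow> smooth (\<lambda>p. \<phi> p *\<^sub>R \<psi> p)"
  by (simp add: smooth_def Ck_scaleR)

lemma smooth_inner: "smooth \<phi> \<Longrightarrow> smooth \<psi> \<Longrightarrow> smooth (\<lambda>p. \<phi> p \<bullet> \<psi> p)"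
  by (simp add: smooth_def Ck_inner)

lemma smooth_uminus: "smooth \<phi> \<Longrightarrow> smooth (\<lambda>p. - \<phi> p)"
  using smooth_scaleR[OF smooth_const[of "- 1"]] by simp

lemma smooth_diff: "smooth \<phi> \<Longrightarrow> smooth \<psi> \<Longrightarrow> smooth (\<lambda>p. \<phi> p - \<psi> p)"
  using smooth_add[OF _ smooth_uminus] by fastforce

lemma smooth_translate: "smooth \<phi> \<Longrightarrow> smooth (\<lambda>p. \<phi> (p + c))"
  unfolding smooth_def using Ck_compose_affine[OF bounded_linear_ident] by blast

lemma smooth_translate_minus: "smooth \<phi> \<Longrightarrow> smooth (\<lambda>p. \<phi> (p - c))"
  using smooth_translate[of \<phi> "- c"] by simp

lemma smooth_has_derivative':
  assumes "smooth \<phi>"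
  shows "(\<phi> has_derivative (\<lambda>h. dir_deriv h \<phi> p)) (at p)"
  using smooth_differentiable[OF assms] by (simp add: dir_deriv_def frechet_derivative_works[symmetric])

lemma dir_deriv_add:
  assumes "smooth \<phi>" "smooth \<psi>"
  shows "dir_deriv b (\<lambda>p. \<phi> p + \<psi> p) p = dir_deriv b \<phi> p + dir_deriv b \<psi> p"
  by (rule dir_deriv_eq[OF has_derivative_add]) (intro smooth_has_derivative' assms)+

lemma dir_deriv_diff:
  assumes "smooth \<phi>" "smooth \<psi>"
  shows "dir_deriv b (\<lambda>p. \<phi> p - \<psi> p) p = dir_deriv b \<phi> p - dir_deriv b \<psi> p"
  by (rule dir_deriv_eq[OF has_derivative_diff]) (intro smooth_has_derivative' assms)+

lemma dir_deriv_mult: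
  fixes \<phi> \<psi> :: "'e::euclidean_space \<Rightarrow> real"
  assumes "smooth \<phi>" "smooth \<psi>"
  shows "dir_deriv b (\<lambda>p. \<phi> p * \<psi> p) p = \<phi> p * dir_deriv b \<psi> p + dir_deriv b \<phi> p * \<psi> p"
  by (rule dir_deriv_eq[OF has_derivative_mult]) (intro smooth_has_derivative' assms)+

lemma dir_deriv_linear:
  assumes "bounded_linear f" "smooth \<phi>"
  shows "dir_deriv b (\<lambda>p. f (\<phi> p)) p = f (dir_deriv b \<phi> p)"
  unfolding dir_deriv_def
  using frechet_derivative_at[symmetric, OF bounded_linear.has_derivative[OF assms(1)
      frechet_derivative_works[THEN iffD1, OF smooth_differentiable[OF assms(2)]]]] by simp

lemma dir_deriv_scaleR_const:
  "smooth \<phi> \<Longrightarrow> dir_deriv b (\<lambda>p. \<phi> p *\<^sub>R c) p = dir_deriv b \<phi> p *\<^sub>R c"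
  by (rule dir_deriv_linear[OF bounded_linear_scaleR_left])

lemma dir_deriv_sum:
  "(\<And>i. i \<in> I \<Longrightarrow> smooth (\<phi> i)) \<Longrightarrow> dir_deriv b (\<lambda>p. \<Sum>i\<in>I. \<phi> i p) p = (\<Sum>i\<in>I. dir_deriv b (\<phi> i) p)"
proof (induction I rule: infinite_finite_induct)
  case (insert x F)
  then show ?case by (simp add: dir_deriv_add smooth_sum)
qed (simp_all add: dir_deriv_def)

lemma dir_deriv_translate:
  assumes "smooth \<phi>"
  shows "dir_deriv b (\<lambda>p. \<phi> (p + c)) p = dir_deriv b \<phi> (p + c)"
proof (rule dir_deriv_eq)
  have "((\<lambda>p. p + c) has_derivative (\<lambda>h. h)) (at p)"
    by (auto intro!: derivative_eq_intros)
  then show "((\<lambda>p. \<phi> (p + c)) has_derivative (\<lambda>b. dir_deriv b \<phi> (p + c))) (at p)"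
    unfolding dir_deriv_def
    by (rule has_derivative_compose)
       (use smooth_differentiable[OF assms] frechet_derivative_works in blast)
qed

lemma Basis_prod_simps [simp]:
  "((i, 0) :: 'a::euclidean_space \<times> real) \<in> Basis \<longleftrightarrow> i \<in> Basis"
  "((0, 1) :: 'a::euclidean_space \<times> real) \<in> Basis"
  by (auto simp: Basis_prod_def)

lemma smooth_line_derivative:
  assumes "smooth (\<phi> :: 'e::euclidean_space \<Rightarrow> real)"
  shows "((\<lambda>s. \<phi> (p + s *\<^sub>R d)) has_real_derivative (\<Sum>b\<in>Basis. (d \<bullet> b) * dir_deriv b \<phi> (p + s *\<^sub>R d))) (at s)"
proof -
  have "((\<lambda>s. p + s *\<^sub>R d) has_derivative (\<lambda>h. h *\<^sub>R d)) (at s)"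
    by (auto intro!: derivative_eq_intros)
  from has_derivative_compose[OF this smooth_has_derivative[OF assms]]
  have "((\<lambda>s. \<phi> (p + s *\<^sub>R d)) has_derivative (\<lambda>h. h * (\<Sum>b\<in>Basis. (d \<bullet> b) * dir_deriv b \<phi> (p + s *\<^sub>R d)))) (at s)"
    by (simp add: sum_distrib_left mult.assoc)
  then show ?thesis
    by (simp add: has_field_derivative_def mult_commute_abs)
qed

lemma smooth_dt_derivative:
  assumes "smooth (\<phi> :: 'a::euclidean_space \<times> real \<Rightarrow> real)"
  shows "((\<lambda>s. \<phi> (x, s)) has_real_derivative dir_deriv (0, 1) \<phi> (x, s)) (at s)"
proof -
  have "((\<lambda>s. (x, s)) has_derivative (\<lambda>h. (0, h))) (at s)"
    by (auto intro!: derivative_eq_intros)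
  moreover have "(\<phi> has_derivative frechet_derivative \<phi> (at (x, s))) (at (x, s))"
    using smooth_differentiable[OF assms] by (simp add: frechet_derivative_works[symmetric])
  ultimately have D: "((\<lambda>s. \<phi> (x, s)) has_derivative (\<lambda>h. frechet_derivative \<phi> (at (x, s)) (0, h))) (at s)"
    by (rule has_derivative_compose)
  interpret bounded_linear "frechet_derivative \<phi> (at (x, s))"
    using smooth_differentiable[OF assms] frechet_derivative_works has_derivative_bounded_linear by blast
  have "frechet_derivative \<phi> (at (x, s)) (0, h) = h * dir_deriv (0, 1) \<phi> (x, s)" for h
    using scaleR[of h "(0, 1)"] by (simp add: dir_deriv_def)
  then show ?thesis
    using D by (simp add: has_field_derivative_def mult_commute_abs)
qed

lemma dir_deriv_zero_outside:
  assumes "closed K" "\<And>q. q \<notin> K \<Longrightarrow> \<phi> q = 0" "p \<notin> K"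
  shows "dir_deriv b \<phi> p = 0"
proof -
  have "(\<phi> has_derivative (\<lambda>h. 0)) (at p)"
    by (rule has_derivative_transform_within_open[of "\<lambda>_. 0" _ p UNIV "- K"]) (use assms in auto)
  then show ?thesis
    by (rule dir_deriv_eq)
qed

text \<open>Given differentiability at \<open>p\<close>, the chain rule along the line in direction
  \<open>b\<close> suffices. It serves functions that are constant in some directions only:
  time-independent ones, and cutoffs away from the boundary.\<close>

lemma dir_deriv_locally_constant:
  assumes "0 < d" "\<And>s. \<bar>s\<bar> < d \<Longrightarrow> \<phi> (p + s *\<^sub>R b) = \<phi> p" "\<phi> differentiable (at p)"
  shows "dir_deriv b \<phi> p = 0"
proof -
  have D: "(\<phi> has_derivative frechet_derivative \<phi> (at p)) (at (p + 0 *\<^sub>R b))"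
    using assms(3) by (simp add: frechet_derivative_works)
  have "((\<lambda>s. p + s *\<^sub>R b) has_derivative (\<lambda>h. h *\<^sub>R b)) (at 0)"
    by (auto intro!: derivative_eq_intros)
  from has_derivative_compose[OF this D]
  have "((\<lambda>s. \<phi> (p + s *\<^sub>R b)) has_derivative (\<lambda>h. frechet_derivative \<phi> (at p) (h *\<^sub>R b))) (at 0)" .
  moreover have "((\<lambda>s. \<phi> (p + s *\<^sub>R b)) has_derivative (\<lambda>h. 0)) (at 0)"
    by (rule has_derivative_transform_within_open[of "\<lambda>_. \<phi> p" _ 0 UNIV "{-d<..<d}"]) (use assms in auto)
  ultimately have "(\<lambda>h. frechet_derivative \<phi> (at p) (h *\<^sub>R b)) = (\<lambda>h. 0)"
    by (rule has_derivative_unique)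
  from fun_cong[OF this, of 1] show ?thesis by (simp add: dir_deriv_def)
qed

section \<open>Compactly supported functions and convolution\<close>

text \<open>\<open>K\<close> is any set outside which the function vanishes, not the support itself.
  The same \<open>K\<close> can then be kept for products and, when closed, for derivatives.\<close>

definition supp_in :: "'e::euclidean_space set \<Rightarrow> ('e \<Rightarrow> 'b::zero) \<Rightarrow> bool" where
  "supp_in K \<phi> \<longleftrightarrow> (\<forall>p. p \<notin> K \<longrightarrow> \<phi> p = 0)"

lemma test_functions_iff:
  "\<phi> \<in> test_functions Q \<longleftrightarrow> smooth \<phi> \<and> (\<exists>K. compact K \<and> K \<subseteq> Q \<and> supp_in K \<phi>)"
  by (auto simp: test_functions_def supp_in_def)

lemma test_functions_smooth: "\<phi> \<in> test_functions Q \<Longrightarrow> smooth \<phi>"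
  by (simp add: test_functions_def)

lemma supp_in_dir_deriv: "supp_in K \<phi> \<Longrightarrow> closed K \<Longrightarrow> supp_in K (dir_deriv b \<phi>)"
  unfolding supp_in_def by (intro allI impI dir_deriv_zero_outside[of K]) auto

lemma test_functions_dir_deriv:
  "\<phi> \<in> test_functions Q \<Longrightarrow> b \<in> Basis \<Longrightarrow> dir_deriv b \<phi> \<in> test_functions Q"
  unfolding test_functions_iff by (auto intro: smooth_dir_deriv supp_in_dir_deriv compact_imp_closed)

lemma test_functions_mult:
  "\<phi> \<in> test_functions Q \<Longrightarrow> smooth \<psi> \<Longrightarrow> (\<lambda>p. \<phi> p * \<psi> p) \<in> test_functions Q"
  unfolding test_functions_iff by (auto intro!: smooth_mult simp: supp_in_def)

lemma test_functions_add:
  "\<phi> \<in> test_functions Q \<Longrightarrow> \<psi> \<in> test_functions Q \<Longrightarrow> (\<lambda>p. \<phi> p + \<psi> p) \<in> test_functions Q"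
  unfolding test_functions_iff
proof (elim conjE exE, intro conjI exI)
  fix K L assume "compact K" "compact L" "K \<subseteq> Q" "L \<subseteq> Q" "supp_in K \<phi>" "supp_in L \<psi>"
  then show "compact (K \<union> L)" "K \<union> L \<subseteq> Q" "supp_in (K \<union> L) (\<lambda>p. \<phi> p + \<psi> p)"
    by (auto simp: supp_in_def)
qed (auto intro: smooth_add)

lemma test_functions_subset: "\<phi> \<in> test_functions Q \<Longrightarrow> Q \<subseteq> R \<Longrightarrow> \<phi> \<in> test_functions R"
  by (auto simp: test_functions_iff)

lemma test_functions_outside: "\<phi> \<in> test_functions Q \<Longrightarrow> p \<notin> Q \<Longrightarrow> \<phi> p = 0"
  by (auto simp: test_functions_iff supp_in_def)

lemma test_functions_translate:
  assumes "\<phi> \<in> test_functions Q" "\<And>p. p \<in> Q \<Longrightarrow> p - c \<in> R"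
  shows "(\<lambda>p. \<phi> (p + c)) \<in> test_functions R"
proof -
  from assms obtain K where "compact K" "K \<subseteq> Q" "supp_in K \<phi>" "smooth \<phi>"
    by (auto simp: test_functions_iff)
  then have "compact ((\<lambda>p. p - c) ` K)" "(\<lambda>p. p - c) ` K \<subseteq> R" "supp_in ((\<lambda>p. p - c) ` K) (\<lambda>p. \<phi> (p + c))"
    using assms(2) by (auto simp: supp_in_def image_iff intro!: compact_continuous_image continuous_intros)
      (metis add_diff_cancel_right')
  then show ?thesis
    unfolding test_functions_iff using smooth_translate[OF \<open>smooth \<phi>\<close>] by auto
qed

lemma supp_in_bounded:
  fixes \<phi> :: "'e::euclidean_space \<Rightarrow> real"
  assumes "continuous_on UNIV \<phi>" "compact K" "supp_in K \<phi>"
  obtains B where "0 < B" "\<And>p. \<bar>\<phi> p\<bar> \<le> B"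
proof -
  have "bounded (\<phi> ` K)"
    using assms by (intro compact_imp_bounded compact_continuous_image) (auto intro: continuous_on_subset)
  then obtain B where B: "\<And>p. p \<in> K \<Longrightarrow> \<bar>\<phi> p\<bar> \<le> B" "0 < B"
    unfolding bounded_pos by auto
  have "\<bar>\<phi> p\<bar> \<le> B" for p
    using B assms(3) by (cases "p \<in> K") (auto simp: supp_in_def)
  then show thesis using B that by blast
qed

lemma supp_in_uniformly_continuous:
  fixes \<phi> :: "'e::euclidean_space \<Rightarrow> real"
  assumes c: "continuous_on UNIV \<phi>" and K: "compact K" "supp_in K \<phi>" and e: "0 < e"
  obtains d where "0 < d" "\<And>p q. dist p q < d \<Longrightarrow> \<bar>\<phi> p - \<phi> q\<bar> < e"
proof -
  obtain R where R: "\<And>p. p \<in> K \<Longrightarrow> norm p \<le> R"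
    using compact_imp_bounded[OF K(1)] by (auto simp: bounded_iff)
  \<comment> \<open>The margin 1 ensures that two points at distance less than 1 both lie in this
    compact ball unless both miss \<open>K\<close>.\<close>
  have "uniformly_continuous_on (cball 0 (R + 1)) \<phi>"
    using c by (intro compact_uniformly_continuous) (auto intro: continuous_on_subset)
  then obtain d where d: "0 < d" "\<And>p q. p \<in> cball 0 (R + 1) \<Longrightarrow> q \<in> cball 0 (R + 1) \<Longrightarrow> dist p q < d \<Longrightarrow> dist (\<phi> p) (\<phi> q) < e"
    unfolding uniformly_continuous_on_def using e by metis
  show thesis
  proof (rule that[of "min d 1"])
    fix p q :: 'e assume pq: "dist p q < min d 1"
    show "\<bar>\<phi> p - \<phi> q\<bar> < e"
    proof (cases "norm p \<le> R \<or> norm q \<le> R")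
      case True
      have "norm p \<le> norm q + 1" "norm q \<le> norm p + 1"
        using pq norm_triangle_ineq2[of p q] norm_triangle_ineq2[of q p] by (auto simp: dist_norm norm_minus_commute)
      then show ?thesis
        using True pq d(2)[of p q] by (auto simp: dist_real_def)
    next
      case False
      then have "\<phi> p = 0" "\<phi> q = 0" using R K(2) by (auto simp: supp_in_def)
      then show ?thesis using e by simp
    qed
  qed (use d in auto)
qed

text \<open>Compact support makes the partial derivatives uniformly continuous, so the mean value
  inequality bounds the remainder with one \<open>d\<close> for all \<open>p\<close>. This
  uniformity is what permits differentiation under an integral against any finite measure.\<close>

lemma uniform_linearization:
  fixes \<psi> :: "'e::euclidean_space \<Rightarrow> real"
  assumes s: "smooth \<psi>" and K: "compact K" "supp_in K \<psi>" and e: "0 < e"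
  obtains d where "0 < d"
    "\<And>p h. norm h < d \<Longrightarrow> \<bar>\<psi> (p + h) - \<psi> p - (\<Sum>b\<in>Basis. (h \<bullet> b) * dir_deriv b \<psi> p)\<bar> \<le> e * norm h"
proof -
  define n where "n = real DIM('e)"
  have n: "0 < n" by (simp add: n_def)
  \<comment> \<open>Each of the \<open>n\<close> partial derivatives may vary by
    \<open>e / n\<close>; together they contribute \<open>e\<close>.\<close>
  have "\<exists>d>0. \<forall>p q. dist p q < d \<longrightarrow> \<bar>dir_deriv b \<psi> p - dir_deriv b \<psi> q\<bar> < e / n" if "b \<in> Basis" for b
  proof -
    have "continuous_on UNIV (dir_deriv b \<psi>)"
      by (intro smooth_continuous smooth_dir_deriv s that)
    from supp_in_uniformly_continuous[OF this K(1) supp_in_dir_deriv[OF K(2)], of "e / n"]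
    show ?thesis using K e n by (metis compact_imp_closed divide_pos_pos)
  qed
  then obtain d where d: "\<And>b. b \<in> Basis \<Longrightarrow> 0 < d b"
    "\<And>b p q. b \<in> Basis \<Longrightarrow> dist p q < d b \<Longrightarrow> \<bar>dir_deriv b \<psi> p - dir_deriv b \<psi> q\<bar> < e / n"
    by metis
  define d0 where "d0 = Min (d ` Basis)"
  have d0: "0 < d0" "\<And>b. b \<in> Basis \<Longrightarrow> d0 \<le> d b" using d by (auto simp: d0_def)
  show thesis
  proof (rule that[OF d0(1)])
    fix p h :: 'e assume h: "norm h < d0"
    define D where "D x = (\<lambda>h. \<Sum>b\<in>Basis. (h \<bullet> b) * dir_deriv b \<psi> x)" for x
    have "norm (\<psi> (p + h) - \<psi> p - D p (p + h - p)) \<le> norm (p + h - p) * e"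
    proof (rule differentiable_bound_linearization[where S="ball p d0"])
      show "p + t *\<^sub>R (p + h - p) \<in> ball p d0" if "t \<in> {0..1}" for t
      proof -
        have "\<bar>t\<bar> * norm h \<le> 1 * norm h" using that by (intro mult_right_mono) auto
        then show ?thesis using h by (auto simp: dist_norm)
      qed
      show "(\<psi> has_derivative D x) (at x within ball p d0)" for x
        unfolding D_def using smooth_has_derivative[OF s, of x] has_derivative_at_withinI by fastforce
      show "onorm (D x - D p) \<le> e" if x: "x \<in> ball p d0" for x
      proof (rule onorm_le)
        fix k
        have "norm ((D x - D p) k) = \<bar>\<Sum>b\<in>Basis. (k \<bullet> b) * (dir_deriv b \<psi> x - dir_deriv b \<psi> p)\<bar>"
          by (simp add: D_def right_diff_distrib sum_subtractf)
        also have "\<dots> \<le> (\<Sum>b\<in>(Basis::'e set). norm k * (e / n))"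
        proof (rule order_trans[OF sum_abs sum_mono])
          fix b :: 'e assume b: "b \<in> Basis"
          have "\<bar>k \<bullet> b\<bar> \<le> norm k" using Basis_le_norm[OF b] .
          moreover have "\<bar>dir_deriv b \<psi> x - dir_deriv b \<psi> p\<bar> \<le> e / n"
            using d(2)[OF b, of x p] d0(2)[OF b] x by (auto simp: dist_commute)
          ultimately show "\<bar>(k \<bullet> b) * (dir_deriv b \<psi> x - dir_deriv b \<psi> p)\<bar> \<le> norm k * (e / n)"
            unfolding abs_mult by (intro mult_mono) auto
        qed
        also have "\<dots> = e * norm k" using n by (simp add: n_def)
        finally show "norm ((D x - D p) k) \<le> e * norm k" .
      qed
    qed (use d0 in auto)
    then show "\<bar>\<psi> (p + h) - \<psi> p - (\<Sum>b\<in>Basis. (h \<bullet> b) * dir_deriv b \<psi> p)\<bar> \<le> e * norm h"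
      by (simp add: D_def mult.commute)
  qed
qed

text \<open>Averages of translates cover two constructions at once. With Lebesgue measure on a set
  and \<open>\<kappa>\<close> the identity they smooth an indicator function; with Lebesgue measure
  on an interval and \<open>\<kappa> r = (0, r)\<close> they integrate in time.\<close>

locale convolution = finite_measure \<nu> for \<nu> :: "'m measure" +
  fixes \<kappa> :: "'m \<Rightarrow> 'e::euclidean_space"
  assumes \<kappa> [measurable]: "\<kappa> \<in> borel_measurable \<nu>"
begin

definition conv :: "('e \<Rightarrow> real) \<Rightarrow> 'e \<Rightarrow> real" where
  "conv \<psi> p = (\<integral>s. \<psi> (p - \<kappa> s) \<partial>\<nu>)"

lemma conv_integrable:
  fixes \<psi> :: "'e \<Rightarrow> real"
  assumes "smooth \<psi>" "compact K" "supp_in K \<psi>"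
  shows "integrable \<nu> (\<lambda>s. \<psi> (p - \<kappa> s))"
proof -
  obtain B where "\<And>p. \<bar>\<psi> p\<bar> \<le> B"
    using supp_in_bounded[OF smooth_continuous[OF assms(1)] assms(2,3)] by blast
  then show ?thesis
    using smooth_borel[OF assms(1)] by (intro integrable_const_bound[of _ B]) auto
qed

text \<open>The uniform linearization error of \<open>\<psi>\<close> is integrated against
  \<open>\<nu>\<close>, which multiplies it by at most the total mass.\<close>

lemma conv_has_derivative:
  fixes \<psi> :: "'e \<Rightarrow> real"
  assumes \<psi>: "smooth \<psi>" "compact K" "supp_in K \<psi>"
  shows "(conv \<psi> has_derivative (\<lambda>h. \<Sum>b\<in>Basis. (h \<bullet> b) * conv (dir_deriv b \<psi>) p)) (at p)"
  unfolding has_derivative_at_alt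
proof (intro conjI allI impI)
  show "bounded_linear (\<lambda>h. \<Sum>b\<in>Basis. (h \<bullet> b) * conv (dir_deriv b \<psi>) p)"
    by (intro bounded_linear_sum bounded_linear_mult_const bounded_linear_inner_left)
  fix e :: real assume e: "0 < e"
  \<comment> \<open>The summand 1 keeps the divisor positive when \<open>\<nu>\<close> has mass
    zero.\<close>
  define m where "m = measure \<nu> (space \<nu>) + 1"
  have m: "0 < m" "measure \<nu> (space \<nu>) \<le> m" by (auto simp: m_def add_nonneg_pos)
  obtain d where d: "0 < d"
    "\<And>p h. norm h < d \<Longrightarrow> \<bar>\<psi> (p + h) - \<psi> p - (\<Sum>b\<in>Basis. (h \<bullet> b) * dir_deriv b \<psi> p)\<bar> \<le> e / m * norm h"
    using uniform_linearization[OF \<psi>, of "e / m"] e m by auto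
  have "norm (conv \<psi> q - conv \<psi> p - (\<Sum>b\<in>Basis. ((q - p) \<bullet> b) * conv (dir_deriv b \<psi>) p)) \<le> e * norm (q - p)"
    if q: "norm (q - p) < d" for q
  proof -
    define r where "r s = \<psi> (q - \<kappa> s) - \<psi> (p - \<kappa> s) - (\<Sum>b\<in>Basis. ((q - p) \<bullet> b) * dir_deriv b \<psi> (p - \<kappa> s))" for s
    have i: "integrable \<nu> (\<lambda>s. \<psi> (q - \<kappa> s))" "integrable \<nu> (\<lambda>s. \<psi> (p - \<kappa> s))"
      "b \<in> Basis \<Longrightarrow> integrable \<nu> (\<lambda>s. dir_deriv b \<psi> (p - \<kappa> s))" for b
      using conv_integrable[OF \<psi>] conv_integrable[OF smooth_dir_deriv[OF \<psi>(1)] \<psi>(2) supp_in_dir_deriv[OF \<psi>(3)]]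
      compact_imp_closed[OF \<psi>(2)] by auto
    have ir: "integrable \<nu> r" unfolding r_def using i by auto
    have "conv \<psi> q - conv \<psi> p - (\<Sum>b\<in>Basis. ((q - p) \<bullet> b) * conv (dir_deriv b \<psi>) p) = (\<integral>s. r s \<partial>\<nu>)"
      unfolding r_def conv_def using i by (simp add: Bochner_Integration.integral_sum)
    also have "norm \<dots> \<le> (\<integral>s. e / m * norm (q - p) \<partial>\<nu>)"
    proof (rule order_trans[OF integral_norm_bound integral_mono])
      fix s
      show "norm (r s) \<le> e / m * norm (q - p)"
        using d(2)[OF q, of "p - \<kappa> s"] by (simp add: r_def algebra_simps)
    qed (use ir in auto)
    also have "\<dots> = (measure \<nu> (space \<nu>) / m) * (e * norm (q - p))" by simp
    also have "\<dots> \<le> 1 * (e * norm (q - p))"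
      using m e by (intro mult_right_mono) auto
    finally show ?thesis by simp
  qed
  then show "\<exists>d>0. \<forall>q. norm (q - p) < d \<longrightarrow>
      norm (conv \<psi> q - conv \<psi> p - (\<Sum>b\<in>Basis. ((q - p) \<bullet> b) * conv (dir_deriv b \<psi>) p)) \<le> e * norm (q - p)"
    using d by blast
qed

lemma dir_deriv_conv:
  fixes \<psi> :: "'e \<Rightarrow> real"
  assumes "smooth \<psi>" "compact K" "supp_in K \<psi>" "b \<in> Basis"
  shows "dir_deriv b (conv \<psi>) = conv (dir_deriv b \<psi>)"
proof
  fix p
  have "dir_deriv b (conv \<psi>) p = (\<Sum>c\<in>Basis. (b \<bullet> c) * conv (dir_deriv c \<psi>) p)"
    by (rule dir_deriv_eq[OF conv_has_derivative[OF assms(1-3)]])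
  also have "\<dots> = (\<Sum>c\<in>Basis. (if c = b then 1 else 0) * conv (dir_deriv c \<psi>) p)"
    using assms(4) by (intro sum.cong) (auto simp: inner_Basis)
  also have "\<dots> = (\<Sum>c\<in>{b}. conv (dir_deriv c \<psi>) p)"
    using assms(4) by (intro sum.mono_neutral_cong_right) auto
  finally show "dir_deriv b (conv \<psi>) p = conv (dir_deriv b \<psi>) p" by simp
qed

text \<open>Differentiation passes to \<open>\<psi>\<close>, and the derivatives of
  \<open>\<psi>\<close> satisfy the same hypotheses with the same \<open>K\<close>; hence the
  induction with \<open>\<psi>\<close> arbitrary.\<close>

lemma smooth_conv:
  fixes \<psi> :: "'e \<Rightarrow> real"
  assumes "smooth \<psi>" "compact K" "supp_in K \<psi>"
  shows "smooth (conv \<psi>)"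
  unfolding smooth_def
proof
  fix k
  show "Ck k (conv \<psi>)"
    using assms
  proof (induction k arbitrary: \<psi>)
    case 0
    then show ?case
      using conv_has_derivative[OF 0]
      by (auto intro!: continuous_at_imp_continuous_on has_derivative_continuous)
  next
    case (Suc k)
    have "conv \<psi> differentiable at p" for p
      using conv_has_derivative[OF Suc.prems] differentiable_def by blast
    moreover have "Ck k (dir_deriv b (conv \<psi>))" if b: "b \<in> Basis" for b
      unfolding dir_deriv_conv[OF Suc.prems b]
      using Suc.prems b by (intro Suc.IH smooth_dir_deriv supp_in_dir_deriv compact_imp_closed)
    ultimately show ?case by simp
  qed
qed

end

section \<open>Mollified indicator functions\<close>

text \<open>The powers of \<open>inverse s\<close> make the family closed under differentiation up
  to linear combinations. Smoothness of \<open>exp (- inverse s)\<close>, continued by zero, then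
  follows by one induction for all \<open>k\<close> at once.\<close>

definition bump :: "nat \<Rightarrow> real \<Rightarrow> real" where
  "bump k s = (if s \<le> 0 then 0 else inverse s ^ k * exp (- inverse s))"

lemma bump_nonneg: "0 \<le> bump k s"
  by (simp add: bump_def)

lemma power_le_fact_exp: "0 \<le> u \<Longrightarrow> u ^ k \<le> fact k * exp (u::real)"
proof -
  assume u: "0 \<le> u"
  have "inverse (fact k) * u ^ k \<le> (\<Sum>n. inverse (fact n) * u ^ n)"
    using sum_le_suminf[OF summable_exp[of u], of "{k}"] u by simp
  also have "\<dots> = exp u" by (simp add: exp_def)
  finally show ?thesis by (simp add: field_simps)
qed

lemma bump_le: "bump k s \<le> fact k"
proof (cases "s \<le> 0")
  case False
  then have "inverse s ^ k * exp (- inverse s) \<le> fact k * exp (inverse s) * exp (- inverse s)"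
    by (intro mult_right_mono power_le_fact_exp) auto
  also have "\<dots> = fact k" by (simp add: exp_minus)
  finally show ?thesis using False by (simp add: bump_def)
qed (simp add: bump_def)

lemma bump_derivative:
  "(bump k has_real_derivative bump (k + 2) s - real k * bump (k + 1) s) (at s)"
proof -
  consider "s < 0" | "s = 0" | "s > 0" by linarith
  then show ?thesis
  proof cases
    case 1
    have "(bump k has_real_derivative 0) (at s)"
      by (rule has_field_derivative_transform_within_open[of "\<lambda>_. 0" _ _ "{..<0}"])
         (use 1 in \<open>auto simp: bump_def\<close>)
    then show ?thesis using 1 by (simp add: bump_def)
  next
    case 3
    have "((\<lambda>s. inverse s ^ k * exp (- inverse s)) has_real_derivative
       bump (k + 2) s - real k * bump (k + 1) s) (at s)"
      using 3 by (auto intro!: derivative_eq_intros simp: bump_def power2_eq_square)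
        (cases k; simp add: field_simps)
    then show ?thesis
      by (rule has_field_derivative_transform_within_open[of _ _ _ "{0<..}"])
         (use 3 in \<open>auto simp: bump_def\<close>)
  next
    case 2
    have "((\<lambda>h. (bump k (0 + h) - bump k 0) / h) \<longlongrightarrow> 0) (at 0)"
    proof (rule Lim_null_comparison)
      have "\<bar>bump k h / h\<bar> \<le> fact (k + 2) * \<bar>h\<bar>" for h
      proof (cases "h \<le> 0")
        case False
        \<comment> \<open>The quotient at the origin stays within the family: two more powers of
          \<open>inverse h\<close> leave a factor \<open>h\<close>, and \<open>bump_le\<close>
          bounds the rest.\<close>
        have "bump k h / h = h * bump (k + 2) h"
          using False by (simp add: bump_def field_simps)
        also have "\<dots> \<le> h * fact (k + 2)"
          using False bump_le by (intro mult_left_mono) (auto simp del: fact_Suc)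
        finally show ?thesis
          using False bump_nonneg[of k h] by (simp add: mult.commute del: fact_Suc)
      qed (auto simp: bump_def mult_nonneg_nonpos simp del: fact_Suc)
      then show "\<forall>\<^sub>F h in at 0. norm ((bump k (0 + h) - bump k 0) / h) \<le> fact (k + 2) * \<bar>h\<bar>"
        by (simp add: bump_def)
      show "((\<lambda>h. fact (k + 2) * \<bar>h\<bar> :: real) \<longlongrightarrow> 0) (at 0)"
        by (auto intro!: tendsto_eq_intros)
    qed
    then have "(bump k has_real_derivative 0) (at 0)"
      by (simp add: DERIV_def)
    then show ?thesis using 2 by (simp add: bump_def)
  qed
qed

lemma Ck_bump:
  fixes q :: "'e::euclidean_space \<Rightarrow> real"
  assumes q: "smooth q"
  shows "Ck m (\<lambda>p. bump k (q p))"
proof (induction m arbitrary: k)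
  case 0
  have "continuous_on UNIV (bump k)"
    by (intro continuous_at_imp_continuous_on ballI DERIV_isCont[OF bump_derivative])
  then show ?case
    using smooth_continuous[OF q, of UNIV] by (auto intro: continuous_on_compose2)
next
  case (Suc m)
  define D where "D p b = (bump (k + 2) (q p) + (- real k) * bump (k + 1) (q p)) * dir_deriv b q p" for p b
  show ?case
  proof (rule Ck_SucI)
    show "((\<lambda>p. bump k (q p)) has_derivative D p) (at p)" for p
    proof -
      have "(q has_derivative frechet_derivative q (at p)) (at p)"
        using smooth_differentiable[OF q] frechet_derivative_works by blast
      from has_derivative_compose[OF this bump_derivative[THEN has_field_derivative_imp_has_derivative]]
      show ?thesis unfolding D_def dir_deriv_def by (simp add: algebra_simps)
    qed
    show "Ck m (\<lambda>p. D p b)" if "b \<in> Basis" for b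
      unfolding D_def using Suc smooth_dir_deriv[OF q that]
      by (intro Ck_mult Ck_add Ck_const) (auto simp: smooth_def)
  qed
qed

text \<open>The standard mollifier \<open>exp (- 1 / (1 - |p|^2 / \<epsilon>^2))\<close> on the ball
  of radius \<open>\<epsilon>\<close>, left unnormalized. Writing \<open>p \<bullet> p\<close>
  instead of a norm makes the argument a polynomial, smooth also at the origin.\<close>

definition kern :: "real \<Rightarrow> 'e::euclidean_space \<Rightarrow> real" where
  "kern \<epsilon> p = bump 0 (1 - (1 / \<epsilon>\<^sup>2) * (p \<bullet> p))"

lemma smooth_kern_arg: "smooth (\<lambda>p::'e::euclidean_space. 1 - c * (p \<bullet> p))"
  by (intro smooth_diff smooth_mult smooth_inner smooth_const)
     (simp_all add: smooth_def Ck_linear[OF bounded_linear_ident])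

lemma smooth_kern: "smooth (kern \<epsilon> :: 'e::euclidean_space \<Rightarrow> real)"
  unfolding smooth_def kern_def using Ck_bump[OF smooth_kern_arg] by blast

lemma kern_nonneg: "0 \<le> kern \<epsilon> p" and kern_le_1: "kern \<epsilon> p \<le> 1"
  using bump_le[of 0] by (auto simp: kern_def bump_nonneg)

lemma kern_zero:
  assumes "0 < \<epsilon>" "\<epsilon> \<le> norm p"
  shows "kern \<epsilon> p = 0"
proof -
  have "\<epsilon>\<^sup>2 \<le> p \<bullet> p"
    using assms by (auto simp: power2_norm_eq_inner[symmetric] intro: power_mono)
  then show ?thesis
    using assms by (simp add: kern_def bump_def)
qed

text \<open>On half the radius the argument of \<open>bump 0\<close> is at least 3/4, in particular
  at least 1/2, and \<open>exp (- inverse s)\<close> increases with \<open>s\<close>.\<close>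

lemma kern_ge:
  assumes "0 < \<epsilon>" "norm p \<le> \<epsilon> / 2"
  shows "exp (- 2) \<le> kern \<epsilon> p"
proof -
  define x where "x = 1 / \<epsilon>\<^sup>2 * (p \<bullet> p)"
  have "p \<bullet> p \<le> (\<epsilon> / 2)\<^sup>2"
    using assms by (auto simp: power2_norm_eq_inner[symmetric] intro: power_mono)
  then have "x \<le> 1 / \<epsilon>\<^sup>2 * (\<epsilon> / 2)\<^sup>2"
    unfolding x_def by (intro mult_left_mono) auto
  also have "\<dots> = 1 / 4"
    using assms by (simp add: power_divide)
  finally have x: "1 / 2 \<le> 1 - x"
    by linarith
  then have "inverse (1 - x) \<le> inverse (1 / 2)"
    by (intro le_imp_inverse_le) auto
  moreover have "kern \<epsilon> p = bump 0 (1 - x)"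
    by (simp only: kern_def x_def)
  ultimately show ?thesis
    using x by (simp add: bump_def)
qed

text \<open>On the ball \<open>bump 2\<close> is at most \<open>fact 2 = 2\<close> and the
  derivative of its argument is at most \<open>2 / \<epsilon>\<close> in absolute value; outside the
  kernel vanishes.\<close>

lemma dir_deriv_kern_le:
  fixes p :: "'e::euclidean_space"
  assumes \<epsilon>: "0 < \<epsilon>" and b: "b \<in> Basis"
  shows "\<bar>dir_deriv b (kern \<epsilon>) p\<bar> \<le> 4 / \<epsilon>"
proof (cases "norm p \<le> \<epsilon>")
  case True
  have "((\<lambda>p. 1 - (1 / \<epsilon>\<^sup>2) * (p \<bullet> p)) has_derivative (\<lambda>h. - (1 / \<epsilon>\<^sup>2) * (2 * (p \<bullet> h)))) (at p)"
    by (rule derivative_eq_intros refl)+ (auto simp: inner_commute algebra_simps)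
  from has_derivative_compose[OF this bump_derivative[of 0, THEN has_field_derivative_imp_has_derivative]]
  have "(kern \<epsilon> has_derivative (\<lambda>h. bump 2 (1 - (1 / \<epsilon>\<^sup>2) * (p \<bullet> p)) * (- (1 / \<epsilon>\<^sup>2) * (2 * (p \<bullet> h))))) (at p)"
    by (simp add: kern_def[abs_def] numeral_2_eq_2)
  then have "dir_deriv b (kern \<epsilon>) p = bump 2 (1 - (1 / \<epsilon>\<^sup>2) * (p \<bullet> p)) * (- (1 / \<epsilon>\<^sup>2) * (2 * (p \<bullet> b)))"
    by (rule dir_deriv_eq)
  also have "\<bar>\<dots>\<bar> = bump 2 (1 - (1 / \<epsilon>\<^sup>2) * (p \<bullet> p)) * ((1 / \<epsilon>\<^sup>2) * (2 * \<bar>p \<bullet> b\<bar>))"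
    by (simp add: abs_mult bump_nonneg)
  also have "\<dots> \<le> 2 * ((1 / \<epsilon>\<^sup>2) * (2 * \<epsilon>))"
    using bump_le[of 2] Basis_le_norm[OF b, of p] True \<epsilon>
    by (intro mult_mono) (auto simp: numeral_2_eq_2)
  also have "\<dots> = 4 / \<epsilon>" using \<epsilon> by (simp add: power2_eq_square)
  finally show ?thesis .
next
  case False
  have "dir_deriv b (kern \<epsilon>) p = 0"
    by (rule dir_deriv_zero_outside[of "cball 0 \<epsilon>"]) (use False in \<open>auto intro!: kern_zero \<epsilon>\<close>)
  then show ?thesis using \<epsilon> by simp
qed

lemma lborel_integral_translate:
  fixes f :: "'e::euclidean_space \<Rightarrow> 'b::{banach, second_countable_topology}"
  assumes "f \<in> borel_measurable borel"
  shows "(\<integral>q. f (p + q) \<partial>lborel) = (\<integral>q. f q \<partial>lborel)"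
proof -
  have "(\<integral>q. f q \<partial>distr lborel borel ((+) p)) = (\<integral>q. f (p + q) \<partial>lborel)"
    using assms by (subst integral_distr) auto
  then show ?thesis
    by (simp add: lborel_distr_plus)
qed

definition kern_mass :: "'e::euclidean_space itself \<Rightarrow> real \<Rightarrow> real" where
  "kern_mass _ \<epsilon> = (\<integral>q. kern \<epsilon> (q::'e) \<partial>lborel)"

lemma kern_measurable [measurable]: "kern \<epsilon> \<in> borel_measurable borel"
  by (rule smooth_borel[OF smooth_kern])

lemma kern_minus: "kern \<epsilon> (- p) = kern \<epsilon> p"
  by (simp add: kern_def)

lemma kern_integrable:
  assumes "0 < \<epsilon>"
  shows "integrable lborel (kern \<epsilon> :: 'e::euclidean_space \<Rightarrow> real)"
proof (rule Bochner_Integration.integrable_bound)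
  show "integrable lborel (indicator (ball (0::'e) \<epsilon>) :: 'e \<Rightarrow> real)"
    using emeasure_bounded_finite[OF bounded_ball] by (intro integrable_real_indicator) auto
  show "AE x in lborel. norm (kern \<epsilon> (x::'e)) \<le> norm (indicator (ball 0 \<epsilon>) x :: real)"
  proof (intro AE_I2)
    fix x :: 'e
    show "norm (kern \<epsilon> x) \<le> norm (indicator (ball 0 \<epsilon>) x :: real)"
      using kern_zero[OF assms, of x] kern_le_1[of \<epsilon> x] kern_nonneg[of \<epsilon> x]
      by (cases "norm x < \<epsilon>") (auto simp: indicator_def)
  qed
qed auto

text \<open>Only the half ball is counted, where \<open>kern_ge\<close> applies. The bound has the
  order of a ball volume, which cancels in the gradient estimate for \<open>moll\<close>.\<close>

lemma kern_mass_ge: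
  assumes \<epsilon>: "0 < \<epsilon>"
  shows "exp (- 2) * (unit_ball_vol DIM('e) * (\<epsilon> / 2) ^ DIM('e)) \<le> kern_mass TYPE('e::euclidean_space) \<epsilon>"
proof -
  have "exp (- 2) * (unit_ball_vol DIM('e) * (\<epsilon> / 2) ^ DIM('e)) =
      (\<integral>x. exp (- 2) * indicator (ball (0::'e) (\<epsilon> / 2)) x \<partial>lborel)"
    using \<epsilon> by (simp add: content_ball)
  also have "\<dots> \<le> kern_mass TYPE('e) \<epsilon>"
    unfolding kern_mass_def
  proof (rule integral_mono)
    show "integrable lborel (\<lambda>x. exp (- 2) * indicator (ball (0::'e) (\<epsilon> / 2)) x :: real)"
      using emeasure_bounded_finite[OF bounded_ball]
      by (intro integrable_mult_right integrable_real_indicator) auto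
    show "exp (- 2) * indicator (ball 0 (\<epsilon> / 2)) x \<le> kern \<epsilon> x" for x :: 'e
      using kern_ge[OF \<epsilon>, of x] kern_nonneg[of \<epsilon> x] by (auto simp: indicator_def)
  qed (rule kern_integrable[OF \<epsilon>])
  finally show ?thesis .
qed

lemma kern_mass_pos: "0 < \<epsilon> \<Longrightarrow> 0 < kern_mass TYPE('e::euclidean_space) \<epsilon>"
  by (rule less_le_trans[OF _ kern_mass_ge]) auto

text \<open>Convolution of the indicator function of \<open>A\<close> with the normalized kernel,
  written as an integral over \<open>A\<close> so as to be an instance of
  \<open>convolution\<close>.\<close>

definition moll :: "real \<Rightarrow> 'e::euclidean_space set \<Rightarrow> 'e \<Rightarrow> real" where
  "moll \<epsilon> A p = (\<integral>q. kern \<epsilon> (p - q) \<partial>restrict_space lborel A) / kern_mass TYPE('e) \<epsilon>"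

lemma moll_convolution:
  assumes "A \<in> sets borel" "bounded A"
  shows "convolution (restrict_space lborel A) (\<lambda>q::'e::euclidean_space. q)"
proof (intro convolution.intro finite_measureI convolution_axioms.intro)
  show "emeasure (restrict_space lborel A) (space (restrict_space lborel A)) \<noteq> \<infinity>"
    using assms emeasure_bounded_finite[OF assms(2)] by (auto simp: emeasure_restrict_space space_restrict_space)
qed (auto intro: measurable_restrict_space1)

context
  fixes A :: "'e::euclidean_space set" and \<epsilon> :: real
  assumes A: "A \<in> sets borel" "bounded A" and \<epsilon>: "0 < \<epsilon>"
begin

interpretation convolution "restrict_space lborel A" "\<lambda>q. q"
  by (rule moll_convolution[OF A])

lemma kern_supp: "compact (cball (0::'e) \<epsilon>)" "supp_in (cball (0::'e) \<epsilon>) (kern \<epsilon>)"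
  using \<epsilon> by (auto simp: supp_in_def intro!: kern_zero)

lemma moll_eq_conv: "moll \<epsilon> A = (\<lambda>p. conv (kern \<epsilon>) p * (1 / kern_mass TYPE('e) \<epsilon>))"
  by (auto simp: moll_def conv_def)

lemma smooth_moll: "smooth (moll \<epsilon> A)"
  unfolding moll_eq_conv
  by (intro smooth_mult smooth_const smooth_conv[OF smooth_kern kern_supp])

lemma moll_eq: "moll \<epsilon> A p = (\<integral>q. indicator A (p + q) * kern \<epsilon> q \<partial>lborel) / kern_mass TYPE('e) \<epsilon>"
proof -
  have "(\<integral>q. kern \<epsilon> (p - q) \<partial>restrict_space lborel A) = (\<integral>q. indicator A q * kern \<epsilon> (p - q) \<partial>lborel)"
    using A by (subst integral_restrict_space) auto
  also have "\<dots> = (\<integral>q. indicator A (p + q) * kern \<epsilon> (p - (p + q)) \<partial>lborel)"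
    using A by (subst lborel_integral_translate) auto
  also have "\<dots> = (\<integral>q. indicator A (p + q) * kern \<epsilon> q \<partial>lborel)"
    by (simp add: kern_minus)
  finally show ?thesis by (simp add: moll_def)
qed

lemma moll_int: "integrable lborel (\<lambda>q. indicator A (p + q) * kern \<epsilon> q)"
  by (rule Bochner_Integration.integrable_bound[OF kern_integrable[OF \<epsilon>]])
     (use A in \<open>auto simp: indicator_def kern_nonneg\<close>)

lemma moll_nonneg: "0 \<le> moll \<epsilon> A p"
  unfolding moll_eq using kern_mass_pos[OF \<epsilon>, where 'e='e]
  by (intro divide_nonneg_pos Bochner_Integration.integral_nonneg) (auto simp: kern_nonneg)

lemma moll_le_1: "moll \<epsilon> A p \<le> 1"
proof -
  have "(\<integral>q. indicator A (p + q) * kern \<epsilon> q \<partial>lborel) \<le> kern_mass TYPE('e) \<epsilon>"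
    unfolding kern_mass_def
    by (intro integral_mono moll_int kern_integrable[OF \<epsilon>]) (auto simp: indicator_def kern_nonneg)
  then show ?thesis
    unfolding moll_eq using kern_mass_pos[OF \<epsilon>, where 'e='e] by simp
qed

text \<open>Only the part of \<open>A\<close> within distance \<open>\<epsilon>\<close> enters.
  Comparing these parts shows that \<open>moll\<close> is locally constant in a direction without
  computing a derivative.\<close>

lemma moll_cong:
  assumes "\<And>q. norm q < \<epsilon> \<Longrightarrow> p + q \<in> A \<longleftrightarrow> p' + q \<in> A"
  shows "moll \<epsilon> A p = moll \<epsilon> A p'"
proof -
  have "indicator A (p + q) * kern \<epsilon> q = indicator A (p' + q) * kern \<epsilon> q" for q
    using assms[of q] kern_zero[OF \<epsilon>, of q] by (cases "norm q < \<epsilon>") (auto simp: indicator_def)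
  then show ?thesis unfolding moll_eq by (simp only:)
qed

lemma moll_eq_1:
  assumes "\<And>q. norm q < \<epsilon> \<Longrightarrow> p + q \<in> A"
  shows "moll \<epsilon> A p = 1"
proof -
  have "indicator A (p + q) * kern \<epsilon> q = kern \<epsilon> q" for q
    using assms[of q] kern_zero[OF \<epsilon>, of q] by (cases "norm q < \<epsilon>") (auto simp: indicator_def)
  then show ?thesis
    unfolding moll_eq using kern_mass_pos[OF \<epsilon>, where 'e='e] by (simp only: kern_mass_def) simp
qed

lemma moll_eq_0:
  assumes "\<And>q. norm q < \<epsilon> \<Longrightarrow> p + q \<notin> A"
  shows "moll \<epsilon> A p = 0"
proof -
  have "indicator A (p + q) * kern \<epsilon> q = 0" for q
    using assms[of q] kern_zero[OF \<epsilon>, of q] by (cases "norm q < \<epsilon>") (auto simp: indicator_def)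
  then show ?thesis unfolding moll_eq by (simp only:) simp
qed

text \<open>The derivative of the kernel, at most \<open>4 / \<epsilon>\<close>, is integrated over
  a ball of volume \<open>V\<close>, and the mass is at least
  \<open>exp (- 2) * (V / 2 ^ DIM('e))\<close>. As \<open>V\<close> cancels, the bound is the same
  for all sets \<open>A\<close>.\<close>

lemma dir_deriv_moll_le:
  assumes b: "b \<in> Basis"
  shows "\<bar>dir_deriv b (moll \<epsilon> A) p\<bar> \<le> 4 * exp 2 * 2 ^ DIM('e) / \<epsilon>"
proof -
  define m where "m = kern_mass TYPE('e) \<epsilon>"
  define V where "V = unit_ball_vol DIM('e) * \<epsilon> ^ DIM('e)"
  have V: "0 < V" using \<epsilon> by (simp add: V_def)
  have m: "exp (- 2) * (V / 2 ^ DIM('e)) \<le> m" "0 < m"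
    using kern_mass_ge[OF \<epsilon>, where 'e='e] kern_mass_pos[OF \<epsilon>, where 'e='e]
    by (auto simp: m_def V_def power_divide)
  have supp: "supp_in (cball (0::'e) \<epsilon>) (dir_deriv b (kern \<epsilon>))"
    by (intro supp_in_dir_deriv kern_supp closed_cball)
  have "dir_deriv b (moll \<epsilon> A) p = dir_deriv b (conv (kern \<epsilon>)) p * (1 / m)"
    using dir_deriv_scaleR_const[OF smooth_conv[OF smooth_kern kern_supp], of b "1 / m" p]
    by (simp add: moll_eq_conv m_def)
  also have "dir_deriv b (conv (kern \<epsilon>)) p = (\<integral>q. dir_deriv b (kern \<epsilon>) (p - q) \<partial>restrict_space lborel A)"
    using dir_deriv_conv[OF smooth_kern kern_supp b] by (simp add: conv_def)
  also have "\<dots> = (\<integral>q. indicator A q * dir_deriv b (kern \<epsilon>) (p - q) \<partial>lborel)"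
    using A by (subst integral_restrict_space) auto
  also have "\<bar>\<dots> * (1 / m)\<bar> \<le> 4 / \<epsilon> * V * (1 / m)"
  proof -
    have "\<bar>\<integral>q. indicator A q * dir_deriv b (kern \<epsilon>) (p - q) \<partial>lborel\<bar> \<le> (\<integral>q. 4 / \<epsilon> * indicator (cball p \<epsilon>) q \<partial>lborel)"
    proof (rule order_trans[OF integral_abs_bound integral_mono'])
      show "integrable lborel (\<lambda>q. 4 / \<epsilon> * indicator (cball p \<epsilon>) q :: real)"
        using emeasure_bounded_finite[OF bounded_cball]
        by (intro integrable_mult_right integrable_real_indicator) auto
      show "\<bar>indicator A q * dir_deriv b (kern \<epsilon>) (p - q)\<bar> \<le> 4 / \<epsilon> * indicator (cball p \<epsilon>) q" for q
        using dir_deriv_kern_le[OF \<epsilon> b, of "p - q"] supp \<epsilon>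
        by (auto simp: indicator_def supp_in_def dist_norm)
      show "0 \<le> 4 / \<epsilon> * indicator (cball p \<epsilon>) q" for q using \<epsilon> by auto
    qed
    also have "\<dots> = 4 / \<epsilon> * V" using \<epsilon> by (simp add: content_cball V_def)
    finally have "\<bar>\<integral>q. indicator A q * dir_deriv b (kern \<epsilon>) (p - q) \<partial>lborel\<bar> * (1 / m) \<le> 4 / \<epsilon> * V * (1 / m)"
      using m by (intro mult_right_mono) auto
    then show ?thesis using m by (simp only: abs_mult abs_of_pos) (simp add: abs_mult)
  qed
  also have "\<dots> \<le> 4 / \<epsilon> * V * (1 / (exp (- 2) * (V / 2 ^ DIM('e))))"
    using m V \<epsilon> by (intro mult_left_mono divide_left_mono) auto
  also have "\<dots> = 4 * exp 2 * 2 ^ DIM('e) / \<epsilon>"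
    using V \<epsilon> by (simp add: exp_minus field_simps)
  finally show ?thesis .
qed

end

section \<open>Density of test functions\<close>

lemma integrable_indicator_lebesgue_on:
  assumes "B \<in> lmeasurable" "Q \<in> sets lebesgue"
  shows "integrable (lebesgue_on Q) (indicator B :: _ \<Rightarrow> real)"
    and "(\<integral>p. indicator B p \<partial>lebesgue_on Q) = measure lebesgue (B \<inter> Q)"
proof -
  have eq: "(\<lambda>x. indicator Q x * indicator B x) = (indicator (B \<inter> Q) :: _ \<Rightarrow> real)"
    by (auto simp: indicator_def)
  have BQ: "B \<inter> Q \<in> lmeasurable"
    using assms by (simp add: fmeasurable_Int_fmeasurable)
  show "integrable (lebesgue_on Q) (indicator B :: _ \<Rightarrow> real)"
    using assms BQ by (subst integrable_restrict_space) (auto simp: eq fmeasurable_def simp del: emeasure_completion)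
  show "(\<integral>p. indicator B p \<partial>lebesgue_on Q) = measure lebesgue (B \<inter> Q)"
    using assms by (subst integral_restrict_space) (auto simp: eq)
qed

lemma test_function_L2:
  assumes "\<phi> \<in> test_functions Q" "S \<in> sets lebesgue"
  shows "\<phi> \<in> L2 (lebesgue_on S)"
proof -
  obtain K where K: "smooth \<phi>" "compact K" "supp_in K \<phi>"
    using assms by (auto simp: test_functions_iff)
  obtain B where B: "0 < B" "\<And>p. \<bar>\<phi> p\<bar> \<le> B"
    using supp_in_bounded[OF smooth_continuous[OF K(1)] K(2,3)] by blast
  have m: "\<phi> \<in> borel_measurable (lebesgue_on S)"
    using smooth_continuous[OF K(1), of S] assms(2) by (rule continuous_imp_measurable_on_sets_lebesgue)
  show ?thesis
  proof (rule L2_boundI(1)[OF m])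
    show "integrable (lebesgue_on S) (\<lambda>p. B\<^sup>2 * indicator K p)"
      using K(2) assms(2) by (intro integrable_mult_right integrable_indicator_lebesgue_on(1) lmeasurable_compact)
    have "(\<phi> p)\<^sup>2 \<le> B\<^sup>2 * indicator K p" for p
      using K(3) power_mono[OF B(2), of p 2] by (auto simp: supp_in_def indicator_def)
    then show "AE p in lebesgue_on S. (norm (\<phi> p))\<^sup>2 \<le> B\<^sup>2 * indicator K p" by simp
  qed
qed

lemma smooth_cutoff:
  fixes K U :: "'e::euclidean_space set"
  assumes "compact K" "open U" "K \<subseteq> U"
  shows "\<exists>\<phi>\<in>test_functions U. (\<forall>p. 0 \<le> \<phi> p \<and> \<phi> p \<le> 1) \<and> (\<forall>p\<in>K. \<phi> p = 1)"
proof -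
  obtain \<delta> where \<delta>: "0 < \<delta>" "(\<Union>x\<in>K. ball x \<delta>) \<subseteq> U"
    using compact_subset_open_imp_ball_epsilon_subset[OF assms] .
  \<comment> \<open>The \<open>\<epsilon>\<close>-neighbourhood \<open>A\<close> of \<open>K\<close>
    is mollified at scale \<open>\<epsilon>\<close>; the result lives in the
    \<open>2 * \<epsilon>\<close>-neighbourhood \<open>L\<close>, still inside
    \<open>U\<close>.\<close>
  define \<epsilon> where "\<epsilon> = \<delta> / 3"
  have \<epsilon>: "0 < \<epsilon>" using \<delta> by (simp add: \<epsilon>_def)
  define A where "A = (\<Union>x\<in>K. \<Union>y\<in>cball 0 \<epsilon>. {x + y})"
  define L where "L = (\<Union>x\<in>K. \<Union>y\<in>cball 0 (2 * \<epsilon>). {x + y})"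
  have "compact A" "compact L"
    unfolding A_def L_def using compact_sums'[OF assms(1) compact_cball] by auto
  then have A: "A \<in> sets borel" "bounded A" by (auto intro: borel_compact compact_imp_bounded)
  have "L \<subseteq> U"
  proof
    fix z assume "z \<in> L"
    then obtain x y where "x \<in> K" "norm y \<le> 2 * \<epsilon>" "z = x + y" by (auto simp: L_def)
    then have "z \<in> ball x \<delta>" using \<delta>(1) by (auto simp: \<epsilon>_def dist_norm)
    then show "z \<in> U" using \<delta>(2) \<open>x \<in> K\<close> by blast
  qed
  show ?thesis
  proof (intro bexI conjI allI ballI)
    have "moll \<epsilon> A p = 0" if "p \<notin> L" for p
    proof (rule moll_eq_0[OF A \<epsilon>], rule notI)
      fix q :: 'e assume q: "norm q < \<epsilon>" "p + q \<in> A"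
      then obtain x y where xy: "x \<in> K" "norm y \<le> \<epsilon>" "p + q = x + y" by (auto simp: A_def)
      then have "p = x + (y - q)" by (simp add: algebra_simps)
      moreover have "y - q \<in> cball 0 (2 * \<epsilon>)"
        using xy(2) q(1) norm_triangle_ineq4[of y q] by simp
      ultimately show False using that xy(1) unfolding L_def by blast
    qed
    then show "moll \<epsilon> A \<in> test_functions U"
      using smooth_moll[OF A \<epsilon>] \<open>compact L\<close> \<open>L \<subseteq> U\<close> by (auto simp: test_functions_iff supp_in_def)
    show "moll \<epsilon> A p = 1" if "p \<in> K" for p
    proof (rule moll_eq_1[OF A \<epsilon>])
      fix q :: 'e assume "norm q < \<epsilon>"
      then have "q \<in> cball 0 \<epsilon>" by simp
      then show "p + q \<in> A" unfolding A_def using that by blast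
    qed
  qed (use moll_nonneg[OF A \<epsilon>] moll_le_1[OF A \<epsilon>] in auto)
qed

definition test_approx :: "'e::euclidean_space set \<Rightarrow> ('e \<Rightarrow> real) \<Rightarrow> bool" where
  "test_approx Q w \<longleftrightarrow> (\<forall>e>0. \<exists>\<phi>\<in>test_functions Q. L2_norm (lebesgue_on Q) (\<lambda>p. \<phi> p - w p) < e)"

text \<open>Regularity of Lebesgue measure gives a compact \<open>K\<close> inside \<open>A\<close>
  and an open \<open>U\<close> around \<open>K\<close> with small differences. A cutoff between
  \<open>K\<close> and \<open>U\<close> differs from the indicator function by at most 1, and only
  on \<open>B\<close>.\<close>

lemma test_approx_indicator:
  assumes Q: "open Q" "bounded Q" and A: "A \<in> sets lebesgue" "A \<subseteq> Q"
  shows "test_approx Q (indicator A)"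
  unfolding test_approx_def
proof (intro allI impI)
  fix e :: real assume e: "0 < e"
  \<comment> \<open>The exceptional set \<open>B\<close> has measure at most \<open>2 * d\<close>,
    half of \<open>e\<^sup>2\<close>.\<close>
  define d where "d = e\<^sup>2 / 4"
  have d: "0 < d" using e by (simp add: d_def)
  obtain K where K: "closed K" "K \<subseteq> A" "A - K \<in> lmeasurable" "emeasure lebesgue (A - K) < ennreal d"
    using sets_lebesgue_inner_closed[OF A(1) d] .
  have "bounded K" using K(2) A(2) Q(2) bounded_subset by blast
  with K have "compact K" by (simp add: compact_eq_bounded_closed)
  obtain U where U: "open U" "K \<subseteq> U" "U - K \<in> lmeasurable" "emeasure lebesgue (U - K) < ennreal d"
    using sets_lebesgue_outer_open[of K d] \<open>compact K\<close> d by (metis borel_compact lmeasurable_compact fmeasurableD)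
  have UQ: "open (U \<inter> Q)" "K \<subseteq> U \<inter> Q" using U K A Q by auto
  obtain \<phi> where \<phi>: "\<phi> \<in> test_functions (U \<inter> Q)" "\<forall>p. 0 \<le> \<phi> p \<and> \<phi> p \<le> 1" "\<forall>p\<in>K. \<phi> p = 1"
    using smooth_cutoff[OF \<open>compact K\<close> UQ] by blast
  define B where "B = (A - K) \<union> (U - K)"
  have B: "B \<in> lmeasurable" "measure lebesgue B \<le> 2 * d"
  proof -
    have "measure lebesgue (A - K) < d" "measure lebesgue (U - K) < d"
      using K(3,4) U(3,4) by (auto simp: emeasure_eq_measure2 ennreal_less_iff)
    then show "measure lebesgue B \<le> 2 * d"
      unfolding B_def using measure_Un_le[of "A - K" lebesgue "U - K"] K(3) U(3) by (auto simp: fmeasurable_def)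
  qed (use K U in \<open>auto simp: B_def\<close>)
  have Qm: "Q \<in> sets lebesgue" using Q by auto
  have m: "(\<lambda>p. \<phi> p - indicator A p) \<in> borel_measurable (lebesgue_on Q)"
    using L2_measurable[OF test_function_L2[OF \<phi>(1) Qm]] A
    by (intro borel_measurable_diff) (auto simp: measurable_restrict_space1)
  note i = integrable_indicator_lebesgue_on[OF B(1) Qm]
  have le: "AE p in lebesgue_on Q. (norm (\<phi> p - indicator A p))\<^sup>2 \<le> indicator B p"
  proof (intro AE_I2)
    fix p
    have "\<phi> p = 0" if "p \<notin> U" using test_functions_outside[OF \<phi>(1)] that by auto
    moreover have "\<bar>\<phi> p - indicator A p\<bar>\<^sup>2 \<le> 1\<^sup>2" using spec[OF \<phi>(2), of p] by (intro power_mono) (auto simp: indicator_def)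
    ultimately show "(norm (\<phi> p - indicator A p))\<^sup>2 \<le> indicator B p"
      using \<phi>(3) K(2) by (auto simp: B_def indicator_def)
  qed
  have "(L2_norm (lebesgue_on Q) (\<lambda>p. \<phi> p - indicator A p))\<^sup>2 \<le> (\<integral>p. indicator B p \<partial>lebesgue_on Q)"
    by (rule L2_boundI(2)[OF m i(1) le])
  also have "\<dots> \<le> measure lebesgue B"
    using B(1) Qm unfolding i(2) by (intro measure_mono_fmeasurable) auto
  also have "\<dots> \<le> 2 * d" by (rule B(2))
  also have "\<dots> < e\<^sup>2" using e by (simp add: d_def)
  finally have "L2_norm (lebesgue_on Q) (\<lambda>p. \<phi> p - indicator A p) < e"
    by (rule power2_less_imp_less) (use e in auto)
  then show "\<exists>\<phi>\<in>test_functions Q. L2_norm (lebesgue_on Q) (\<lambda>p. \<phi> p - indicator A p) < e"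
    by (intro bexI[of _ \<phi>] test_functions_subset[OF \<phi>(1)]) auto
qed

lemma test_approx_add:
  assumes Q: "Q \<in> sets lebesgue" and w: "w \<in> L2 (lebesgue_on Q)" "v \<in> L2 (lebesgue_on Q)"
    and a: "test_approx Q w" "test_approx Q v"
  shows "test_approx Q (\<lambda>p. w p + v p)"
  unfolding test_approx_def
proof (intro allI impI)
  fix e :: real assume "0 < e"
  then obtain \<phi> \<psi> where \<phi>: "\<phi> \<in> test_functions Q" "L2_norm (lebesgue_on Q) (\<lambda>p. \<phi> p - w p) < e / 2"
    and \<psi>: "\<psi> \<in> test_functions Q" "L2_norm (lebesgue_on Q) (\<lambda>p. \<psi> p - v p) < e / 2"
    using a unfolding test_approx_def by (metis half_gt_zero)
  have "L2_norm (lebesgue_on Q) (\<lambda>p. \<phi> p + \<psi> p - (w p + v p)) < e"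
    using L2_norm_triangle[OF L2_diff[OF test_function_L2[OF \<phi>(1) Q] w(1)] L2_diff[OF test_function_L2[OF \<psi>(1) Q] w(2)]]
      \<phi>(2) \<psi>(2) by (simp add: algebra_simps)
  then show "\<exists>\<phi>\<in>test_functions Q. L2_norm (lebesgue_on Q) (\<lambda>p. \<phi> p - (w p + v p)) < e"
    using test_functions_add[OF \<phi>(1) \<psi>(1)] by (intro bexI[of _ "\<lambda>p. \<phi> p + \<psi> p"])
qed

lemma test_approx_mult:
  assumes "test_approx Q w"
  shows "test_approx Q (\<lambda>p. c * w p)"
  unfolding test_approx_def
proof (intro allI impI)
  fix e :: real assume e: "0 < e"
  have "0 < e / (\<bar>c\<bar> + 1)" using e by (intro divide_pos_pos) auto
  then obtain \<phi> where \<phi>: "\<phi> \<in> test_functions Q" "L2_norm (lebesgue_on Q) (\<lambda>p. \<phi> p - w p) < e / (\<bar>c\<bar> + 1)"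
    using assms unfolding test_approx_def by blast
  have "L2_norm (lebesgue_on Q) (\<lambda>p. \<phi> p * c - c * w p) = \<bar>c\<bar> * L2_norm (lebesgue_on Q) (\<lambda>p. \<phi> p - w p)"
    using L2_norm_scaleR[of "lebesgue_on Q" c "\<lambda>p. \<phi> p - w p"] by (simp add: algebra_simps)
  also have "\<dots> \<le> \<bar>c\<bar> * (e / (\<bar>c\<bar> + 1))" using \<phi>(2) by (intro mult_left_mono) auto
  also have "\<dots> < e" using e by (simp add: field_simps)
  finally show "\<exists>\<phi>\<in>test_functions Q. L2_norm (lebesgue_on Q) (\<lambda>p. \<phi> p - c * w p) < e"
    using test_functions_mult[OF \<phi>(1) smooth_const[of c]] by (intro bexI[of _ "\<lambda>p. \<phi> p * c"])
qed

lemma test_approx_zero: "test_approx Q (\<lambda>p. 0)"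
proof -
  have "(\<lambda>p. 0) \<in> test_functions Q"
    unfolding test_functions_iff by (auto simp: smooth_const supp_in_def intro!: exI[of _ "{}"])
  then show ?thesis
    unfolding test_approx_def by (intro allI impI bexI[of _ "\<lambda>p. 0"]) simp_all
qed

text \<open>Linearity extends the approximation from indicator functions to simple functions. These
  converge to \<open>w\<close> pointwise with values at most \<open>2 * |w|\<close>, so
  \<open>3 * |w|\<close> dominates the errors.\<close>

lemma test_functions_dense:
  assumes Q: "open Q" "bounded Q" and w: "w \<in> L2 (lebesgue_on Q)"
  shows "test_approx Q w"
proof -
  have Qm: "Q \<in> sets lebesgue" using Q by auto
  have fin: "emeasure (lebesgue_on Q) A < \<infinity>" if "A \<in> sets (lebesgue_on Q)" for A
  proof -
    have "A \<in> sets lebesgue" "A \<subseteq> Q" using that Qm by (auto simp: sets_restrict_space_iff)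
    then have "emeasure lebesgue A < \<infinity>"
      using Q(2) bounded_subset bounded_set_imp_lmeasurable fmeasurableD2 by (metis infinity_ennreal_def less_top)
    then show ?thesis using Qm \<open>A \<subseteq> Q\<close> by (subst emeasure_restrict_space) auto
  qed
  have simple: "test_approx Q s \<and> s \<in> L2 (lebesgue_on Q)" if s: "simple_function (lebesgue_on Q) s" for s
  proof -
    define t where "t p = (\<Sum>y\<in>s ` Q. y * indicator (s -` {y} \<inter> Q) p)" for p
    have A: "s -` {y} \<inter> Q \<in> sets (lebesgue_on Q)" for y
      using simple_functionD(2)[OF s, of "{y}"] by simp
    have ind: "(indicator (s -` {y} \<inter> Q) :: _ \<Rightarrow> real) \<in> L2 (lebesgue_on Q)" for y
      using A[of y] fin[OF A[of y]]
      by (intro L2_boundI(1)[where h="indicator (s -` {y} \<inter> Q)"] integrable_real_indicator)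
         (auto simp: indicator_def)
    define g where "g y p = y * indicator (s -` {y} \<inter> Q) p" for y p
    have g: "test_approx Q (g y)" "g y \<in> L2 (lebesgue_on Q)" for y
    proof -
      have "s -` {y} \<inter> Q \<in> sets lebesgue" using A[of y] Qm by (auto simp: sets_restrict_space_iff)
      from test_approx_mult[OF test_approx_indicator[OF Q this]]
      show "test_approx Q (g y)" by (auto simp: g_def[abs_def])
      show "g y \<in> L2 (lebesgue_on Q)" using L2_mult[OF ind[of y], of y] by (simp add: g_def[abs_def])
    qed
    have "test_approx Q (\<lambda>p. \<Sum>y\<in>F. g y p) \<and> (\<lambda>p. \<Sum>y\<in>F. g y p) \<in> L2 (lebesgue_on Q)" if "finite F" for F
      using that
    proof (induction F rule: finite_induct)
      case (insert y F)
      then show ?case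
        using test_approx_add[OF Qm g(2)[of y] _ g(1)[of y]] L2_add[OF g(2)[of y]] by simp
    qed (simp add: test_approx_zero)
    from this[of "s ` Q"] have t: "test_approx Q t" "t \<in> L2 (lebesgue_on Q)"
      using simple_functionD(1)[OF s] by (auto simp: t_def[abs_def] g_def)
    have ts: "t p = s p" if "p \<in> Q" for p
      using simple_function_indicator_representation_banach[OF s, of p] that
      by (simp only: t_def real_scaleR_def space_lebesgue_on mult.commute)
    have "L2_norm (lebesgue_on Q) (\<lambda>p. \<phi> p - s p) = L2_norm (lebesgue_on Q) (\<lambda>p. \<phi> p - t p)" for \<phi>
      unfolding L2_norm_def by (intro arg_cong[where f=sqrt] Bochner_Integration.integral_cong) (auto simp: ts)
    then have "test_approx Q s" using t(1) by (simp add: test_approx_def)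
    moreover have "s \<in> L2 (lebesgue_on Q)"
      by (rule L2_cong(1)[OF t(2) borel_measurable_simple_function[OF s]]) (auto simp: ts)
    ultimately show ?thesis by simp
  qed
  obtain F where F0: "(\<forall>i. simple_function (lebesgue_on Q) (F i)) \<and> (\<forall>x\<in>space (lebesgue_on Q). (\<lambda>i. F i x) \<longlonglongrightarrow> w x) \<and>
      (\<forall>i. \<forall>x\<in>space (lebesgue_on Q). dist (F i x) 0 \<le> 2 * dist (w x) 0)"
    using borel_measurable_implies_sequence_metric[OF L2_measurable[OF w], of 0] by blast
  have F: "\<And>i. simple_function (lebesgue_on Q) (F i)" "\<And>x. x \<in> Q \<Longrightarrow> (\<lambda>i. F i x) \<longlonglongrightarrow> w x"
    "\<And>i x. x \<in> Q \<Longrightarrow> dist (F i x) 0 \<le> 2 * dist (w x) 0"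
    using F0 by simp_all
  have "L2_lim (lebesgue_on Q) F w"
  proof (rule L2_dominated_convergence[where g="\<lambda>x. 3 * \<bar>w x\<bar>"])
    show "(\<lambda>x. 3 * \<bar>w x\<bar>) \<in> L2 (lebesgue_on Q)"
      using w by (auto simp: L2_def power_mult_distrib)
    show "AE x in lebesgue_on Q. norm (F n x - w x) \<le> 3 * \<bar>w x\<bar>" for n
    proof (intro AE_I2)
      fix x assume "x \<in> space (lebesgue_on Q)"
      then show "norm (F n x - w x) \<le> 3 * \<bar>w x\<bar>" using F(3)[of x n] by (auto simp: dist_norm)
    qed
  qed (use F w in \<open>auto intro: borel_measurable_simple_function\<close>)
  then have lim: "(\<lambda>n. L2_norm (lebesgue_on Q) (\<lambda>x. F n x - w x)) \<longlonglongrightarrow> 0"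
    by (simp add: L2_lim_def)
  show ?thesis
    unfolding test_approx_def
  proof (intro allI impI)
    fix e :: real assume e: "0 < e"
    obtain n where n: "L2_norm (lebesgue_on Q) (\<lambda>x. F n x - w x) < e / 2"
      using order_tendstoD(2)[OF lim, of "e / 2"] e by (auto simp: eventually_sequentially)
    obtain \<phi> where \<phi>: "\<phi> \<in> test_functions Q" "L2_norm (lebesgue_on Q) (\<lambda>p. \<phi> p - F n p) < e / 2"
      using simple[OF F(1)[of n]] e unfolding test_approx_def by (metis half_gt_zero)
    have "L2_norm (lebesgue_on Q) (\<lambda>p. \<phi> p - w p) < e"
      using L2_norm_triangle3[OF test_function_L2[OF \<phi>(1) Qm] conjunct2[OF simple[OF F(1)[of n]]] w] n \<phi>(2)
      by linarith
    then show "\<exists>\<phi>\<in>test_functions Q. L2_norm (lebesgue_on Q) (\<lambda>p. \<phi> p - w p) < e"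
      using \<phi>(1) by blast
  qed
qed

lemma test_functions_dense_seq:
  assumes Q: "open Q" "bounded Q" and w: "w \<in> L2 (lebesgue_on Q)"
  obtains \<phi> where "\<And>n. \<phi> n \<in> test_functions Q" "L2_lim (lebesgue_on Q) \<phi> w"
proof -
  have "\<exists>\<phi>\<in>test_functions Q. L2_norm (lebesgue_on Q) (\<lambda>p. \<phi> p - w p) < 1 / real (Suc n)" for n
    using test_functions_dense[OF assms] unfolding test_approx_def by (simp del: of_nat_Suc)
  then obtain \<phi> where \<phi>: "\<And>n. \<phi> n \<in> test_functions Q"
    "\<And>n. L2_norm (lebesgue_on Q) (\<lambda>p. \<phi> n p - w p) < 1 / real (Suc n)" by metis
  have "(\<lambda>n. L2_norm (lebesgue_on Q) (\<lambda>p. \<phi> n p - w p)) \<longlonglongrightarrow> 0"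
  proof (rule Lim_null_comparison[OF _ lim_1_over_n[THEN LIMSEQ_Suc]])
    show "\<forall>\<^sub>F n in sequentially. norm (L2_norm (lebesgue_on Q) (\<lambda>p. \<phi> n p - w p)) \<le> 1 / real (Suc n)"
      using less_imp_le[OF \<phi>(2)] by (simp del: of_nat_Suc)
  qed
  then have "L2_lim (lebesgue_on Q) \<phi> w"
    using Q by (intro L2_lim_I test_function_L2[OF \<phi>(1)] w) auto
  then show thesis using that[of \<phi>] \<phi>(1) by blast
qed

text \<open>Test functions that converge to \<open>w\<close> itself turn the hypothesis into the
  vanishing of its norm.\<close>

lemma test_functions_separate:
  assumes Q: "open Q" "bounded Q" and w: "w \<in> L2 (lebesgue_on Q)"
    and z: "\<And>\<phi>. \<phi> \<in> test_functions Q \<Longrightarrow> (\<integral>p. \<phi> p * w p \<partial>lebesgue_on Q) = 0"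
  shows "AE p in lebesgue_on Q. w p = 0"
proof -
  obtain \<phi> where \<phi>: "\<And>n. \<phi> n \<in> test_functions Q" "L2_lim (lebesgue_on Q) \<phi> w"
    using test_functions_dense_seq[OF Q w] by blast
  have "(\<lambda>n. 0 :: real) \<longlonglongrightarrow> (\<integral>p. w p * w p \<partial>lebesgue_on Q)"
    using L2_lim_mult[OF \<phi>(2) w w] by (simp add: z \<phi>(1))
  then have "(L2_norm (lebesgue_on Q) w)\<^sup>2 = 0"
    by (simp add: L2_norm_square LIMSEQ_const_iff power2_eq_square[of "w _"])
  then show ?thesis using L2_norm_eq_0[OF w] by simp
qed

section \<open>Restriction and translation\<close>

lemma L2_norm_nn_integral:
  assumes "f \<in> L2 M"
  shows "ennreal ((L2_norm M f)\<^sup>2) = (\<integral>\<^sup>+x. ennreal ((norm (f x))\<^sup>2) \<partial>M)"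
  unfolding L2_norm_square by (rule nn_integral_eq_integral[symmetric]) (use assms in \<open>auto simp: L2_def\<close>)

lemma L2I_nn_integral:
  assumes "f \<in> borel_measurable M" "(\<integral>\<^sup>+x. ennreal ((norm (f x))\<^sup>2) \<partial>M) \<le> ennreal c" "0 \<le> c"
  shows "f \<in> L2 M" "(L2_norm M f)\<^sup>2 \<le> c"
proof -
  show f: "f \<in> L2 M"
    unfolding L2_def using assms(1) le_less_trans[OF assms(2) ennreal_less_top]
    by (auto intro!: integrableI_bounded)
  show "(L2_norm M f)\<^sup>2 \<le> c"
    using assms(2,3) L2_norm_nn_integral[OF f] by (metis ennreal_le_iff)
qed

lemma nn_integral_lebesgue_on:
  assumes "S \<in> sets lebesgue"
  shows "(\<integral>\<^sup>+x. f x \<partial>lebesgue_on S) = (\<integral>\<^sup>+x. f x * indicator S x \<partial>lborel)"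
  using assms by (simp add: nn_integral_restrict_space nn_integral_completion)

lemma L2_scaleR_integrable:
  assumes "f \<in> L2 M" "g \<in> L2 M"
  shows "integrable M (\<lambda>x. f x *\<^sub>R g x)"
proof (rule Bochner_Integration.integrable_bound)
  show "integrable M (\<lambda>x. (f x)\<^sup>2 + (norm (g x))\<^sup>2)"
    using assms by (auto simp: L2_def)
  show "AE x in M. norm (f x *\<^sub>R g x) \<le> norm ((f x)\<^sup>2 + (norm (g x))\<^sup>2)"
  proof (intro AE_I2)
    fix x
    have "\<bar>f x\<bar> * norm (g x) \<le> \<bar>f x\<bar>\<^sup>2 + (norm (g x))\<^sup>2"
      using sum_squares_bound[of "\<bar>f x\<bar>" "norm (g x)"]
        mult_nonneg_nonneg[OF abs_ge_zero norm_ge_zero, of "f x" "g x"] by linarith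
    then show "norm (f x *\<^sub>R g x) \<le> norm ((f x)\<^sup>2 + (norm (g x))\<^sup>2)" by simp
  qed
qed (use assms in \<open>auto simp: L2_def\<close>)

lemma L2_restrict:
  assumes f: "f \<in> L2 (lebesgue_on S)" and S: "S \<in> sets lebesgue" "S' \<in> sets lebesgue" "S' \<subseteq> S"
  shows "f \<in> L2 (lebesgue_on S')" "L2_norm (lebesgue_on S') f \<le> L2_norm (lebesgue_on S) f"
proof -
  have m: "f \<in> borel_measurable (lebesgue_on S')"
    using measurable_restrict_mono[OF L2_measurable[OF f] S(3)] .
  have le: "(\<integral>\<^sup>+x. ennreal ((norm (f x))\<^sup>2) \<partial>lebesgue_on S') \<le> ennreal ((L2_norm (lebesgue_on S) f)\<^sup>2)"
    unfolding L2_norm_nn_integral[OF f] nn_integral_lebesgue_on[OF S(1)] nn_integral_lebesgue_on[OF S(2)]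
    using S(3) by (intro nn_integral_mono) (auto simp: indicator_def)
  from L2I_nn_integral[OF m le] show "f \<in> L2 (lebesgue_on S')" by simp
  from L2I_nn_integral[OF m le] show "L2_norm (lebesgue_on S') f \<le> L2_norm (lebesgue_on S) f"
    by (auto dest: power2_le_imp_le)
qed

lemma integral_lebesgue_on_subset:
  fixes f :: "'e::euclidean_space \<Rightarrow> 'b::{banach, second_countable_topology}"
  assumes S: "S \<in> sets lebesgue" "S' \<in> sets lebesgue" "S' \<subseteq> S" and "\<And>x. x \<in> S \<Longrightarrow> x \<notin> S' \<Longrightarrow> f x = 0"
  shows "(\<integral>x. f x \<partial>lebesgue_on S) = (\<integral>x. f x \<partial>lebesgue_on S')"
proof -
  have "(\<lambda>x. indicator S x *\<^sub>R f x) = (\<lambda>x. indicator S' x *\<^sub>R f x)"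
    using assms by (auto simp: indicator_def fun_eq_iff)
  then show ?thesis
    using S by (simp add: integral_restrict_space)
qed

lemma lebesgue_distr_translate:
  fixes c :: "'e::euclidean_space"
  shows "(\<lambda>x. x + c) \<in> lebesgue \<rightarrow>\<^sub>M lebesgue" "distr lebesgue lebesgue (\<lambda>x. x + c) = lebesgue"
proof -
  have eq: "(\<lambda>x. c + (\<Sum>j\<in>Basis. (1 * (x \<bullet> j)) *\<^sub>R j)) = (\<lambda>x. x + c)"
    by (simp add: euclidean_representation add.commute)
  show "(\<lambda>x. x + c) \<in> lebesgue \<rightarrow>\<^sub>M lebesgue"
    using lebesgue_affine_measurable[of "\<lambda>_. 1" c] unfolding eq by simp
  show "distr lebesgue lebesgue (\<lambda>x. x + c) = lebesgue"
    using lebesgue_affine_euclidean[of "\<lambda>_. 1" c] unfolding eq by (simp add: density_1)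
qed

lemma lebesgue_on_translate:
  fixes c :: "'e::euclidean_space"
  assumes S: "S \<in> sets lebesgue"
  defines "S' \<equiv> (\<lambda>x. x + c) -` S"
  shows "S' \<in> sets lebesgue" "(\<lambda>x. x + c) \<in> lebesgue_on S' \<rightarrow>\<^sub>M lebesgue_on S"
    "distr (lebesgue_on S') (lebesgue_on S) (\<lambda>x. x + c) = lebesgue_on S"
proof -
  show S': "S' \<in> sets lebesgue"
    using measurable_sets[OF lebesgue_distr_translate(1) S, of c] by (simp add: S'_def)
  show m: "(\<lambda>x. x + c) \<in> lebesgue_on S' \<rightarrow>\<^sub>M lebesgue_on S"
    by (rule measurable_restrict_space3[OF lebesgue_distr_translate(1)]) (auto simp: S'_def)
  show "distr (lebesgue_on S') (lebesgue_on S) (\<lambda>x. x + c) = lebesgue_on S"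
  proof (rule measure_eqI)
    fix A assume "A \<in> sets (distr (lebesgue_on S') (lebesgue_on S) (\<lambda>x. x + c))"
    then have A: "A \<in> sets (lebesgue_on S)" by simp
    then have A': "A \<in> sets lebesgue" "A \<subseteq> S" using S by (auto simp: sets_restrict_space_iff)
    have "emeasure (distr (lebesgue_on S') (lebesgue_on S) (\<lambda>x. x + c)) A
        = emeasure (lebesgue_on S') ((\<lambda>x. x + c) -` A \<inter> S')"
      using m A by (simp add: emeasure_distr)
    also have "(\<lambda>x. x + c) -` A \<inter> S' = (\<lambda>x. x + c) -` A"
      using A' by (auto simp: S'_def)
    also have "emeasure (lebesgue_on S') \<dots> = emeasure lebesgue ((\<lambda>x. x + c) -` A)"
      using S' A' by (intro emeasure_restrict_space) (auto simp: S'_def)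
    also have "\<dots> = emeasure (distr lebesgue lebesgue (\<lambda>x. x + c)) A"
      using emeasure_distr[OF lebesgue_distr_translate(1) A'(1), of c] by simp
    also have "\<dots> = emeasure (lebesgue_on S) A"
      unfolding lebesgue_distr_translate(2) using S A' by (intro emeasure_restrict_space[symmetric]) auto
    finally show "emeasure (distr (lebesgue_on S') (lebesgue_on S) (\<lambda>x. x + c)) A = emeasure (lebesgue_on S) A" .
  qed simp
qed

lemma integral_lebesgue_on_translate:
  fixes f :: "'e::euclidean_space \<Rightarrow> 'b::{banach, second_countable_topology}"
  assumes "S \<in> sets lebesgue" "f \<in> borel_measurable (lebesgue_on S)"
  shows "(\<integral>x. f (x + c) \<partial>lebesgue_on ((\<lambda>x. x + c) -` S)) = (\<integral>x. f x \<partial>lebesgue_on S)"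
  using integral_distr[OF lebesgue_on_translate(2)[OF assms(1)] assms(2), of c]
  by (simp add: lebesgue_on_translate(3)[OF assms(1)])

lemma L2_translate:
  fixes f :: "'e::euclidean_space \<Rightarrow> 'b::euclidean_space"
  assumes S: "S \<in> sets lebesgue" and f: "f \<in> L2 (lebesgue_on S)"
  shows "(\<lambda>x. f (x + c)) \<in> L2 (lebesgue_on ((\<lambda>x. x + c) -` S))"
    "L2_norm (lebesgue_on ((\<lambda>x. x + c) -` S)) (\<lambda>x. f (x + c)) = L2_norm (lebesgue_on S) f"
proof -
  note t = lebesgue_on_translate[OF S, of c]
  have i: "integrable (distr (lebesgue_on ((\<lambda>x. x + c) -` S)) (lebesgue_on S) (\<lambda>x. x + c)) (\<lambda>x. (norm (f x))\<^sup>2)"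
    unfolding t(3) by (rule L2_integrable[OF f])
  show "(\<lambda>x. f (x + c)) \<in> L2 (lebesgue_on ((\<lambda>x. x + c) -` S))"
    unfolding L2_def using integrable_distr[OF t(2) i] measurable_compose[OF t(2) L2_measurable[OF f]] by simp
  show "L2_norm (lebesgue_on ((\<lambda>x. x + c) -` S)) (\<lambda>x. f (x + c)) = L2_norm (lebesgue_on S) f"
    unfolding L2_norm_def
    by (subst integral_lebesgue_on_translate[OF S]) (use f in \<open>auto simp: L2_def\<close>)
qed

lemma smooth_L2:
  fixes \<phi> :: "'e::euclidean_space \<Rightarrow> 'b::euclidean_space"
  assumes "smooth \<phi>" "bounded S" "S \<in> sets lebesgue"
  shows "\<phi> \<in> L2 (lebesgue_on S)"
proof -
  have "bounded (\<phi> ` closure S)"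
    using compact_continuous_image[OF smooth_continuous[OF assms(1), of "closure S"]] assms(2)
    by (simp add: compact_imp_bounded)
  then obtain B where B: "\<forall>y\<in>\<phi> ` closure S. norm y \<le> B"
    unfolding bounded_iff by (elim exE)
  show ?thesis
  proof (rule L2_boundI(1))
    show "\<phi> \<in> borel_measurable (lebesgue_on S)"
      by (rule continuous_imp_measurable_on_sets_lebesgue[OF smooth_continuous[OF assms(1)] assms(3)])
    show "integrable (lebesgue_on S) (\<lambda>x. B\<^sup>2 * indicator S x)"
      using assms by (intro integrable_mult_right integrable_indicator_lebesgue_on bounded_set_imp_lmeasurable)
    show "AE x in lebesgue_on S. (norm (\<phi> x))\<^sup>2 \<le> B\<^sup>2 * indicator S x"
    proof (intro AE_I2)
      fix x assume "x \<in> space (lebesgue_on S)"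
      then have "x \<in> S" by simp
      then have "x \<in> closure S" using closure_subset by blast
      then have "norm (\<phi> x) \<le> B" using B by simp
      from power_mono[OF this, of 2] \<open>x \<in> S\<close>
      show "(norm (\<phi> x))\<^sup>2 \<le> B\<^sup>2 * indicator S x" by simp
    qed
  qed
qed

section \<open>Weak derivatives\<close>

lemma integral_test_components:
  fixes w :: "'e::euclidean_space \<Rightarrow> 'b::euclidean_space"
  assumes "\<phi> \<in> L2 M" "w \<in> L2 M"
  shows "(\<integral>p. \<phi> p *\<^sub>R w p \<partial>M) \<bullet> i = (\<integral>p. \<phi> p * (w p \<bullet> i) \<partial>M)"
proof -
  have "(\<integral>p. (\<phi> p *\<^sub>R w p) \<bullet> i \<partial>M) = (\<integral>p. \<phi> p *\<^sub>R w p \<partial>M) \<bullet> i"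
    by (rule integral_inner_left) (rule L2_scaleR_integrable[OF assms])
  then show ?thesis by (simp only: inner_scaleR_left)
qed

lemma test_functions_separate_vector:
  fixes w :: "'e::euclidean_space \<Rightarrow> 'b::euclidean_space"
  assumes Q: "open Q" "bounded Q" and w: "w \<in> L2 (lebesgue_on Q)"
    and z: "\<And>\<phi>. \<phi> \<in> test_functions Q \<Longrightarrow> (\<integral>p. \<phi> p *\<^sub>R w p \<partial>lebesgue_on Q) = 0"
  shows "AE p in lebesgue_on Q. w p = 0"
proof -
  have Qm: "Q \<in> sets lebesgue" using Q by auto
  have "AE p in lebesgue_on Q. w p \<bullet> i = 0" if "i \<in> Basis" for i
    using test_functions_separate[OF Q L2_inner_const[OF w]]
      integral_test_components[OF test_function_L2[OF _ Qm] w, of _ Q i] z by simp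
  then have "AE p in lebesgue_on Q. \<forall>i\<in>Basis. w p \<bullet> i = 0"
    by (simp add: AE_ball_countable[OF countable_finite])
  then show ?thesis
    by eventually_elim (simp add: euclidean_all_zero_iff)
qed

text \<open>Inner products with basis vectors commute with the integrals, and the test functions are
  scalar. This reduces time derivatives of vector fields to those of their components.\<close>

lemma has_weak_dt_component:
  fixes w :: "'a::euclidean_space \<times> real \<Rightarrow> 'b::euclidean_space"
  assumes "open Q" "w \<in> L2 (lebesgue_on Q)" "g \<in> L2 (lebesgue_on Q)"
  shows "has_weak_dt Q w g \<longleftrightarrow> (\<forall>i\<in>Basis. has_weak_dt Q (\<lambda>p. w p \<bullet> i) (\<lambda>p. g p \<bullet> i))"
proof -
  have Qm: "Q \<in> sets lebesgue" using assms by auto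
  have "((\<integral>p. dir_deriv (0, 1) \<phi> p *\<^sub>R w p \<partial>lebesgue_on Q) = - (\<integral>p. \<phi> p *\<^sub>R g p \<partial>lebesgue_on Q)) \<longleftrightarrow>
    (\<forall>i\<in>Basis. (\<integral>p. dir_deriv (0, 1) \<phi> p * (w p \<bullet> i) \<partial>lebesgue_on Q) = - (\<integral>p. \<phi> p * (g p \<bullet> i) \<partial>lebesgue_on Q))"
    if \<phi>: "\<phi> \<in> test_functions Q" for \<phi>
  proof -
    have \<phi>': "\<phi> \<in> L2 (lebesgue_on Q)" "dir_deriv (0, 1) \<phi> \<in> L2 (lebesgue_on Q)"
      using test_function_L2[OF \<phi> Qm] test_function_L2[OF test_functions_dir_deriv[OF \<phi>] Qm] by auto
    show ?thesis
      unfolding integral_test_components[OF \<phi>'(1) assms(3), symmetric]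
        integral_test_components[OF \<phi>'(2) assms(2), symmetric]
      by (subst euclidean_eq_iff) simp
  qed
  then show ?thesis unfolding has_weak_dt_def real_scaleR_def by blast
qed

lemma weak_dt_unique:
  fixes w :: "'a::euclidean_space \<times> real \<Rightarrow> 'b::euclidean_space"
  assumes Q: "open Q" "bounded Q" and g: "g \<in> L2 (lebesgue_on Q)" "g' \<in> L2 (lebesgue_on Q)"
    and w: "has_weak_dt Q w g" "has_weak_dt Q w g'"
  shows "AE p in lebesgue_on Q. g p = g' p"
proof -
  have Qm: "Q \<in> sets lebesgue" using Q by auto
  have "(\<integral>p. \<phi> p *\<^sub>R (g p - g' p) \<partial>lebesgue_on Q) = 0" if \<phi>: "\<phi> \<in> test_functions Q" for \<phi>
    using w \<phi> L2_scaleR_integrable[OF test_function_L2[OF \<phi> Qm] g(1)] L2_scaleR_integrable[OF test_function_L2[OF \<phi> Qm] g(2)]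
    by (auto simp: has_weak_dt_def scaleR_diff_right dest!: bspec[of _ _ \<phi>])
  from test_functions_separate_vector[OF Q L2_diff[OF g] this] show ?thesis by simp
qed

lemma weak_grad_x_unique:
  fixes w :: "'a::euclidean_space \<times> real \<Rightarrow> real"
  assumes Q: "open Q" "bounded Q" and g: "g \<in> L2 (lebesgue_on Q)" "g' \<in> L2 (lebesgue_on Q)"
    and w: "has_weak_grad_x Q w g" "has_weak_grad_x Q w g'"
  shows "AE p in lebesgue_on Q. g p = g' p"
proof -
  have Qm: "Q \<in> sets lebesgue" using Q by auto
  have "(\<integral>p. \<phi> p *\<^sub>R (g p - g' p) \<partial>lebesgue_on Q) = 0" if \<phi>: "\<phi> \<in> test_functions Q" for \<phi>
  proof (rule euclidean_eqI)
    fix i :: 'a assume i: "i \<in> Basis"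
    have "(\<integral>p. \<phi> p * (g p \<bullet> i) \<partial>lebesgue_on Q) = (\<integral>p. \<phi> p * (g' p \<bullet> i) \<partial>lebesgue_on Q)"
      using w(1)[unfolded has_weak_grad_x_def, rule_format, OF \<phi> i] w(2)[unfolded has_weak_grad_x_def, rule_format, OF \<phi> i]
      by simp
    then show "(\<integral>p. \<phi> p *\<^sub>R (g p - g' p) \<partial>lebesgue_on Q) \<bullet> i = 0 \<bullet> i"
      using L2_mult_integrable[OF test_function_L2[OF \<phi> Qm] L2_inner_const[OF g(1)]]
        L2_mult_integrable[OF test_function_L2[OF \<phi> Qm] L2_inner_const[OF g(2)]]
      by (subst integral_test_components[OF test_function_L2[OF \<phi> Qm] L2_diff[OF g]])
         (simp add: inner_diff_left right_diff_distrib)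
  qed
  from test_functions_separate_vector[OF Q L2_diff[OF g] this] show ?thesis by simp
qed

section \<open>Representatives picked by the operators, and linearity of weak derivatives\<close>

lemma dt_has_weak_dt:
  assumes "w \<in> H_dt Q"
  shows "dt Q w \<in> L2 (lebesgue_on Q)" "has_weak_dt Q w (dt Q w)"
  using someI_ex[of "\<lambda>g. g \<in> L2 (lebesgue_on Q) \<and> has_weak_dt Q w g"] assms
  by (auto simp: H_dt_def dt_def)

lemma grad_x_has_weak_grad_x:
  assumes "w \<in> H_grad_x Q"
  shows "grad_x Q w \<in> L2 (lebesgue_on Q)" "has_weak_grad_x Q w (grad_x Q w)"
  using someI_ex[of "\<lambda>g. g \<in> L2 (lebesgue_on Q) \<and> has_weak_grad_x Q w g"] assms
  by (auto simp: H_grad_x_def grad_x_def)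

lemma div_x_has_weak_div_x:
  assumes "y \<in> H_div_x Q"
  shows "div_x Q y \<in> L2 (lebesgue_on Q)" "has_weak_div_x Q y (div_x Q y)"
  using someI_ex[of "\<lambda>g. g \<in> L2 (lebesgue_on Q) \<and> has_weak_div_x Q y g"] assms
  by (auto simp: H_div_x_def div_x_def)

lemma has_weak_dt_diff:
  assumes Q: "open Q" and L: "w \<in> L2 (lebesgue_on Q)" "w' \<in> L2 (lebesgue_on Q)" "g \<in> L2 (lebesgue_on Q)" "g' \<in> L2 (lebesgue_on Q)"
    and "has_weak_dt Q w g" "has_weak_dt Q w' g'"
  shows "has_weak_dt Q (\<lambda>p. w p - w' p) (\<lambda>p. g p - g' p)"
  unfolding has_weak_dt_def
proof
  fix \<phi> assume \<phi>: "\<phi> \<in> test_functions Q"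
  have Qm: "Q \<in> sets lebesgue" using Q by auto
  have \<phi>': "\<phi> \<in> L2 (lebesgue_on Q)" "dir_deriv (0, 1) \<phi> \<in> L2 (lebesgue_on Q)"
    using test_function_L2[OF \<phi> Qm] test_function_L2[OF test_functions_dir_deriv[OF \<phi>] Qm] by auto
  note i = L2_scaleR_integrable[OF \<phi>'(1) L(3)] L2_scaleR_integrable[OF \<phi>'(1) L(4)]
    L2_scaleR_integrable[OF \<phi>'(2) L(1)] L2_scaleR_integrable[OF \<phi>'(2) L(2)]
  show "(\<integral>p. dir_deriv (0, 1) \<phi> p *\<^sub>R (w p - w' p) \<partial>lebesgue_on Q) = - (\<integral>p. \<phi> p *\<^sub>R (g p - g' p) \<partial>lebesgue_on Q)"
    using assms(6,7) \<phi> i by (simp add: has_weak_dt_def scaleR_diff_right)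
qed

lemma has_weak_grad_x_diff:
  assumes Q: "open Q" and L: "w \<in> L2 (lebesgue_on Q)" "w' \<in> L2 (lebesgue_on Q)" "g \<in> L2 (lebesgue_on Q)" "g' \<in> L2 (lebesgue_on Q)"
    and "has_weak_grad_x Q w g" "has_weak_grad_x Q w' g'"
  shows "has_weak_grad_x Q (\<lambda>p. w p - w' p) (\<lambda>p. g p - g' p)"
  unfolding has_weak_grad_x_def
proof (intro ballI)
  fix \<phi> and i :: 'a assume \<phi>: "\<phi> \<in> test_functions Q" and i: "i \<in> Basis"
  have Qm: "Q \<in> sets lebesgue" using Q by auto
  have \<phi>': "\<phi> \<in> L2 (lebesgue_on Q)" "dir_deriv (i, 0) \<phi> \<in> L2 (lebesgue_on Q)"
    using test_function_L2[OF \<phi> Qm] test_function_L2[OF test_functions_dir_deriv[OF \<phi>] Qm] i by auto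
  note int = L2_mult_integrable[OF \<phi>'(1) L2_inner_const[OF L(3), of i]]
    L2_mult_integrable[OF \<phi>'(1) L2_inner_const[OF L(4), of i]]
    L2_mult_integrable[OF \<phi>'(2) L(1)] L2_mult_integrable[OF \<phi>'(2) L(2)]
  show "(\<integral>p. dir_deriv (i, 0) \<phi> p * (w p - w' p) \<partial>lebesgue_on Q) = - (\<integral>p. \<phi> p * ((g p - g' p) \<bullet> i) \<partial>lebesgue_on Q)"
    using assms(6,7) \<phi> int i
    by (simp add: has_weak_grad_x_def right_diff_distrib inner_diff_left)
qed

lemma has_weak_div_x_iff:
  assumes Q: "open Q" and y: "y \<in> L2 (lebesgue_on Q)"
  shows "has_weak_div_x Q y D \<longleftrightarrow> (\<forall>\<phi>\<in>test_functions Q.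
     (\<Sum>i\<in>Basis. \<integral>p. dir_deriv (i, 0) \<phi> p * (y p \<bullet> i) \<partial>lebesgue_on Q) = - (\<integral>p. \<phi> p * D p \<partial>lebesgue_on Q))"
proof -
  have Qm: "Q \<in> sets lebesgue" using Q by auto
  have "(\<integral>p. (\<Sum>i\<in>Basis. dir_deriv (i, 0) \<phi> p * (y p \<bullet> i)) \<partial>lebesgue_on Q) =
      (\<Sum>i\<in>Basis. \<integral>p. dir_deriv (i, 0) \<phi> p * (y p \<bullet> i) \<partial>lebesgue_on Q)" if "\<phi> \<in> test_functions Q" for \<phi>
    using that by (intro Bochner_Integration.integral_sum L2_mult_integrable L2_inner_const y
        test_function_L2[OF test_functions_dir_deriv Qm]) auto
  then show ?thesis by (simp add: has_weak_div_x_def)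
qed

lemma has_weak_div_x_diff:
  assumes Q: "open Q" and L: "w \<in> L2 (lebesgue_on Q)" "w' \<in> L2 (lebesgue_on Q)" "g \<in> L2 (lebesgue_on Q)" "g' \<in> L2 (lebesgue_on Q)"
    and d: "has_weak_div_x Q w g" "has_weak_div_x Q w' g'"
  shows "has_weak_div_x Q (\<lambda>p. w p - w' p) (\<lambda>p. g p - g' p)"
  unfolding has_weak_div_x_iff[OF Q L2_diff[OF L(1,2)]]
proof
  fix \<phi> assume \<phi>: "\<phi> \<in> test_functions Q"
  have Qm: "Q \<in> sets lebesgue" using Q by auto
  note int = L2_mult_integrable[OF test_function_L2[OF \<phi> Qm] L(3)] L2_mult_integrable[OF test_function_L2[OF \<phi> Qm] L(4)]
  have int': "integrable (lebesgue_on Q) (\<lambda>p. dir_deriv (i, 0) \<phi> p * (v p \<bullet> i))"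
    if "i \<in> Basis" "v \<in> L2 (lebesgue_on Q)" for i and v :: "'a \<times> real \<Rightarrow> 'a"
    using that by (intro L2_mult_integrable test_function_L2[OF test_functions_dir_deriv[OF \<phi>] Qm] L2_inner_const) auto
  show "(\<Sum>i\<in>Basis. \<integral>p. dir_deriv (i, 0) \<phi> p * ((w p - w' p) \<bullet> i) \<partial>lebesgue_on Q) = - (\<integral>p. \<phi> p * (g p - g' p) \<partial>lebesgue_on Q)"
    using d[unfolded has_weak_div_x_iff[OF Q L(1)] has_weak_div_x_iff[OF Q L(2)]] \<phi> int int'[OF _ L(1)] int'[OF _ L(2)]
    by (simp add: right_diff_distrib inner_diff_left sum_subtractf)
qed

lemma has_weak_div_x_cong:
  assumes Q: "open Q" and L: "w \<in> L2 (lebesgue_on Q)" "w' \<in> L2 (lebesgue_on Q)"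
    and d: "has_weak_div_x Q w g" and eq: "AE p in lebesgue_on Q. w p = w' p"
  shows "has_weak_div_x Q w' g"
  unfolding has_weak_div_x_iff[OF Q L(2)]
proof
  fix \<phi> assume \<phi>: "\<phi> \<in> test_functions Q"
  have Qm: "Q \<in> sets lebesgue" using Q by auto
  have "(\<integral>p. dir_deriv (i, 0) \<phi> p * (w' p \<bullet> i) \<partial>lebesgue_on Q) = (\<integral>p. dir_deriv (i, 0) \<phi> p * (w p \<bullet> i) \<partial>lebesgue_on Q)"
    if i: "i \<in> Basis" for i
  proof (rule integral_cong_AE)
    have "dir_deriv (i, 0) \<phi> \<in> borel_measurable (lebesgue_on Q)"
      using L2_measurable[OF test_function_L2[OF test_functions_dir_deriv[OF \<phi>, of "(i, 0)"] Qm]] i by simp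
    then show "(\<lambda>p. dir_deriv (i, 0) \<phi> p * (w' p \<bullet> i)) \<in> borel_measurable (lebesgue_on Q)"
      "(\<lambda>p. dir_deriv (i, 0) \<phi> p * (w p \<bullet> i)) \<in> borel_measurable (lebesgue_on Q)"
      using L2_measurable[OF L(1)] L2_measurable[OF L(2)] by (auto intro!: borel_measurable_times borel_measurable_inner)
    show "AE p in lebesgue_on Q. dir_deriv (i, 0) \<phi> p * (w' p \<bullet> i) = dir_deriv (i, 0) \<phi> p * (w p \<bullet> i)"
      using eq by eventually_elim simp
  qed
  then show "(\<Sum>i\<in>Basis. \<integral>p. dir_deriv (i, 0) \<phi> p * (w' p \<bullet> i) \<partial>lebesgue_on Q) = - (\<integral>p. \<phi> p * g p \<partial>lebesgue_on Q)"
    using d \<phi> by (simp add: has_weak_div_x_iff[OF Q L(1)])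
qed

text \<open>The integral of \<open>\<Phi>(p + sb)\<close> does not depend on \<open>s\<close>.\<close>

lemma integral_dir_deriv_eq_0:
  fixes \<Phi> :: "'e::euclidean_space \<Rightarrow> real"
  assumes \<Phi>: "smooth \<Phi>" and K: "compact K" "supp_in K \<Phi>" and b: "b \<in> Basis"
  shows "(\<integral>p. dir_deriv b \<Phi> p \<partial>lebesgue) = 0"
proof (rule ccontr)
  define I where "I = (\<integral>p. dir_deriv b \<Phi> p \<partial>lebesgue)"
  assume "(\<integral>p. dir_deriv b \<Phi> p \<partial>lebesgue) \<noteq> 0"
  then have I: "0 < \<bar>I\<bar>" by (simp add: I_def)
  \<comment> \<open>The unit neighbourhood of \<open>K\<close> contains the supports of
    \<open>\<Phi>\<close> and of its translates by at most 1, whence \<open>s \<le> 1\<close>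
    below.\<close>
  define L where "L = (\<Union>x\<in>K. \<Union>y\<in>cball 0 1. {x + y})"
  have L: "compact L" unfolding L_def using compact_sums'[OF K(1) compact_cball] by auto
  define m where "m = measure lebesgue L + 1"
  have m: "0 < m" by (simp add: m_def add_nonneg_pos)
  \<comment> \<open>With this tolerance the linearization error, integrated over \<open>L\<close>,
    is at most half of \<open>s * |I|\<close>. Translation invariance forces it to equal
    \<open>s * |I|\<close>.\<close>
  obtain d where d: "0 < d"
    "\<And>p h. norm h < d \<Longrightarrow> \<bar>\<Phi> (p + h) - \<Phi> p - (\<Sum>c\<in>Basis. (h \<bullet> c) * dir_deriv c \<Phi> p)\<bar> \<le> \<bar>I\<bar> / (2 * m) * norm h"
    using uniform_linearization[OF \<Phi> K, of "\<bar>I\<bar> / (2 * m)"] I m by auto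
  define s where "s = min 1 (d / 2)"
  have s: "0 < s" "s < d" "s \<le> 1" using d(1) by (auto simp: s_def)
  have test: "\<Phi> \<in> test_functions UNIV" using \<Phi> K by (auto simp: test_functions_iff)
  have shift: "(\<lambda>p. \<Phi> (p + s *\<^sub>R b)) \<in> test_functions UNIV" by (rule test_functions_translate[OF test]) simp
  have dtest: "dir_deriv b \<Phi> \<in> test_functions UNIV" by (rule test_functions_dir_deriv[OF test b])
  have int: "integrable lebesgue \<psi>" if t: "\<psi> \<in> test_functions UNIV" for \<psi> :: "'e \<Rightarrow> real"
  proof -
    obtain K' where K': "smooth \<psi>" "compact K'" "supp_in K' \<psi>" using t unfolding test_functions_iff by blast
    have "integrable lborel (\<lambda>x. indicator K' x *\<^sub>R \<psi> x)"
      by (rule borel_integrable_compact[OF K'(2) smooth_continuous[OF K'(1)]])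
    moreover have "(\<lambda>x. indicator K' x *\<^sub>R \<psi> x) = \<psi>"
      using K'(3) by (auto simp: supp_in_def indicator_def fun_eq_iff)
    ultimately show ?thesis using smooth_borel[OF K'(1)] by (simp add: integrable_completion)
  qed
  have 0: "(\<integral>p. \<Phi> (p + s *\<^sub>R b) \<partial>lebesgue) = (\<integral>p. \<Phi> p \<partial>lebesgue)"
    using integral_lebesgue_on_translate[of UNIV \<Phi> "s *\<^sub>R b"] borel_measurable_integrable[OF int[OF test]]
    by (simp add: lebesgue_on_UNIV_eq)
  have le: "\<bar>\<Phi> (p + s *\<^sub>R b) - \<Phi> p - s * dir_deriv b \<Phi> p\<bar> \<le> \<bar>I\<bar> / (2 * m) * s * indicator L p" for p
  proof (cases "p \<in> L")
    case True
    have "(\<Sum>c\<in>Basis. ((s *\<^sub>R b) \<bullet> c) * dir_deriv c \<Phi> p) = s * dir_deriv b \<Phi> p"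
      using b by (simp add: inner_Basis if_distrib[of "\<lambda>x. _ * x"] if_distrib[of "\<lambda>x. x * _"] sum.delta cong: if_cong)
    then show ?thesis using d(2)[of "s *\<^sub>R b" p] s b True by simp
  next
    case False
    have "p \<notin> K" using False unfolding L_def by force
    moreover have "p + s *\<^sub>R b \<notin> K"
    proof
      assume "p + s *\<^sub>R b \<in> K"
      moreover have "- (s *\<^sub>R b) \<in> cball 0 1" using s b by simp
      moreover have "p = (p + s *\<^sub>R b) + - (s *\<^sub>R b)" by simp
      ultimately show False using False unfolding L_def by blast
    qed
    ultimately show ?thesis
      using K dir_deriv_zero_outside[OF compact_imp_closed[OF K(1)], of \<Phi> p b] False by (auto simp: supp_in_def)
  qed
  have "s * \<bar>I\<bar> = \<bar>\<integral>p. \<Phi> (p + s *\<^sub>R b) - \<Phi> p - s * dir_deriv b \<Phi> p \<partial>lebesgue\<bar>"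
    using int[OF test] int[OF shift] int[OF dtest] 0 s by (simp add: I_def abs_mult)
  also have "\<dots> \<le> (\<integral>p. \<bar>I\<bar> / (2 * m) * s * indicator L p \<partial>lebesgue)"
  proof (rule order_trans[OF integral_abs_bound integral_mono'[OF _ le]])
    show "integrable lebesgue (\<lambda>p. \<bar>I\<bar> / (2 * m) * s * indicator L p)"
      using lmeasurable_compact[OF L] by (intro integrable_mult_right integrable_real_indicator) (auto simp: fmeasurable_def simp del: emeasure_completion)
    show "0 \<le> \<bar>I\<bar> / (2 * m) * s * indicator L p" for p using m s by auto
  qed
  also have "\<dots> = \<bar>I\<bar> / (2 * m) * s * measure lebesgue L" by simp
  also have "\<dots> \<le> \<bar>I\<bar> / (2 * m) * s * m" using m s I by (intro mult_left_mono) (auto simp: m_def)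
  also have "\<dots> = s * \<bar>I\<bar> / 2" using m by simp
  finally show False using s I by simp
qed

text \<open>The product \<open>\<phi> p * \<psi> p\<close> has compact support, so the integral of
  its derivative vanishes. The two terms are separated on \<open>K\<close>, which is bounded, so
  that the arbitrary smooth \<open>\<psi>\<close> is square-integrable there.\<close>

lemma integral_by_parts:
  assumes Q: "open Q" and \<phi>: "\<phi> \<in> test_functions Q" and \<psi>: "smooth \<psi>" and b: "b \<in> Basis"
  shows "(\<integral>p. dir_deriv b \<phi> p * \<psi> p \<partial>lebesgue_on Q) = - (\<integral>p. \<phi> p * dir_deriv b \<psi> p \<partial>lebesgue_on Q)"
proof -
  have Qm: "Q \<in> sets lebesgue" using Q by auto
  obtain K where K: "smooth \<phi>" "compact K" "K \<subseteq> Q" "supp_in K \<phi>"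
    using \<phi> by (auto simp: test_functions_iff)
  have Km: "K \<in> sets lebesgue" using lmeasurable_compact[OF K(2)] by (simp add: fmeasurableD)
  have prod: "(\<lambda>p. \<phi> p * \<psi> p) \<in> test_functions Q" by (rule test_functions_mult[OF \<phi> \<psi>])
  have dz: "dir_deriv b \<phi> p = 0" if "p \<notin> K" for p
    using K dir_deriv_zero_outside[OF compact_imp_closed[OF K(2)], of \<phi> p b] that by (auto simp: supp_in_def)
  have "supp_in K (\<lambda>p. \<phi> p * \<psi> p)" using K by (auto simp: supp_in_def)
  from integral_dir_deriv_eq_0[OF smooth_mult[OF K(1) \<psi>] K(2) this b]
  have "0 = (\<integral>p. \<phi> p * dir_deriv b \<psi> p + dir_deriv b \<phi> p * \<psi> p \<partial>lebesgue_on UNIV)"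
    by (simp add: dir_deriv_mult[OF K(1) \<psi>] lebesgue_on_UNIV_eq)
  also have "\<dots> = (\<integral>p. \<phi> p * dir_deriv b \<psi> p + dir_deriv b \<phi> p * \<psi> p \<partial>lebesgue_on K)"
    using Km K dz by (intro integral_lebesgue_on_subset) (auto simp: supp_in_def)
  also have "\<dots> = (\<integral>p. \<phi> p * dir_deriv b \<psi> p \<partial>lebesgue_on K) + (\<integral>p. dir_deriv b \<phi> p * \<psi> p \<partial>lebesgue_on K)"
    using K Km \<psi> b by (intro Bochner_Integration.integral_add L2_mult_integrable smooth_L2 smooth_dir_deriv compact_imp_bounded)
  also have "(\<integral>p. \<phi> p * dir_deriv b \<psi> p \<partial>lebesgue_on K) = (\<integral>p. \<phi> p * dir_deriv b \<psi> p \<partial>lebesgue_on Q)"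
    using Km Qm K by (intro integral_lebesgue_on_subset[symmetric]) (auto simp: supp_in_def)
  also have "(\<integral>p. dir_deriv b \<phi> p * \<psi> p \<partial>lebesgue_on K) = (\<integral>p. dir_deriv b \<phi> p * \<psi> p \<partial>lebesgue_on Q)"
    using Km Qm K dz by (intro integral_lebesgue_on_subset[symmetric]) auto
  finally show ?thesis by simp
qed

lemma smooth_has_weak_dt:
  fixes \<psi> :: "'a::euclidean_space \<times> real \<Rightarrow> real"
  assumes "open Q" "smooth \<psi>"
  shows "has_weak_dt Q \<psi> (dir_deriv (0, 1) \<psi>)"
  unfolding has_weak_dt_def using integral_by_parts[OF assms(1) _ assms(2), of _ "(0, 1)"] by simp

section \<open>Cylinders and translation in time\<close>

definition cyl :: "'a::euclidean_space set \<Rightarrow> real \<Rightarrow> real \<Rightarrow> ('a \<times> real) set" where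
  "cyl \<Omega> a b = \<Omega> \<times> {a<..<b}"

lemma cylinder_eq_cyl: "cylinder \<Omega> T = cyl \<Omega> 0 T"
  by (simp add: cylinder_def cyl_def)

lemma mem_cyl [simp]: "(x, t) \<in> cyl \<Omega> a b \<longleftrightarrow> x \<in> \<Omega> \<and> a < t \<and> t < b"
  by (auto simp: cyl_def)

lemma open_cyl: "open \<Omega> \<Longrightarrow> open (cyl \<Omega> a b)"
  by (auto simp: cyl_def intro: open_Times)

lemma bounded_cyl: "bounded \<Omega> \<Longrightarrow> bounded (cyl \<Omega> a b)"
  by (auto simp: cyl_def intro: bounded_Times)

lemma sets_cyl: "open \<Omega> \<Longrightarrow> cyl \<Omega> a b \<in> sets lebesgue" "open \<Omega> \<Longrightarrow> cyl \<Omega> a b \<in> sets borel"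
  using open_cyl[of \<Omega> a b] by auto

lemma vimage_cyl: "(\<lambda>p. p + (0, s)) -` cyl \<Omega> a b = cyl \<Omega> (a - s) (b - s)"
  by (auto simp: cyl_def)

lemma cyl_mono: "a' \<le> a \<Longrightarrow> b \<le> b' \<Longrightarrow> cyl \<Omega> a b \<subseteq> cyl \<Omega> a' b'"
  by (auto simp: cyl_def)

lemma L2_cyl_mono:
  assumes "open \<Omega>" "f \<in> L2 (lebesgue_on (cyl \<Omega> a' b'))" "a' \<le> a" "b \<le> b'"
  shows "f \<in> L2 (lebesgue_on (cyl \<Omega> a b))"
    "L2_norm (lebesgue_on (cyl \<Omega> a b)) f \<le> L2_norm (lebesgue_on (cyl \<Omega> a' b')) f"
  using L2_restrict[OF assms(2) sets_cyl(1)[OF assms(1)] sets_cyl(1)[OF assms(1)] cyl_mono[OF assms(3,4)]] by auto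

lemma L2_shift:
  assumes "open \<Omega>" "f \<in> L2 (lebesgue_on (cyl \<Omega> a b))"
  shows "(\<lambda>p. f (p + (0, s))) \<in> L2 (lebesgue_on (cyl \<Omega> (a - s) (b - s)))"
    "L2_norm (lebesgue_on (cyl \<Omega> (a - s) (b - s))) (\<lambda>p. f (p + (0, s))) = L2_norm (lebesgue_on (cyl \<Omega> a b)) f"
  using L2_translate[OF sets_cyl(1)[OF assms(1)] assms(2), of "(0, s)"] by (simp_all add: vimage_cyl)

lemma integral_shift:
  fixes f :: "'a::euclidean_space \<times> real \<Rightarrow> real"
  assumes "open \<Omega>" "f \<in> borel_measurable (lebesgue_on (cyl \<Omega> a b))"
  shows "(\<integral>p. f (p + (0, s)) \<partial>lebesgue_on (cyl \<Omega> (a - s) (b - s))) = (\<integral>p. f p \<partial>lebesgue_on (cyl \<Omega> a b))"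
  using integral_lebesgue_on_translate[OF sets_cyl(1)[OF assms(1)] assms(2), of "(0, s)"] by (simp add: vimage_cyl)

section \<open>Averages in time and the size of time translates\<close>

lemma nn_integral_lborel_translate:
  fixes f :: "'e::euclidean_space \<Rightarrow> ennreal"
  assumes "f \<in> borel_measurable borel"
  shows "(\<integral>\<^sup>+q. f (q + p) \<partial>lborel) = (\<integral>\<^sup>+q. f q \<partial>lborel)"
proof -
  have "(\<integral>\<^sup>+q. f q \<partial>distr lborel borel ((+) p)) = (\<integral>\<^sup>+q. f (p + q) \<partial>lborel)"
    using assms by (subst nn_integral_distr) auto
  then show ?thesis
    by (simp add: lborel_distr_plus add.commute)
qed

text \<open>Cauchy-Schwarz against the constant 1 moves the square inside at the cost of one factor
  \<open>m\<close>. After exchanging the integrals, translation invariance makes the integrand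
  constant in \<open>s\<close>, which gives the second factor.\<close>

lemma (in convolution) conv_square_nn:
  fixes \<psi> :: "'e \<Rightarrow> real"
  assumes \<psi>: "smooth \<psi>" "compact K" "supp_in K \<psi>"
  defines "m \<equiv> measure \<nu> (space \<nu>)"
  shows "(\<integral>\<^sup>+p. ennreal ((conv \<psi> p)\<^sup>2) \<partial>lborel) \<le> ennreal (m\<^sup>2) * (\<integral>\<^sup>+p. ennreal ((\<psi> p)\<^sup>2) \<partial>lborel)"
proof -
  interpret pair_sigma_finite lborel \<nu> ..
  have mb[measurable]: "\<psi> \<in> borel_measurable borel" by (rule smooth_borel[OF \<psi>(1)])
  have m: "0 \<le> m" by (simp add: m_def)
  have 1: "ennreal ((conv \<psi> p)\<^sup>2) \<le> ennreal m * (\<integral>\<^sup>+s. ennreal ((\<psi> (p - \<kappa> s))\<^sup>2) \<partial>\<nu>)" for p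
  proof -
    obtain B where B: "\<And>p. \<bar>\<psi> p\<bar> \<le> B"
      using supp_in_bounded[OF smooth_continuous[OF \<psi>(1)] \<psi>(2,3)] by blast
    have L: "(\<lambda>s. \<psi> (p - \<kappa> s)) \<in> L2 \<nu>"
      unfolding L2_def using power_mono[OF B, where n=2]
      by (auto intro!: integrable_const_bound[of _ "B\<^sup>2"])
    have L1: "(\<lambda>s. 1 :: real) \<in> L2 \<nu>" by (simp add: L2_def)
    have "\<bar>conv \<psi> p\<bar> \<le> L2_norm \<nu> (\<lambda>s. 1 :: real) * L2_norm \<nu> (\<lambda>s. \<psi> (p - \<kappa> s))"
      using L2_Cauchy_Schwarz_mult[OF L1 L] by (simp add: conv_def)
    from power_mono[OF this, of 2]
    have "(conv \<psi> p)\<^sup>2 \<le> (L2_norm \<nu> (\<lambda>s. 1 :: real))\<^sup>2 * (L2_norm \<nu> (\<lambda>s. \<psi> (p - \<kappa> s)))\<^sup>2"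
      by (simp add: power_mult_distrib)
    also have "(L2_norm \<nu> (\<lambda>s. 1 :: real))\<^sup>2 = m"
      by (simp add: L2_norm_square m_def)
    finally have "ennreal ((conv \<psi> p)\<^sup>2) \<le> ennreal (m * (L2_norm \<nu> (\<lambda>s. \<psi> (p - \<kappa> s)))\<^sup>2)"
      by (rule ennreal_leI)
    then show ?thesis
      using L2_norm_nn_integral[OF L] m by (simp add: ennreal_mult)
  qed
  have "(\<integral>\<^sup>+p. ennreal ((conv \<psi> p)\<^sup>2) \<partial>lborel)
      \<le> (\<integral>\<^sup>+p. ennreal m * (\<integral>\<^sup>+s. ennreal ((\<psi> (p - \<kappa> s))\<^sup>2) \<partial>\<nu>) \<partial>lborel)"
    by (intro nn_integral_mono 1)
  also have "\<dots> = ennreal m * (\<integral>\<^sup>+p. (\<integral>\<^sup>+s. ennreal ((\<psi> (p - \<kappa> s))\<^sup>2) \<partial>\<nu>) \<partial>lborel)"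
    by (intro nn_integral_cmult) auto
  also have "(\<integral>\<^sup>+p. (\<integral>\<^sup>+s. ennreal ((\<psi> (p - \<kappa> s))\<^sup>2) \<partial>\<nu>) \<partial>lborel)
      = (\<integral>\<^sup>+s. (\<integral>\<^sup>+p. ennreal ((\<psi> (p - \<kappa> s))\<^sup>2) \<partial>lborel) \<partial>\<nu>)"
    by (rule Fubini'[symmetric]) auto
  also have "(\<lambda>s. \<integral>\<^sup>+p. ennreal ((\<psi> (p - \<kappa> s))\<^sup>2) \<partial>lborel) = (\<lambda>s. \<integral>\<^sup>+p. ennreal ((\<psi> p)\<^sup>2) \<partial>lborel)"
  proof
    fix s
    show "(\<integral>\<^sup>+p. ennreal ((\<psi> (p - \<kappa> s))\<^sup>2) \<partial>lborel) = (\<integral>\<^sup>+p. ennreal ((\<psi> p)\<^sup>2) \<partial>lborel)"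
      using nn_integral_lborel_translate[of "\<lambda>p. ennreal ((\<psi> p)\<^sup>2)" "- \<kappa> s"] by simp
  qed
  finally show ?thesis
    using m by (simp add: emeasure_eq_measure m_def[symmetric] power2_eq_square ennreal_mult mult_ac)
qed

text \<open>The integral of \<open>\<psi>\<close> over the times from \<open>t - s\<close> to
  \<open>t\<close>. If \<open>s\<close> is at least the length of the time interval carrying
  \<open>\<psi>\<close>, this is on that interval the primitive that vanishes initially.\<close>

definition tprim :: "real \<Rightarrow> ('a::euclidean_space \<times> real \<Rightarrow> real) \<Rightarrow> 'a \<times> real \<Rightarrow> real" where
  "tprim s \<psi> p = (\<integral>r. \<psi> (p - (0, r)) \<partial>restrict_space lborel {0..s})"

lemma time_convolution:
  "convolution (restrict_space lborel {0..s}) (\<lambda>r::real. (0::'a::euclidean_space, r))"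
proof (intro convolution.intro finite_measureI convolution_axioms.intro)
  show "emeasure (restrict_space lborel {0..s}) (space (restrict_space lborel {0..s})) \<noteq> \<infinity>"
    by (simp add: emeasure_restrict_space space_restrict_space emeasure_lborel_Icc_eq)
qed (auto intro: measurable_restrict_space1)

context
  fixes \<psi> :: "'a::euclidean_space \<times> real \<Rightarrow> real" and K and s :: real
  assumes \<psi>: "smooth \<psi>" "compact K" "supp_in K \<psi>" and s: "0 \<le> s"
begin

interpretation convolution "restrict_space lborel {0..s}" "\<lambda>r. (0::'a, r)"
  by (rule time_convolution)

lemma tprim_conv: "tprim s \<psi> = conv \<psi>"
  by (auto simp: tprim_def conv_def)

lemma smooth_tprim: "smooth (tprim s \<psi>)"
  unfolding tprim_conv by (rule smooth_conv[OF \<psi>])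

lemma dt_tprim: "dir_deriv (0, 1) (tprim s \<psi>) p = \<psi> p - \<psi> (p - (0, s))"
proof (cases p)
  case (Pair x t)
  have c: "continuous_on UNIV (dir_deriv (0, 1) \<psi>)"
    by (intro smooth_continuous smooth_dir_deriv \<psi>) simp
  have "dir_deriv (0, 1) (tprim s \<psi>) p = conv (dir_deriv (0, 1) \<psi>) p"
    unfolding tprim_conv by (subst dir_deriv_conv[OF \<psi>]) auto
  also have "\<dots> = (\<integral>r. dir_deriv (0, 1) \<psi> (x, t - r) * indicator {0..s} r \<partial>lborel)"
    unfolding conv_def by (subst integral_restrict_space) (auto simp: Pair mult.commute)
  also have "\<dots> = - \<psi> (x, t - s) - (- \<psi> (x, t - 0))"
  proof (rule integral_FTC_Icc_real[OF s])
    show "DERIV (\<lambda>r. - \<psi> (x, t - r)) r :> dir_deriv (0, 1) \<psi> (x, t - r)" for r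
    proof -
      have "((\<lambda>r. t - r) has_real_derivative - 1) (at r)"
        by (auto intro!: derivative_eq_intros)
      from DERIV_minus[OF DERIV_chain'[OF this smooth_dt_derivative[OF \<psi>(1), of x "t - r"]]]
      show ?thesis by simp
    qed
    have "continuous_on UNIV (\<lambda>r. dir_deriv (0, 1) \<psi> (x, t - r))"
      by (rule continuous_on_compose2[OF c]) (auto intro!: continuous_intros)
    then show "isCont (\<lambda>r. dir_deriv (0, 1) \<psi> (x, t - r)) r" for r
      by (simp add: continuous_on_eq_continuous_at)
  qed
  finally show ?thesis by (simp add: Pair)
qed

lemma tprim_supp: "compact (\<Union>x\<in>K. \<Union>y\<in>{0} \<times> {0..s}. {x + y})" "supp_in (\<Union>x\<in>K. \<Union>y\<in>{0} \<times> {0..s}. {x + y}) (tprim s \<psi>)"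
proof -
  show "compact (\<Union>x\<in>K. \<Union>y\<in>{0} \<times> {0..s}. {x + y})"
    by (intro compact_sums' \<psi> compact_Times) auto
  show "supp_in (\<Union>x\<in>K. \<Union>y\<in>{0} \<times> {0..s}. {x + y}) (tprim s \<psi>)"
    unfolding supp_in_def
  proof (intro allI impI)
    fix p assume p: "p \<notin> (\<Union>x\<in>K. \<Union>y\<in>{0} \<times> {0..s}. {x + y})"
    have "\<psi> (p - (0, r)) = 0" if "r \<in> {0..s}" for r
    proof (rule ccontr)
      assume "\<psi> (p - (0, r)) \<noteq> 0"
      then have "p - (0, r) \<in> K" using \<psi>(3) unfolding supp_in_def by blast
      moreover have "p = (p - (0, r)) + (0, r)" by simp
      ultimately show False using p that by blast
    qed
    then have "(\<integral>r. \<psi> (p - (0, r)) \<partial>restrict_space lborel {0..s}) = (\<integral>r. 0 \<partial>restrict_space lborel {0..s})"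
      by (intro Bochner_Integration.integral_cong) (auto simp: space_restrict_space)
    then show "tprim s \<psi> p = 0" by (simp add: tprim_def)
  qed
qed

lemma tprim_L2:
  assumes S: "S \<in> sets lebesgue" "S' \<in> sets lebesgue" and z: "\<And>p. p \<notin> S' \<Longrightarrow> \<psi> p = 0"
  shows "tprim s \<psi> \<in> L2 (lebesgue_on S)"
    "L2_norm (lebesgue_on S) (tprim s \<psi>) \<le> s * L2_norm (lebesgue_on S') \<psi>"
proof -
  have \<psi>L: "\<psi> \<in> L2 (lebesgue_on S')"
    using \<psi> by (intro test_function_L2[OF _ S(2), of \<psi> UNIV]) (auto simp: test_functions_iff)
  have m: "tprim s \<psi> \<in> borel_measurable (lebesgue_on S)"
    by (rule continuous_imp_measurable_on_sets_lebesgue[OF smooth_continuous[OF smooth_tprim] S(1)])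
  have "(\<integral>\<^sup>+p. ennreal ((norm (tprim s \<psi> p))\<^sup>2) \<partial>lebesgue_on S) \<le> (\<integral>\<^sup>+p. ennreal ((conv \<psi> p)\<^sup>2) \<partial>lborel)"
    unfolding nn_integral_lebesgue_on[OF S(1)] tprim_conv
    by (intro nn_integral_mono) (auto simp: indicator_def)
  also have "\<dots> \<le> ennreal (s\<^sup>2) * (\<integral>\<^sup>+p. ennreal ((\<psi> p)\<^sup>2) \<partial>lborel)"
    using conv_square_nn[OF \<psi>] s by (simp add: space_restrict_space measure_restrict_space)
  also have "(\<integral>\<^sup>+p. ennreal ((\<psi> p)\<^sup>2) \<partial>lborel) = (\<integral>\<^sup>+p. ennreal ((norm (\<psi> p))\<^sup>2) \<partial>lebesgue_on S')"
    unfolding nn_integral_lebesgue_on[OF S(2)]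
    using z by (intro nn_integral_cong) (auto simp: indicator_def)
  also have "\<dots> = ennreal ((L2_norm (lebesgue_on S') \<psi>)\<^sup>2)"
    by (rule L2_norm_nn_integral[OF \<psi>L, symmetric])
  finally have le: "(\<integral>\<^sup>+p. ennreal ((norm (tprim s \<psi> p))\<^sup>2) \<partial>lebesgue_on S)
      \<le> ennreal ((s * L2_norm (lebesgue_on S') \<psi>)\<^sup>2)"
    by (simp add: power_mult_distrib ennreal_mult)
  show "tprim s \<psi> \<in> L2 (lebesgue_on S)" by (rule L2I_nn_integral(1)[OF m le]) simp
  show "L2_norm (lebesgue_on S) (tprim s \<psi>) \<le> s * L2_norm (lebesgue_on S') \<psi>"
    using L2I_nn_integral(2)[OF m le] s by (auto intro: power2_le_imp_le)
qed

end

text \<open>Test functions approximating \<open>h\<close> give \<open>N * N \<le> C * N\<close> for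
  its norm \<open>N\<close>, and \<open>N\<close> can be cancelled unless it is zero.\<close>

lemma L2_norm_dual:
  assumes Q: "open Q" "bounded Q" and h: "h \<in> L2 (lebesgue_on Q)"
    and le: "\<And>\<psi>. \<psi> \<in> test_functions Q \<Longrightarrow> \<bar>\<integral>p. \<psi> p * h p \<partial>lebesgue_on Q\<bar> \<le> C * L2_norm (lebesgue_on Q) \<psi>"
    and C: "0 \<le> C"
  shows "L2_norm (lebesgue_on Q) h \<le> C"
proof -
  obtain \<psi> where \<psi>: "\<And>n. \<psi> n \<in> test_functions Q" "L2_lim (lebesgue_on Q) \<psi> h"
    using test_functions_dense_seq[OF Q h] by blast
  have "(\<integral>p. h p * h p \<partial>lebesgue_on Q) \<le> C * L2_norm (lebesgue_on Q) h"
  proof (rule LIMSEQ_le)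
    show "(\<lambda>n. \<integral>p. \<psi> n p * h p \<partial>lebesgue_on Q) \<longlonglongrightarrow> (\<integral>p. h p * h p \<partial>lebesgue_on Q)"
      by (rule L2_lim_mult[OF \<psi>(2) h h])
    show "(\<lambda>n. C * L2_norm (lebesgue_on Q) (\<psi> n)) \<longlonglongrightarrow> C * L2_norm (lebesgue_on Q) h"
      by (intro tendsto_intros L2_lim_norm[OF \<psi>(2) h])
    show "\<exists>N. \<forall>n\<ge>N. (\<integral>p. \<psi> n p * h p \<partial>lebesgue_on Q) \<le> C * L2_norm (lebesgue_on Q) (\<psi> n)"
      using le[OF \<psi>(1)] by (auto intro: order_trans[OF abs_ge_self])
  qed
  moreover have "(\<integral>p. h p * h p \<partial>lebesgue_on Q) = L2_norm (lebesgue_on Q) h * L2_norm (lebesgue_on Q) h"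
    using L2_norm_square[of "lebesgue_on Q" h] by (simp add: power2_eq_square)
  ultimately have "L2_norm (lebesgue_on Q) h * L2_norm (lebesgue_on Q) h \<le> C * L2_norm (lebesgue_on Q) h" by simp
  then show ?thesis
    using L2_norm_nonneg[of "lebesgue_on Q" h] C by (cases "L2_norm (lebesgue_on Q) h = 0") (auto simp: mult_le_cancel_right)
qed

text \<open>
  By duality it suffices to test with \<open>\<psi>\<close>, and then \<open>\<psi>(x, t) - \<psi>(x, t - s)\<close> is the time
  derivative of the test function \<open>tprim s \<psi>\<close>.
\<close>

lemma weak_dt_shift_le:
  fixes w :: "'a::euclidean_space \<times> real \<Rightarrow> real"
  assumes \<Omega>: "open \<Omega>" "bounded \<Omega>" and s: "0 \<le> s"
    and w: "w \<in> L2 (lebesgue_on (cyl \<Omega> a b))" "k \<in> L2 (lebesgue_on (cyl \<Omega> a b))"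
    and wk: "has_weak_dt (cyl \<Omega> a b) w k"
  shows "(\<lambda>p. w (p + (0, s)) - w p) \<in> L2 (lebesgue_on (cyl \<Omega> a (b - s)))"
    "L2_norm (lebesgue_on (cyl \<Omega> a (b - s))) (\<lambda>p. w (p + (0, s)) - w p) \<le> s * L2_norm (lebesgue_on (cyl \<Omega> a b)) k"
proof -
  let ?Q = "cyl \<Omega> a b" and ?Q' = "cyl \<Omega> a (b - s)"
  have Qm: "?Q \<in> sets lebesgue" "?Q' \<in> sets lebesgue" using sets_cyl[OF \<Omega>(1)] by auto
  have sub: "?Q' \<subseteq> ?Q" using s by (intro cyl_mono) auto
  have ws: "(\<lambda>p. w (p + (0, s))) \<in> L2 (lebesgue_on ?Q')"
    by (rule L2_cyl_mono[OF \<Omega>(1) L2_shift(1)[OF \<Omega>(1) w(1), of s]]) (use s in auto)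
  have w': "w \<in> L2 (lebesgue_on ?Q')" by (rule L2_restrict(1)[OF w(1) Qm sub])
  show L: "(\<lambda>p. w (p + (0, s)) - w p) \<in> L2 (lebesgue_on ?Q')"
    by (rule L2_diff[OF ws w'])
  show "L2_norm (lebesgue_on ?Q') (\<lambda>p. w (p + (0, s)) - w p) \<le> s * L2_norm (lebesgue_on ?Q) k"
  proof (rule L2_norm_dual[OF open_cyl[OF \<Omega>(1)] bounded_cyl[OF \<Omega>(2)] L])
    fix \<psi> assume \<psi>: "\<psi> \<in> test_functions ?Q'"
    then obtain K where K: "smooth \<psi>" "compact K" "supp_in K \<psi>" "K \<subseteq> ?Q'"
      by (auto simp: test_functions_iff)
    define \<phi> where "\<phi> = tprim s \<psi>"
    have \<phi>: "\<phi> \<in> test_functions ?Q"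
      unfolding test_functions_iff \<phi>_def
    proof (intro conjI exI)
      show "(\<Union>x\<in>K. \<Union>y\<in>{0} \<times> {0..s}. {x + y}) \<subseteq> ?Q"
        using K(4) s by (force simp: cyl_def)
    qed (use smooth_tprim[OF K(1-3) s] tprim_supp[OF K(1-3) s] in auto)
    have \<psi>0: "\<psi> p = 0" if "p \<notin> ?Q'" for p using test_functions_outside[OF \<psi> that] .
    have \<psi>t: "(\<lambda>p. \<psi> (p - (0, s))) \<in> test_functions ?Q"
      unfolding diff_conv_add_uminus by (rule test_functions_translate[OF \<psi>]) (use s in \<open>auto simp: cyl_def\<close>)
    note \<psi>L = test_function_L2[OF test_functions_subset[OF \<psi> sub] Qm(1)] test_function_L2[OF \<psi>t Qm(1)]
    have "(\<integral>p. (\<psi> p - \<psi> (p - (0, s))) * w p \<partial>lebesgue_on ?Q) = - (\<integral>p. \<phi> p * k p \<partial>lebesgue_on ?Q)"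
      using wk[unfolded has_weak_dt_def, rule_format, OF \<phi>] by (simp add: dt_tprim[OF K(1-3) s] \<phi>_def)
    moreover have "(\<integral>p. (\<psi> p - \<psi> (p - (0, s))) * w p \<partial>lebesgue_on ?Q)
        = (\<integral>p. \<psi> p * w p \<partial>lebesgue_on ?Q) - (\<integral>p. \<psi> (p - (0, s)) * w p \<partial>lebesgue_on ?Q)"
      using L2_mult_integrable[OF \<psi>L(1) w(1)] L2_mult_integrable[OF \<psi>L(2) w(1)] by (simp add: left_diff_distrib)
    moreover have "(\<integral>p. \<psi> p * w p \<partial>lebesgue_on ?Q) = (\<integral>p. \<psi> p * w p \<partial>lebesgue_on ?Q')"
      using sub \<psi>0 by (intro integral_lebesgue_on_subset Qm) auto
    \<comment> \<open>Substitution moves the shift from \<open>\<psi>\<close> to \<open>w\<close>;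
      the domain is then cut down to the cylinder that carries \<open>\<psi>\<close>.\<close>
    moreover have "(\<integral>p. \<psi> (p - (0, s)) * w p \<partial>lebesgue_on ?Q) = (\<integral>p. \<psi> p * w (p + (0, s)) \<partial>lebesgue_on ?Q')"
    proof -
      have "(\<integral>p. \<psi> (p - (0, s)) * w p \<partial>lebesgue_on ?Q) = (\<integral>p. \<psi> p * w (p + (0, s)) \<partial>lebesgue_on (cyl \<Omega> (a - s) (b - s)))"
        using integral_shift[OF \<Omega>(1), of "\<lambda>p. \<psi> (p - (0, s)) * w p" a b s] L2_measurable[OF \<psi>L(2)] L2_measurable[OF w(1)]
        by simp
      also have "\<dots> = (\<integral>p. \<psi> p * w (p + (0, s)) \<partial>lebesgue_on ?Q')"
        using s \<psi>0 by (intro integral_lebesgue_on_subset sets_cyl \<Omega> cyl_mono) auto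
      finally show ?thesis .
    qed
    moreover have "(\<integral>p. \<psi> p * (w (p + (0, s)) - w p) \<partial>lebesgue_on ?Q') =
       (\<integral>p. \<psi> p * w (p + (0, s)) \<partial>lebesgue_on ?Q') - (\<integral>p. \<psi> p * w p \<partial>lebesgue_on ?Q')"
      using L2_mult_integrable[OF test_function_L2[OF \<psi> Qm(2)] ws] L2_mult_integrable[OF test_function_L2[OF \<psi> Qm(2)] w']
      by (simp add: right_diff_distrib)
    ultimately have "(\<integral>p. \<psi> p * (w (p + (0, s)) - w p) \<partial>lebesgue_on ?Q') = (\<integral>p. \<phi> p * k p \<partial>lebesgue_on ?Q)"
      by simp
    also have "\<bar>\<dots>\<bar> \<le> L2_norm (lebesgue_on ?Q) \<phi> * L2_norm (lebesgue_on ?Q) k"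
      by (intro L2_Cauchy_Schwarz_mult test_function_L2[OF \<phi> Qm(1)] w)
    also have "\<dots> \<le> s * L2_norm (lebesgue_on ?Q') \<psi> * L2_norm (lebesgue_on ?Q) k"
      unfolding \<phi>_def using tprim_L2(2)[OF K(1-3) s Qm \<psi>0] by (intro mult_right_mono) auto
    finally show "\<bar>\<integral>p. \<psi> p * (w (p + (0, s)) - w p) \<partial>lebesgue_on ?Q'\<bar>
        \<le> s * L2_norm (lebesgue_on ?Q) k * L2_norm (lebesgue_on ?Q') \<psi>"
      by (simp add: mult_ac)
  qed (use s in simp)
qed

section \<open>Completeness\<close>

text \<open>The partial sums \<open>S\<close> of the absolute increments have norms at most
  \<open>2 * C\<close>, so by monotone convergence their pointwise supremum is square-integrable.
  Where it is finite the sequence converges, and it dominates the distance of every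
  \<open>f n\<close> to the limit.\<close>

lemma L2_complete_fast:
  fixes f :: "nat \<Rightarrow> 'm \<Rightarrow> real"
  assumes f: "\<And>n. f n \<in> L2 M" and C: "\<And>n. L2_norm M (\<lambda>x. f (Suc n) x - f n x) \<le> C * (1 / 2) ^ n" "0 \<le> C"
  obtains g where "g \<in> L2 M" "L2_lim M f g"
proof -
  define d where "d n x = \<bar>f (Suc n) x - f n x\<bar>" for n x
  have d: "d n \<in> L2 M" "L2_norm M (d n) \<le> C * (1 / 2) ^ n" for n
  proof -
    have "(\<lambda>x. f (Suc n) x - f n x) \<in> L2 M" by (intro L2_diff f)
    then show "d n \<in> L2 M" by (auto simp: L2_def d_def[abs_def] intro: borel_measurable_abs)
    show "L2_norm M (d n) \<le> C * (1 / 2) ^ n" using C(1)[of n] by (simp add: L2_norm_def d_def)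
  qed
  have [measurable]: "f n \<in> borel_measurable M" "d n \<in> borel_measurable M" for n
    using f d by (auto dest: L2_measurable)
  define S where "S N x = (\<Sum>n<N. d n x)" for N x
  have S: "S N \<in> L2 M" for N unfolding S_def[abs_def] by (intro L2_sum d)
  have [measurable]: "S n \<in> borel_measurable M" for n using S by (auto dest: L2_measurable)
  have S_le: "L2_norm M (S N) \<le> C * (\<Sum>n<N. (1 / 2) ^ n)" for N
  proof (induction N)
    case (Suc N)
    have "L2_norm M (S (Suc N)) \<le> L2_norm M (S N) + L2_norm M (d N)"
      using L2_norm_triangle[OF S[of N] d(1)[of N]] by (simp add: S_def[abs_def])
    then show ?case using Suc d(2)[of N] by (simp add: algebra_simps)
  qed (simp add: S_def)
  have geo: "(\<Sum>n<N. (1 / 2) ^ n) \<le> (2::real)" for N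
    using sum_le_suminf[of "\<lambda>n. (1 / 2 :: real) ^ n" "{..<N}"] by (simp add: suminf_geometric summable_geometric)
  have S_nn: "(\<integral>\<^sup>+x. ennreal ((S N x)\<^sup>2) \<partial>M) \<le> ennreal ((2 * C)\<^sup>2)" for N
  proof -
    have "L2_norm M (S N) \<le> 2 * C"
      using S_le[of N] mult_left_mono[OF geo C(2), of N] by linarith
    then have "(L2_norm M (S N))\<^sup>2 \<le> (2 * C)\<^sup>2" by (intro power_mono) auto
    then show ?thesis using L2_norm_nn_integral[OF S[of N]] by (simp add: ennreal_leI flip: ennreal_le_iff)
  qed
  have S_mono: "S N x \<le> S (Suc N) x" "0 \<le> S N x" for N x
    by (auto simp: S_def d_def intro: sum_nonneg)
  \<comment> \<open>The supremum of the squares is formed in \<open>ennreal\<close>, where it always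
    exists; off a null set its root is a real bound.\<close>
  define U where "U x = (SUP N. ennreal ((S N x)\<^sup>2))" for x
  have [measurable]: "U \<in> borel_measurable M" unfolding U_def[abs_def] by measurable
  have "(\<integral>\<^sup>+x. U x \<partial>M) = (SUP N. \<integral>\<^sup>+x. ennreal ((S N x)\<^sup>2) \<partial>M)"
    unfolding U_def
  proof (rule nn_integral_monotone_convergence_SUP)
    show "incseq (\<lambda>N x. ennreal ((S N x)\<^sup>2))"
      using S_mono by (intro incseq_SucI le_funI ennreal_leI power_mono) auto
  qed simp
  also have "\<dots> \<le> ennreal ((2 * C)\<^sup>2)" by (intro SUP_least S_nn)
  finally have U: "(\<integral>\<^sup>+x. U x \<partial>M) \<le> ennreal ((2 * C)\<^sup>2)" .
  then have fin: "AE x in M. U x \<noteq> \<infinity>"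
    by (intro nn_integral_PInf_AE) (auto simp: top_unique)
  have bd: "S N x \<le> sqrt (enn2real (U x))" if "U x \<noteq> \<infinity>" for N x
  proof -
    have "ennreal ((S N x)\<^sup>2) \<le> U x" unfolding U_def by (rule SUP_upper) simp
    then have "(S N x)\<^sup>2 \<le> enn2real (U x)"
      using that by (cases "U x") auto
    then show ?thesis by (rule real_le_rsqrt)
  qed
  have conv: "convergent (\<lambda>n. f n x)" "\<bar>f n x - lim (\<lambda>n. f n x)\<bar> \<le> sqrt (enn2real (U x))" if "U x \<noteq> \<infinity>" for x n
  proof -
    have sm: "summable (\<lambda>n. d n x)"
      by (rule bounded_imp_summable[of _ "sqrt (enn2real (U x))"])
         (use bd[OF that, of "Suc _"] in \<open>auto simp: S_def d_def lessThan_Suc_atMost\<close>)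
    have "summable (\<lambda>n. f (Suc n) x - f n x)"
      by (rule summable_rabs_cancel) (use sm in \<open>simp add: d_def\<close>)
    then have "convergent (\<lambda>n. \<Sum>i<n. f (Suc i) x - f i x)" by (simp add: summable_iff_convergent)
    then have "convergent (\<lambda>n. f n x - f 0 x)" by (simp only: sum_lessThan_telescope[of "\<lambda>i. f i x"])
    from convergent_add[OF this convergent_const[of "f 0 x"]] show c: "convergent (\<lambda>n. f n x)" by simp
    have tri: "\<bar>f n x - f (n + k) x\<bar> \<le> S (n + k) x - S n x" for k
      by (induction k) (auto simp: S_def d_def)
    have le: "\<bar>f n x - f (n + k) x\<bar> \<le> sqrt (enn2real (U x))" for k
      using tri[of k] S_mono(2)[of n x] bd[OF that, of "n + k"] by linarith
    have "(\<lambda>k. \<bar>f n x - f (k + n) x\<bar>) \<longlonglongrightarrow> \<bar>f n x - lim (\<lambda>n. f n x)\<bar>"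
      using LIMSEQ_ignore_initial_segment[OF convergent_LIMSEQ_iff[THEN iffD1, OF c], of n] by (intro tendsto_intros)
    then show "\<bar>f n x - lim (\<lambda>n. f n x)\<bar> \<le> sqrt (enn2real (U x))"
      by (rule LIMSEQ_le_const2) (use le in \<open>auto simp: add.commute\<close>)
  qed
  define g where "g x = lim (\<lambda>n. f n x)" for x
  have [measurable]: "g \<in> borel_measurable M" unfolding g_def[abs_def] by measurable
  have dom: "(\<lambda>x. sqrt (enn2real (U x))) \<in> L2 M"
  proof (rule L2I_nn_integral(1))
    have "(\<integral>\<^sup>+x. ennreal ((norm (sqrt (enn2real (U x))))\<^sup>2) \<partial>M) \<le> (\<integral>\<^sup>+x. U x \<partial>M)"
      by (intro nn_integral_mono) (auto simp: ennreal_enn2real_if)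
    then show "(\<integral>\<^sup>+x. ennreal ((norm (sqrt (enn2real (U x))))\<^sup>2) \<partial>M) \<le> ennreal ((2 * C)\<^sup>2)" using U by simp
  qed auto
  have lim: "L2_lim M f g"
  proof (rule L2_dominated_convergence[OF _ _ dom])
    show "AE x in M. (\<lambda>n. f n x) \<longlonglongrightarrow> g x"
      using fin by eventually_elim (use conv(1) in \<open>auto simp: g_def convergent_LIMSEQ_iff\<close>)
    show "AE x in M. norm (f n x - g x) \<le> sqrt (enn2real (U x))" for n
      using fin by eventually_elim (use conv(2) in \<open>auto simp: g_def\<close>)
  qed auto
  have "g \<in> L2 M"
    using L2_diff[OF f[of 0], of "\<lambda>x. f 0 x - g x"] lim by (simp add: L2_lim_def)
  then show thesis using lim by (rule that)
qed

section \<open>Integration in time of continuous functions\<close>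

lemma continuous_bounded_integrable:
  fixes F :: "'e::euclidean_space \<Rightarrow> real"
  assumes F: "continuous_on UNIV F" and S: "bounded S" "S \<in> sets lebesgue"
  shows "F \<in> borel_measurable (lebesgue_on S)" "integrable (lebesgue_on S) F" "F \<in> L2 (lebesgue_on S)"
proof -
  have "bounded (F ` closure S)"
    using compact_continuous_image[OF continuous_on_subset[OF F], of "closure S"] S(1)
    by (simp add: compact_imp_bounded)
  then obtain B where B: "\<forall>y\<in>F ` closure S. norm y \<le> B"
    unfolding bounded_iff by (elim exE)
  have le: "\<bar>F x\<bar> \<le> B" if "x \<in> S" for x
    using B that closure_subset[of S] by auto
  show m: "F \<in> borel_measurable (lebesgue_on S)"
    by (rule continuous_imp_measurable_on_sets_lebesgue[OF continuous_on_subset[OF F] S(2)]) simp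
  interpret finite_measure "lebesgue_on S"
    using S by (intro finite_measure_lebesgue_on bounded_set_imp_lmeasurable)
  show "integrable (lebesgue_on S) F"
    by (rule integrable_const_bound[of _ B]) (use m le in auto)
  show "F \<in> L2 (lebesgue_on S)"
    unfolding L2_def using m power_mono[OF le, of _ 2] by (auto intro!: integrable_const_bound[of _ "B\<^sup>2"])
qed

text \<open>The inner integral is the gauge integral over a closed interval, to which the
  fundamental theorem of calculus applies directly; the end points do not change its value.\<close>

lemma Fubini_cyl:
  fixes F :: "'a::euclidean_space \<times> real \<Rightarrow> real"
  assumes \<Omega>: "open \<Omega>" "bounded \<Omega>" and F: "continuous_on UNIV F"
  shows "integrable (lebesgue_on \<Omega>) (\<lambda>x. integral {a..b} (\<lambda>t. F (x, t)))"
    "(\<integral>p. F p \<partial>lebesgue_on (cyl \<Omega> a b)) = (\<integral>x. integral {a..b} (\<lambda>t. F (x, t)) \<partial>lebesgue_on \<Omega>)"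
proof -
  note cs = sets_cyl[OF \<Omega>(1), of a b]
  have Fb[measurable]: "F \<in> borel_measurable borel" by (rule borel_measurable_continuous_onI[OF F])
  have "integrable (lebesgue_on (cyl \<Omega> a b)) F"
    by (rule continuous_bounded_integrable(2)[OF F bounded_cyl[OF \<Omega>(2)] cs(1)])
  then have "integrable lebesgue (\<lambda>p. indicator (cyl \<Omega> a b) p *\<^sub>R F p)"
    using cs by (subst (asm) integrable_restrict_space) auto
  then have i: "integrable (lborel \<Otimes>\<^sub>M lborel) (\<lambda>p. indicator (cyl \<Omega> a b) p *\<^sub>R F p)"
    using cs by (simp add: integrable_completion lborel_prod)
  have inner: "(\<integral>t. indicator (cyl \<Omega> a b) (x, t) *\<^sub>R F (x, t) \<partial>lborel)
      = indicator \<Omega> x *\<^sub>R integral {a..b} (\<lambda>t. F (x, t))" for x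
  proof -
    have c: "continuous_on S (\<lambda>t. F (x, t))" for S
      by (rule continuous_on_compose2[OF F]) (auto intro!: continuous_intros)
    have "set_integrable lborel {a<..<b} (\<lambda>t. F (x, t))"
      by (rule set_integrable_subset[OF borel_integrable_atLeastAtMost'[of a b, OF c]]) auto
    then have "(\<integral>t. indicator {a<..<b} t *\<^sub>R F (x, t) \<partial>lborel) = integral {a<..<b} (\<lambda>t. F (x, t))"
      using set_borel_integral_eq_integral(2) unfolding set_lebesgue_integral_def by blast
    also have "\<dots> = integral {a..b} (\<lambda>t. F (x, t))" by (rule integral_open_interval_real[symmetric])
    finally have "indicator \<Omega> x *\<^sub>R (\<integral>t. indicator {a<..<b} t *\<^sub>R F (x, t) \<partial>lborel) = indicator \<Omega> x *\<^sub>R integral {a..b} (\<lambda>t. F (x, t))"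
      by simp
    moreover have "(\<lambda>t. indicator (cyl \<Omega> a b) (x, t) *\<^sub>R F (x, t)) = (\<lambda>t. indicator \<Omega> x *\<^sub>R indicator {a<..<b} t *\<^sub>R F (x, t))"
      by (auto simp: indicator_def fun_eq_iff)
    ultimately show ?thesis by (simp only: integral_scaleR_right)
  qed
  have int: "integrable lborel (\<lambda>x. indicator \<Omega> x *\<^sub>R integral {a..b} (\<lambda>t. F (x, t)))"
    using lborel_pair.integrable_fst'[OF i] unfolding inner .
  then show "integrable (lebesgue_on \<Omega>) (\<lambda>x. integral {a..b} (\<lambda>t. F (x, t)))"
    using \<Omega>(1) by (subst integrable_restrict_space) (auto simp: integrable_completion dest: borel_measurable_integrable)
  have "(\<integral>p. F p \<partial>lebesgue_on (cyl \<Omega> a b)) = (\<integral>p. indicator (cyl \<Omega> a b) p *\<^sub>R F p \<partial>lebesgue)"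
    using cs by (subst integral_restrict_space) auto
  also have "\<dots> = (\<integral>p. indicator (cyl \<Omega> a b) p *\<^sub>R F p \<partial>(lborel \<Otimes>\<^sub>M lborel))"
    using cs by (simp add: integral_completion lborel_prod)
  also have "\<dots> = (\<integral>x. indicator \<Omega> x *\<^sub>R integral {a..b} (\<lambda>t. F (x, t)) \<partial>lborel)"
    using lborel_pair.integral_fst'[OF i] unfolding inner by simp
  also have "\<dots> = (\<integral>x. indicator \<Omega> x *\<^sub>R integral {a..b} (\<lambda>t. F (x, t)) \<partial>lebesgue)"
    using borel_measurable_integrable[OF int] by (simp add: integral_completion)
  also have "\<dots> = (\<integral>x. integral {a..b} (\<lambda>t. F (x, t)) \<partial>lebesgue_on \<Omega>)"
    using \<Omega>(1) by (subst integral_restrict_space) auto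
  finally show "(\<integral>p. F p \<partial>lebesgue_on (cyl \<Omega> a b)) = (\<integral>x. integral {a..b} (\<lambda>t. F (x, t)) \<partial>lebesgue_on \<Omega>)" .
qed

text \<open>For the mean slope \<open>m\<close> between the two times, the integral of
  \<open>(f' x - m)\<^sup>2\<close> is nonnegative; expanding it leaves the claim on the interval
  between them.\<close>

lemma square_diff_le_integral:
  fixes f f' :: "real \<Rightarrow> real"
  assumes d: "\<And>x. (f has_real_derivative f' x) (at x)" and c: "continuous_on UNIV f'"
    and st: "a \<le> s" "s \<le> b" "a \<le> t" "t \<le> b"
  shows "(f s - f t)\<^sup>2 \<le> \<bar>s - t\<bar> * integral {a..b} (\<lambda>x. (f' x)\<^sup>2)"
proof -
  have main: "(f s - f t)\<^sup>2 \<le> (s - t) * integral {a..b} (\<lambda>x. (f' x)\<^sup>2)" if "a \<le> t" "t < s" "s \<le> b" for s t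
  proof -
    have cS: "continuous_on S f'" for S using c by (rule continuous_on_subset) simp
    define m where "m = (f s - f t) / (s - t)"
    have "(f' has_integral (f s - f t)) {t..s}"
      using that d by (intro fundamental_theorem_of_calculus)
        (auto simp: has_real_derivative_iff_has_vector_derivative[symmetric] intro: DERIV_subset)
    from has_integral_mult_right[OF this, of "2 * m"]
    have I: "((\<lambda>x. 2 * m * f' x) has_integral 2 * m * (f s - f t)) {t..s}" .
    have i: "(\<lambda>x. (f' x)\<^sup>2) integrable_on {u..v}" for u v
      by (intro integrable_continuous_interval continuous_intros cS)
    have J: "((\<lambda>x. m\<^sup>2) has_integral m\<^sup>2 * (s - t)) {t..s}"
      using has_integral_const_real[of "m\<^sup>2" t s] that by (simp add: mult.commute)
    have "0 \<le> integral {t..s} (\<lambda>x. (f' x - m)\<^sup>2)"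
      by (intro integral_nonneg integrable_continuous_interval continuous_intros cS) simp
    also have "(\<lambda>x. (f' x - m)\<^sup>2) = (\<lambda>x. ((f' x)\<^sup>2 - 2 * m * f' x) + m\<^sup>2)"
      by (auto simp: power2_eq_square algebra_simps)
    also have "integral {t..s} \<dots> = integral {t..s} (\<lambda>x. (f' x)\<^sup>2) - 2 * m * (f s - f t) + m\<^sup>2 * (s - t)"
      by (intro integral_unique has_integral_add has_integral_diff I J integrable_integral i)
    also have "\<dots> = integral {t..s} (\<lambda>x. (f' x)\<^sup>2) - (f s - f t)\<^sup>2 / (s - t)"
    proof -
      have fm: "f s - f t = m * (s - t)" using that by (simp add: m_def)
      show ?thesis using that unfolding fm by (simp add: power2_eq_square)
    qed
    finally have "(f s - f t)\<^sup>2 / (s - t) \<le> integral {t..s} (\<lambda>x. (f' x)\<^sup>2)" by simp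
    also have "\<dots> \<le> integral {a..b} (\<lambda>x. (f' x)\<^sup>2)"
      using that i by (intro integral_subset_le) auto
    finally show ?thesis using that by (simp add: field_simps)
  qed
  consider "t < s" | "s < t" | "s = t" by linarith
  then show ?thesis
  proof cases
    case 2
    then show ?thesis using main[of s t] st by (simp add: power2_commute)
  qed (use main[of t s] st in auto)
qed

lemma continuous_slice: "continuous_on UNIV F \<Longrightarrow> continuous_on S (\<lambda>t. F (x, t))"
  by (rule continuous_on_compose2[of UNIV F]) (auto intro!: continuous_intros)

lemma continuous_slice_x: "continuous_on UNIV F \<Longrightarrow> continuous_on S (\<lambda>x. F (x, t))"
  by (rule continuous_on_compose2[of UNIV F]) (auto intro!: continuous_intros)

context
  fixes \<Omega> :: "'a::euclidean_space set" and \<phi> :: "'a \<times> real \<Rightarrow> real"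
  assumes \<Omega>: "open \<Omega>" "bounded \<Omega>" and \<phi>: "smooth \<phi>"
begin

lemma smooth_cyl_L2: "\<phi> \<in> L2 (lebesgue_on (cyl \<Omega> a b))" "dir_deriv (0, 1) \<phi> \<in> L2 (lebesgue_on (cyl \<Omega> a b))"
  by (intro smooth_L2 smooth_dir_deriv \<phi> bounded_cyl sets_cyl \<Omega>; simp)+

lemma smooth_slice_L2: "(\<lambda>x. \<phi> (x, s)) \<in> L2 (lebesgue_on \<Omega>)"
  using \<Omega> by (intro continuous_bounded_integrable(3) continuous_slice_x smooth_continuous \<phi>) auto

private lemma cont: "continuous_on UNIV (dir_deriv (0, 1) \<phi>)" "continuous_on UNIV \<phi>"
  by (intro smooth_continuous smooth_dir_deriv \<phi>; simp)+

lemma L2_norm_cyl_Fubini: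
  "integrable (lebesgue_on \<Omega>) (\<lambda>x. integral {a..b} (\<lambda>t. (\<phi> (x, t))\<^sup>2))"
  "(L2_norm (lebesgue_on (cyl \<Omega> a b)) \<phi>)\<^sup>2 = (\<integral>x. integral {a..b} (\<lambda>t. (\<phi> (x, t))\<^sup>2) \<partial>lebesgue_on \<Omega>)"
  "integrable (lebesgue_on \<Omega>) (\<lambda>x. integral {a..b} (\<lambda>t. (dir_deriv (0, 1) \<phi> (x, t))\<^sup>2))"
  "(L2_norm (lebesgue_on (cyl \<Omega> a b)) (dir_deriv (0, 1) \<phi>))\<^sup>2 = (\<integral>x. integral {a..b} (\<lambda>t. (dir_deriv (0, 1) \<phi> (x, t))\<^sup>2) \<partial>lebesgue_on \<Omega>)"
  using Fubini_cyl[OF \<Omega>, of "\<lambda>p. (\<phi> p)\<^sup>2" a b] Fubini_cyl[OF \<Omega>, of "\<lambda>p. (dir_deriv (0, 1) \<phi> p)\<^sup>2" a b] cont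
  by (auto simp: L2_norm_square intro!: continuous_intros)

text \<open>The value at \<open>s\<close> is compared with the values at all times \<open>t\<close>,
  and the comparison is averaged over \<open>t\<close>. This is the trace inequality behind
  existence and uniqueness of time traces.\<close>

lemma slice_le:
  assumes s: "a \<le> s" "s \<le> b" and ab: "a < b"
  shows "(L2_norm (lebesgue_on \<Omega>) (\<lambda>x. \<phi> (x, s)))\<^sup>2
     \<le> 2 / (b - a) * (L2_norm (lebesgue_on (cyl \<Omega> a b)) \<phi>)\<^sup>2
       + 2 * (b - a) * (L2_norm (lebesgue_on (cyl \<Omega> a b)) (dir_deriv (0, 1) \<phi>))\<^sup>2"
proof -
  define I D where "I x = integral {a..b} (\<lambda>t. (\<phi> (x, t))\<^sup>2)"
    and "D x = integral {a..b} (\<lambda>t. (dir_deriv (0, 1) \<phi> (x, t))\<^sup>2)" for x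
  have le: "(\<phi> (x, s))\<^sup>2 \<le> 2 / (b - a) * I x + 2 * (b - a) * D x" for x
  proof -
    have D0: "0 \<le> D x" unfolding D_def
      by (intro integral_nonneg integrable_continuous_interval continuous_intros continuous_slice cont) simp
    have pt: "(\<phi> (x, s))\<^sup>2 \<le> 2 * (\<phi> (x, t))\<^sup>2 + 2 * ((b - a) * D x)" if "t \<in> {a..b}" for t
    proof -
      have "(\<phi> (x, s) - \<phi> (x, t))\<^sup>2 \<le> \<bar>s - t\<bar> * D x"
        unfolding D_def using s that
        by (intro square_diff_le_integral smooth_dt_derivative \<phi> continuous_slice cont) auto
      also have "\<dots> \<le> (b - a) * D x" using s that D0 by (intro mult_right_mono) auto
      finally have "(\<phi> (x, s) - \<phi> (x, t))\<^sup>2 \<le> (b - a) * D x" .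
      moreover have "(\<phi> (x, s))\<^sup>2 \<le> 2 * (\<phi> (x, t))\<^sup>2 + 2 * (\<phi> (x, s) - \<phi> (x, t))\<^sup>2"
        using zero_le_power2[of "2 * \<phi> (x, t) - \<phi> (x, s)"] by (simp add: power2_eq_square algebra_simps)
      ultimately show ?thesis by linarith
    qed
    have c2: "continuous_on {a..b} (\<lambda>t. (\<phi> (x, t))\<^sup>2)"
      by (intro continuous_intros continuous_slice cont)
    have "integral {a..b} (\<lambda>t. (\<phi> (x, s))\<^sup>2) \<le> integral {a..b} (\<lambda>t. 2 * (\<phi> (x, t))\<^sup>2 + 2 * ((b - a) * D x))"
      using pt by (intro integral_le integrable_continuous_interval continuous_intros c2) auto
    also have "\<dots> = 2 * I x + 2 * ((b - a) * D x) * (b - a)"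
    proof (intro integral_unique has_integral_add)
      show "((\<lambda>t. 2 * (\<phi> (x, t))\<^sup>2) has_integral 2 * I x) {a..b}"
        unfolding I_def by (intro has_integral_mult_right integrable_integral integrable_continuous_interval c2)
      show "((\<lambda>t. 2 * ((b - a) * D x)) has_integral 2 * ((b - a) * D x) * (b - a)) {a..b}"
        using has_integral_const_real[of "2 * ((b - a) * D x)" a b] ab by (simp add: mult.commute)
    qed
    finally have "(b - a) * (\<phi> (x, s))\<^sup>2 \<le> 2 * I x + 2 * ((b - a) * D x) * (b - a)"
      using ab by (simp add: mult.commute)
    then have "(b - a) * (\<phi> (x, s))\<^sup>2 / (b - a) \<le> (2 * I x + 2 * ((b - a) * D x) * (b - a)) / (b - a)"
      using ab by (intro divide_right_mono) auto
    moreover have "(2 * I x + 2 * (L * D x) * L) / L = 2 / L * I x + 2 * L * D x" if "0 < L" for L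
      using that by (simp add: field_simps)
    from this[of "b - a"] have "(2 * I x + 2 * ((b - a) * D x) * (b - a)) / (b - a) = 2 / (b - a) * I x + 2 * (b - a) * D x"
      using ab by simp
    ultimately show ?thesis using ab by simp
  qed
  have "(\<integral>x. (norm (\<phi> (x, s)))\<^sup>2 \<partial>lebesgue_on \<Omega>) \<le> (\<integral>x. 2 / (b - a) * I x + 2 * (b - a) * D x \<partial>lebesgue_on \<Omega>)"
    using L2_integrable[OF smooth_slice_L2, of s] L2_norm_cyl_Fubini[of a b] le unfolding I_def D_def
    by (intro integral_mono) auto
  then show ?thesis
    unfolding L2_norm_cyl_Fubini L2_norm_square[of "lebesgue_on \<Omega>"] I_def D_def
    using L2_norm_cyl_Fubini[of a b] by (simp add: L2_norm_square)
qed

text \<open>The final slice frozen in time has norm \<open>sqrt h\<close> times its norm on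
  \<open>\<Omega>\<close>. At each time of the layer the squared distance of \<open>\<phi>\<close>
  to it is at most \<open>h * D x\<close>, and integration over the layer adds another factor
  \<open>h\<close>.\<close>

lemma slice_average_le:
  assumes h: "0 \<le> h"
  shows "\<bar>L2_norm (lebesgue_on (cyl \<Omega> (b - h) b)) \<phi> - sqrt h * L2_norm (lebesgue_on \<Omega>) (\<lambda>x. \<phi> (x, b))\<bar>
     \<le> h * L2_norm (lebesgue_on (cyl \<Omega> (b - h) b)) (dir_deriv (0, 1) \<phi>)"
proof -
  let ?C = "cyl \<Omega> (b - h) b"
  define c :: "'a \<times> real \<Rightarrow> real" where "c p = \<phi> (fst p, b)" for p
  have cc: "continuous_on UNIV c"
    unfolding c_def by (rule continuous_on_compose2[OF cont(2)]) (auto intro!: continuous_intros)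
  have cL: "c \<in> L2 (lebesgue_on ?C)"
    by (rule continuous_bounded_integrable(3)[OF cc bounded_cyl[OF \<Omega>(2)] sets_cyl(1)[OF \<Omega>(1)]])
  have "(L2_norm (lebesgue_on ?C) c)\<^sup>2 = (\<integral>x. integral {b - h..b} (\<lambda>t. (c (x, t))\<^sup>2) \<partial>lebesgue_on \<Omega>)"
    using Fubini_cyl(2)[OF \<Omega>, of "\<lambda>p. (c p)\<^sup>2" "b - h" b] cc by (auto simp: L2_norm_square intro!: continuous_intros)
  also have "\<dots> = h * (L2_norm (lebesgue_on \<Omega>) (\<lambda>x. \<phi> (x, b)))\<^sup>2"
    using h by (simp add: c_def L2_norm_square)
  finally have "(L2_norm (lebesgue_on ?C) c)\<^sup>2 = h * (L2_norm (lebesgue_on \<Omega>) (\<lambda>x. \<phi> (x, b)))\<^sup>2" .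
  from arg_cong[where f=sqrt, OF this]
  have c: "L2_norm (lebesgue_on ?C) c = sqrt h * L2_norm (lebesgue_on \<Omega>) (\<lambda>x. \<phi> (x, b))"
    by (simp add: real_sqrt_mult)
  have cpd: "continuous_on UNIV (\<lambda>p. (\<phi> p - c p)\<^sup>2)"
    by (intro continuous_intros cont cc)
  define D where "D x = integral {b - h..b} (\<lambda>t. (dir_deriv (0, 1) \<phi> (x, t))\<^sup>2)" for x
  have "(L2_norm (lebesgue_on ?C) (\<lambda>p. \<phi> p - c p))\<^sup>2 = (\<integral>x. integral {b - h..b} (\<lambda>t. (\<phi> (x, t) - c (x, t))\<^sup>2) \<partial>lebesgue_on \<Omega>)"
    using Fubini_cyl(2)[OF \<Omega> cpd, of "b - h" b] by (simp add: L2_norm_square)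
  also have "\<dots> \<le> (\<integral>x. h * (h * D x) \<partial>lebesgue_on \<Omega>)"
  proof (rule integral_mono)
    show "integrable (lebesgue_on \<Omega>) (\<lambda>x. integral {b - h..b} (\<lambda>t. (\<phi> (x, t) - c (x, t))\<^sup>2))"
      by (rule Fubini_cyl(1)[OF \<Omega> cpd])
    show "integrable (lebesgue_on \<Omega>) (\<lambda>x. h * (h * D x))"
      using L2_norm_cyl_Fubini(3)[of "b - h" b] by (simp add: D_def)
    fix x
    have D0: "0 \<le> D x" unfolding D_def
      by (intro integral_nonneg integrable_continuous_interval continuous_intros continuous_slice cont) simp
    have "integral {b - h..b} (\<lambda>t. (\<phi> (x, t) - c (x, t))\<^sup>2) \<le> integral {b - h..b} (\<lambda>t. h * D x)"
    proof (rule integral_le)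
      show "(\<lambda>t. (\<phi> (x, t) - c (x, t))\<^sup>2) integrable_on {b - h..b}"
        by (intro integrable_continuous_interval continuous_intros continuous_slice cont cc)
      fix t assume t: "t \<in> {b - h..b}"
      have "(\<phi> (x, t) - \<phi> (x, b))\<^sup>2 \<le> \<bar>t - b\<bar> * D x"
        unfolding D_def using t h
        by (intro square_diff_le_integral smooth_dt_derivative \<phi> continuous_slice cont) auto
      also have "\<dots> \<le> h * D x" using t D0 by (intro mult_right_mono) auto
      finally show "(\<phi> (x, t) - c (x, t))\<^sup>2 \<le> h * D x" by (simp add: c_def)
    qed (simp add: integrable_const_ivl)
    then show "integral {b - h..b} (\<lambda>t. (\<phi> (x, t) - c (x, t))\<^sup>2) \<le> h * (h * D x)" using h by simp
  qed
  also have "\<dots> = (h * L2_norm (lebesgue_on ?C) (dir_deriv (0, 1) \<phi>))\<^sup>2"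
    using L2_norm_cyl_Fubini(4)[of "b - h" b] by (simp add: D_def power_mult_distrib power2_eq_square mult.assoc)
  finally have "L2_norm (lebesgue_on ?C) (\<lambda>p. \<phi> p - c p) \<le> h * L2_norm (lebesgue_on ?C) (dir_deriv (0, 1) \<phi>)"
    by (rule power2_le_imp_le) (use h in simp)
  then show ?thesis
    using L2_norm_triangle_diff[OF smooth_cyl_L2(1)[of "b - h" b] cL] unfolding c by linarith
qed

lemma integral_dt:
  assumes "a \<le> b"
  shows "(\<integral>p. dir_deriv (0, 1) \<phi> p \<partial>lebesgue_on (cyl \<Omega> a b))
     = (\<integral>x. \<phi> (x, b) \<partial>lebesgue_on \<Omega>) - (\<integral>x. \<phi> (x, a) \<partial>lebesgue_on \<Omega>)"
proof -
  have "integral {a..b} (\<lambda>t. dir_deriv (0, 1) \<phi> (x, t)) = \<phi> (x, b) - \<phi> (x, a)" for x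
    using assms smooth_dt_derivative[OF \<phi>]
    by (intro integral_unique fundamental_theorem_of_calculus)
      (auto simp: has_real_derivative_iff_has_vector_derivative[symmetric] intro: DERIV_subset)
  then have "(\<integral>p. dir_deriv (0, 1) \<phi> p \<partial>lebesgue_on (cyl \<Omega> a b)) = (\<integral>x. \<phi> (x, b) - \<phi> (x, a) \<partial>lebesgue_on \<Omega>)"
    using Fubini_cyl(2)[OF \<Omega> cont(1)] by simp
  also have "\<dots> = (\<integral>x. \<phi> (x, b) \<partial>lebesgue_on \<Omega>) - (\<integral>x. \<phi> (x, a) \<partial>lebesgue_on \<Omega>)"
    using \<Omega> by (intro Bochner_Integration.integral_diff continuous_bounded_integrable(2) continuous_slice_x cont) auto
  finally show ?thesis .
qed

end

section \<open>Functions with a weak time derivative\<close>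

text \<open>Time is the outer variable and the integrals are extended nonnegative ones, so that
  slices can be regrouped by Fubini without integrability conditions.\<close>

lemma L2_norm_cyl_nn:
  fixes F :: "'a::euclidean_space \<times> real \<Rightarrow> real"
  assumes \<Omega>: "open \<Omega>" "bounded \<Omega>" and F: "continuous_on UNIV F"
  shows "ennreal ((L2_norm (lebesgue_on (cyl \<Omega> c d)) F)\<^sup>2)
    = (\<integral>\<^sup>+t. (\<integral>\<^sup>+x. ennreal ((F (x, t))\<^sup>2) * indicator \<Omega> x \<partial>lborel) * indicator {c<..<d} t \<partial>lborel)"
proof -
  have [measurable]: "F \<in> borel_measurable borel" by (rule borel_measurable_continuous_onI[OF F])
  have [measurable]: "\<Omega> \<in> sets borel" "cyl \<Omega> c d \<in> sets borel" using \<Omega> sets_cyl(2) by auto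
  have L: "F \<in> L2 (lebesgue_on (cyl \<Omega> c d))"
    by (rule continuous_bounded_integrable(3)[OF F bounded_cyl[OF \<Omega>(2)] sets_cyl(1)[OF \<Omega>(1)]])
  have "ennreal ((L2_norm (lebesgue_on (cyl \<Omega> c d)) F)\<^sup>2) = (\<integral>\<^sup>+p. ennreal ((F p)\<^sup>2) * indicator (cyl \<Omega> c d) p \<partial>lborel)"
    unfolding L2_norm_nn_integral[OF L] nn_integral_lebesgue_on[OF sets_cyl(1)[OF \<Omega>(1)]] by simp
  also have "\<dots> = (\<integral>\<^sup>+p. ennreal ((F p)\<^sup>2) * indicator (cyl \<Omega> c d) p \<partial>(lborel \<Otimes>\<^sub>M lborel))"
    by (simp add: lborel_prod)
  also have "\<dots> = (\<integral>\<^sup>+t. (\<integral>\<^sup>+x. ennreal ((F (x, t))\<^sup>2) * indicator (cyl \<Omega> c d) (x, t) \<partial>lborel) \<partial>lborel)"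
    by (rule lborel_pair.nn_integral_snd[symmetric]) (simp add: lborel_prod)
  also have "\<dots> = (\<integral>\<^sup>+t. (\<integral>\<^sup>+x. ennreal ((F (x, t))\<^sup>2) * indicator \<Omega> x \<partial>lborel) * indicator {c<..<d} t \<partial>lborel)"
  proof (intro nn_integral_cong)
    fix t
    have "(\<lambda>x. ennreal ((F (x, t))\<^sup>2) * indicator (cyl \<Omega> c d) (x, t)) = (\<lambda>x. ennreal ((F (x, t))\<^sup>2) * indicator \<Omega> x * indicator {c<..<d} t)"
      by (auto simp: indicator_def fun_eq_iff)
    then show "(\<integral>\<^sup>+x. ennreal ((F (x, t))\<^sup>2) * indicator (cyl \<Omega> c d) (x, t) \<partial>lborel) =
        (\<integral>\<^sup>+x. ennreal ((F (x, t))\<^sup>2) * indicator \<Omega> x \<partial>lborel) * indicator {c<..<d} t"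
      by (simp only:) (rule nn_integral_multc, simp)
  qed
  finally show ?thesis .
qed

text \<open>
  The squared distances between the slices of \<open>\<theta>\<close> at times \<open>t\<close> and \<open>t'\<close>, integrated over \<open>t\<close> and
  \<open>t' = t + s\<close>, are controlled for every \<open>s\<close>; hence some slice is close to \<open>\<theta>\<close> on average.
\<close>

lemma exists_good_slice:
  fixes \<theta> :: "'a::euclidean_space \<times> real \<Rightarrow> real"
  assumes \<Omega>: "open \<Omega>" "bounded \<Omega>" and \<theta>: "continuous_on UNIV \<theta>" and ab: "a < b" and E: "0 < E"
    and le: "\<And>s. 0 \<le> s \<Longrightarrow> (L2_norm (lebesgue_on (cyl \<Omega> a (b - s))) (\<lambda>p. \<theta> (p + (0, s)) - \<theta> p))\<^sup>2 \<le> E"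
  shows "\<exists>t0. (L2_norm (lebesgue_on (cyl \<Omega> a b)) (\<lambda>p. \<theta> p - \<theta> (fst p, t0)))\<^sup>2 \<le> 3 * E"
proof (rule ccontr)
  \<comment> \<open>If every slice missed by more than \<open>3 * E\<close>, integration over
    \<open>t0\<close> in \<open>(a, b)\<close> would give at least \<open>3 * E * (b - a)\<close>.
    The hypothesis allows at most \<open>2 * E * (b - a)\<close>, since the shifts fill an interval
    of length \<open>2 * (b - a)\<close>.\<close>
  assume contr: "\<not> ?thesis"
  have \<theta>b: "\<theta> \<in> borel_measurable (borel \<Otimes>\<^sub>M borel)"
    using borel_measurable_continuous_onI[OF \<theta>] by (simp add: borel_prod)
  note [measurable] = \<theta>b
  have [measurable]: "\<Omega> \<in> sets borel" using \<Omega> by auto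
  define G where "G t t' = (\<integral>\<^sup>+x. ennreal ((\<theta> (x, t') - \<theta> (x, t))\<^sup>2) * indicator \<Omega> x \<partial>lborel) * indicator {a<..<b} t * indicator {a<..<b} t'" for t t'
  have Gm[measurable]: "(\<lambda>(t, t'). G t t') \<in> borel_measurable (borel \<Otimes>\<^sub>M borel)"
    unfolding G_def by measurable
  have sym: "G t t' = G t' t" for t t'
    by (simp add: G_def power2_commute[of "\<theta> (_, t)"] mult_ac)
  have pos: "(\<integral>\<^sup>+t. G t (t + s) \<partial>lborel) \<le> ennreal E * indicator {-(b - a)<..<b - a} s" if s: "0 \<le> s" for s
  proof (cases "s < b - a")
    case True
    have c: "continuous_on UNIV (\<lambda>p. \<theta> (p + (0, s)) - \<theta> p)"
      by (intro continuous_intros \<theta> continuous_on_compose2[OF \<theta>]) auto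
    have "(\<integral>\<^sup>+t. G t (t + s) \<partial>lborel) =
      (\<integral>\<^sup>+t. (\<integral>\<^sup>+x. ennreal ((\<theta> ((x, t) + (0, s)) - \<theta> (x, t))\<^sup>2) * indicator \<Omega> x \<partial>lborel) * indicator {a<..<b - s} t \<partial>lborel)"
      using s by (intro nn_integral_cong) (auto simp: G_def indicator_def)
    also have "\<dots> = ennreal ((L2_norm (lebesgue_on (cyl \<Omega> a (b - s))) (\<lambda>p. \<theta> (p + (0, s)) - \<theta> p))\<^sup>2)"
      by (rule L2_norm_cyl_nn[OF \<Omega> c, symmetric])
    also have "\<dots> \<le> ennreal E" by (intro ennreal_leI le s)
    finally show ?thesis using True s by simp
  next
    case False
    have "G t (t + s) = 0" for t using False by (auto simp: G_def indicator_def)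
    then show ?thesis by simp
  qed
  \<comment> \<open>Negative shifts reduce to positive ones by translation in \<open>t\<close> and
    the symmetry of \<open>G\<close>.\<close>
  have all: "(\<integral>\<^sup>+t. G t (t + s) \<partial>lborel) \<le> ennreal E * indicator {-(b - a)<..<b - a} s" for s
  proof (cases "0 \<le> s")
    case False
    have "(\<integral>\<^sup>+t. G t (t + s) \<partial>lborel) = (\<integral>\<^sup>+t. G (t + - s) ((t + - s) + s) \<partial>lborel)"
      by (rule nn_integral_lborel_translate[symmetric]) simp
    also have "\<dots> = (\<integral>\<^sup>+t. G t (t + - s) \<partial>lborel)"
      by (intro nn_integral_cong) (simp add: sym[of "_ - s"])
    also have "\<dots> \<le> ennreal E * indicator {-(b - a)<..<b - a} (- s)" using False by (intro pos) simp
    also have "\<dots> = ennreal E * indicator {-(b - a)<..<b - a} s" by (simp add: indicator_def) linarith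
    finally show ?thesis .
  qed (rule pos)
  have "(\<integral>\<^sup>+t. (\<integral>\<^sup>+t'. G t t' \<partial>lborel) \<partial>lborel) = (\<integral>\<^sup>+t. (\<integral>\<^sup>+s. G t (t + s) \<partial>lborel) \<partial>lborel)"
  proof (rule nn_integral_cong)
    fix t
    have "(\<integral>\<^sup>+s. G t (s + t) \<partial>lborel) = (\<integral>\<^sup>+t'. G t t' \<partial>lborel)"
      by (rule nn_integral_lborel_translate) simp
    then show "(\<integral>\<^sup>+t'. G t t' \<partial>lborel) = (\<integral>\<^sup>+s. G t (t + s) \<partial>lborel)" by (simp add: add.commute)
  qed
  also have "\<dots> = (\<integral>\<^sup>+s. (\<integral>\<^sup>+t. G t (t + s) \<partial>lborel) \<partial>lborel)"
    by (rule lborel_pair.Fubini') measurable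
  also have "\<dots> \<le> (\<integral>\<^sup>+s. ennreal E * indicator {-(b - a)<..<b - a} s \<partial>lborel)"
    by (intro nn_integral_mono all)
  also have "\<dots> = ennreal (E * (2 * (b - a)))"
    using ab E by (simp add: nn_integral_cmult_indicator ennreal_mult)
  finally have upper: "(\<integral>\<^sup>+t. (\<integral>\<^sup>+t'. G t t' \<partial>lborel) \<partial>lborel) \<le> ennreal (E * (2 * (b - a)))" .
  have lower: "ennreal (3 * E) * indicator {a<..<b} t \<le> (\<integral>\<^sup>+t'. G t t' \<partial>lborel)" for t
  proof (cases "t \<in> {a<..<b}")
    case True
    have c: "continuous_on UNIV (\<lambda>p. \<theta> p - \<theta> (fst p, t))"
      by (intro continuous_intros \<theta> continuous_on_compose2[OF \<theta>]) auto
    have "ennreal (3 * E) \<le> ennreal ((L2_norm (lebesgue_on (cyl \<Omega> a b)) (\<lambda>p. \<theta> p - \<theta> (fst p, t)))\<^sup>2)"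
      using contr by (intro ennreal_leI) (auto simp: not_le intro: less_imp_le)
    also have "\<dots> = (\<integral>\<^sup>+t'. G t t' \<partial>lborel)"
      unfolding L2_norm_cyl_nn[OF \<Omega> c] using True by (intro nn_integral_cong) (auto simp: G_def)
    finally show ?thesis using True by simp
  qed simp
  have "ennreal (3 * E * (b - a)) = (\<integral>\<^sup>+t. ennreal (3 * E) * indicator {a<..<b} t \<partial>lborel)"
    using ab E by (simp add: nn_integral_cmult_indicator ennreal_mult)
  also have "\<dots> \<le> ennreal (E * (2 * (b - a)))"
    by (rule order_trans[OF nn_integral_mono[OF lower] upper])
  finally have "3 * E * (b - a) \<le> E * (2 * (b - a))"
    using E ab by (subst (asm) ennreal_le_iff) auto
  moreover have "0 < E * (b - a)" using E ab by simp
  ultimately show False by (simp add: algebra_simps)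
qed

lemma smooth_slice:
  fixes \<theta> :: "'a::euclidean_space \<times> real \<Rightarrow> real"
  shows "smooth \<theta> \<Longrightarrow> smooth (\<lambda>p::'a \<times> real. \<theta> (fst p, t0))"
proof -
  have bl: "bounded_linear (\<lambda>p::'a \<times> real. (fst p, 0::real))"
    by (intro bounded_linear_Pair bounded_linear_fst bounded_linear_zero)
  assume "smooth \<theta>"
  then show ?thesis
    unfolding smooth_def using Ck_compose_affine[OF bl, of _ \<theta> "(0, t0)"] by simp
qed

lemma dt_slice: "dir_deriv (0, 1) (\<lambda>p::'a \<times> real. \<theta> (fst p, t0)) p = 0"
  if "smooth \<theta>" for \<theta> :: "'a::euclidean_space \<times> real \<Rightarrow> real"
  by (rule dir_deriv_locally_constant[of 1]) (auto intro: smooth_differentiable smooth_slice that)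

text \<open>
  The approximation is \<open>\<integral>\<psi> dt\<close> plus a function of \<open>x\<close> alone, where \<open>\<psi>\<close> approximates \<open>k\<close>; the
  function of \<open>x\<close> is a slice of an approximation of \<open>h = w - \<integral>\<psi> dt\<close>, whose derivative is small.
\<close>

lemma weak_dt_approx:
  fixes w :: "'a::euclidean_space \<times> real \<Rightarrow> real"
  assumes \<Omega>: "open \<Omega>" "bounded \<Omega>" and ab: "a < b"
    and w: "w \<in> L2 (lebesgue_on (cyl \<Omega> a b))" "k \<in> L2 (lebesgue_on (cyl \<Omega> a b))"
    and wk: "has_weak_dt (cyl \<Omega> a b) w k" and \<epsilon>: "0 < \<epsilon>"
  shows "\<exists>\<phi>. smooth \<phi> \<and> L2_norm (lebesgue_on (cyl \<Omega> a b)) (\<lambda>p. \<phi> p - w p) < \<epsilon> \<and>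
     L2_norm (lebesgue_on (cyl \<Omega> a b)) (\<lambda>p. dir_deriv (0, 1) \<phi> p - k p) < \<epsilon>"
proof -
  let ?Q = "cyl \<Omega> a b"
  note Q = open_cyl[OF \<Omega>(1), of a b] bounded_cyl[OF \<Omega>(2), of a b] and Qm = sets_cyl(1)[OF \<Omega>(1)]
  define L where "L = b - a"
  have L: "0 < L" using ab by (simp add: L_def)
  \<comment> \<open>The choice of a slice costs \<open>2 * ((2 + L) * \<delta>)\<close> and the
    approximation \<open>\<theta>\<close> another \<open>\<delta>\<close>, together
    \<open>(5 + 2 * L) * \<delta>\<close>.\<close>
  define \<delta> where "\<delta> = \<epsilon> / (5 + 2 * L)"
  have \<delta>: "0 < \<delta>" "\<delta> * (5 + 2 * L) = \<epsilon>" using L \<epsilon> by (auto simp: \<delta>_def)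
  have \<delta>\<epsilon>: "\<delta> \<le> \<epsilon>" using \<delta> L mult_left_mono[of 1 "5 + 2 * L" \<delta>] by simp
  obtain \<psi> where \<psi>: "\<psi> \<in> test_functions ?Q" "L2_norm (lebesgue_on ?Q) (\<lambda>p. \<psi> p - k p) < \<delta>"
    using test_functions_dense[OF Q w(2)] \<delta> unfolding test_approx_def by blast
  obtain K where K: "smooth \<psi>" "compact K" "supp_in K \<psi>"
    using \<psi>(1) unfolding test_functions_iff by blast
  define P where "P = tprim L \<psi>"
  have P: "smooth P" unfolding P_def using L by (intro smooth_tprim[OF K]) simp
  \<comment> \<open>Going back by the full length \<open>L\<close> leaves the strip, where
    \<open>\<psi>\<close> vanishes; hence the time derivative of \<open>P\<close> is exactly
    \<open>\<psi>\<close> on it.\<close>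
  have dP: "dir_deriv (0, 1) P p = \<psi> p" if "p \<in> ?Q" for p
  proof -
    have "p - (0, L) \<notin> ?Q" using that by (auto simp: cyl_def L_def)
    from test_functions_outside[OF \<psi>(1) this] show ?thesis
      using dt_tprim[OF K, of L p] L by (simp add: P_def)
  qed
  have PL: "P \<in> L2 (lebesgue_on ?Q)" "dir_deriv (0, 1) P \<in> L2 (lebesgue_on ?Q)"
    by (rule smooth_cyl_L2[OF \<Omega> P])+
  define h where "h p = w p - P p" for p
  have h: "h \<in> L2 (lebesgue_on ?Q)" unfolding h_def[abs_def] by (rule L2_diff[OF w(1) PL(1)])
  have dh: "has_weak_dt ?Q h (\<lambda>p. k p - dir_deriv (0, 1) P p)"
    unfolding h_def[abs_def] by (rule has_weak_dt_diff[OF Q(1) w(1) PL(1) w(2) PL(2) wk smooth_has_weak_dt[OF Q(1) P]])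
  have dhL: "(\<lambda>p. k p - dir_deriv (0, 1) P p) \<in> L2 (lebesgue_on ?Q)" by (rule L2_diff[OF w(2) PL(2)])
  have dh_le: "L2_norm (lebesgue_on ?Q) (\<lambda>p. k p - dir_deriv (0, 1) P p) < \<delta>"
  proof -
    have "L2_norm (lebesgue_on ?Q) (\<lambda>p. k p - dir_deriv (0, 1) P p) = L2_norm (lebesgue_on ?Q) (\<lambda>p. \<psi> p - k p)"
      unfolding L2_norm_def by (intro arg_cong[where f=sqrt] Bochner_Integration.integral_cong) (auto simp: dP power2_commute)
    then show ?thesis using \<psi>(2) by simp
  qed
  obtain \<theta> where \<theta>: "\<theta> \<in> test_functions ?Q" "L2_norm (lebesgue_on ?Q) (\<lambda>p. \<theta> p - h p) < \<delta>"
    using test_functions_dense[OF Q h] \<delta> unfolding test_approx_def by blast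
  have \<theta>s: "smooth \<theta>" by (rule test_functions_smooth[OF \<theta>(1)])
  have \<theta>L: "\<theta> \<in> L2 (lebesgue_on ?Q)" by (rule test_function_L2[OF \<theta>(1) Qm])
  \<comment> \<open>\<open>\<theta>\<close> and its translate differ from \<open>h\<close> and its
    translate by at most \<open>\<delta>\<close> each, and \<open>h\<close> itself moves by at most
    \<open>L * \<delta>\<close> because its derivative has norm less than
    \<open>\<delta>\<close>.\<close>
  define E where "E = ((2 + L) * \<delta>)\<^sup>2"
  have "\<exists>t0. (L2_norm (lebesgue_on ?Q) (\<lambda>p. \<theta> p - \<theta> (fst p, t0)))\<^sup>2 \<le> 3 * E"
  proof (rule exists_good_slice[OF \<Omega> smooth_continuous[OF \<theta>s] ab])
    show "0 < E" using \<delta> L by (simp add: E_def)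
    fix s :: real assume s: "0 \<le> s"
    show "(L2_norm (lebesgue_on (cyl \<Omega> a (b - s))) (\<lambda>p. \<theta> (p + (0, s)) - \<theta> p))\<^sup>2 \<le> E"
    proof (cases "s < L")
      case False
      then have "cyl \<Omega> a (b - s) = {}" by (auto simp: cyl_def L_def)
      then show ?thesis by (simp add: E_def L2_norm_def)
    next
      case True
      let ?Q' = "lebesgue_on (cyl \<Omega> a (b - s))"
      have d: "(\<lambda>p. \<theta> p - h p) \<in> L2 (lebesgue_on ?Q)" by (rule L2_diff[OF \<theta>L h])
      have 1: "(\<lambda>p. \<theta> (p + (0, s)) - h (p + (0, s))) \<in> L2 ?Q'"
        "L2_norm ?Q' (\<lambda>p. \<theta> (p + (0, s)) - h (p + (0, s))) \<le> L2_norm (lebesgue_on ?Q) (\<lambda>p. \<theta> p - h p)"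
        using L2_cyl_mono[OF \<Omega>(1) L2_shift(1)[OF \<Omega>(1) d, of s], of a "b - s"] L2_shift(2)[OF \<Omega>(1) d, of s] s by auto
      have 2: "(\<lambda>p. h (p + (0, s)) - h p) \<in> L2 ?Q'"
        "L2_norm ?Q' (\<lambda>p. h (p + (0, s)) - h p) \<le> s * L2_norm (lebesgue_on ?Q) (\<lambda>p. k p - dir_deriv (0, 1) P p)"
        by (rule weak_dt_shift_le[OF \<Omega> s h dhL dh])+
      have 3: "(\<lambda>p. h p - \<theta> p) \<in> L2 ?Q'" "L2_norm ?Q' (\<lambda>p. h p - \<theta> p) \<le> L2_norm (lebesgue_on ?Q) (\<lambda>p. \<theta> p - h p)"
        using L2_cyl_mono[OF \<Omega>(1) L2_diff[OF h \<theta>L], of a "b - s"] s L2_norm_minus_commute[of "lebesgue_on ?Q" \<theta> h] by auto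
      have "L2_norm ?Q' (\<lambda>p. (\<theta> (p + (0, s)) - h (p + (0, s))) + ((h (p + (0, s)) - h p) + (h p - \<theta> p)))
          \<le> L2_norm ?Q' (\<lambda>p. \<theta> (p + (0, s)) - h (p + (0, s))) + (L2_norm ?Q' (\<lambda>p. h (p + (0, s)) - h p) + L2_norm ?Q' (\<lambda>p. h p - \<theta> p))"
        using L2_norm_triangle[OF 1(1) L2_add[OF 2(1) 3(1)]] L2_norm_triangle[OF 2(1) 3(1)] by linarith
      also have "\<dots> \<le> \<delta> + (L * \<delta> + \<delta>)"
      proof -
        have "s * L2_norm (lebesgue_on ?Q) (\<lambda>p. k p - dir_deriv (0, 1) P p) \<le> L * \<delta>"
          using s True dh_le L by (intro mult_mono) auto
        then show ?thesis using 1(2) 2(2) 3(2) \<theta>(2) by linarith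
      qed
      finally have "L2_norm ?Q' (\<lambda>p. \<theta> (p + (0, s)) - \<theta> p) \<le> (2 + L) * \<delta>" by (simp add: algebra_simps)
      then show ?thesis unfolding E_def by (intro power_mono) auto
    qed
  qed
  then obtain t0 where t0: "(L2_norm (lebesgue_on ?Q) (\<lambda>p. \<theta> p - \<theta> (fst p, t0)))\<^sup>2 \<le> 3 * E" by blast
  also have "\<dots> \<le> (2 * ((2 + L) * \<delta>))\<^sup>2"
    unfolding E_def power_mult_distrib[of 2] by (intro mult_right_mono) auto
  finally have A_le: "L2_norm (lebesgue_on ?Q) (\<lambda>p. \<theta> p - \<theta> (fst p, t0)) \<le> 2 * ((2 + L) * \<delta>)"
    by (rule power2_le_imp_le) (use L \<delta> in auto)
  define A where "A p = \<theta> (fst p, t0)" for p :: "'a \<times> real"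
  have A: "smooth A" unfolding A_def[abs_def] by (rule smooth_slice[OF \<theta>s])
  have AL: "A \<in> L2 (lebesgue_on ?Q)" by (rule smooth_cyl_L2(1)[OF \<Omega> A])
  show ?thesis
  proof (intro exI conjI)
    show "smooth (\<lambda>p. P p + A p)" by (rule smooth_add[OF P A])
    have "L2_norm (lebesgue_on ?Q) (\<lambda>p. A p - h p) \<le> L2_norm (lebesgue_on ?Q) (\<lambda>p. A p - \<theta> p) + L2_norm (lebesgue_on ?Q) (\<lambda>p. \<theta> p - h p)"
      by (rule L2_norm_triangle3[OF AL \<theta>L h])
    also have "\<dots> < 2 * ((2 + L) * \<delta>) + \<delta>"
      using A_le \<theta>(2) L2_norm_minus_commute[of "lebesgue_on ?Q" \<theta> A] by (simp add: A_def)
    also have "\<dots> = \<epsilon>" using \<delta>(2) by (simp add: algebra_simps)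
    finally show "L2_norm (lebesgue_on ?Q) (\<lambda>p. P p + A p - w p) < \<epsilon>" by (simp add: h_def algebra_simps)
    have "dir_deriv (0, 1) (\<lambda>p. P p + A p) p = dir_deriv (0, 1) P p" for p
      unfolding dir_deriv_add[OF P A] using dt_slice[OF \<theta>s, of t0 p] by (simp add: A_def[abs_def])
    then show "L2_norm (lebesgue_on ?Q) (\<lambda>p. dir_deriv (0, 1) (\<lambda>p. P p + A p) p - k p) < \<epsilon>"
      using dh_le \<delta>\<epsilon> L2_norm_minus_commute[of "lebesgue_on ?Q" k "dir_deriv (0, 1) P"] by simp
  qed
qed

section \<open>Traces on time slices and difference quotients\<close>

lemma L2_lim_cyl_mono:
  assumes "open \<Omega>" "L2_lim (lebesgue_on (cyl \<Omega> a' b')) \<phi> w" "a' \<le> a" "b \<le> b'"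
  shows "L2_lim (lebesgue_on (cyl \<Omega> a b)) \<phi> w"
  unfolding L2_lim_def
proof (intro conjI allI)
  have d: "(\<lambda>x. \<phi> n x - w x) \<in> L2 (lebesgue_on (cyl \<Omega> a' b'))" for n using assms(2) by (simp add: L2_lim_def)
  show "(\<lambda>x. \<phi> n x - w x) \<in> L2 (lebesgue_on (cyl \<Omega> a b))" for n
    by (rule L2_cyl_mono(1)[OF assms(1) d assms(3,4)])
  have "\<forall>\<^sub>F n in sequentially. norm (L2_norm (lebesgue_on (cyl \<Omega> a b)) (\<lambda>x. \<phi> n x - w x))
      \<le> L2_norm (lebesgue_on (cyl \<Omega> a' b')) (\<lambda>x. \<phi> n x - w x)"
    using L2_cyl_mono(2)[OF assms(1) d assms(3,4)] by simp
  then show "(\<lambda>n. L2_norm (lebesgue_on (cyl \<Omega> a b)) (\<lambda>x. \<phi> n x - w x)) \<longlonglongrightarrow> 0"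
    by (rule Lim_null_comparison) (use assms(2) in \<open>simp add: L2_lim_def\<close>)
qed

definition dt_approx ::
  "'a::euclidean_space set \<Rightarrow> real \<Rightarrow> real \<Rightarrow> (nat \<Rightarrow> 'a \<times> real \<Rightarrow> real) \<Rightarrow> ('a \<times> real \<Rightarrow> real) \<Rightarrow> ('a \<times> real \<Rightarrow> real) \<Rightarrow> bool" where
  "dt_approx \<Omega> a b \<phi> w k \<longleftrightarrow> (\<forall>n. smooth (\<phi> n)) \<and> L2_lim (lebesgue_on (cyl \<Omega> a b)) \<phi> w \<and>
     L2_lim (lebesgue_on (cyl \<Omega> a b)) (\<lambda>n. dir_deriv (0, 1) (\<phi> n)) k"

text \<open>The derivative \<open>k\<close> is an argument instead of the choice \<open>dt\<close>,
  and the strip need not start at 0; components of vector fields and zero extensions to negative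
  times can thus be treated alike.\<close>

definition time_trace ::
  "'a::euclidean_space set \<Rightarrow> real \<Rightarrow> real \<Rightarrow> real \<Rightarrow> ('a \<times> real \<Rightarrow> real) \<Rightarrow> ('a \<times> real \<Rightarrow> real) \<Rightarrow> ('a \<Rightarrow> real) \<Rightarrow> bool" where
  "time_trace \<Omega> a b s w k g \<longleftrightarrow> g \<in> L2 (lebesgue_on \<Omega>) \<and>
     (\<exists>\<phi>. dt_approx \<Omega> a b \<phi> w k \<and> L2_lim (lebesgue_on \<Omega>) (\<lambda>n x. \<phi> n (x, s)) g)"

locale time_strip =
  fixes \<Omega> :: "'a::euclidean_space set" and a b :: real and w k :: "'a \<times> real \<Rightarrow> real"
  assumes \<Omega>: "open \<Omega>" "bounded \<Omega>" and ab: "a < b"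
    and w: "w \<in> L2 (lebesgue_on (cyl \<Omega> a b))" and k: "k \<in> L2 (lebesgue_on (cyl \<Omega> a b))"
begin

abbreviation Q where "Q \<equiv> lebesgue_on (cyl \<Omega> a b)"

lemma slice_null:
  fixes \<phi> :: "nat \<Rightarrow> 'a \<times> real \<Rightarrow> real"
  assumes \<phi>: "\<And>n. smooth (\<phi> n)" and l: "(\<lambda>n. L2_norm Q (\<phi> n)) \<longlonglongrightarrow> 0" "(\<lambda>n. L2_norm Q (dir_deriv (0, 1) (\<phi> n))) \<longlonglongrightarrow> 0"
    and s: "a \<le> s" "s \<le> b"
  shows "(\<lambda>n. L2_norm (lebesgue_on \<Omega>) (\<lambda>x. \<phi> n (x, s))) \<longlonglongrightarrow> 0"
proof -
  define F where "F n = sqrt (2 / (b - a) * (L2_norm Q (\<phi> n))\<^sup>2 + 2 * (b - a) * (L2_norm Q (dir_deriv (0, 1) (\<phi> n)))\<^sup>2)" for n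
  have "F \<longlonglongrightarrow> sqrt (2 / (b - a) * 0\<^sup>2 + 2 * (b - a) * 0\<^sup>2)"
    unfolding F_def by (intro tendsto_intros l)
  then have F: "F \<longlonglongrightarrow> 0" by simp
  have "L2_norm (lebesgue_on \<Omega>) (\<lambda>x. \<phi> n (x, s)) \<le> F n" for n
    unfolding F_def by (rule real_le_rsqrt[OF slice_le[OF \<Omega> \<phi> s ab]])
  then have "\<forall>\<^sub>F n in sequentially. norm (L2_norm (lebesgue_on \<Omega>) (\<lambda>x. \<phi> n (x, s))) \<le> F n" by simp
  then show ?thesis by (rule Lim_null_comparison[OF _ F])
qed

text \<open>The difference of two approximating sequences tends to zero together with its time
  derivative, and by \<open>slice_null\<close> so do its slices. The trace is therefore independent
  of the sequence, and one sequence may serve at several times.\<close>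

lemma time_trace_seq:
  assumes g: "time_trace \<Omega> a b s w k g" and \<phi>: "dt_approx \<Omega> a b \<phi> w k" and s: "a \<le> s" "s \<le> b"
  shows "L2_lim (lebesgue_on \<Omega>) (\<lambda>n x. \<phi> n (x, s)) g"
proof -
  obtain \<psi> where \<psi>: "dt_approx \<Omega> a b \<psi> w k" "L2_lim (lebesgue_on \<Omega>) (\<lambda>n x. \<psi> n (x, s)) g" and gL: "g \<in> L2 (lebesgue_on \<Omega>)"
    using g by (auto simp: time_trace_def)
  have sm: "smooth (\<phi> n)" "smooth (\<psi> n)" for n using \<phi> \<psi> by (auto simp: dt_approx_def)
  have "L2_lim Q (\<lambda>n p. \<phi> n p - \<psi> n p) (\<lambda>p. w p - w p)" "L2_lim Q (\<lambda>n p. dir_deriv (0, 1) (\<phi> n) p - dir_deriv (0, 1) (\<psi> n) p) (\<lambda>p. k p - k p)"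
    using \<phi> \<psi> by (intro L2_lim_diff; simp add: dt_approx_def)+
  then have "(\<lambda>n. L2_norm Q (\<lambda>p. \<phi> n p - \<psi> n p)) \<longlonglongrightarrow> 0"
    "(\<lambda>n. L2_norm Q (dir_deriv (0, 1) (\<lambda>p. \<phi> n p - \<psi> n p))) \<longlonglongrightarrow> 0"
    by (auto simp: L2_lim_def dir_deriv_diff[OF sm, abs_def])
  from slice_null[OF smooth_diff[OF sm] this s]
  have d: "L2_lim (lebesgue_on \<Omega>) (\<lambda>n x. \<phi> n (x, s) - \<psi> n (x, s)) (\<lambda>x. 0)"
    using L2_diff[OF smooth_slice_L2[OF \<Omega> sm(1)] smooth_slice_L2[OF \<Omega> sm(2)]] by (auto simp: L2_lim_def)
  have "L2_lim (lebesgue_on \<Omega>) (\<lambda>n x. 0 - \<psi> n (x, s)) (\<lambda>x. 0 - g x)"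
    by (rule L2_lim_diff[OF _ \<psi>(2)]) (simp add: L2_lim_def)
  from L2_lim_diff[OF d this] show ?thesis by simp
qed

text \<open>The limit form of \<open>slice_average_le\<close>. Divided by \<open>sqrt h\<close> it
  recovers the norm of the final trace from averages over short final layers, the form in which
  \<open>residual_bound\<close> uses it.\<close>

lemma time_trace_average:
  assumes g: "time_trace \<Omega> a b b w k g" and h: "0 \<le> h" "h \<le> b - a"
  shows "\<bar>L2_norm (lebesgue_on (cyl \<Omega> (b - h) b)) w - sqrt h * L2_norm (lebesgue_on \<Omega>) g\<bar> \<le> h * L2_norm Q k"
proof -
  obtain \<phi> where \<phi>: "dt_approx \<Omega> a b \<phi> w k" "L2_lim (lebesgue_on \<Omega>) (\<lambda>n x. \<phi> n (x, b)) g" and gL: "g \<in> L2 (lebesgue_on \<Omega>)"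
    using g by (auto simp: time_trace_def)
  have sm: "smooth (\<phi> n)" for n using \<phi> by (auto simp: dt_approx_def)
  let ?C = "lebesgue_on (cyl \<Omega> (b - h) b)"
  have l: "L2_lim ?C \<phi> w" "L2_lim Q (\<lambda>n. dir_deriv (0, 1) (\<phi> n)) k"
    using \<phi>(1) L2_lim_cyl_mono[OF \<Omega>(1), of a b \<phi> w "b - h" b] h by (auto simp: dt_approx_def)
  have wC: "w \<in> L2 ?C" by (rule L2_cyl_mono(1)[OF \<Omega>(1) w]) (use h in auto)
  show ?thesis
  proof (rule LIMSEQ_le)
    show "(\<lambda>n. \<bar>L2_norm ?C (\<phi> n) - sqrt h * L2_norm (lebesgue_on \<Omega>) (\<lambda>x. \<phi> n (x, b))\<bar>)
       \<longlonglongrightarrow> \<bar>L2_norm ?C w - sqrt h * L2_norm (lebesgue_on \<Omega>) g\<bar>"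
      by (intro tendsto_intros L2_lim_norm[OF l(1) wC] L2_lim_norm[OF \<phi>(2) gL])
    show "(\<lambda>n. h * L2_norm Q (dir_deriv (0, 1) (\<phi> n))) \<longlonglongrightarrow> h * L2_norm Q k"
      by (intro tendsto_intros L2_lim_norm[OF l(2) k])
    have "\<bar>L2_norm ?C (\<phi> n) - sqrt h * L2_norm (lebesgue_on \<Omega>) (\<lambda>x. \<phi> n (x, b))\<bar> \<le> h * L2_norm Q (dir_deriv (0, 1) (\<phi> n))" for n
    proof -
      have "L2_norm ?C (dir_deriv (0, 1) (\<phi> n)) \<le> L2_norm Q (dir_deriv (0, 1) (\<phi> n))"
        by (rule L2_cyl_mono(2)[OF \<Omega>(1) smooth_cyl_L2(2)[OF \<Omega> sm]]) (use h in auto)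
      then show ?thesis
        using slice_average_le[OF \<Omega> sm[of n] h(1), of b] mult_left_mono[OF _ h(1)] by (meson order_trans)
    qed
    then show "\<exists>N. \<forall>n\<ge>N. \<bar>L2_norm ?C (\<phi> n) - sqrt h * L2_norm (lebesgue_on \<Omega>) (\<lambda>x. \<phi> n (x, b))\<bar> \<le> h * L2_norm Q (dir_deriv (0, 1) (\<phi> n))"
      by blast
  qed
qed

text \<open>For smooth functions twice the product is the time derivative of the square. Product and
  slices pass to the limit along one common sequence.\<close>

lemma time_trace_energy:
  assumes g: "time_trace \<Omega> a b a w k g0" "time_trace \<Omega> a b b w k g1"
  shows "2 * (\<integral>p. k p * w p \<partial>Q) = (L2_norm (lebesgue_on \<Omega>) g1)\<^sup>2 - (L2_norm (lebesgue_on \<Omega>) g0)\<^sup>2"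
proof -
  obtain \<phi> where \<phi>: "dt_approx \<Omega> a b \<phi> w k" using g by (auto simp: time_trace_def)
  have sm: "smooth (\<phi> n)" for n using \<phi> by (auto simp: dt_approx_def)
  have gL: "g0 \<in> L2 (lebesgue_on \<Omega>)" "g1 \<in> L2 (lebesgue_on \<Omega>)" using g by (auto simp: time_trace_def)
  have eq: "2 * (\<integral>p. dir_deriv (0, 1) (\<phi> n) p * \<phi> n p \<partial>Q)
      = (L2_norm (lebesgue_on \<Omega>) (\<lambda>x. \<phi> n (x, b)))\<^sup>2 - (L2_norm (lebesgue_on \<Omega>) (\<lambda>x. \<phi> n (x, a)))\<^sup>2" for n
  proof -
    have "2 * (\<integral>p. dir_deriv (0, 1) (\<phi> n) p * \<phi> n p \<partial>Q) = (\<integral>p. dir_deriv (0, 1) (\<lambda>p. \<phi> n p * \<phi> n p) p \<partial>Q)"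
      by (simp only: dir_deriv_mult[OF sm sm] Bochner_Integration.integral_mult_right_zero[symmetric])
         (intro Bochner_Integration.integral_cong refl, simp)
    then show ?thesis
      using integral_dt[OF \<Omega> smooth_mult[OF sm sm] less_imp_le[OF ab], of n n] by (simp add: L2_norm_square power2_eq_square[of "\<phi> _ _"])
  qed
  have "(\<lambda>n. 2 * (\<integral>p. dir_deriv (0, 1) (\<phi> n) p * \<phi> n p \<partial>Q)) \<longlonglongrightarrow> 2 * (\<integral>p. k p * w p \<partial>Q)"
    using \<phi> by (intro tendsto_mult_left L2_lim_mult2 w k) (auto simp: dt_approx_def)
  moreover have "(\<lambda>n. 2 * (\<integral>p. dir_deriv (0, 1) (\<phi> n) p * \<phi> n p \<partial>Q)) \<longlonglongrightarrow>
      (L2_norm (lebesgue_on \<Omega>) g1)\<^sup>2 - (L2_norm (lebesgue_on \<Omega>) g0)\<^sup>2"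
    unfolding eq using ab by (intro tendsto_intros L2_lim_norm[OF time_trace_seq[OF g(2) \<phi>] gL(2)] L2_lim_norm[OF time_trace_seq[OF g(1) \<phi>] gL(1)]) auto
  ultimately show ?thesis by (rule LIMSEQ_unique)
qed

text \<open>A zero trace means that the extension has no jump at time \<open>a\<close>: the boundary
  term of the integration by parts contains the slices \<open>\<phi> n (x, a)\<close>, which tend to
  zero, while the test function vanishes at time \<open>b\<close>.\<close>

lemma zero_extension_weak_dt:
  assumes g: "time_trace \<Omega> a b a w k (\<lambda>x. 0)" and a': "a' \<le> a"
  shows "has_weak_dt (cyl \<Omega> a' b) (\<lambda>p. if a < snd p then w p else 0) (\<lambda>p. if a < snd p then k p else 0)"
  unfolding has_weak_dt_def
proof
  fix \<psi> assume \<psi>: "\<psi> \<in> test_functions (cyl \<Omega> a' b)"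
  let ?Q' = "cyl \<Omega> a' b"
  obtain \<phi> where \<phi>: "dt_approx \<Omega> a b \<phi> w k" "L2_lim (lebesgue_on \<Omega>) (\<lambda>n x. \<phi> n (x, a)) (\<lambda>x. 0)" using g by (auto simp: time_trace_def)
  have sm: "smooth (\<phi> n)" for n using \<phi> by (auto simp: dt_approx_def)
  note \<psi>s = test_functions_smooth[OF \<psi>]
  note Qm = sets_cyl(1)[OF \<Omega>(1)]
  have \<psi>L: "\<psi> \<in> L2 Q" "dir_deriv (0, 1) \<psi> \<in> L2 Q"
    by (rule smooth_cyl_L2[OF \<Omega> \<psi>s])+
  have eq: "(\<integral>p. \<phi> n p * dir_deriv (0, 1) \<psi> p \<partial>Q) + (\<integral>p. dir_deriv (0, 1) (\<phi> n) p * \<psi> p \<partial>Q)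
      = - (\<integral>x. \<phi> n (x, a) * \<psi> (x, a) \<partial>lebesgue_on \<Omega>)" for n
  proof -
    have "(\<integral>p. dir_deriv (0, 1) (\<lambda>p. \<phi> n p * \<psi> p) p \<partial>Q) = (\<integral>p. \<phi> n p * dir_deriv (0, 1) \<psi> p \<partial>Q) + (\<integral>p. dir_deriv (0, 1) (\<phi> n) p * \<psi> p \<partial>Q)"
      unfolding dir_deriv_mult[OF sm \<psi>s]
      by (intro Bochner_Integration.integral_add L2_mult_integrable \<psi>L smooth_cyl_L2[OF \<Omega> sm])
    moreover have "\<psi> (x, b) = 0" for x using test_functions_outside[OF \<psi>, of "(x, b)"] by simp
    ultimately show ?thesis
      using integral_dt[OF \<Omega> smooth_mult[OF sm \<psi>s] less_imp_le[OF ab], of n] by simp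
  qed
  have "(\<lambda>n. (\<integral>p. \<phi> n p * dir_deriv (0, 1) \<psi> p \<partial>Q) + (\<integral>p. dir_deriv (0, 1) (\<phi> n) p * \<psi> p \<partial>Q)) \<longlonglongrightarrow>
      (\<integral>p. w p * dir_deriv (0, 1) \<psi> p \<partial>Q) + (\<integral>p. k p * \<psi> p \<partial>Q)"
    using \<phi>(1) by (intro tendsto_add L2_lim_mult \<psi>L w k) (auto simp: dt_approx_def)
  moreover have "(\<lambda>n. - (\<integral>x. \<phi> n (x, a) * \<psi> (x, a) \<partial>lebesgue_on \<Omega>)) \<longlonglongrightarrow> - (\<integral>x. 0 * \<psi> (x, a) \<partial>lebesgue_on \<Omega>)"
    by (intro tendsto_minus L2_lim_mult[OF \<phi>(2)] smooth_slice_L2[OF \<Omega> \<psi>s]) simp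
  ultimately have "(\<integral>p. w p * dir_deriv (0, 1) \<psi> p \<partial>Q) + (\<integral>p. k p * \<psi> p \<partial>Q) = 0"
    unfolding eq using LIMSEQ_unique by fastforce
  moreover have "(\<integral>p. dir_deriv (0, 1) \<psi> p *\<^sub>R (if a < snd p then w p else 0) \<partial>lebesgue_on ?Q') = (\<integral>p. w p * dir_deriv (0, 1) \<psi> p \<partial>Q)"
  proof -
    have "(\<integral>p. dir_deriv (0, 1) \<psi> p *\<^sub>R (if a < snd p then w p else 0) \<partial>lebesgue_on ?Q') = (\<integral>p. dir_deriv (0, 1) \<psi> p *\<^sub>R (if a < snd p then w p else 0) \<partial>Q)"
      by (intro integral_lebesgue_on_subset Qm cyl_mono a') (auto simp: cyl_def)
    also have "\<dots> = (\<integral>p. w p * dir_deriv (0, 1) \<psi> p \<partial>Q)"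
      by (intro Bochner_Integration.integral_cong) (auto simp: cyl_def mult.commute)
    finally show ?thesis .
  qed
  moreover have "(\<integral>p. \<psi> p *\<^sub>R (if a < snd p then k p else 0) \<partial>lebesgue_on ?Q') = (\<integral>p. k p * \<psi> p \<partial>Q)"
  proof -
    have "(\<integral>p. \<psi> p *\<^sub>R (if a < snd p then k p else 0) \<partial>lebesgue_on ?Q') = (\<integral>p. \<psi> p *\<^sub>R (if a < snd p then k p else 0) \<partial>Q)"
      by (intro integral_lebesgue_on_subset Qm cyl_mono a') (auto simp: cyl_def)
    also have "\<dots> = (\<integral>p. k p * \<psi> p \<partial>Q)"
      by (intro Bochner_Integration.integral_cong) (auto simp: cyl_def mult.commute)
    finally show ?thesis .
  qed
  ultimately show "(\<integral>p. dir_deriv (0, 1) \<psi> p *\<^sub>R (if a < snd p then w p else 0) \<partial>lebesgue_on ?Q') =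
      - (\<integral>p. \<psi> p *\<^sub>R (if a < snd p then k p else 0) \<partial>lebesgue_on ?Q')" by simp
qed

end

locale weak_time_strip = time_strip +
  assumes wk: "has_weak_dt (cyl \<Omega> a b) w k"
begin

text \<open>Approximations with error \<open>(1 / 2) ^ n\<close> have slices with geometrically
  decreasing increments by \<open>slice_le\<close>; \<open>L2_complete_fast\<close> supplies the
  limit.\<close>

lemma time_trace_exists:
  assumes s: "a \<le> s" "s \<le> b"
  shows "\<exists>g. time_trace \<Omega> a b s w k g"
proof -
  have "\<forall>n. \<exists>\<phi>. smooth \<phi> \<and> L2_norm Q (\<lambda>p. \<phi> p - w p) < (1 / 2) ^ n \<and> L2_norm Q (\<lambda>p. dir_deriv (0, 1) \<phi> p - k p) < (1 / 2) ^ n"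
    by (intro allI weak_dt_approx[OF \<Omega> ab w k wk]) simp
  from choice[OF this] obtain \<phi> where \<phi>0: "\<forall>n. smooth (\<phi> n) \<and> L2_norm Q (\<lambda>p. \<phi> n p - w p) < (1 / 2) ^ n \<and>
      L2_norm Q (\<lambda>p. dir_deriv (0, 1) (\<phi> n) p - k p) < (1 / 2) ^ n" ..
  have \<phi>: "smooth (\<phi> n)" "L2_norm Q (\<lambda>p. \<phi> n p - w p) < (1 / 2) ^ n"
    "L2_norm Q (\<lambda>p. dir_deriv (0, 1) (\<phi> n) p - k p) < (1 / 2) ^ n" for n
    using spec[OF \<phi>0, of n] by simp_all
  have half: "(\<lambda>n. (1 / 2 :: real) ^ n) \<longlonglongrightarrow> 0" by (rule LIMSEQ_power_zero) simp
  note \<phi>L = smooth_cyl_L2[OF \<Omega> \<phi>(1)]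
  have "(\<lambda>n. L2_norm Q (\<lambda>p. \<phi> n p - w p)) \<longlonglongrightarrow> 0"
    by (rule Lim_null_comparison[OF _ half]) (use less_imp_le[OF \<phi>(2)] in simp)
  moreover have "(\<lambda>n. L2_norm Q (\<lambda>p. dir_deriv (0, 1) (\<phi> n) p - k p)) \<longlonglongrightarrow> 0"
    by (rule Lim_null_comparison[OF _ half]) (use less_imp_le[OF \<phi>(3)] in simp)
  ultimately have app: "dt_approx \<Omega> a b \<phi> w k"
    unfolding dt_approx_def by (intro conjI allI \<phi>(1) L2_lim_I \<phi>L w k)
  \<comment> \<open>Consecutive approximations and their derivatives differ by at most
    \<open>2 * (1 / 2) ^ n\<close>; \<open>C\<close> is the root of the bound in
    \<open>slice_le\<close> with 2 for both norms.\<close>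
  define C where "C = sqrt (2 / (b - a) * 2\<^sup>2 + 2 * (b - a) * 2\<^sup>2)"
  have le: "L2_norm (lebesgue_on \<Omega>) (\<lambda>x. \<phi> (Suc n) (x, s) - \<phi> n (x, s)) \<le> C * (1 / 2) ^ n" for n
  proof -
    define \<eta> where "\<eta> p = \<phi> (Suc n) p - \<phi> n p" for p
    have \<eta>: "smooth \<eta>" unfolding \<eta>_def[abs_def] by (intro smooth_diff \<phi>)
    define q where "q = (1 / 2 :: real) ^ n"
    have q: "0 \<le> q" "(1 / 2 :: real) ^ Suc n \<le> q" by (auto simp: q_def)
    have 1: "L2_norm Q \<eta> \<le> 2 * q"
      using L2_norm_triangle3[OF \<phi>L(1)[of "Suc n"] w \<phi>L(1)[of n]] \<phi>(2)[of n] \<phi>(2)[of "Suc n"] q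
        L2_norm_minus_commute[of Q w "\<phi> n"] unfolding \<eta>_def[abs_def] q_def by linarith
    have "L2_norm Q (\<lambda>p. dir_deriv (0, 1) (\<phi> (Suc n)) p - dir_deriv (0, 1) (\<phi> n) p) \<le> 2 * q"
      using L2_norm_triangle3[OF \<phi>L(2)[of "Suc n"] k \<phi>L(2)[of n]] \<phi>(3)[of n] \<phi>(3)[of "Suc n"] q
        L2_norm_minus_commute[of Q k "dir_deriv (0, 1) (\<phi> n)"] unfolding q_def by linarith
    then have 2: "L2_norm Q (dir_deriv (0, 1) \<eta>) \<le> 2 * q"
      by (simp add: \<eta>_def[abs_def] dir_deriv_diff[OF \<phi>(1) \<phi>(1), abs_def])
    have "(L2_norm (lebesgue_on \<Omega>) (\<lambda>x. \<eta> (x, s)))\<^sup>2 \<le> 2 / (b - a) * (2 * q)\<^sup>2 + 2 * (b - a) * (2 * q)\<^sup>2"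
      using ab by (intro order_trans[OF slice_le[OF \<Omega> \<eta> s ab]] add_mono mult_left_mono power_mono 1 2) auto
    also have "\<dots> = (C * q)\<^sup>2"
    proof -
      have "C\<^sup>2 = 2 / (b - a) * 2\<^sup>2 + 2 * (b - a) * 2\<^sup>2"
        unfolding C_def using ab by (intro real_sqrt_pow2) simp
      then show ?thesis by (simp only: power_mult_distrib) (simp add: algebra_simps)
    qed
    finally have "L2_norm (lebesgue_on \<Omega>) (\<lambda>x. \<eta> (x, s)) \<le> C * q"
      by (rule power2_le_imp_le) (use q ab in \<open>simp add: C_def\<close>)
    then show ?thesis by (simp add: \<eta>_def q_def)
  qed
  have "0 \<le> C" using ab by (simp add: C_def)
  from L2_complete_fast[OF smooth_slice_L2[OF \<Omega> \<phi>(1)] le this]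
  obtain g where "g \<in> L2 (lebesgue_on \<Omega>)" "L2_lim (lebesgue_on \<Omega>) (\<lambda>n x. \<phi> n (x, s)) g" .
  then show ?thesis using app unfolding time_trace_def by (intro exI[of _ g] conjI exI[of _ \<phi>])
qed

text \<open>\<open>\<sigma>\<close> selects the time, \<open>t\<close> or \<open>t + h\<close>, at which the derivative is compared with the quotient.\<close>

lemma difference_quotient:
  fixes \<sigma> :: real
  assumes \<sigma>: "\<sigma> = 0 \<or> \<sigma> = 1" and \<epsilon>: "0 < \<epsilon>"
  shows "\<exists>d>0. \<forall>h. 0 < h \<and> h < d \<longrightarrow>
     (\<lambda>p. (w (p + (0, h)) - w p) / h - k (p + (0, \<sigma> * h))) \<in> L2 (lebesgue_on (cyl \<Omega> a (b - h))) \<and>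
     L2_norm (lebesgue_on (cyl \<Omega> a (b - h))) (\<lambda>p. (w (p + (0, h)) - w p) / h - k (p + (0, \<sigma> * h))) < \<epsilon>"
proof -
  \<comment> \<open>\<open>w\<close> is split into a smooth part and a remainder with small
    derivative. Quotient and derivative of the remainder are small for every \<open>h\<close>; for
    the smooth part the mean value theorem gives an error proportional to \<open>h\<close>.\<close>
  obtain \<phi> where \<phi>: "smooth \<phi>" "L2_norm Q (\<lambda>p. dir_deriv (0, 1) \<phi> p - k p) < \<epsilon> / 4"
    using weak_dt_approx[OF \<Omega> ab w k wk, of "\<epsilon> / 4"] \<epsilon> by auto
  define \<phi>' where "\<phi>' = dir_deriv (0, 1) \<phi>"
  have \<phi>'s: "smooth \<phi>'" unfolding \<phi>'_def by (intro smooth_dir_deriv \<phi>) simp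
  have c2: "continuous_on UNIV (dir_deriv (0, 1) \<phi>')"
    by (intro smooth_continuous smooth_dir_deriv \<phi>'s) simp
  have "compact (closure \<Omega> \<times> {a..b})" using \<Omega>(2) by (intro compact_Times) auto
  then have "bounded (dir_deriv (0, 1) \<phi>' ` (closure \<Omega> \<times> {a..b}))"
    by (intro compact_imp_bounded compact_continuous_image continuous_on_subset[OF c2]) auto
  \<comment> \<open>\<open>C\<close> bounds the second time derivative of \<open>\<phi>\<close>,
    which controls how far the quotient is from the derivative at either end.\<close>
  then obtain C where C: "0 < C" "\<And>p. p \<in> closure \<Omega> \<times> {a..b} \<Longrightarrow> \<bar>dir_deriv (0, 1) \<phi>' p\<bar> \<le> C"
    unfolding bounded_pos by auto
  define V where "V = sqrt (measure lebesgue (cyl \<Omega> a b)) + 1"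
  have V: "0 < V" by (simp add: V_def add_nonneg_pos)
  have Qm: "cyl \<Omega> a b \<in> sets lebesgue" for a b by (rule sets_cyl(1)[OF \<Omega>(1)])
  have \<phi>L: "\<phi> \<in> L2 Q" "\<phi>' \<in> L2 Q" unfolding \<phi>'_def by (rule smooth_cyl_L2[OF \<Omega> \<phi>(1)])+
  define r where "r p = w p - \<phi> p" for p
  define r' where "r' p = k p - \<phi>' p" for p
  have rL: "r \<in> L2 Q" "r' \<in> L2 Q" unfolding r_def[abs_def] r'_def[abs_def] by (intro L2_diff w k \<phi>L)+
  have rr: "has_weak_dt (cyl \<Omega> a b) r r'"
    unfolding r_def[abs_def] r'_def[abs_def] \<phi>'_def
    by (rule has_weak_dt_diff[OF open_cyl[OF \<Omega>(1)] w \<phi>L(1) k _ wk smooth_has_weak_dt[OF open_cyl[OF \<Omega>(1)] \<phi>(1)]])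
       (use \<phi>L in \<open>simp add: \<phi>'_def\<close>)
  have r'_le: "L2_norm Q r' < \<epsilon> / 4"
    using \<phi>(2) L2_norm_minus_commute[of Q k \<phi>'] by (simp add: r'_def[abs_def] \<phi>'_def)
  show ?thesis
  proof (intro exI conjI allI impI; (elim conjE)?)
    \<comment> \<open>The error \<open>C * h * V\<close> of the smooth part is then below
      \<open>\<epsilon> / 4\<close>; the two terms of the remainder take another
      \<open>\<epsilon> / 4\<close> each.\<close>
    show "0 < \<epsilon> / (4 * C * V)" using \<epsilon> C V by simp
    fix h assume h: "0 < h" "h < \<epsilon> / (4 * C * V)"
    let ?C = "lebesgue_on (cyl \<Omega> a (b - h))"
    have \<sigma>h: "0 \<le> \<sigma> * h" "\<sigma> * h \<le> h" using \<sigma> h by auto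
    define A where "A p = (1 / h) *\<^sub>R (r (p + (0, h)) - r p)" for p
    define B where "B p = r' (p + (0, \<sigma> * h))" for p
    define D where "D p = (\<phi> (p + (0, h)) - \<phi> p) / h - \<phi>' (p + (0, \<sigma> * h))" for p
    have A: "A \<in> L2 ?C" "L2_norm ?C A \<le> L2_norm Q r'"
    proof -
      note s = weak_dt_shift_le[OF \<Omega> less_imp_le[OF h(1)] rL rr]
      show "A \<in> L2 ?C" unfolding A_def[abs_def] by (rule L2_scaleR[OF s(1)])
      have "L2_norm ?C A = 1 / h * L2_norm ?C (\<lambda>p. r (p + (0, h)) - r p)"
        unfolding A_def[abs_def] L2_norm_scaleR using h by simp
      also have "\<dots> \<le> 1 / h * (h * L2_norm Q r')" using s(2) h by (intro mult_left_mono) auto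
      finally show "L2_norm ?C A \<le> L2_norm Q r'" using h by simp
    qed
    have B: "B \<in> L2 ?C" "L2_norm ?C B \<le> L2_norm Q r'"
      unfolding B_def[abs_def]
      using L2_cyl_mono[OF \<Omega>(1) L2_shift(1)[OF \<Omega>(1) rL(2), of "\<sigma> * h"], of a "b - h"]
        L2_shift(2)[OF \<Omega>(1) rL(2), of "\<sigma> * h"] \<sigma>h by auto
    have D_le: "\<bar>D p\<bar> \<le> C * h" if p: "p \<in> cyl \<Omega> a (b - h)" for p
    proof -
      obtain x t where xt: "p = (x, t)" "x \<in> \<Omega>" "a < t" "t < b - h" using p by (cases p) auto
      have xc: "x \<in> closure \<Omega>" using xt(2) closure_subset by blast
      obtain \<xi> where \<xi>: "t < \<xi>" "\<xi> < t + h" "\<phi> (x, t + h) - \<phi> (x, t) = h * \<phi>' (x, \<xi>)"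
        using MVT2[of t "t + h" "\<lambda>s. \<phi> (x, s)" "\<lambda>s. \<phi>' (x, s)"] smooth_dt_derivative[OF \<phi>(1)] h by (auto simp: \<phi>'_def)
      have "\<bar>\<phi>' (x, \<xi>) - \<phi>' (x, t + \<sigma> * h)\<bar> \<le> C * \<bar>\<xi> - (t + \<sigma> * h)\<bar>"
      proof -
        have "norm (\<phi>' (x, \<xi>) - \<phi>' (x, t + \<sigma> * h)) \<le> C * norm (\<xi> - (t + \<sigma> * h))"
        proof (rule field_differentiable_bound[of "{a..b}"])
          show "((\<lambda>s. \<phi>' (x, s)) has_field_derivative dir_deriv (0, 1) \<phi>' (x, s)) (at s within {a..b})" for s
            by (rule DERIV_subset[OF smooth_dt_derivative[OF \<phi>'s]]) simp
          show "norm (dir_deriv (0, 1) \<phi>' (x, s)) \<le> C" if "s \<in> {a..b}" for s using C(2)[of "(x, s)"] xc that by simp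
          show "\<xi> \<in> {a..b}" "t + \<sigma> * h \<in> {a..b}"
            using xt \<xi> \<sigma>h unfolding atLeastAtMost_iff by linarith+
        qed simp
        then show ?thesis by simp
      qed
      also have "\<bar>\<xi> - (t + \<sigma> * h)\<bar> \<le> h"
        using \<xi>(1,2) \<sigma>h by (intro abs_leI) linarith+
      finally show ?thesis using \<xi>(3) h C(1) by (simp add: D_def xt)
    qed
    have Dc: "continuous_on UNIV D"
      unfolding D_def[abs_def] using h
      by (intro continuous_intros smooth_continuous[OF smooth_translate[OF \<phi>(1)]] smooth_continuous[OF \<phi>(1)] smooth_continuous[OF smooth_translate[OF \<phi>'s]]) auto
    have D: "D \<in> L2 ?C" by (rule continuous_bounded_integrable(3)[OF Dc bounded_cyl[OF \<Omega>(2)] Qm])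
    have "L2_norm ?C D \<le> C * h * V"
    proof (rule power2_le_imp_le)
      have fm: "cyl \<Omega> a (b - h) \<in> lmeasurable" "cyl \<Omega> a b \<in> lmeasurable"
        by (intro bounded_set_imp_lmeasurable bounded_cyl \<Omega> Qm)+
      have "(L2_norm ?C D)\<^sup>2 \<le> (\<integral>p. (C * h)\<^sup>2 * indicator (cyl \<Omega> a (b - h)) p \<partial>?C)"
      proof (rule L2_boundI(2))
        show "D \<in> borel_measurable ?C" by (rule L2_measurable[OF D])
        show "integrable ?C (\<lambda>p. (C * h)\<^sup>2 * indicator (cyl \<Omega> a (b - h)) p)"
          by (intro integrable_mult_right integrable_indicator_lebesgue_on fm Qm)
        show "AE p in ?C. (norm (D p))\<^sup>2 \<le> (C * h)\<^sup>2 * indicator (cyl \<Omega> a (b - h)) p"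
          by (rule AE_I2) (use power_mono[OF D_le, where n=2] in simp)
      qed
      also have "\<dots> = (C * h)\<^sup>2 * measure lebesgue (cyl \<Omega> a (b - h))"
        using integrable_indicator_lebesgue_on(2)[OF fm(1) Qm, of a "b - h"] by simp
      also have "\<dots> \<le> (C * h)\<^sup>2 * measure lebesgue (cyl \<Omega> a b)"
        using h by (intro mult_left_mono measure_mono_fmeasurable cyl_mono fm Qm) auto
      also have "\<dots> \<le> (C * h)\<^sup>2 * V\<^sup>2"
      proof (intro mult_left_mono)
        have "(sqrt (measure lebesgue (cyl \<Omega> a b)))\<^sup>2 \<le> V\<^sup>2" by (intro power_mono) (auto simp: V_def)
        then show "measure lebesgue (cyl \<Omega> a b) \<le> V\<^sup>2" by simp
      qed simp
      finally show "(L2_norm ?C D)\<^sup>2 \<le> (C * h * V)\<^sup>2" by (simp add: power_mult_distrib)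
    qed (use C h V in simp)
    also have "\<dots> < \<epsilon> / 4" using h C V by (simp add: field_simps)
    finally have Dn: "L2_norm ?C D < \<epsilon> / 4" .
    have eq: "(\<lambda>p. (w (p + (0, h)) - w p) / h - k (p + (0, \<sigma> * h))) = (\<lambda>p. A p + (D p - B p))"
      using h by (auto simp: A_def B_def D_def r_def r'_def field_simps)
    show "(\<lambda>p. (w (p + (0, h)) - w p) / h - k (p + (0, \<sigma> * h))) \<in> L2 ?C"
      unfolding eq by (intro L2_add L2_diff A B D)
    have "L2_norm ?C (\<lambda>p. A p + (D p - B p)) \<le> L2_norm ?C A + (L2_norm ?C D + L2_norm ?C B)"
      using L2_norm_triangle[OF A(1) L2_diff[OF D B(1)]] L2_norm_triangle[OF D L2_uminus[OF B(1)]] by simp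
    then show "L2_norm ?C (\<lambda>p. (w (p + (0, h)) - w p) / h - k (p + (0, \<sigma> * h))) < \<epsilon>"
      unfolding eq using A(2) B(2) Dn r'_le \<epsilon> by linarith
  qed
qed

end

section \<open>Hausdorff measure of the lateral boundary\<close>

definition tube :: "real \<Rightarrow> 'e::euclidean_space \<Rightarrow> 'e set \<Rightarrow> 'e set" where
  "tube h m B = {b + s *\<^sub>R m | b s. b \<in> B \<and> 0 \<le> s \<and> s \<le> h}"

text \<open>At most \<open>2 * (h / \<rho>)\<close> balls of radius \<open>2 * \<rho>\<close> occur
  in \<open>tube_cover\<close>; the constant collects the factors other than
  \<open>h * \<rho> ^ d\<close> in their total volume.\<close>

definition tube_const :: "'e::euclidean_space itself \<Rightarrow> real" where
  "tube_const _ = 2 * unit_ball_vol DIM('e) * 2 ^ DIM('e)"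

lemma tube_const_nonneg: "0 \<le> tube_const TYPE('e::euclidean_space)"
  by (simp add: tube_const_def)

text \<open>About \<open>h/\<rho>\<close> balls of radius \<open>2\<rho>\<close> cover the tube of length \<open>h\<close> over a set of diameter \<open>\<rho>\<close>.\<close>

lemma tube_cover:
  fixes C :: "'e::euclidean_space set"
  assumes C: "bounded C" "diameter C \<le> \<rho>" and \<rho>: "0 < \<rho>" "\<rho> \<le> h" and m: "norm m \<le> 1" and d: "DIM('e) = Suc d"
  shows "\<exists>U\<in>sets borel. tube h m C \<subseteq> U \<and> emeasure lborel U \<le> ennreal (tube_const TYPE('e) * h * \<rho> ^ d)"
proof (cases "C = {}")
  case True
  then show ?thesis by (intro bexI[of _ "{}"]) (auto simp: tube_def)
next
  case False
  then obtain c where c: "c \<in> C" by blast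
  define N where "N = nat \<lfloor>h / \<rho>\<rfloor>"
  define U where "U = (\<Union>k\<in>{..N}. cball (c + (real k * \<rho>) *\<^sub>R m) (2 * \<rho>))"
  have "tube h m C \<subseteq> U"
  proof
    fix z assume "z \<in> tube h m C"
    then obtain b s where z: "z = b + s *\<^sub>R m" "b \<in> C" "0 \<le> s" "s \<le> h" by (auto simp: tube_def)
    define k where "k = nat \<lfloor>s / \<rho>\<rfloor>"
    have k: "real k \<le> s / \<rho>" "s / \<rho> < real k + 1"
      unfolding k_def using z \<rho> by (auto simp: of_nat_nat)
    have kN: "k \<le> N" unfolding k_def N_def using z \<rho> by (intro nat_mono floor_mono divide_right_mono) auto
    have bc: "dist c b \<le> \<rho>" using diameter_bounded_bound[OF C(1) c z(2)] C(2) by linarith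
    have ks: "\<bar>s - real k * \<rho>\<bar> \<le> \<rho>" using k \<rho> by (simp add: field_simps)
    have n: "norm ((real k * \<rho> - s) *\<^sub>R m) \<le> \<rho> * 1"
      unfolding norm_scaleR using ks m \<rho> by (intro mult_mono) auto
    have eq: "c + (real k * \<rho>) *\<^sub>R m - z = (c - b) + (real k * \<rho> - s) *\<^sub>R m"
      by (simp add: z algebra_simps)
    have "dist (c + (real k * \<rho>) *\<^sub>R m) z \<le> 2 * \<rho>"
      using bc n norm_triangle_ineq[of "c - b" "(real k * \<rho> - s) *\<^sub>R m"] unfolding dist_norm eq by linarith
    then show "z \<in> U" unfolding U_def using kN by auto
  qed
  moreover have "emeasure lborel U \<le> ennreal (tube_const TYPE('e) * h * \<rho> ^ d)"
  proof -
    have "emeasure lborel U \<le> (\<Sum>k\<in>{..N}. emeasure lborel (cball (c + (real k * \<rho>) *\<^sub>R m) (2 * \<rho>)))"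
      unfolding U_def by (intro emeasure_subadditive_finite) auto
    also have "\<dots> = (\<Sum>k\<in>{..N}. ennreal (unit_ball_vol DIM('e) * (2 * \<rho>) ^ DIM('e)))"
      using \<rho> by (intro sum.cong refl emeasure_cball) auto
    also have "\<dots> = ennreal (\<Sum>k\<in>{..N}. unit_ball_vol DIM('e) * (2 * \<rho>) ^ DIM('e))"
      using \<rho> by (intro sum_ennreal) auto
    also have "(\<Sum>k\<in>{..N}. unit_ball_vol DIM('e) * (2 * \<rho>) ^ DIM('e)) = (real N + 1) * (unit_ball_vol DIM('e) * (2 * \<rho>) ^ DIM('e))"
      by (simp add: algebra_simps)
    \<comment> \<open>As \<open>\<rho> \<le> h\<close>, the one additional ball counts no more than
      \<open>h / \<rho>\<close>.\<close>
    also have "\<dots> \<le> (2 * (h / \<rho>)) * (unit_ball_vol DIM('e) * (2 * \<rho>) ^ DIM('e))"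
    proof (rule mult_right_mono)
      have "real N \<le> h / \<rho>" unfolding N_def using \<rho> by (auto simp: of_nat_nat)
      moreover have "1 \<le> h / \<rho>" using \<rho> by simp
      ultimately show "real N + 1 \<le> 2 * (h / \<rho>)" by linarith
    qed (use \<rho> in auto)
    also have "\<dots> = tube_const TYPE('e) * h * \<rho> ^ d"
      using \<rho> by (simp add: tube_const_def d power_mult_distrib)
    finally show ?thesis by (simp add: ennreal_leI)
  qed
  ultimately show ?thesis by (intro bexI[of _ U]) (auto simp: U_def)
qed

text \<open>A cover of \<open>B\<close> by sets of diameter at most \<open>h\<close> yields a cover
  of the tube whose volume is at most a constant times \<open>h\<close> times the sum of the
  \<open>d\<close>-th powers of the diameters; \<open>2 ^ d / unit_ball_vol d\<close> turns these
  powers into Hausdorff weights. The measure is a supremum over scales, so the single scale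
  \<open>h\<close> is enough.\<close>

lemma emeasure_tube_le:
  fixes A B :: "'e::euclidean_space set"
  assumes A: "A \<in> sets borel" "A \<subseteq> tube h m B" and h: "0 < h" and m: "norm m \<le> 1" and d: "DIM('e) = Suc d" "0 < d"
  shows "emeasure lborel A \<le> ennreal (tube_const TYPE('e) * 2 ^ d / unit_ball_vol d * h) * hausdorff_outer d B"
proof -
  define K where "K = tube_const TYPE('e)"
  have K: "0 \<le> K" by (simp add: K_def tube_const_nonneg)
  define c where "c = K * 2 ^ d / unit_ball_vol d * h"
  have c: "0 < unit_ball_vol (real d)" "0 \<le> c" using K h by (auto simp: c_def)
  have main: "emeasure lborel A \<le> ennreal c * (\<Sum>i. hausdorff_weight d h (X i))" if X: "B \<subseteq> (\<Union>i. X i)" for X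
  proof (cases "\<forall>i. X i = {} \<or> (bounded (X i) \<and> diameter (X i) \<le> h)")
    case False
    then obtain i where i: "X i \<noteq> {}" "\<not> (bounded (X i) \<and> diameter (X i) \<le> h)" by blast
    have "hausdorff_weight d h (X i) = \<infinity>" unfolding hausdorff_weight_def using i by (simp only: if_False)
    moreover have "hausdorff_weight d h (X i) \<le> (\<Sum>i. hausdorff_weight d h (X i))"
      using sum_le_suminf[of "\<lambda>i. hausdorff_weight d h (X i)" "{i}"] by simp
    ultimately have inf: "(\<Sum>i. hausdorff_weight d h (X i)) = \<infinity>" by (simp add: top_unique)
    show ?thesis
    proof (cases "c = 0")
      case True
      then have K0: "K = 0" using c(1) h by (simp add: c_def)
      have "unit_ball_vol (real DIM('e)) > 0" by simp
      then have "0 < K" unfolding K_def tube_const_def by simp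
      then show ?thesis using K0 by simp
    next
      case False
      then show ?thesis using inf c by (simp add: ennreal_mult_top)
    qed
  next
    case True
    show ?thesis
    proof (rule ennreal_le_epsilon)
      fix e :: real assume e: "0 < e"
      \<comment> \<open>Slack for sets of diameter zero, whose balls need a positive radius: the
        excesses \<open>K * h * \<epsilon> * (1 / 2) ^ i\<close> add up to at most
        \<open>e\<close>.\<close>
      define \<epsilon> where "\<epsilon> = e / (2 * (K * h + 1))"
      have \<epsilon>: "0 < \<epsilon>" using e K h by (simp add: \<epsilon>_def add_nonneg_pos)
      have "\<exists>U\<in>sets borel. tube h m (X i) \<subseteq> U \<and>
          emeasure lborel U \<le> ennreal c * hausdorff_weight d h (X i) + ennreal (K * h * \<epsilon>) * ennreal ((1 / 2) ^ i)" for i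
      proof (cases "X i = {}")
        case True
        then show ?thesis by (intro bexI[of _ "{}"]) (auto simp: tube_def)
      next
        case False
        then have b: "bounded (X i)" "diameter (X i) \<le> h" using True by auto
        define \<delta> where "\<delta> = diameter (X i)"
        have \<delta>: "0 \<le> \<delta>" unfolding \<delta>_def by (rule diameter_ge_0[OF b(1)])
        define \<eta> where "\<eta> = \<epsilon> * (1 / 2) ^ i"
        have \<eta>: "0 < \<eta>" using \<epsilon> by (simp add: \<eta>_def)
        \<comment> \<open>For diameter zero the radius is chosen such that
          \<open>\<rho> ^ d \<le> \<rho> \<le> \<eta>\<close>, by \<open>\<rho> \<le> 1\<close> and
          \<open>0 < d\<close>.\<close>
        define \<rho> where "\<rho> = (if 0 < \<delta> then \<delta> else min h (min 1 \<eta>))"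
        have \<rho>: "0 < \<rho>" "\<rho> \<le> h" "\<delta> \<le> \<rho>" using b h \<eta> \<delta> by (auto simp: \<rho>_def \<delta>_def)
        have \<rho>d: "\<rho> ^ d \<le> \<delta> ^ d + \<eta>"
        proof (cases "0 < \<delta>")
          case False
          then have "\<rho> = min h (min 1 \<eta>)" by (simp add: \<rho>_def)
          then have "\<rho> \<le> 1" "\<rho> \<le> \<eta>" by auto
          moreover have "\<rho> ^ d \<le> \<rho> ^ 1" using \<rho>(1) \<open>\<rho> \<le> 1\<close> d(2) by (intro power_decreasing) auto
          moreover have "0 \<le> \<delta> ^ d" using \<delta> by simp
          ultimately show ?thesis by simp
        qed (use \<eta> in \<open>simp add: \<rho>_def\<close>)
        obtain U where U: "U \<in> sets borel" "tube h m (X i) \<subseteq> U" "emeasure lborel U \<le> ennreal (K * h * \<rho> ^ d)"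
          using tube_cover[OF b(1) _ \<rho>(1,2) m d(1)] \<rho>(3) unfolding K_def \<delta>_def by blast
        note U(3)
        also have "ennreal (K * h * \<rho> ^ d) \<le> ennreal (K * h * (\<delta> ^ d + \<eta>))"
          using K h \<rho>d by (intro ennreal_leI mult_left_mono) auto
        also have "K * h * (\<delta> ^ d + \<eta>) = c * (unit_ball_vol d * (\<delta> / 2) ^ d) + (K * h * \<epsilon>) * (1 / 2) ^ i"
        proof -
          have "unit_ball_vol (real d) \<noteq> 0" using c(1) by linarith
          then show ?thesis by (simp add: c_def \<eta>_def power_divide algebra_simps)
        qed
        also have "ennreal \<dots> = ennreal c * hausdorff_weight d h (X i) + ennreal (K * h * \<epsilon>) * ennreal ((1 / 2) ^ i)"
          using False b c K h \<epsilon> \<delta> by (simp add: hausdorff_weight_def \<delta>_def[symmetric] ennreal_mult ennreal_plus)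
        finally show ?thesis using U by blast
      qed
      then obtain U where U: "\<And>i. U i \<in> sets borel" "\<And>i. tube h m (X i) \<subseteq> U i"
        "\<And>i. emeasure lborel (U i) \<le> ennreal c * hausdorff_weight d h (X i) + ennreal (K * h * \<epsilon>) * ennreal ((1 / 2) ^ i)"
        by metis
      have "A \<subseteq> (\<Union>i. U i)"
      proof
        fix z assume "z \<in> A"
        then obtain b s where z: "z = b + s *\<^sub>R m" "b \<in> B" "0 \<le> s" "s \<le> h" using A(2) by (auto simp: tube_def)
        then obtain i where "b \<in> X i" using X by blast
        then have "z \<in> tube h m (X i)" using z by (auto simp: tube_def)
        then show "z \<in> (\<Union>i. U i)" using U(2) by blast
      qed
      then have "emeasure lborel A \<le> emeasure lborel (\<Union>i. U i)"
        using U(1) by (intro emeasure_mono) auto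
      also have "\<dots> \<le> (\<Sum>i. emeasure lborel (U i))"
        using U(1) by (intro emeasure_subadditive_countably) auto
      also have "\<dots> \<le> (\<Sum>i. ennreal c * hausdorff_weight d h (X i) + ennreal (K * h * \<epsilon>) * ennreal ((1 / 2) ^ i))"
        by (intro suminf_le U(3)) auto
      also have "\<dots> = (\<Sum>i. ennreal c * hausdorff_weight d h (X i)) + (\<Sum>i. ennreal (K * h * \<epsilon>) * ennreal ((1 / 2) ^ i))"
        by (intro suminf_add[symmetric]) auto
      also have "(\<Sum>i. ennreal c * hausdorff_weight d h (X i)) = ennreal c * (\<Sum>i. hausdorff_weight d h (X i))"
        by simp
      also have "(\<Sum>i. ennreal (K * h * \<epsilon>) * ennreal ((1 / 2) ^ i)) = ennreal (K * h * \<epsilon>) * (\<Sum>i. ennreal ((1 / 2) ^ i))"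
        by simp
      also have "(\<Sum>i. ennreal ((1 / 2) ^ i)) = ennreal 2"
        by (subst suminf_ennreal2) (auto simp: summable_geometric suminf_geometric)
      also have "ennreal (K * h * \<epsilon>) * ennreal 2 \<le> ennreal e"
      proof -
        have "K * h * \<epsilon> * 2 \<le> (K * h + 1) * \<epsilon> * 2" using \<epsilon> by (simp add: algebra_simps)
        also have "\<dots> = e"
        proof -
          have "K * h + 1 \<noteq> 0" using K h by (smt (verit) mult_nonneg_nonneg)
          then show ?thesis by (simp add: \<epsilon>_def field_simps)
        qed
        finally show ?thesis using K h \<epsilon> by (simp add: ennreal_mult[symmetric] ennreal_leI del: ennreal_numeral)
      qed
      finally show "emeasure lborel A \<le> ennreal c * (\<Sum>i. hausdorff_weight d h (X i)) + ennreal e"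
        by (simp add: add_left_mono)
    qed
  qed
  have "emeasure lborel A \<le> ennreal c * outer_measure UNIV (hausdorff_weight d h) B"
  proof (cases "c = 0")
    case True
    have "B \<subseteq> (\<Union>i. (\<lambda>_::nat. B) i)" by auto
    from main[OF this] True show ?thesis by simp
  next
    case False
    then have "0 < c" using c by simp
    have "emeasure lborel A / ennreal c \<le> outer_measure UNIV (hausdorff_weight d h) B"
      unfolding outer_measure_def
    proof (rule INF_greatest)
      fix X :: "nat \<Rightarrow> 'e set" assume "X \<in> {A. range A \<subseteq> UNIV \<and> disjoint_family A \<and> B \<subseteq> (\<Union>i. A i)}"
      then have "emeasure lborel A \<le> (\<Sum>i. hausdorff_weight d h (X i)) * ennreal c"
        using main[of X] by (simp add: mult.commute)
      then show "emeasure lborel A / ennreal c \<le> (\<Sum>i. hausdorff_weight d h (X i))"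
        using \<open>0 < c\<close> by (intro divide_le_posI_ennreal) (auto simp: mult.commute)
    qed
    then have "ennreal c * (emeasure lborel A / ennreal c) \<le> ennreal c * outer_measure UNIV (hausdorff_weight d h) B"
      by (rule mult_left_mono) simp
    moreover have "(emeasure lborel A * ennreal c) / ennreal c = emeasure lborel A"
      by (rule mult_divide_eq_ennreal) (use \<open>0 < c\<close> in auto)
    ultimately show ?thesis
      by (simp add: ennreal_times_divide mult.commute)
  qed
  also have "\<dots> \<le> ennreal c * hausdorff_outer d B"
    unfolding hausdorff_outer_def using h by (intro mult_left_mono SUP_upper) auto
  finally show ?thesis by (simp add: c_def K_def)
qed

section \<open>Hardy's inequality near a Lipschitz boundary\<close>

text \<open>Measuring the distance to points outside \<open>\<Omega>\<close> makes the layer the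
  intersection of \<open>\<Omega>\<close> with a union of balls, hence open.\<close>

definition layer :: "'a::euclidean_space set \<Rightarrow> real \<Rightarrow> 'a set" where
  "layer \<Omega> \<delta> = {x\<in>\<Omega>. \<exists>z. z \<notin> \<Omega> \<and> dist x z < \<delta>}"

lemma open_layer: "open \<Omega> \<Longrightarrow> open (layer \<Omega> \<delta>)"
proof -
  have "layer \<Omega> \<delta> = \<Omega> \<inter> (\<Union>z\<in>-\<Omega>. ball z \<delta>)" by (auto simp: layer_def dist_commute)
  then show "open \<Omega> \<Longrightarrow> open (layer \<Omega> \<delta>)" by auto
qed

lemma layer_mono: "\<delta> \<le> \<delta>' \<Longrightarrow> layer \<Omega> \<delta> \<subseteq> layer \<Omega> \<delta>'"
  by (force simp: layer_def)

lemma layer_subset: "layer \<Omega> \<delta> \<subseteq> \<Omega>"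
  by (auto simp: layer_def)

definition sgrad :: "('a::euclidean_space \<times> real \<Rightarrow> real) \<Rightarrow> 'a \<times> real \<Rightarrow> 'a" where
  "sgrad \<phi> p = (\<Sum>i\<in>Basis. dir_deriv (i, 0) \<phi> p *\<^sub>R i)"

lemma sgrad_continuous: "smooth \<phi> \<Longrightarrow> continuous_on S (sgrad \<phi>)"
  unfolding sgrad_def by (intro continuous_intros smooth_continuous smooth_dir_deriv) auto

lemma sum_Basis_prod_real:
  fixes f :: "'a::euclidean_space \<times> real \<Rightarrow> real"
  shows "(\<Sum>b\<in>Basis. f b) = (\<Sum>i\<in>Basis. f (i, 0)) + f (0, 1)"
proof -
  have "(\<lambda>u::'a. (u, 0::real)) ` Basis \<inter> (\<lambda>v::real. (0::'a, v)) ` Basis = {}" by auto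
  then show ?thesis
    unfolding Basis_prod_def by (subst sum.union_disjoint) (auto simp: sum.reindex inj_on_def)
qed

lemma sgrad_line_derivative:
  assumes "smooth (\<phi> :: 'a::euclidean_space \<times> real \<Rightarrow> real)"
  shows "((\<lambda>s. \<phi> (p - s *\<^sub>R (n, 0))) has_real_derivative - (sgrad \<phi> (p - s *\<^sub>R (n, 0)) \<bullet> n)) (at s)"
proof -
  have "((\<lambda>s. \<phi> (p + s *\<^sub>R (- n, 0))) has_real_derivative
     (\<Sum>b\<in>Basis. ((- n, 0) \<bullet> b) * dir_deriv b \<phi> (p + s *\<^sub>R (- n, 0)))) (at s)"
    by (rule smooth_line_derivative[OF assms])
  also have "(\<Sum>b\<in>Basis. ((- n, 0) \<bullet> b) * dir_deriv b \<phi> (p + s *\<^sub>R (- n, 0)))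
      = - (sgrad \<phi> (p + s *\<^sub>R (- n, 0)) \<bullet> n)"
    by (subst sum_Basis_prod_real) (simp add: sgrad_def inner_sum_left inner_sum_right sum_negf inner_commute mult.commute)
  finally show ?thesis by (simp add: diff_conv_add_uminus scaleR_minus_right[symmetric] del: scaleR_minus_right)
qed

lemma emeasure_density_indicator:
  assumes "A \<in> sets M" "B \<in> sets M"
  shows "emeasure (density M (indicator A)) B = emeasure M (B \<inter> A)"
proof -
  have "emeasure (density M (indicator A)) B = (\<integral>\<^sup>+x. indicator A x * indicator B x \<partial>M)"
    using assms by (intro emeasure_density) auto
  also have "\<dots> = (\<integral>\<^sup>+x. indicator (B \<inter> A) x \<partial>M)"
    by (intro nn_integral_cong) (auto simp: indicator_def)
  finally show ?thesis using assms by simp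
qed

section \<open>The inequality in a single Lipschitz chart\<close>

locale lipschitz_chart =
  fixes \<Omega> :: "'a::euclidean_space set" and p :: 'a and r :: real and n :: 'a and \<gamma> :: "'a \<Rightarrow> real" and L :: real
  assumes op: "open \<Omega>" and r: "0 < r" and n: "norm n = 1" and \<gamma>: "L-lipschitz_on {z. z \<bullet> n = 0} \<gamma>"
    and chart: "\<And>z. z \<in> ball p r \<Longrightarrow> z \<in> \<Omega> \<longleftrightarrow> \<gamma> (z - (z \<bullet> n) *\<^sub>R n) < z \<bullet> n"
begin

text \<open>Signed height above the boundary graph. Within the chart it is positive exactly on
  \<open>\<Omega>\<close> and zero exactly on the frontier, and unlike the distance to the frontier
  it changes at unit speed along \<open>n\<close>; \<open>\<sigma>\<close> is the foot point on the
  graph.\<close>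

definition \<tau> :: "'a \<Rightarrow> real" where "\<tau> z = z \<bullet> n - \<gamma> (z - (z \<bullet> n) *\<^sub>R n)"

definition \<sigma> :: "'a \<Rightarrow> 'a" where "\<sigma> z = z - \<tau> z *\<^sub>R n"

lemma nn: "n \<bullet> n = 1" using n by (simp add: dot_square_norm)

lemma L: "0 \<le> L" by (rule lipschitz_on_nonneg[OF \<gamma>])

lemma mem_iff: "z \<in> ball p r \<Longrightarrow> z \<in> \<Omega> \<longleftrightarrow> 0 < \<tau> z"
  using chart by (simp add: \<tau>_def)

lemma \<tau>_shift: "\<tau> (z + s *\<^sub>R n) = \<tau> z + s"
proof -
  have "z + s *\<^sub>R n - ((z + s *\<^sub>R n) \<bullet> n) *\<^sub>R n = z - (z \<bullet> n) *\<^sub>R n"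
    by (simp add: inner_add_left nn algebra_simps)
  then show ?thesis unfolding \<tau>_def by (simp only:) (simp add: inner_add_left nn)
qed

lemma \<tau>_shift_minus: "\<tau> (z - s *\<^sub>R n) = \<tau> z - s"
  using \<tau>_shift[of z "- s"] by simp

lemma \<tau>_\<sigma>: "\<tau> (\<sigma> z) = 0"
  by (simp add: \<sigma>_def \<tau>_shift_minus)

text \<open>The vertical coordinate contributes 1. The graph function contributes \<open>L\<close>,
  since it is composed with the orthogonal projection \<open>P\<close>, which does not increase
  distances.\<close>

lemma \<tau>_lipschitz: "\<bar>\<tau> z - \<tau> z'\<bar> \<le> (1 + L) * dist z z'"
proof -
  define P where "P z = z - (z \<bullet> n) *\<^sub>R n" for z
  have P0: "P z \<in> {z. z \<bullet> n = 0}" for z by (simp add: P_def inner_diff_left nn)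
  have "dist (P z) (P z') \<le> dist z z'"
  proof -
    have eq: "P z - P z' = P (z - z')" by (simp add: P_def algebra_simps inner_diff_left)
    have "(norm (P u))\<^sup>2 \<le> (norm u)\<^sup>2" for u
      by (simp add: P_def power2_norm_eq_inner inner_diff_left inner_diff_right nn inner_commute)
    then have "norm (P u) \<le> norm u" for u by (rule power2_le_imp_le) simp
    then show ?thesis by (simp add: dist_norm eq)
  qed
  then have "dist (\<gamma> (P z)) (\<gamma> (P z')) \<le> L * dist z z'"
    using lipschitz_onD[OF \<gamma> P0 P0] L by (meson mult_left_mono order_trans)
  moreover have "\<bar>z \<bullet> n - z' \<bullet> n\<bar> \<le> dist z z'"
    using Cauchy_Schwarz_ineq2[of "z - z'" n] by (simp add: inner_diff_left n dist_norm)
  ultimately show ?thesis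
    by (simp add: \<tau>_def P_def dist_real_def algebra_simps)
qed

lemma \<tau>_continuous: "continuous_on S \<tau>"
proof -
  have "(1 + L)-lipschitz_on S \<tau>"
    by (rule lipschitz_onI) (use \<tau>_lipschitz L in \<open>auto simp: dist_real_def\<close>)
  then show ?thesis by (rule lipschitz_on_continuous_on)
qed

text \<open>Where \<open>\<tau>\<close> is negative, a whole neighbourhood misses
  \<open>\<Omega>\<close>; where it is zero, small shifts along \<open>n\<close> lead into
  \<open>\<Omega>\<close>.\<close>

lemma frontier_iff:
  assumes z: "z \<in> ball p r"
  shows "z \<in> frontier \<Omega> \<longleftrightarrow> \<tau> z = 0"
proof
  assume f: "z \<in> frontier \<Omega>"
  have "z \<notin> \<Omega>" using f op by (auto simp: frontier_def interior_open)
  then have le: "\<tau> z \<le> 0" using mem_iff[OF z] by simp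
  show "\<tau> z = 0"
  proof (rule ccontr)
    assume "\<tau> z \<noteq> 0"
    then have "\<tau> z < 0" using le by simp
    moreover have "open {x. \<tau> x < 0}" by (intro open_Collect_less \<tau>_continuous continuous_intros)
    ultimately have "open ({x. \<tau> x < 0} \<inter> ball p r)" "z \<in> {x. \<tau> x < 0} \<inter> ball p r" using z by auto
    moreover have "({x. \<tau> x < 0} \<inter> ball p r) \<inter> \<Omega> = {}" using mem_iff by force
    ultimately have "z \<notin> closure \<Omega>" using open_Int_closure_eq_empty by blast
    then show False using f by (simp add: frontier_def)
  qed
next
  assume 0: "\<tau> z = 0"
  have "z \<notin> \<Omega>" using mem_iff[OF z] 0 by simp
  moreover have "z \<in> closure \<Omega>"
    unfolding closure_approachable
  proof (intro allI impI)
    fix e :: real assume e: "0 < e"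
    define s where "s = min (e / 2) ((r - dist p z) / 2)"
    have s: "0 < s" "s < e" "s < r - dist p z" using e z by (auto simp: s_def min_def)
    have "dist p (z + s *\<^sub>R n) \<le> dist p z + s"
      using dist_triangle[of p "z + s *\<^sub>R n" z] n s by (simp add: dist_norm)
    then have "z + s *\<^sub>R n \<in> ball p r" using s by simp
    then have "z + s *\<^sub>R n \<in> \<Omega>" using mem_iff \<tau>_shift[of z s] 0 s by simp
    then show "\<exists>y\<in>\<Omega>. dist y z < e" using s n by (intro bexI[of _ "z + s *\<^sub>R n"]) (auto simp: dist_norm)
  qed
  ultimately show "z \<in> frontier \<Omega>" using op by (simp add: frontier_def interior_open)
qed

text \<open>Some point within \<open>\<delta>\<close> lies outside \<open>\<Omega>\<close> and thus
  has height at most 0, and \<open>\<tau>\<close> is Lipschitz. The two radii \<open>r / 4\<close>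
  keep that point inside the chart.\<close>

lemma layer_height:
  assumes x: "x \<in> layer \<Omega> \<delta>" "x \<in> ball p (r / 4)" and \<delta>: "\<delta> \<le> r / 4"
  shows "0 < \<tau> x" "\<tau> x < (1 + L) * \<delta>"
proof -
  have xr: "x \<in> ball p r" using x(2) r by auto
  have "x \<in> \<Omega>" using x(1) layer_subset by blast
  then show "0 < \<tau> x" using mem_iff[OF xr] by simp
  obtain z where z: "z \<notin> \<Omega>" "dist x z < \<delta>" using x(1) by (auto simp: layer_def)
  have "z \<in> ball p r" using z(2) x(2) \<delta> r dist_triangle[of p z x] by simp
  then have "\<tau> z \<le> 0" using mem_iff z(1) by force
  moreover have "\<tau> x - \<tau> z \<le> (1 + L) * dist x z" using \<tau>_lipschitz[of x z] by linarith
  moreover have "(1 + L) * dist x z < (1 + L) * \<delta>" using z(2) L by (intro mult_strict_left_mono) auto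
  ultimately show "\<tau> x < (1 + L) * \<delta>" by linarith
qed

text \<open>From each point one descends along \<open>n\<close> to its foot point. Integrating the
  foot value transports volume to the surface by \<open>S\<close>, which by
  \<open>emeasure_tube_le\<close> costs a multiple of \<open>h\<close>. The gradient along the
  descent contributes one \<open>h\<close> from the length of the path and another from exchanging
  the integrals.\<close>

lemma hardy_local:
  assumes \<phi>: "smooth \<phi>" and T: "0 < T" and h: "0 < h" "h \<le> r / 4"
  defines "U \<equiv> {x \<in> ball p (r / 4). 0 < \<tau> x \<and> \<tau> x < h}"
  shows "(\<integral>\<^sup>+q. ennreal ((\<phi> q)\<^sup>2) * indicator (U \<times> {0<..<T}) q \<partial>lborel)
    \<le> ennreal (2 * (tube_const TYPE('a \<times> real) * 2 ^ DIM('a) / unit_ball_vol DIM('a)) * h) *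
        (\<integral>\<^sup>+q. ennreal ((\<phi> q)\<^sup>2) \<partial>surface_measure \<Omega> T)
      + ennreal (2 * h\<^sup>2) * (\<integral>\<^sup>+q. ennreal ((norm (sgrad \<phi> q))\<^sup>2) * indicator (layer \<Omega> h \<times> {0<..<T}) q \<partial>lborel)"
proof -
  note [measurable] = smooth_borel[OF \<phi>]
  have [measurable]: "sgrad \<phi> \<in> borel_measurable borel"
    by (intro borel_measurable_continuous_onI sgrad_continuous \<phi>)
  have oU: "open U"
  proof -
    have "open {x. 0 < \<tau> x}" "open {x. \<tau> x < h}" by (intro open_Collect_less \<tau>_continuous continuous_intros)+
    then have "open (ball p (r / 4) \<inter> {x. 0 < \<tau> x} \<inter> {x. \<tau> x < h})" by (intro open_Int) auto
    moreover have "U = ball p (r / 4) \<inter> {x. 0 < \<tau> x} \<inter> {x. \<tau> x < h}" by (auto simp: U_def)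
    ultimately show ?thesis by simp
  qed
  define UT where "UT = U \<times> {0<..<T}"
  define E where "E = layer \<Omega> h \<times> {0<..<T}"
  have [measurable]: "UT \<in> sets borel" "E \<in> sets borel"
    unfolding UT_def E_def using oU open_layer[OF op] by (auto intro!: borel_open open_Times)
  define S where "S q = (\<sigma> (fst q), snd q)" for q :: "'a \<times> real"
  have Sc: "continuous_on UNIV S"
    unfolding S_def[abs_def] \<sigma>_def by (intro continuous_intros continuous_on_compose2[OF \<tau>_continuous[of UNIV]]) auto
  have [measurable]: "S \<in> borel_measurable borel" by (rule borel_measurable_continuous_onI[OF Sc])
  \<comment> \<open>The foot point lies on the frontier, hence outside \<open>\<Omega>\<close>, and
    all points of the vertical segment above it are within \<open>h\<close> of it; so the segment
    stays in the layer.\<close>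
  have inU: "\<sigma> x \<in> frontier \<Omega>" "\<And>s. 0 < s \<Longrightarrow> s < \<tau> x \<Longrightarrow> x - s *\<^sub>R n \<in> layer \<Omega> h" if x: "x \<in> U" for x
  proof -
    have x': "dist p x < r / 4" "0 < \<tau> x" "\<tau> x < h" using x by (auto simp: U_def)
    have near: "x - s *\<^sub>R n \<in> ball p r" if "0 \<le> s" "s \<le> \<tau> x" for s
    proof -
      have "dist x (x - s *\<^sub>R n) = s" using that n by (simp add: dist_norm)
      then show ?thesis using dist_triangle[of p "x - s *\<^sub>R n" x] x' h that r unfolding mem_ball by linarith
    qed
    show f: "\<sigma> x \<in> frontier \<Omega>"
      using frontier_iff[of "\<sigma> x"] near[of "\<tau> x"] x' \<tau>_\<sigma>[of x] by (simp add: \<sigma>_def)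
    then have "\<sigma> x \<notin> \<Omega>" using op by (auto simp: frontier_def interior_open)
    fix s assume s: "0 < s" "s < \<tau> x"
    have "x - s *\<^sub>R n \<in> \<Omega>" using mem_iff[OF near[of s]] s by (simp add: \<tau>_shift_minus)
    moreover have "x - s *\<^sub>R n - \<sigma> x = (\<tau> x - s) *\<^sub>R n" by (simp add: \<sigma>_def algebra_simps)
    then have "dist (x - s *\<^sub>R n) (\<sigma> x) = \<tau> x - s" using s n by (simp add: dist_norm)
    ultimately show "x - s *\<^sub>R n \<in> layer \<Omega> h" using \<open>\<sigma> x \<notin> \<Omega>\<close> s x' unfolding layer_def by force
  qed
  define H where "H q = ennreal ((norm (sgrad \<phi> q))\<^sup>2) * indicator E q" for q
  have [measurable]: "H \<in> borel_measurable borel" unfolding H_def[abs_def] by measurable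
  \<comment> \<open>The path has length \<open>\<tau> x < h\<close>. Its integral may be extended to
    all \<open>s\<close> in \<open>(0, h)\<close> because \<open>H\<close> is nonnegative;
    \<open>H\<close> carries the restriction to the layer.\<close>
  have pt: "ennreal ((\<phi> q)\<^sup>2) * indicator UT q \<le> 2 * (ennreal ((\<phi> (S q))\<^sup>2) * indicator UT q)
      + ennreal (2 * h) * (\<integral>\<^sup>+s. H (q - s *\<^sub>R (n, 0)) * indicator {0<..<h} s \<partial>lborel)" for q
  proof (cases "q \<in> UT")
    case True
    obtain x t where q: "q = (x, t)" by (cases q)
    have x: "x \<in> U" "0 < t" "t < T" using True by (auto simp: UT_def q)
    have \<tau>x: "0 < \<tau> x" "\<tau> x < h" using x by (auto simp: U_def)
    define f where "f s = \<phi> (q - s *\<^sub>R (n, 0))" for s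
    define f' where "f' s = - (sgrad \<phi> (q - s *\<^sub>R (n, 0)) \<bullet> n)" for s
    have f'c: "continuous_on UNIV f'"
      unfolding f'_def by (intro continuous_intros continuous_on_compose2[OF sgrad_continuous[OF \<phi>, of UNIV]]) auto
    have "(f 0 - f (\<tau> x))\<^sup>2 \<le> \<bar>0 - \<tau> x\<bar> * integral {0..\<tau> x} (\<lambda>s. (f' s)\<^sup>2)"
    proof (rule square_diff_le_integral[OF _ f'c])
      show "(f has_real_derivative f' s) (at s)" for s
        unfolding f_def[abs_def] f'_def by (rule sgrad_line_derivative[OF \<phi>])
    qed (use \<tau>x in auto)
    moreover have "f 0 = \<phi> q" "f (\<tau> x) = \<phi> (S q)" by (auto simp: f_def S_def q \<sigma>_def)
    moreover have I0: "0 \<le> integral {0..\<tau> x} (\<lambda>s. (f' s)\<^sup>2)"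
      by (intro integral_nonneg integrable_continuous_interval continuous_intros continuous_on_subset[OF f'c]) auto
    ultimately have "(\<phi> q - \<phi> (S q))\<^sup>2 \<le> h * integral {0..\<tau> x} (\<lambda>s. (f' s)\<^sup>2)"
      using \<tau>x mult_right_mono[OF less_imp_le[OF \<tau>x(2)] I0] by simp
    moreover have "(\<phi> q)\<^sup>2 \<le> 2 * (\<phi> (S q))\<^sup>2 + 2 * (\<phi> q - \<phi> (S q))\<^sup>2"
      using zero_le_power2[of "2 * \<phi> (S q) - \<phi> q"] by (simp add: power2_eq_square algebra_simps)
    ultimately have "(\<phi> q)\<^sup>2 \<le> 2 * (\<phi> (S q))\<^sup>2 + 2 * h * integral {0..\<tau> x} (\<lambda>s. (f' s)\<^sup>2)" by linarith
    then have "ennreal ((\<phi> q)\<^sup>2) \<le> ennreal (2 * (\<phi> (S q))\<^sup>2 + 2 * h * integral {0..\<tau> x} (\<lambda>s. (f' s)\<^sup>2))"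
      by (rule ennreal_leI)
    also have "\<dots> = 2 * ennreal ((\<phi> (S q))\<^sup>2) + ennreal (2 * h) * ennreal (integral {0..\<tau> x} (\<lambda>s. (f' s)\<^sup>2))"
      using h I0 by (simp add: ennreal_plus ennreal_mult)
    also have "ennreal (integral {0..\<tau> x} (\<lambda>s. (f' s)\<^sup>2)) = (\<integral>\<^sup>+s. ennreal ((f' s)\<^sup>2) * indicator {0<..<\<tau> x} s \<partial>lborel)"
    proof (rule nn_integral_has_integral_lebesgue'[symmetric])
      have "(\<lambda>s. (f' s)\<^sup>2) integrable_on {0..\<tau> x}"
        by (intro integrable_continuous_interval continuous_intros continuous_on_subset[OF f'c]) auto
      then show "((\<lambda>s. (f' s)\<^sup>2) has_integral integral {0..\<tau> x} (\<lambda>s. (f' s)\<^sup>2)) {0<..<\<tau> x}"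
        by (simp add: has_integral_Icc_iff_Ioo[symmetric] integrable_integral)
    qed simp
    also have "\<dots> \<le> (\<integral>\<^sup>+s. H (q - s *\<^sub>R (n, 0)) * indicator {0<..<h} s \<partial>lborel)"
    proof (rule nn_integral_mono)
      fix s
      have "(f' s)\<^sup>2 \<le> (norm (sgrad \<phi> (q - s *\<^sub>R (n, 0))))\<^sup>2"
        using power_mono[OF Cauchy_Schwarz_ineq2[of "sgrad \<phi> (q - s *\<^sub>R (n, 0))" n], of 2] by (simp add: f'_def n)
      moreover have "q - s *\<^sub>R (n, 0) \<in> E" if "0 < s" "s < \<tau> x"
        using inU(2)[OF x(1) that] x by (simp add: E_def q)
      ultimately show "ennreal ((f' s)\<^sup>2) * indicator {0<..<\<tau> x} s \<le> H (q - s *\<^sub>R (n, 0)) * indicator {0<..<h} s"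
        using \<tau>x by (auto simp: H_def indicator_def intro: ennreal_leI)
    qed
    finally show ?thesis using True by (simp add: mult_left_mono add_left_mono)
  qed simp
  have "(\<integral>\<^sup>+q. ennreal ((\<phi> q)\<^sup>2) * indicator UT q \<partial>lborel)
      \<le> (\<integral>\<^sup>+q. 2 * (ennreal ((\<phi> (S q))\<^sup>2) * indicator UT q) + ennreal (2 * h) * (\<integral>\<^sup>+s. H (q - s *\<^sub>R (n, 0)) * indicator {0<..<h} s \<partial>lborel) \<partial>lborel)"
    by (rule nn_integral_mono[OF pt])
  also have "\<dots> = 2 * (\<integral>\<^sup>+q. ennreal ((\<phi> (S q))\<^sup>2) * indicator UT q \<partial>lborel)
      + ennreal (2 * h) * (\<integral>\<^sup>+q. (\<integral>\<^sup>+s. H (q - s *\<^sub>R (n, 0)) * indicator {0<..<h} s \<partial>lborel) \<partial>lborel)"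
    by (subst nn_integral_add) (auto simp: nn_integral_cmult)
  \<comment> \<open>For fixed \<open>s\<close> the integrand is a translate of \<open>H\<close>, so
    that only the length \<open>h\<close> of the parameter interval remains.\<close>
  also have "(\<integral>\<^sup>+q. (\<integral>\<^sup>+s. H (q - s *\<^sub>R (n, 0)) * indicator {0<..<h} s \<partial>lborel) \<partial>lborel) = ennreal h * (\<integral>\<^sup>+q. H q \<partial>lborel)"
  proof -
    have "(\<integral>\<^sup>+q. (\<integral>\<^sup>+s. H (q - s *\<^sub>R (n, 0)) * indicator {0<..<h} s \<partial>lborel) \<partial>lborel)
        = (\<integral>\<^sup>+s. (\<integral>\<^sup>+q. H (q - s *\<^sub>R (n, 0)) * indicator {0<..<h} s \<partial>lborel) \<partial>lborel)"
      by (rule lborel_pair.Fubini'[symmetric]) measurable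
    also have "\<dots> = (\<integral>\<^sup>+s. (\<integral>\<^sup>+q. H q \<partial>lborel) * indicator {0<..<h} s \<partial>lborel)"
    proof (rule nn_integral_cong)
      fix s :: real
      have "(\<integral>\<^sup>+q. H (q - s *\<^sub>R (n, 0)) * indicator {0<..<h} s \<partial>lborel) = (\<integral>\<^sup>+q. H (q - s *\<^sub>R (n, 0)) \<partial>lborel) * indicator {0<..<h} s"
        by (rule nn_integral_multc) simp
      also have "(\<integral>\<^sup>+q. H (q - s *\<^sub>R (n, 0)) \<partial>lborel) = (\<integral>\<^sup>+q. H q \<partial>lborel)"
        using nn_integral_lborel_translate[of H "- (s *\<^sub>R (n, 0))"] by (simp only: diff_conv_add_uminus) simp
      finally show "(\<integral>\<^sup>+q. H (q - s *\<^sub>R (n, 0)) * indicator {0<..<h} s \<partial>lborel) = (\<integral>\<^sup>+q. H q \<partial>lborel) * indicator {0<..<h} s" .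
    qed
    also have "\<dots> = (\<integral>\<^sup>+q. H q \<partial>lborel) * ennreal h"
      using h by (simp add: nn_integral_cmult_indicator)
    finally show ?thesis by (simp add: mult.commute)
  qed
  finally have main: "(\<integral>\<^sup>+q. ennreal ((\<phi> q)\<^sup>2) * indicator UT q \<partial>lborel)
      \<le> 2 * (\<integral>\<^sup>+q. ennreal ((\<phi> (S q))\<^sup>2) * indicator UT q \<partial>lborel) + ennreal (2 * h) * (ennreal h * (\<integral>\<^sup>+q. H q \<partial>lborel))" .
  have surf: "(\<integral>\<^sup>+q. ennreal ((\<phi> (S q))\<^sup>2) * indicator UT q \<partial>lborel)
      \<le> ennreal (tube_const TYPE('a \<times> real) * 2 ^ DIM('a) / unit_ball_vol DIM('a) * h) * (\<integral>\<^sup>+q. ennreal ((\<phi> q)\<^sup>2) \<partial>surface_measure \<Omega> T)"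
  proof -
    define c where "c = ennreal (tube_const TYPE('a \<times> real) * 2 ^ DIM('a) / unit_ball_vol DIM('a) * h)"
    define HM where "HM = (hausdorff_measure DIM('a) :: ('a \<times> real) measure)"
    have HMs: "sets HM = sets borel" by (simp add: HM_def)
    have lat: "lateral \<Omega> T \<in> sets borel"
    proof -
      have "lateral \<Omega> T = (frontier \<Omega> \<times> UNIV) \<inter> (UNIV \<times> {0<..<T})" by (auto simp: lateral_def)
      moreover have "frontier \<Omega> \<times> (UNIV :: real set) \<in> sets borel" by (intro borel_closed closed_Times) auto
      moreover have "(UNIV :: 'a set) \<times> {0<..<T} \<in> sets borel" by (intro borel_open open_Times) auto
      ultimately show ?thesis by auto
    qed
    \<comment> \<open>The image of volume on \<open>UT\<close> under \<open>S\<close>. It is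
      dominated by a multiple of the surface measure as a measure, because preimages under
      \<open>S\<close> lie in tubes over the boundary.\<close>
    define \<nu> where "\<nu> = distr (density lborel (indicator UT)) borel S"
    define N where "N = scale_measure c (density HM (indicator (lateral \<Omega> T)))"
    have sN: "sets \<nu> = sets N" by (simp add: \<nu>_def N_def HMs)
    have "\<nu> \<le> N"
    proof -
      have "emeasure \<nu> B \<le> emeasure N B" for B
      proof (cases "B \<in> sets borel")
        case B: True
        have "emeasure \<nu> B = emeasure lborel (S -` B \<inter> UT)"
          unfolding \<nu>_def using B measurable_sets[of S borel borel B]
          by (subst emeasure_distr) (auto simp: emeasure_density_indicator)
        also have "\<dots> \<le> c * hausdorff_outer DIM('a) (B \<inter> lateral \<Omega> T)"
          unfolding c_def
        proof (rule emeasure_tube_le[where m="(n, 0)"])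
          show "S -` B \<inter> UT \<in> sets borel" using B measurable_sets[of S borel borel B] by simp
          show "S -` B \<inter> UT \<subseteq> tube h (n, 0) (B \<inter> lateral \<Omega> T)"
          proof
            fix q assume q: "q \<in> S -` B \<inter> UT"
            obtain x t where xt: "q = (x, t)" by (cases q)
            have x: "x \<in> U" "0 < t" "t < T" using q by (auto simp: UT_def xt)
            have "S q \<in> B \<inter> lateral \<Omega> T" using q inU(1)[OF x(1)] x by (auto simp: S_def xt lateral_def)
            moreover have "q = S q + \<tau> x *\<^sub>R (n, 0)" by (simp add: S_def xt \<sigma>_def)
            moreover have "0 \<le> \<tau> x" "\<tau> x \<le> h" using x by (auto simp: U_def)
            ultimately show "q \<in> tube h (n, 0) (B \<inter> lateral \<Omega> T)" unfolding tube_def by blast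
          qed
        qed (use h n in \<open>auto simp: norm_Pair\<close>)
        also have "hausdorff_outer DIM('a) (B \<inter> lateral \<Omega> T) = emeasure HM (B \<inter> lateral \<Omega> T)"
          unfolding HM_def using B lat by (simp add: emeasure_hausdorff_measure)
        also have "\<dots> = emeasure (density HM (indicator (lateral \<Omega> T))) B"
          using B lat HMs by (subst emeasure_density_indicator) auto
        finally show ?thesis by (simp add: N_def)
      next
        case False
        then show ?thesis using emeasure_notin_sets[of B \<nu>] by (simp add: \<nu>_def)
      qed
      then show ?thesis
        using sN sets_eq_imp_space_eq[OF sN] by (simp add: le_measure_iff le_fun_def)
    qed
    then have "(\<integral>\<^sup>+q. ennreal ((\<phi> q)\<^sup>2) \<partial>\<nu>) \<le> (\<integral>\<^sup>+q. ennreal ((\<phi> q)\<^sup>2) \<partial>N)"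
      by (rule nn_integral_mono_measure[OF sN])
    moreover have "(\<integral>\<^sup>+q. ennreal ((\<phi> q)\<^sup>2) \<partial>\<nu>) = (\<integral>\<^sup>+q. ennreal ((\<phi> (S q))\<^sup>2) * indicator UT q \<partial>lborel)"
      unfolding \<nu>_def by (subst nn_integral_distr) (auto simp: nn_integral_density mult.commute)
    moreover have "(\<integral>\<^sup>+q. ennreal ((\<phi> q)\<^sup>2) \<partial>N) = c * (\<integral>\<^sup>+q. ennreal ((\<phi> q)\<^sup>2) \<partial>surface_measure \<Omega> T)"
    proof -
      have m: "(\<lambda>q. ennreal ((\<phi> q)\<^sup>2)) \<in> borel_measurable HM"
        by (subst measurable_cong_sets[OF HMs refl]) measurable
      have i: "(indicator (lateral \<Omega> T) :: _ \<Rightarrow> ennreal) \<in> borel_measurable HM"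
        using lat HMs by (intro borel_measurable_indicator) auto
      have "(\<integral>\<^sup>+q. ennreal ((\<phi> q)\<^sup>2) \<partial>N) = c * (\<integral>\<^sup>+q. indicator (lateral \<Omega> T) q * ennreal ((\<phi> q)\<^sup>2) \<partial>HM)"
        unfolding N_def using m i by (subst nn_integral_scale_measure) (auto simp: nn_integral_density)
      also have "(\<integral>\<^sup>+q. indicator (lateral \<Omega> T) q * ennreal ((\<phi> q)\<^sup>2) \<partial>HM) = (\<integral>\<^sup>+q. ennreal ((\<phi> q)\<^sup>2) \<partial>surface_measure \<Omega> T)"
        unfolding surface_measure_def HM_def[symmetric] using lat HMs by (subst nn_integral_restrict_space) (auto simp: mult.commute)
      finally show ?thesis .
    qed
    ultimately show ?thesis by (simp add: c_def)
  qed
  define k where "k = tube_const TYPE('a \<times> real) * 2 ^ DIM('a) / unit_ball_vol DIM('a) * h"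
  have k: "0 \<le> k" using h tube_const_nonneg[where 'e="'a \<times> real"] by (simp add: k_def)
  define Y where "Y = (\<integral>\<^sup>+q. ennreal ((\<phi> q)\<^sup>2) \<partial>surface_measure \<Omega> T)"
  have "(\<integral>\<^sup>+q. ennreal ((\<phi> q)\<^sup>2) * indicator UT q \<partial>lborel)
      \<le> 2 * (ennreal k * Y) + ennreal (2 * h) * (ennreal h * (\<integral>\<^sup>+q. H q \<partial>lborel))"
    by (rule order_trans[OF main add_right_mono[OF mult_left_mono[OF surf[folded k_def Y_def]]]]) simp
  also have "2 * (ennreal k * Y) = ennreal (2 * k) * Y"
    using k by (simp add: ennreal_mult mult.assoc)
  also have "ennreal (2 * h) * (ennreal h * (\<integral>\<^sup>+q. H q \<partial>lborel)) = ennreal (2 * h\<^sup>2) * (\<integral>\<^sup>+q. H q \<partial>lborel)"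
    using h by (simp add: ennreal_mult power2_eq_square mult.assoc)
  finally show ?thesis
    unfolding UT_def[symmetric] E_def[symmetric] H_def k_def Y_def by (simp only: mult.assoc)
qed

end

text \<open>The segment from \<open>x\<close> to a nearby point outside \<open>\<Omega>\<close> has
  to cross the frontier.\<close>

lemma layer_near_frontier:
  assumes "x \<in> layer \<Omega> \<delta>"
  shows "\<exists>q\<in>frontier \<Omega>. dist x q < \<delta>"
proof -
  obtain z where z: "x \<in> \<Omega>" "z \<notin> \<Omega>" "dist x z < \<delta>" using assms by (auto simp: layer_def)
  have "closed_segment x z \<inter> frontier \<Omega> \<noteq> {}"
    by (rule connected_Int_frontier) (use z in auto)
  then obtain q where q: "q \<in> closed_segment x z" "q \<in> frontier \<Omega>" by blast
  then have "dist x q \<le> dist x z"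
    using segment_bound1[of q x z] by (simp add: dist_norm norm_minus_commute)
  then have "dist x q < \<delta>" using z(3) by linarith
  then show ?thesis using q(2) by (rule bexI)
qed

text \<open>One constant serves in both coefficients and in the width of the layer. The expression
  is then monotone in \<open>C\<close>, so that bounds from finitely many charts can be brought to a
  common form and added.\<close>

definition hardy_rhs :: "'a::euclidean_space set \<Rightarrow> real \<Rightarrow> real \<Rightarrow> real \<Rightarrow> ('a \<times> real \<Rightarrow> real) \<Rightarrow> ennreal" where
  "hardy_rhs \<Omega> T C \<delta> \<phi> = ennreal (C * \<delta>) * (\<integral>\<^sup>+q. ennreal ((\<phi> q)\<^sup>2) \<partial>surface_measure \<Omega> T)
     + ennreal (C * \<delta>\<^sup>2) * (\<integral>\<^sup>+q. ennreal ((norm (sgrad \<phi> q))\<^sup>2) * indicator (layer \<Omega> (C * \<delta>) \<times> {0<..<T}) q \<partial>lborel)"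

lemma hardy_rhs_mono:
  assumes "0 \<le> C" "C \<le> C'" "0 \<le> \<delta>"
  shows "hardy_rhs \<Omega> T C \<delta> \<phi> \<le> hardy_rhs \<Omega> T C' \<delta> \<phi>"
proof -
  have c: "C * \<delta> \<le> C' * \<delta>" "C * \<delta>\<^sup>2 \<le> C' * \<delta>\<^sup>2" using assms by (auto intro: mult_right_mono)
  have "indicator (layer \<Omega> (C * \<delta>) \<times> {0<..<T}) q \<le> (indicator (layer \<Omega> (C' * \<delta>) \<times> {0<..<T}) q :: ennreal)" for q
    using layer_mono[OF c(1), of \<Omega>] by (auto simp: indicator_def)
  then have "(\<integral>\<^sup>+q. ennreal ((norm (sgrad \<phi> q))\<^sup>2) * indicator (layer \<Omega> (C * \<delta>) \<times> {0<..<T}) q \<partial>lborel)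
      \<le> (\<integral>\<^sup>+q. ennreal ((norm (sgrad \<phi> q))\<^sup>2) * indicator (layer \<Omega> (C' * \<delta>) \<times> {0<..<T}) q \<partial>lborel)"
    by (intro nn_integral_mono mult_left_mono) auto
  then show ?thesis
    unfolding hardy_rhs_def by (intro add_mono mult_mono ennreal_leI c order_refl) auto
qed

lemma hardy_at_point:
  assumes dom: "bounded_lipschitz_domain \<Omega>" and T: "0 < T" and p: "p \<in> frontier \<Omega>"
  shows "\<exists>\<rho>>0. \<exists>C>0. \<exists>d>0. \<forall>\<delta> \<phi>. 0 < \<delta> \<and> \<delta> \<le> d \<and> smooth \<phi> \<longrightarrow>
    (\<integral>\<^sup>+q. ennreal ((\<phi> q)\<^sup>2) * indicator ((layer \<Omega> \<delta> \<inter> ball p \<rho>) \<times> {0<..<T}) q \<partial>lborel) \<le> hardy_rhs \<Omega> T C \<delta> \<phi>"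
proof -
  obtain r n \<gamma> L where ch: "0 < r" "norm n = 1" "L-lipschitz_on {z. z \<bullet> n = 0} \<gamma>"
      "\<forall>z\<in>ball p r. z \<in> \<Omega> \<longleftrightarrow> z \<bullet> n > \<gamma> (z - (z \<bullet> n) *\<^sub>R n)"
    using dom p unfolding bounded_lipschitz_domain_def lipschitz_boundary_def by blast
  interpret lipschitz_chart \<Omega> p r n \<gamma> L
    by unfold_locales (use dom ch in \<open>auto simp: bounded_lipschitz_domain_def\<close>)
  define K where "K = tube_const TYPE('a \<times> real) * 2 ^ DIM('a) / unit_ball_vol DIM('a)"
  have K: "0 \<le> K" using tube_const_nonneg[where 'e="'a \<times> real"] by (simp add: K_def)
  \<comment> \<open>At height \<open>h = (1 + L) * \<delta>\<close> the coefficients of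
    \<open>hardy_local\<close> are \<open>2 * K * h\<close> and \<open>2 * h\<^sup>2\<close>; the
    two summands cover them, and \<open>1 + L \<le> C\<close> covers the width of the layer.\<close>
  define C where "C = 2 * K * (1 + L) + 2 * (1 + L)\<^sup>2"
  have L1: "1 \<le> 1 + L" using L by simp
  have C: "1 + L \<le> C" "0 < C"
  proof -
    have "1 + L \<le> (1 + L)\<^sup>2" using L1 self_le_power[of "1 + L" 2] by simp
    moreover have "0 \<le> 2 * K * (1 + L)" using K L by simp
    ultimately show "1 + L \<le> C" unfolding C_def using L by linarith
    then show "0 < C" using L by linarith
  qed
  define d where "d = r / (4 * (1 + L))"
  have d: "0 < d" using ch(1) L by (simp add: d_def)
  show ?thesis
  proof (intro exI conjI allI impI; (elim conjE)?)
    show "0 < r / 4" "0 < C" "0 < d" using ch(1) C d by auto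
    fix \<delta> :: real and \<phi> :: "'a \<times> real \<Rightarrow> real" assume \<delta>: "0 < \<delta>" "\<delta> \<le> d" and \<phi>: "smooth \<phi>"
    define h where "h = (1 + L) * \<delta>"
    have h: "0 < h" "h \<le> r / 4"
    proof -
      show "0 < h" using \<delta> L by (simp add: h_def)
      have "h \<le> (1 + L) * d" unfolding h_def using \<delta> L by (intro mult_left_mono) auto
      moreover have "1 + L \<noteq> 0" using L by linarith
      then have "(1 + L) * d = r / 4" unfolding d_def by (simp add: field_simps)
      ultimately show "h \<le> r / 4" by simp
    qed
    have "\<delta> \<le> h" using mult_right_mono[OF L1, of \<delta>] \<delta> by (simp add: h_def)
    then have \<delta>r: "\<delta> \<le> r / 4" using h by linarith
    have sub: "layer \<Omega> \<delta> \<inter> ball p (r / 4) \<subseteq> {x \<in> ball p (r / 4). 0 < \<tau> x \<and> \<tau> x < h}"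
      using layer_height[OF _ _ \<delta>r] by (auto simp: h_def)
    have "(\<integral>\<^sup>+q. ennreal ((\<phi> q)\<^sup>2) * indicator ((layer \<Omega> \<delta> \<inter> ball p (r / 4)) \<times> {0<..<T}) q \<partial>lborel)
       \<le> (\<integral>\<^sup>+q. ennreal ((\<phi> q)\<^sup>2) * indicator ({x \<in> ball p (r / 4). 0 < \<tau> x \<and> \<tau> x < h} \<times> {0<..<T}) q \<partial>lborel)"
      using sub by (intro nn_integral_mono mult_left_mono) (auto simp: indicator_def)
    also note hardy_local[OF \<phi> T h]
    also have "ennreal (2 * (tube_const TYPE('a \<times> real) * 2 ^ DIM('a) / unit_ball_vol DIM('a)) * h) *
        (\<integral>\<^sup>+q. ennreal ((\<phi> q)\<^sup>2) \<partial>surface_measure \<Omega> T)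
      + ennreal (2 * h\<^sup>2) * (\<integral>\<^sup>+q. ennreal ((norm (sgrad \<phi> q))\<^sup>2) * indicator (layer \<Omega> h \<times> {0<..<T}) q \<partial>lborel)
      \<le> hardy_rhs \<Omega> T C \<delta> \<phi>"
    proof -
      have c1: "2 * K * h \<le> C * \<delta>" using \<delta> L by (simp add: h_def C_def algebra_simps)
      have "2 * h\<^sup>2 = 2 * (1 + L)\<^sup>2 * \<delta>\<^sup>2" by (simp add: h_def power_mult_distrib)
      also have "\<dots> \<le> C * \<delta>\<^sup>2" unfolding C_def using K L by (intro mult_right_mono) auto
      finally have c2: "2 * h\<^sup>2 \<le> C * \<delta>\<^sup>2" .
      have "layer \<Omega> h \<subseteq> layer \<Omega> (C * \<delta>)"
        unfolding h_def using C \<delta> by (intro layer_mono mult_right_mono) auto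
      then have "(\<integral>\<^sup>+q. ennreal ((norm (sgrad \<phi> q))\<^sup>2) * indicator (layer \<Omega> h \<times> {0<..<T}) q \<partial>lborel)
        \<le> (\<integral>\<^sup>+q. ennreal ((norm (sgrad \<phi> q))\<^sup>2) * indicator (layer \<Omega> (C * \<delta>) \<times> {0<..<T}) q \<partial>lborel)"
        by (intro nn_integral_mono mult_left_mono) (auto simp: indicator_def)
      then show ?thesis
        unfolding hardy_rhs_def K_def[symmetric] by (intro add_mono mult_mono[OF ennreal_leI[OF c1]] mult_mono[OF ennreal_leI[OF c2]] order_refl) auto
    qed
    finally show "(\<integral>\<^sup>+q. ennreal ((\<phi> q)\<^sup>2) * indicator ((layer \<Omega> \<delta> \<inter> ball p (r / 4)) \<times> {0<..<T}) q \<partial>lborel) \<le> hardy_rhs \<Omega> T C \<delta> \<phi>" .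
  qed
qed

text \<open>Finitely many charts cover the compact frontier already with balls of half the radius.
  For \<open>\<delta>\<close> at most half of each radius, the full balls then cover the whole
  layer, and the bounds of the charts add up.\<close>

lemma hardy:
  assumes dom: "bounded_lipschitz_domain \<Omega>" and T: "0 < T"
  shows "\<exists>C>0. \<exists>d>0. \<forall>\<delta> \<phi>. 0 < \<delta> \<and> \<delta> \<le> d \<and> smooth \<phi> \<longrightarrow>
    (\<integral>\<^sup>+q. ennreal ((\<phi> q)\<^sup>2) * indicator (cyl (layer \<Omega> \<delta>) 0 T) q \<partial>lborel) \<le> hardy_rhs \<Omega> T C \<delta> \<phi>"
proof -
  have \<Omega>: "open \<Omega>" "bounded \<Omega>" using dom by (auto simp: bounded_lipschitz_domain_def)
  have "\<forall>p\<in>frontier \<Omega>. \<exists>\<rho>CD. 0 < fst \<rho>CD \<and> 0 < fst (snd \<rho>CD) \<and> 0 < snd (snd \<rho>CD) \<and> (\<forall>\<delta> \<phi>. 0 < \<delta> \<and> \<delta> \<le> snd (snd \<rho>CD) \<and> smooth \<phi> \<longrightarrow>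
    (\<integral>\<^sup>+q. ennreal ((\<phi> q)\<^sup>2) * indicator ((layer \<Omega> \<delta> \<inter> ball p (fst \<rho>CD)) \<times> {0<..<T}) q \<partial>lborel) \<le> hardy_rhs \<Omega> T (fst (snd \<rho>CD)) \<delta> \<phi>)"
  proof
    fix p assume "p \<in> frontier \<Omega>"
    from hardy_at_point[OF dom T this] obtain \<rho> C d where "0 < \<rho>" "0 < C" "0 < d" "\<forall>\<delta> \<phi>. 0 < \<delta> \<and> \<delta> \<le> d \<and> smooth \<phi> \<longrightarrow>
      (\<integral>\<^sup>+q. ennreal ((\<phi> q)\<^sup>2) * indicator ((layer \<Omega> \<delta> \<inter> ball p \<rho>) \<times> {0<..<T}) q \<partial>lborel) \<le> hardy_rhs \<Omega> T C \<delta> \<phi>" by blast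
    then show "\<exists>\<rho>CD. 0 < fst \<rho>CD \<and> 0 < fst (snd \<rho>CD) \<and> 0 < snd (snd \<rho>CD) \<and> (\<forall>\<delta> \<phi>. 0 < \<delta> \<and> \<delta> \<le> snd (snd \<rho>CD) \<and> smooth \<phi> \<longrightarrow>
      (\<integral>\<^sup>+q. ennreal ((\<phi> q)\<^sup>2) * indicator ((layer \<Omega> \<delta> \<inter> ball p (fst \<rho>CD)) \<times> {0<..<T}) q \<partial>lborel) \<le> hardy_rhs \<Omega> T (fst (snd \<rho>CD)) \<delta> \<phi>)"
      by (intro exI[of _ "(\<rho>, C, d)"]) simp
  qed
  from bchoice[OF this] obtain R where R: "\<forall>p\<in>frontier \<Omega>. 0 < fst (R p) \<and> 0 < fst (snd (R p)) \<and> 0 < snd (snd (R p)) \<and> (\<forall>\<delta> \<phi>. 0 < \<delta> \<and> \<delta> \<le> snd (snd (R p)) \<and> smooth \<phi> \<longrightarrow>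
    (\<integral>\<^sup>+q. ennreal ((\<phi> q)\<^sup>2) * indicator ((layer \<Omega> \<delta> \<inter> ball p (fst (R p))) \<times> {0<..<T}) q \<partial>lborel) \<le> hardy_rhs \<Omega> T (fst (snd (R p))) \<delta> \<phi>)" ..
  define \<rho> C d where "\<rho> p = fst (R p)" and "C p = fst (snd (R p))" and "d p = snd (snd (R p))" for p
  have pos: "0 < \<rho> p" "0 < C p" "0 < d p" if "p \<in> frontier \<Omega>" for p
    using R that by (auto simp: \<rho>_def C_def d_def)
  have loc: "(\<integral>\<^sup>+q. ennreal ((\<phi> q)\<^sup>2) * indicator ((layer \<Omega> \<delta> \<inter> ball p (\<rho> p)) \<times> {0<..<T}) q \<partial>lborel) \<le> hardy_rhs \<Omega> T (C p) \<delta> \<phi>"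
    if "p \<in> frontier \<Omega>" "0 < \<delta>" "\<delta> \<le> d p" "smooth \<phi>" for p \<delta> \<phi>
    using R that by (simp add: \<rho>_def C_def d_def)
  have cov0: "frontier \<Omega> \<subseteq> (\<Union>p\<in>frontier \<Omega>. ball p (\<rho> p / 2))" using pos(1) by force
  have op: "open (ball p (\<rho> p / 2))" for p by simp
  obtain F where F: "F \<subseteq> frontier \<Omega>" "finite F" "frontier \<Omega> \<subseteq> (\<Union>p\<in>F. ball p (\<rho> p / 2))"
    using compactE_image[OF compact_frontier_bounded[OF \<Omega>(2)] op cov0] by metis
  define d0 where "d0 = Min (insert 1 ((\<lambda>p. min (d p) (\<rho> p / 2)) ` F))"
  have d0: "0 < d0" "\<And>p. p \<in> F \<Longrightarrow> d0 \<le> d p" "\<And>p. p \<in> F \<Longrightarrow> d0 \<le> \<rho> p / 2"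
  proof -
    show "0 < d0" unfolding d0_def using F pos by (subst Min_gr_iff) auto
    have "d0 \<le> min (d p) (\<rho> p / 2)" if "p \<in> F" for p unfolding d0_def using F that by (intro Min_le) auto
    then show "\<And>p. p \<in> F \<Longrightarrow> d0 \<le> d p" "\<And>p. p \<in> F \<Longrightarrow> d0 \<le> \<rho> p / 2" by auto
  qed
  define Cs where "Cs = (\<Sum>p\<in>F. C p)"
  have CF: "0 \<le> C p" if "p \<in> F" for p using pos(2)[of p] F(1) that by auto
  have Cs: "C p \<le> Cs" if "p \<in> F" for p
    unfolding Cs_def using F(2) CF that by (intro member_le_sum) auto
  have Cs0: "0 \<le> Cs" unfolding Cs_def using CF by (rule sum_nonneg)
  define N where "N = real (card F)"
  \<comment> \<open>The sum over \<open>N\<close> charts multiplies the coefficients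
    \<open>Cs\<close> by \<open>N\<close>, while the width of the layer keeps the factor
    \<open>Cs\<close>; \<open>C'\<close> dominates both.\<close>
  define C' where "C' = (N + 1) * (Cs + 1)"
  have C': "0 < C'" "N * Cs \<le> C'" "Cs \<le> C'"
  proof -
    have N: "0 \<le> N" "0 \<le> N * Cs" using Cs0 by (auto simp: N_def)
    have "C' = N * Cs + N + Cs + 1" by (simp add: C'_def algebra_simps)
    then show "0 < C'" "N * Cs \<le> C'" "Cs \<le> C'" using N Cs0 by linarith+
  qed
  show ?thesis
  proof (intro exI conjI allI impI; (elim conjE)?)
    show "0 < C'" "0 < d0" by fact+
    fix \<delta> :: real and \<phi> :: "'a \<times> real \<Rightarrow> real" assume \<delta>: "0 < \<delta>" "\<delta> \<le> d0" and \<phi>: "smooth \<phi>"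
    note [measurable] = smooth_borel[OF \<phi>]
    have cov: "layer \<Omega> \<delta> \<subseteq> (\<Union>p\<in>F. ball p (\<rho> p))"
    proof
      fix x assume "x \<in> layer \<Omega> \<delta>"
      then obtain q where q: "q \<in> frontier \<Omega>" "dist x q < \<delta>" using layer_near_frontier by blast
      then obtain p where p: "p \<in> F" "dist p q < \<rho> p / 2" using F(3) by auto
      have "dist p x < \<rho> p" using q p d0(3)[OF p(1)] \<delta> dist_triangle[of p x q] by (simp add: dist_commute)
      then show "x \<in> (\<Union>p\<in>F. ball p (\<rho> p))" using p by auto
    qed
    have "(\<integral>\<^sup>+q. ennreal ((\<phi> q)\<^sup>2) * indicator (cyl (layer \<Omega> \<delta>) 0 T) q \<partial>lborel)
       \<le> (\<integral>\<^sup>+q. (\<Sum>p\<in>F. ennreal ((\<phi> q)\<^sup>2) * indicator ((layer \<Omega> \<delta> \<inter> ball p (\<rho> p)) \<times> {0<..<T}) q) \<partial>lborel)"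
    proof (rule nn_integral_mono)
      fix q :: "'a \<times> real"
      show "ennreal ((\<phi> q)\<^sup>2) * indicator (cyl (layer \<Omega> \<delta>) 0 T) q \<le> (\<Sum>p\<in>F. ennreal ((\<phi> q)\<^sup>2) * indicator ((layer \<Omega> \<delta> \<inter> ball p (\<rho> p)) \<times> {0<..<T}) q)"
      proof (cases "q \<in> cyl (layer \<Omega> \<delta>) 0 T")
        case True
        then obtain p where p: "p \<in> F" "fst q \<in> ball p (\<rho> p)" using cov by (cases q) auto
        have "ennreal ((\<phi> q)\<^sup>2) * indicator (cyl (layer \<Omega> \<delta>) 0 T) q = ennreal ((\<phi> q)\<^sup>2) * indicator ((layer \<Omega> \<delta> \<inter> ball p (\<rho> p)) \<times> {0<..<T}) q"
          using True p by (cases q) (auto simp: indicator_def)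
        also have "\<dots> \<le> (\<Sum>p\<in>F. ennreal ((\<phi> q)\<^sup>2) * indicator ((layer \<Omega> \<delta> \<inter> ball p (\<rho> p)) \<times> {0<..<T}) q)"
          using F(2) p by (intro member_le_sum) auto
        finally show ?thesis .
      qed simp
    qed
    also have "\<dots> = (\<Sum>p\<in>F. \<integral>\<^sup>+q. ennreal ((\<phi> q)\<^sup>2) * indicator ((layer \<Omega> \<delta> \<inter> ball p (\<rho> p)) \<times> {0<..<T}) q \<partial>lborel)"
    proof (rule nn_integral_sum)
      fix p
      have "(layer \<Omega> \<delta> \<inter> ball p (\<rho> p)) \<times> {0<..<T} \<in> sets borel"
        using open_layer[OF \<Omega>(1)] by (intro borel_open open_Times open_Int) auto
      then show "(\<lambda>q. ennreal ((\<phi> q)\<^sup>2) * indicator ((layer \<Omega> \<delta> \<inter> ball p (\<rho> p)) \<times> {0<..<T}) q) \<in> borel_measurable lborel" by measurable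
    qed
    also have "\<dots> \<le> (\<Sum>p\<in>F. hardy_rhs \<Omega> T Cs \<delta> \<phi>)"
    proof (rule sum_mono)
      fix p assume p: "p \<in> F"
      then have "p \<in> frontier \<Omega>" "\<delta> \<le> d p" using F d0(2) \<delta> by force+
      from loc[OF this(1) \<delta>(1) this(2) \<phi>] hardy_rhs_mono[OF less_imp_le[OF pos(2)[OF this(1)]] Cs[OF p]] \<delta>
      show "(\<integral>\<^sup>+q. ennreal ((\<phi> q)\<^sup>2) * indicator ((layer \<Omega> \<delta> \<inter> ball p (\<rho> p)) \<times> {0<..<T}) q \<partial>lborel) \<le> hardy_rhs \<Omega> T Cs \<delta> \<phi>"
        by (meson less_imp_le order_trans)
    qed
    also have "\<dots> = ennreal N * hardy_rhs \<Omega> T Cs \<delta> \<phi>"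
      by (simp add: N_def ennreal_of_nat_eq_real_of_nat)
    also have "\<dots> = ennreal (N * Cs * \<delta>) * (\<integral>\<^sup>+q. ennreal ((\<phi> q)\<^sup>2) \<partial>surface_measure \<Omega> T)
     + ennreal (N * Cs * \<delta>\<^sup>2) * (\<integral>\<^sup>+q. ennreal ((norm (sgrad \<phi> q))\<^sup>2) * indicator (layer \<Omega> (Cs * \<delta>) \<times> {0<..<T}) q \<partial>lborel)"
    proof -
      have "ennreal (N * Cs * \<delta>) = ennreal N * ennreal (Cs * \<delta>)" "ennreal (N * Cs * \<delta>\<^sup>2) = ennreal N * ennreal (Cs * \<delta>\<^sup>2)"
        using Cs0 \<delta> by (simp_all add: N_def ennreal_mult mult.assoc)
      then show ?thesis unfolding hardy_rhs_def by (simp only: distrib_left mult.assoc)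
    qed
    also have "\<dots> \<le> hardy_rhs \<Omega> T C' \<delta> \<phi>"
    proof -
      have c1: "N * Cs * \<delta> \<le> C' * \<delta>" and c2: "N * Cs * \<delta>\<^sup>2 \<le> C' * \<delta>\<^sup>2" using C' \<delta> by (auto intro: mult_right_mono)
      have "layer \<Omega> (Cs * \<delta>) \<subseteq> layer \<Omega> (C' * \<delta>)" using C' \<delta> by (intro layer_mono mult_right_mono) auto
      then have "(\<integral>\<^sup>+q. ennreal ((norm (sgrad \<phi> q))\<^sup>2) * indicator (layer \<Omega> (Cs * \<delta>) \<times> {0<..<T}) q \<partial>lborel)
        \<le> (\<integral>\<^sup>+q. ennreal ((norm (sgrad \<phi> q))\<^sup>2) * indicator (layer \<Omega> (C' * \<delta>) \<times> {0<..<T}) q \<partial>lborel)"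
        by (intro nn_integral_mono mult_left_mono) (auto simp: indicator_def)
      then show ?thesis
        unfolding hardy_rhs_def by (intro add_mono mult_mono[OF ennreal_leI[OF c1]] mult_mono[OF ennreal_leI[OF c2]] order_refl) auto
    qed
    finally show "(\<integral>\<^sup>+q. ennreal ((\<phi> q)\<^sup>2) * indicator (cyl (layer \<Omega> \<delta>) 0 T) q \<partial>lborel) \<le> hardy_rhs \<Omega> T C' \<delta> \<phi>" .
  qed
qed

text \<open>Zero lateral trace with the gradient \<open>G\<close> as an argument instead of the
  choice \<open>grad_x\<close>; \<open>G\<close> is tied to \<open>w\<close> through the
  approximating sequence.\<close>

definition zero_lateral ::
  "'a::euclidean_space set \<Rightarrow> real \<Rightarrow> ('a \<times> real \<Rightarrow> real) \<Rightarrow> ('a \<times> real \<Rightarrow> 'a) \<Rightarrow> bool" where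
  "zero_lateral \<Omega> T w G \<longleftrightarrow> w \<in> L2 (lebesgue_on (cyl \<Omega> 0 T)) \<and> G \<in> L2 (lebesgue_on (cyl \<Omega> 0 T)) \<and>
     (\<exists>\<phi>. (\<forall>n. smooth (\<phi> n)) \<and> L2_lim (lebesgue_on (cyl \<Omega> 0 T)) \<phi> w \<and>
        L2_lim (lebesgue_on (cyl \<Omega> 0 T)) (\<lambda>n. sgrad (\<phi> n)) G \<and> L2_lim (surface_measure \<Omega> T) \<phi> (\<lambda>p. 0))"

lemma L2_lim_lebesgue_on_mono:
  assumes "L2_lim (lebesgue_on S) \<phi> w" "S \<in> sets lebesgue" "S' \<in> sets lebesgue" "S' \<subseteq> S"
  shows "L2_lim (lebesgue_on S') \<phi> w"
  unfolding L2_lim_def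
proof (intro conjI allI)
  have d: "(\<lambda>x. \<phi> n x - w x) \<in> L2 (lebesgue_on S)" for n using assms(1) by (simp add: L2_lim_def)
  show "(\<lambda>x. \<phi> n x - w x) \<in> L2 (lebesgue_on S')" for n
    by (rule L2_restrict(1)[OF d assms(2-4)])
  have "\<forall>\<^sub>F n in sequentially. norm (L2_norm (lebesgue_on S') (\<lambda>x. \<phi> n x - w x))
      \<le> L2_norm (lebesgue_on S) (\<lambda>x. \<phi> n x - w x)"
    using L2_restrict(2)[OF d assms(2-4)] by simp
  then show "(\<lambda>n. L2_norm (lebesgue_on S') (\<lambda>x. \<phi> n x - w x)) \<longlonglongrightarrow> 0"
    by (rule Lim_null_comparison) (use assms(1) in \<open>simp add: L2_lim_def\<close>)
qed

lemma cyl_layer: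
  assumes "open \<Omega>"
  shows "cyl (layer \<Omega> \<delta>) a b \<in> sets lebesgue" "cyl (layer \<Omega> \<delta>) a b \<in> sets borel" "cyl (layer \<Omega> \<delta>) a b \<subseteq> cyl \<Omega> a b"
  using sets_cyl[OF open_layer[OF assms]] layer_subset[of \<Omega> \<delta>] by (auto simp: cyl_def)

text \<open>Along the approximating sequence the surface term of \<open>hardy_rhs\<close> tends to
  zero; only the gradient term with its factor \<open>\<delta>\<^sup>2\<close> survives.\<close>

lemma hardy_zero_lateral:
  assumes dom: "bounded_lipschitz_domain \<Omega>" and T: "0 < T" and z: "zero_lateral \<Omega> T w G"
  shows "\<exists>C>0. \<exists>d>0. \<forall>\<delta>. 0 < \<delta> \<and> \<delta> \<le> d \<longrightarrow>
    (L2_norm (lebesgue_on (cyl (layer \<Omega> \<delta>) 0 T)) w)\<^sup>2 \<le> C * \<delta>\<^sup>2 * (L2_norm (lebesgue_on (cyl (layer \<Omega> (C * \<delta>)) 0 T)) G)\<^sup>2"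
proof -
  have \<Omega>: "open \<Omega>" "bounded \<Omega>" using dom by (auto simp: bounded_lipschitz_domain_def)
  obtain C d where C: "0 < C" "0 < d" and H: "\<forall>\<delta> \<phi>. 0 < \<delta> \<and> \<delta> \<le> d \<and> smooth \<phi> \<longrightarrow>
    (\<integral>\<^sup>+q. ennreal ((\<phi> q)\<^sup>2) * indicator (cyl (layer \<Omega> \<delta>) 0 T) q \<partial>lborel) \<le> hardy_rhs \<Omega> T C \<delta> \<phi>"
    using hardy[OF dom T] by blast
  obtain \<phi> where \<phi>: "\<forall>n. smooth (\<phi> n)" "L2_lim (lebesgue_on (cyl \<Omega> 0 T)) \<phi> w"
     "L2_lim (lebesgue_on (cyl \<Omega> 0 T)) (\<lambda>n. sgrad (\<phi> n)) G" "L2_lim (surface_measure \<Omega> T) \<phi> (\<lambda>p. 0)"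
    and wG: "w \<in> L2 (lebesgue_on (cyl \<Omega> 0 T))" "G \<in> L2 (lebesgue_on (cyl \<Omega> 0 T))"
    using z by (auto simp: zero_lateral_def)
  have "(L2_norm (lebesgue_on (cyl (layer \<Omega> \<delta>) 0 T)) w)\<^sup>2 \<le> C * \<delta>\<^sup>2 * (L2_norm (lebesgue_on (cyl (layer \<Omega> (C * \<delta>)) 0 T)) G)\<^sup>2"
    if \<delta>: "0 < \<delta>" "\<delta> \<le> d" for \<delta>
  proof -
    let ?E = "\<lambda>\<delta>. lebesgue_on (cyl (layer \<Omega> \<delta>) 0 T)"
    note E = cyl_layer[OF \<Omega>(1), of _ 0 T] and Qm = sets_cyl(1)[OF \<Omega>(1), of 0 T]
    have l: "L2_lim (?E \<delta>) \<phi> w" "L2_lim (?E (C * \<delta>)) (\<lambda>n. sgrad (\<phi> n)) G"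
      using L2_lim_lebesgue_on_mono[OF \<phi>(2) Qm E(1,3)] L2_lim_lebesgue_on_mono[OF \<phi>(3) Qm E(1,3)] by auto
    have wE: "w \<in> L2 (?E \<delta>)" "G \<in> L2 (?E (C * \<delta>))"
      using L2_restrict(1)[OF wG(1) Qm E(1,3)] L2_restrict(1)[OF wG(2) Qm E(1,3)] by auto
    have le: "(L2_norm (?E \<delta>) (\<phi> n))\<^sup>2 \<le> C * \<delta> * (L2_norm (surface_measure \<Omega> T) (\<phi> n))\<^sup>2 + C * \<delta>\<^sup>2 * (L2_norm (?E (C * \<delta>)) (sgrad (\<phi> n)))\<^sup>2" for n
    proof -
      note L1 = L2_lim_L2[OF l(1) wE(1), of n] and L2 = L2_lim_L2[OF l(2) wE(2), of n] and L3 = L2_lim_L2[OF \<phi>(4) L2_zero, of n]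
      have "ennreal ((L2_norm (?E \<delta>) (\<phi> n))\<^sup>2) \<le> hardy_rhs \<Omega> T C \<delta> (\<phi> n)"
        unfolding L2_norm_nn_integral[OF L1] nn_integral_lebesgue_on[OF E(1)] using H \<delta> \<phi>(1) by simp
      also have "\<dots> = ennreal (C * \<delta> * (L2_norm (surface_measure \<Omega> T) (\<phi> n))\<^sup>2 + C * \<delta>\<^sup>2 * (L2_norm (?E (C * \<delta>)) (sgrad (\<phi> n)))\<^sup>2)"
        using C \<delta> L2_norm_nn_integral[OF L2] L2_norm_nn_integral[OF L3]
        by (simp add: hardy_rhs_def nn_integral_lebesgue_on[OF E(1)] cyl_def[symmetric] ennreal_plus ennreal_mult)
      finally show ?thesis using C \<delta> by (subst (asm) ennreal_le_iff) auto
    qed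
    have "(\<lambda>n. (L2_norm (?E \<delta>) (\<phi> n))\<^sup>2) \<longlonglongrightarrow> (L2_norm (?E \<delta>) w)\<^sup>2"
      by (intro tendsto_intros L2_lim_norm[OF l(1) wE(1)])
    moreover have "(\<lambda>n. C * \<delta> * (L2_norm (surface_measure \<Omega> T) (\<phi> n))\<^sup>2 + C * \<delta>\<^sup>2 * (L2_norm (?E (C * \<delta>)) (sgrad (\<phi> n)))\<^sup>2)
        \<longlonglongrightarrow> C * \<delta> * (L2_norm (surface_measure \<Omega> T) (\<lambda>p. 0 :: real))\<^sup>2 + C * \<delta>\<^sup>2 * (L2_norm (?E (C * \<delta>)) G)\<^sup>2"
      by (intro tendsto_intros L2_lim_norm[OF l(2) wE(2)] L2_lim_norm[OF \<phi>(4) L2_zero])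
    ultimately show ?thesis using LIMSEQ_le le by fastforce
  qed
  then show ?thesis using C by blast
qed

text \<open>Every point of the open set \<open>\<Omega>\<close> eventually leaves the layers, so
  dominated convergence applies. Hardy's inequality makes the boundary error in Green's formula
  bounded; this makes it vanish.\<close>

lemma layer_norm_tendsto_0:
  fixes f :: "'a::euclidean_space \<times> real \<Rightarrow> 'b::euclidean_space"
  assumes \<Omega>: "open \<Omega>" and f: "f \<in> L2 (lebesgue_on (cyl \<Omega> 0 T))" and \<eta>: "\<eta> \<longlonglongrightarrow> 0"
  shows "(\<lambda>n. L2_norm (lebesgue_on (cyl (layer \<Omega> (\<eta> n)) 0 T)) f) \<longlonglongrightarrow> 0"
proof -
  let ?Q = "cyl \<Omega> 0 T" and ?E = "\<lambda>n. cyl (layer \<Omega> (\<eta> n)) 0 T"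
  note E = cyl_layer[OF \<Omega>, of "\<eta> _" 0 T] and Qm = sets_cyl(1)[OF \<Omega>, of 0 T]
  have eq: "(L2_norm (lebesgue_on (?E n)) f)\<^sup>2 = (\<integral>p. indicator (?E n) p * (norm (f p))\<^sup>2 \<partial>lebesgue_on ?Q)" for n
  proof -
    have "(\<integral>p. indicator (?E n) p * (norm (f p))\<^sup>2 \<partial>lebesgue_on ?Q) = (\<integral>p. indicator (?E n) p * (norm (f p))\<^sup>2 \<partial>lebesgue_on (?E n))"
      by (intro integral_lebesgue_on_subset Qm E) auto
    also have "\<dots> = (\<integral>p. (norm (f p))\<^sup>2 \<partial>lebesgue_on (?E n))"
      by (intro Bochner_Integration.integral_cong) auto
    finally show ?thesis by (simp add: L2_norm_square)
  qed
  have "(\<lambda>n. \<integral>p. indicator (?E n) p * (norm (f p))\<^sup>2 \<partial>lebesgue_on ?Q) \<longlonglongrightarrow> (\<integral>p. 0 \<partial>lebesgue_on ?Q)"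
  proof (rule integral_dominated_convergence[where w="\<lambda>p. (norm (f p))\<^sup>2"])
    show "(\<lambda>p. indicator (?E n) p * (norm (f p))\<^sup>2) \<in> borel_measurable (lebesgue_on ?Q)" for n
      using L2_measurable[OF f] E(1)[of n] E(3)[of n] Qm
      by (intro borel_measurable_times borel_measurable_indicator borel_measurable_power borel_measurable_norm) (auto simp: sets_restrict_space_iff)
    show "AE p in lebesgue_on ?Q. (\<lambda>n. indicator (?E n) p * (norm (f p))\<^sup>2) \<longlonglongrightarrow> 0"
    proof (rule AE_I2)
      fix p assume "p \<in> space (lebesgue_on ?Q)"
      then obtain x t where p: "p = (x, t)" "x \<in> \<Omega>" by (cases p) auto
      obtain e where e: "0 < e" "ball x e \<subseteq> \<Omega>" using \<Omega> p(2) open_contains_ball by blast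
      have "\<forall>\<^sub>F n in sequentially. \<eta> n < e" using order_tendstoD(2)[OF \<eta> e(1)] .
      then have "\<forall>\<^sub>F n in sequentially. indicator (?E n) p * (norm (f p))\<^sup>2 = 0"
      proof eventually_elim
        case (elim n)
        have "x \<notin> layer \<Omega> (\<eta> n)"
        proof
          assume "x \<in> layer \<Omega> (\<eta> n)"
          then obtain z where "z \<notin> \<Omega>" "dist x z < \<eta> n" by (auto simp: layer_def)
          then have "z \<in> ball x e" using elim by simp
          then show False using e \<open>z \<notin> \<Omega>\<close> by blast
        qed
        then show ?case by (simp add: p)
      qed
      then show "(\<lambda>n. indicator (?E n) p * (norm (f p))\<^sup>2) \<longlonglongrightarrow> 0" by (rule tendsto_eventually)
    qed
    show "AE p in lebesgue_on ?Q. norm (indicator (?E n) p * (norm (f p))\<^sup>2) \<le> (norm (f p))\<^sup>2" for n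
      by (auto simp: indicator_def)
  qed (use L2_integrable[OF f] in auto)
  then have "(\<lambda>n. (L2_norm (lebesgue_on (?E n)) f)\<^sup>2) \<longlonglongrightarrow> 0" by (simp add: eq)
  from tendsto_real_sqrt[OF this] show ?thesis by simp
qed

section \<open>Green's formula for functions with zero lateral trace\<close>

lemma has_weak_div_x_subset:
  assumes S: "open S" "S \<in> sets lebesgue" "Q \<in> sets lebesgue" "S \<subseteq> Q" and d: "has_weak_div_x Q y D"
  shows "has_weak_div_x S y D"
  unfolding has_weak_div_x_def
proof
  fix \<phi> assume \<phi>: "\<phi> \<in> test_functions S"
  have z: "\<phi> p = 0" "dir_deriv b \<phi> p = 0" if "p \<notin> S" for p b
  proof -
    obtain K where K: "compact K" "K \<subseteq> S" "supp_in K \<phi>" using \<phi> by (auto simp: test_functions_iff)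
    then show "\<phi> p = 0" "dir_deriv b \<phi> p = 0"
      using K supp_in_dir_deriv[OF K(3) compact_imp_closed[OF K(1)], of b] that unfolding supp_in_def by blast+
  qed
  have "(\<integral>p. (\<Sum>i\<in>Basis. dir_deriv (i, 0) \<phi> p * (y p \<bullet> i)) \<partial>lebesgue_on Q) = - (\<integral>p. \<phi> p * D p \<partial>lebesgue_on Q)"
    using d test_functions_subset[OF \<phi> S(4)] by (simp add: has_weak_div_x_def)
  then show "(\<integral>p. (\<Sum>i\<in>Basis. dir_deriv (i, 0) \<phi> p * (y p \<bullet> i)) \<partial>lebesgue_on S) = - (\<integral>p. \<phi> p * D p \<partial>lebesgue_on S)"
    by (subst (1 2) integral_lebesgue_on_subset[OF S(3) S(2) S(4), symmetric]) (auto simp: z)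
qed

lemma sum_dir_deriv_inner: "(\<Sum>i\<in>Basis. dir_deriv (i, 0) \<phi> p * (y \<bullet> i)) = sgrad \<phi> p \<bullet> y"
  by (simp add: sgrad_def inner_sum_left inner_commute[of y])

lemma sgrad_mult:
  assumes "smooth \<phi>" "smooth \<psi>"
  shows "sgrad (\<lambda>p. \<phi> p * \<psi> p) p = \<phi> p *\<^sub>R sgrad \<psi> p + \<psi> p *\<^sub>R sgrad \<phi> p"
  by (simp add: sgrad_def dir_deriv_mult[OF assms] scaleR_sum_right scaleR_add_left sum.distrib mult.commute)

lemma sgrad_translate: "smooth \<phi> \<Longrightarrow> sgrad (\<lambda>p. \<phi> (p + c)) p = sgrad \<phi> (p + c)"
  by (simp add: sgrad_def dir_deriv_translate)

lemma test_function_bounded: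
  fixes \<phi> :: "'e::euclidean_space \<Rightarrow> real"
  assumes "\<phi> \<in> test_functions Q"
  obtains B where "0 < B" "\<And>p. \<bar>\<phi> p\<bar> \<le> B"
proof -
  obtain K where "compact K" "supp_in K \<phi>" "smooth \<phi>" using assms by (auto simp: test_functions_iff)
  then show ?thesis using supp_in_bounded smooth_continuous that by metis
qed

lemma continuous_lebesgue_on_measurable:
  fixes F :: "'e::euclidean_space \<Rightarrow> 'b::euclidean_space"
  assumes "continuous_on UNIV F"
  shows "F \<in> borel_measurable (lebesgue_on S)"
  by (intro measurable_restrict_space1 measurable_completion) (use borel_measurable_continuous_onI[OF assms] in simp)

text \<open>The divergence is tested with \<open>\<theta> p * \<phi> n p\<close>, whose compact
  support comes from \<open>\<theta>\<close>. The product rule gives three terms, each of which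
  passes to the limit; the one with \<open>sgrad \<theta>\<close> is the error of cutting
  off.\<close>

lemma green_cutoff:
  fixes y :: "'a::euclidean_space \<times> real \<Rightarrow> 'a" and w D :: "'a \<times> real \<Rightarrow> real"
  assumes S: "open S" "S \<in> sets lebesgue" and L: "y \<in> L2 (lebesgue_on S)" "D \<in> L2 (lebesgue_on S)"
      "w \<in> L2 (lebesgue_on S)" "G \<in> L2 (lebesgue_on S)"
    and d: "has_weak_div_x S y D" and \<phi>: "\<And>n. smooth (\<phi> n)" "L2_lim (lebesgue_on S) \<phi> w"
      "L2_lim (lebesgue_on S) (\<lambda>n. sgrad (\<phi> n)) G"
    and \<theta>: "\<theta> \<in> test_functions S"
  shows "(\<lambda>p. sgrad \<theta> p \<bullet> y p) \<in> L2 (lebesgue_on S)"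
    "(\<integral>p. \<theta> p * (y p \<bullet> G p) \<partial>lebesgue_on S) + (\<integral>p. w p * (sgrad \<theta> p \<bullet> y p) \<partial>lebesgue_on S)
      + (\<integral>p. \<theta> p * (w p * D p) \<partial>lebesgue_on S) = 0"
proof -
  let ?S = "lebesgue_on S"
  have bnd: "(\<lambda>p. \<eta> p *\<^sub>R f p) \<in> L2 ?S" if \<eta>: "\<eta> \<in> test_functions S" and f: "f \<in> L2 ?S"
    for \<eta> and f :: "'a \<times> real \<Rightarrow> 'b::euclidean_space"
  proof -
    obtain B where "0 < B" "\<And>p. \<bar>\<eta> p\<bar> \<le> B" using test_function_bounded[OF \<eta>] by auto
    then show ?thesis
      by (intro L2_mult_bounded(1)[OF f, of _ B] continuous_lebesgue_on_measurable smooth_continuous test_functions_smooth[OF \<eta>]) auto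
  qed
  note \<theta>s = test_functions_smooth[OF \<theta>]
  have 1: "(\<lambda>p. \<theta> p *\<^sub>R y p) \<in> L2 ?S" "(\<lambda>p. \<theta> p * D p) \<in> L2 ?S"
    using bnd[OF \<theta> L(1)] bnd[OF \<theta> L(2)] by auto
  show 2: "(\<lambda>p. sgrad \<theta> p \<bullet> y p) \<in> L2 ?S"
    unfolding sum_dir_deriv_inner[symmetric]
    using bnd[OF test_functions_dir_deriv[OF \<theta>] L2_inner_const[OF L(1)]] by (intro L2_sum) simp
  have \<phi>L: "\<phi> n \<in> L2 ?S" "sgrad (\<phi> n) \<in> L2 ?S" for n
    using L2_lim_L2[OF \<phi>(2) L(3)] L2_lim_L2[OF \<phi>(3) L(4)] by auto
  have eq: "(\<integral>p. sgrad (\<phi> n) p \<bullet> (\<theta> p *\<^sub>R y p) \<partial>?S) + (\<integral>p. \<phi> n p * (sgrad \<theta> p \<bullet> y p) \<partial>?S)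
      + (\<integral>p. \<phi> n p * (\<theta> p * D p) \<partial>?S) = 0" for n
  proof -
    have "(\<lambda>p. \<theta> p * \<phi> n p) \<in> test_functions S" by (rule test_functions_mult[OF \<theta> \<phi>(1)])
    then have "(\<integral>p. sgrad (\<lambda>p. \<theta> p * \<phi> n p) p \<bullet> y p \<partial>?S) = - (\<integral>p. \<theta> p * \<phi> n p * D p \<partial>?S)"
      using d unfolding has_weak_div_x_def sum_dir_deriv_inner by blast
    moreover have "(\<integral>p. sgrad (\<lambda>p. \<theta> p * \<phi> n p) p \<bullet> y p \<partial>?S)
        = (\<integral>p. sgrad (\<phi> n) p \<bullet> (\<theta> p *\<^sub>R y p) + \<phi> n p * (sgrad \<theta> p \<bullet> y p) \<partial>?S)"
      by (simp add: sgrad_mult[OF \<theta>s \<phi>(1)] inner_add_left)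
    moreover have "\<dots> = (\<integral>p. sgrad (\<phi> n) p \<bullet> (\<theta> p *\<^sub>R y p) \<partial>?S) + (\<integral>p. \<phi> n p * (sgrad \<theta> p \<bullet> y p) \<partial>?S)"
      by (intro Bochner_Integration.integral_add L2_inner_integrable L2_mult_integrable \<phi>L 1 2)
    ultimately show ?thesis by (simp add: mult.commute mult.left_commute)
  qed
  have "(\<lambda>n. (\<integral>p. sgrad (\<phi> n) p \<bullet> (\<theta> p *\<^sub>R y p) \<partial>?S) + (\<integral>p. \<phi> n p * (sgrad \<theta> p \<bullet> y p) \<partial>?S)
      + (\<integral>p. \<phi> n p * (\<theta> p * D p) \<partial>?S)) \<longlonglongrightarrow>
      (\<integral>p. G p \<bullet> (\<theta> p *\<^sub>R y p) \<partial>?S) + (\<integral>p. w p * (sgrad \<theta> p \<bullet> y p) \<partial>?S) + (\<integral>p. w p * (\<theta> p * D p) \<partial>?S)"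
    by (intro tendsto_add L2_lim_inner[OF \<phi>(3) L(4)] L2_lim_mult[OF \<phi>(2) L(3)] 1 2)
  then have "(\<lambda>n. 0) \<longlonglongrightarrow> (\<integral>p. G p \<bullet> (\<theta> p *\<^sub>R y p) \<partial>?S) + (\<integral>p. w p * (sgrad \<theta> p \<bullet> y p) \<partial>?S) + (\<integral>p. w p * (\<theta> p * D p) \<partial>?S)"
    unfolding eq .
  from LIMSEQ_unique[OF this tendsto_const]
  show "(\<integral>p. \<theta> p * (y p \<bullet> G p) \<partial>?S) + (\<integral>p. w p * (sgrad \<theta> p \<bullet> y p) \<partial>?S) + (\<integral>p. \<theta> p * (w p * D p) \<partial>?S) = 0"
    by (simp add: inner_commute mult.left_commute)
qed

text \<open>Points at depth at least \<open>\<epsilon>\<close>: from the complement of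
  \<open>\<Omega>\<close> and from both end times. The strict inequality in the distance condition
  makes the set closed.\<close>

definition deep :: "'a::euclidean_space set \<Rightarrow> real \<Rightarrow> real \<Rightarrow> real \<Rightarrow> ('a \<times> real) set" where
  "deep \<Omega> a b \<epsilon> = {p. (\<forall>z. dist (fst p) z < \<epsilon> \<longrightarrow> z \<in> \<Omega>) \<and> a + \<epsilon> \<le> snd p \<and> snd p \<le> b - \<epsilon>}"

lemma closed_deep: "closed (deep \<Omega> a b \<epsilon>)"
proof -
  have "deep \<Omega> a b \<epsilon> = (\<Inter>z\<in>-\<Omega>. {p. \<epsilon> \<le> dist (fst p) z}) \<inter> {p. a + \<epsilon> \<le> snd p} \<inter> {p. snd p \<le> b - \<epsilon>}"
    by (auto simp: deep_def not_less) (meson ComplI not_less)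
  then show ?thesis
    by (simp only:) (intro closed_Int closed_INT ballI closed_Collect_le continuous_intros)
qed

lemma deep_subset: "0 < \<epsilon> \<Longrightarrow> deep \<Omega> a b \<epsilon> \<subseteq> cyl \<Omega> a b"
  by (auto simp: deep_def cyl_def)

text \<open>Mollifying the set of depth \<open>3 * \<epsilon>\<close> at scale
  \<open>\<epsilon>\<close> gives a function equal to 1 at depth \<open>4 * \<epsilon>\<close> and
  zero outside depth \<open>2 * \<epsilon>\<close>, hence compactly supported in the
  cylinder.\<close>

definition cutoff :: "'a::euclidean_space set \<Rightarrow> real \<Rightarrow> real \<Rightarrow> real \<Rightarrow> 'a \<times> real \<Rightarrow> real" where
  "cutoff \<Omega> a b \<epsilon> = moll \<epsilon> (deep \<Omega> a b (3 * \<epsilon>))"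

lemma norm_prod_le:
  fixes q :: "'a::real_normed_vector \<times> real"
  assumes "norm q < \<epsilon>"
  shows "norm (fst q) < \<epsilon>" "\<bar>snd q\<bar> < \<epsilon>"
  using norm_fst_le[of "fst q" "snd q"] norm_snd_le[of "snd q" "fst q"] assms by auto

context
  fixes \<Omega> :: "'a::euclidean_space set" and a b \<epsilon> :: real
  assumes \<Omega>: "open \<Omega>" "bounded \<Omega>" and \<epsilon>: "0 < \<epsilon>"
begin

lemma deep_borel_bounded: "deep \<Omega> a b (3 * \<epsilon>) \<in> sets borel" "bounded (deep \<Omega> a b (3 * \<epsilon>))"
  using closed_deep[of \<Omega> a b "3 * \<epsilon>"] bounded_subset[OF bounded_cyl[OF \<Omega>(2)] deep_subset[of "3 * \<epsilon>" \<Omega> a b]] \<epsilon> by auto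

lemmas moll_deep = deep_borel_bounded \<epsilon>

lemma cutoff_range: "0 \<le> cutoff \<Omega> a b \<epsilon> p" "cutoff \<Omega> a b \<epsilon> p \<le> 1"
  unfolding cutoff_def by (rule moll_nonneg[OF moll_deep] moll_le_1[OF moll_deep])+

lemma cutoff_test: "cutoff \<Omega> a b \<epsilon> \<in> test_functions (cyl \<Omega> a b)"
  unfolding test_functions_iff
proof (intro conjI exI)
  show "smooth (cutoff \<Omega> a b \<epsilon>)" unfolding cutoff_def by (rule smooth_moll[OF moll_deep])
  have s: "deep \<Omega> a b (2 * \<epsilon>) \<subseteq> cyl \<Omega> a b" using deep_subset[of "2 * \<epsilon>"] \<epsilon> by simp
  then show "deep \<Omega> a b (2 * \<epsilon>) \<subseteq> cyl \<Omega> a b" .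
  show "compact (deep \<Omega> a b (2 * \<epsilon>))"
    using closed_deep bounded_subset[OF bounded_cyl[OF \<Omega>(2)] s] by (simp add: compact_eq_bounded_closed)
  show "supp_in (deep \<Omega> a b (2 * \<epsilon>)) (cutoff \<Omega> a b \<epsilon>)"
    unfolding supp_in_def
  proof (intro allI impI)
    fix p assume p: "p \<notin> deep \<Omega> a b (2 * \<epsilon>)"
    show "cutoff \<Omega> a b \<epsilon> p = 0"
      unfolding cutoff_def
    proof (rule moll_eq_0[OF moll_deep])
      fix q :: "'a \<times> real" assume q: "norm q < \<epsilon>"
      note q' = norm_prod_le[OF q]
      show "p + q \<notin> deep \<Omega> a b (3 * \<epsilon>)"
      proof
        assume "p + q \<in> deep \<Omega> a b (3 * \<epsilon>)"
        then have d: "\<And>z. dist (fst p + fst q) z < 3 * \<epsilon> \<Longrightarrow> z \<in> \<Omega>" "a + 3 * \<epsilon> \<le> snd p + snd q" "snd p + snd q \<le> b - 3 * \<epsilon>"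
          by (auto simp: deep_def)
        have "z \<in> \<Omega>" if "dist (fst p) z < 2 * \<epsilon>" for z
        proof (rule d(1))
          have "dist (fst p + fst q) (fst p) = norm (fst q)" by (simp add: dist_norm)
          then show "dist (fst p + fst q) z < 3 * \<epsilon>"
            using dist_triangle[of "fst p + fst q" z "fst p"] that q'(1) by linarith
        qed
        moreover have "a + 2 * \<epsilon> \<le> snd p" "snd p \<le> b - 2 * \<epsilon>" using d(2,3) q'(2) by linarith+
        ultimately show False using p by (simp add: deep_def)
      qed
    qed
  qed
qed

lemma cutoff_eq_1:
  assumes "p \<in> deep \<Omega> a b (4 * \<epsilon>)"
  shows "cutoff \<Omega> a b \<epsilon> p = 1"
  unfolding cutoff_def
proof (rule moll_eq_1[OF moll_deep])
  fix q :: "'a \<times> real" assume q: "norm q < \<epsilon>"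
  note q' = norm_prod_le[OF q]
  have d: "\<And>z. dist (fst p) z < 4 * \<epsilon> \<Longrightarrow> z \<in> \<Omega>" "a + 4 * \<epsilon> \<le> snd p" "snd p \<le> b - 4 * \<epsilon>"
    using assms by (auto simp: deep_def)
  have "z \<in> \<Omega>" if "dist (fst p + fst q) z < 3 * \<epsilon>" for z
  proof (rule d(1))
    have "dist (fst p) (fst p + fst q) = norm (fst q)" by (simp add: dist_norm)
    then show "dist (fst p) z < 4 * \<epsilon>"
      using dist_triangle[of "fst p" z "fst p + fst q"] that q'(1) by linarith
  qed
  moreover have "a + 3 * \<epsilon> \<le> snd p + snd q" "snd p + snd q \<le> b - 3 * \<epsilon>" using d(2,3) q'(2) by linarith+
  ultimately show "p + q \<in> deep \<Omega> a b (3 * \<epsilon>)" by (simp add: deep_def)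
qed

lemma sgrad_cutoff_le: "norm (sgrad (cutoff \<Omega> a b \<epsilon>) p) \<le> DIM('a) * (4 * exp 2 * 2 ^ DIM('a \<times> real)) / \<epsilon>"
proof -
  have "norm (sgrad (cutoff \<Omega> a b \<epsilon>) p) \<le> (\<Sum>i\<in>Basis. norm (dir_deriv (i, 0) (cutoff \<Omega> a b \<epsilon>) p *\<^sub>R (i::'a)))"
    unfolding sgrad_def by (rule norm_sum)
  also have "\<dots> \<le> (\<Sum>i\<in>(Basis::'a set). 4 * exp 2 * 2 ^ DIM('a \<times> real) / \<epsilon>)"
  proof (rule sum_mono)
    fix i :: 'a assume i: "i \<in> Basis"
    then show "norm (dir_deriv (i, 0) (cutoff \<Omega> a b \<epsilon>) p *\<^sub>R i) \<le> 4 * exp 2 * 2 ^ DIM('a \<times> real) / \<epsilon>"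
      using dir_deriv_moll_le[OF moll_deep, of "(i, 0)" p] by (simp add: cutoff_def)
  qed
  finally show ?thesis by simp
qed

text \<open>Away from the layer the spatial condition of \<open>deep\<close> holds at all points
  involved; \<open>5 * \<epsilon>\<close> adds the depth \<open>3 * \<epsilon>\<close>, the shift
  and the mollification radius. Membership then depends on time alone, and the cutoff is constant
  along short spatial segments.\<close>

lemma sgrad_cutoff_eq_0:
  assumes p: "fst p \<in> \<Omega>" "fst p \<notin> layer \<Omega> (5 * \<epsilon>)"
  shows "sgrad (cutoff \<Omega> a b \<epsilon>) p = 0"
  unfolding sgrad_def
proof (intro sum.neutral ballI)
  fix i :: 'a assume i: "i \<in> Basis"
  have far: "z \<in> \<Omega>" if "dist (fst p) z < 5 * \<epsilon>" for z using p that by (auto simp: layer_def)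
  have "dir_deriv (i, 0) (cutoff \<Omega> a b \<epsilon>) p = 0"
  proof (rule dir_deriv_locally_constant[OF \<epsilon>])
    show "cutoff \<Omega> a b \<epsilon> differentiable at p" by (rule smooth_differentiable[OF test_functions_smooth[OF cutoff_test]])
    fix s assume s: "\<bar>s\<bar> < \<epsilon>"
    show "cutoff \<Omega> a b \<epsilon> (p + s *\<^sub>R (i, 0)) = cutoff \<Omega> a b \<epsilon> p"
      unfolding cutoff_def
    proof (rule moll_cong[OF moll_deep])
      fix q :: "'a \<times> real" assume q: "norm q < \<epsilon>"
      note q' = norm_prod_le[OF q]
      have in\<Omega>: "z \<in> \<Omega>" if "dist (fst p + r *\<^sub>R i + fst q) z < 3 * \<epsilon>" "\<bar>r\<bar> < \<epsilon>" for z r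
      proof (rule far)
        have "dist (fst p) (fst p + r *\<^sub>R i + fst q) = norm (r *\<^sub>R i + fst q)" using norm_minus_cancel[of "r *\<^sub>R i + fst q"] by (simp add: dist_norm algebra_simps)
        also have "\<dots> \<le> \<bar>r\<bar> + norm (fst q)" using norm_triangle_ineq[of "r *\<^sub>R i" "fst q"] i by simp
        finally show "dist (fst p) z < 5 * \<epsilon>"
          using dist_triangle[of "fst p" z "fst p + r *\<^sub>R i + fst q"] that q'(1) by linarith
      qed
      show "p + s *\<^sub>R (i, 0) + q \<in> deep \<Omega> a b (3 * \<epsilon>) \<longleftrightarrow> p + q \<in> deep \<Omega> a b (3 * \<epsilon>)"
        using in\<Omega>[OF _ s] in\<Omega>[of 0] \<epsilon> by (auto simp: deep_def)
    qed
  qed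
  then show "dir_deriv (i, 0) (cutoff \<Omega> a b \<epsilon>) p *\<^sub>R i = 0" by simp
qed

end

lemma cutoff_integral_tendsto:
  fixes F :: "'a::euclidean_space \<times> real \<Rightarrow> real"
  assumes \<Omega>: "open \<Omega>" "bounded \<Omega>" and F: "integrable (lebesgue_on (cyl \<Omega> a b)) F"
    and \<epsilon>: "\<And>n. 0 < \<epsilon> n" "\<epsilon> \<longlonglongrightarrow> 0"
  shows "(\<lambda>n. \<integral>p. cutoff \<Omega> a b (\<epsilon> n) p * F p \<partial>lebesgue_on (cyl \<Omega> a b)) \<longlonglongrightarrow> (\<integral>p. F p \<partial>lebesgue_on (cyl \<Omega> a b))"
proof (rule integral_dominated_convergence[where w="\<lambda>p. norm (F p)"])
  show "F \<in> borel_measurable (lebesgue_on (cyl \<Omega> a b))" "integrable (lebesgue_on (cyl \<Omega> a b)) (\<lambda>p. norm (F p))" using F by auto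
  show "(\<lambda>p. cutoff \<Omega> a b (\<epsilon> n) p * F p) \<in> borel_measurable (lebesgue_on (cyl \<Omega> a b))" for n
    using F by (intro borel_measurable_times continuous_lebesgue_on_measurable[OF smooth_continuous[OF test_functions_smooth[OF cutoff_test[OF \<Omega> \<epsilon>(1)]]]]) auto
  show "AE p in lebesgue_on (cyl \<Omega> a b). norm (cutoff \<Omega> a b (\<epsilon> n) p * F p) \<le> norm (F p)" for n
  proof (rule AE_I2)
    fix p
    have "\<bar>cutoff \<Omega> a b (\<epsilon> n) p\<bar> \<le> 1" using cutoff_range[OF \<Omega> \<epsilon>(1), of a b n p] by simp
    then have "\<bar>cutoff \<Omega> a b (\<epsilon> n) p\<bar> * \<bar>F p\<bar> \<le> 1 * \<bar>F p\<bar>" by (intro mult_right_mono) auto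
    then show "norm (cutoff \<Omega> a b (\<epsilon> n) p * F p) \<le> norm (F p)" by (simp add: abs_mult)
  qed
  show "AE p in lebesgue_on (cyl \<Omega> a b). (\<lambda>n. cutoff \<Omega> a b (\<epsilon> n) p * F p) \<longlonglongrightarrow> F p"
  proof (rule AE_I2)
    fix p assume "p \<in> space (lebesgue_on (cyl \<Omega> a b))"
    then obtain x t where p: "p = (x, t)" "x \<in> \<Omega>" "a < t" "t < b" by (cases p) auto
    obtain e where e: "0 < e" "ball x e \<subseteq> \<Omega>" using \<Omega> p(2) open_contains_ball by blast
    have "0 < min (e / 4) (min ((t - a) / 4) ((b - t) / 4))" using e p by simp
    from order_tendstoD(2)[OF \<epsilon>(2) this]
    have "\<forall>\<^sub>F n in sequentially. F p = cutoff \<Omega> a b (\<epsilon> n) p * F p"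
    proof eventually_elim
      case (elim n)
      have "ball x (4 * \<epsilon> n) \<subseteq> ball x e" using elim by (intro subset_ball) simp
      then have "p \<in> deep \<Omega> a b (4 * \<epsilon> n)" using e elim by (auto simp: deep_def p subset_iff)
      then show ?case using cutoff_eq_1[OF \<Omega> \<epsilon>(1)] by simp
    qed
    then show "(\<lambda>n. cutoff \<Omega> a b (\<epsilon> n) p * F p) \<longlonglongrightarrow> F p" by (rule Lim_transform_eventually[OF tendsto_const])
  qed
qed

text \<open>The error in \<open>green_cutoff\<close> lives on the layer of width
  \<open>5 * \<epsilon> n\<close>. Hardy's inequality for \<open>w\<close> cancels the factor
  \<open>1 / \<epsilon> n\<close> of the cutoff gradient and leaves the norm of \<open>G\<close> on
  a shrinking layer. Cutting off in time produces no further term, as only spatial derivatives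
  occur. The shift \<open>s\<close> supplies the pairings with difference quotients.\<close>

lemma green_shift:
  fixes y :: "'a::euclidean_space \<times> real \<Rightarrow> 'a" and w D :: "'a \<times> real \<Rightarrow> real"
  assumes dom: "bounded_lipschitz_domain \<Omega>" and T: "0 < T" and z: "zero_lateral \<Omega> T w G"
    and L: "y \<in> L2 (lebesgue_on (cyl \<Omega> 0 T))" "D \<in> L2 (lebesgue_on (cyl \<Omega> 0 T))"
    and d: "has_weak_div_x (cyl \<Omega> 0 T) y D"
    and ab: "0 \<le> a" "b \<le> T" "0 \<le> a + s" "b + s \<le> T"
  shows "(\<integral>p. D p * w (p + (0, s)) \<partial>lebesgue_on (cyl \<Omega> a b)) = - (\<integral>p. y p \<bullet> G (p + (0, s)) \<partial>lebesgue_on (cyl \<Omega> a b))"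
proof -
  have \<Omega>: "open \<Omega>" "bounded \<Omega>" using dom by (auto simp: bounded_lipschitz_domain_def)
  let ?Q = "lebesgue_on (cyl \<Omega> 0 T)" and ?S = "lebesgue_on (cyl \<Omega> a b)"
  note Sm = sets_cyl(1)[OF \<Omega>(1)] and So = open_cyl[OF \<Omega>(1)]
  obtain \<phi> where \<phi>: "\<And>n. smooth (\<phi> n)" "L2_lim ?Q \<phi> w" "L2_lim ?Q (\<lambda>n. sgrad (\<phi> n)) G"
    and wG: "w \<in> L2 ?Q" "G \<in> L2 ?Q"
    using z by (auto simp: zero_lateral_def)
  have sh: "(\<lambda>p. f (p + (0, s))) \<in> L2 ?S" "L2_norm ?S (\<lambda>p. f (p + (0, s))) \<le> L2_norm ?Q f"
    if f: "f \<in> L2 ?Q" for f :: "'a \<times> real \<Rightarrow> 'b::euclidean_space"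
  proof -
    note f' = L2_cyl_mono[OF \<Omega>(1) f ab(3,4)]
    show "(\<lambda>p. f (p + (0, s))) \<in> L2 ?S" "L2_norm ?S (\<lambda>p. f (p + (0, s))) \<le> L2_norm ?Q f"
      using L2_shift[OF \<Omega>(1) f'(1), of s] f'(2) by auto
  qed
  have lim: "L2_lim ?S (\<lambda>n p. f n (p + (0, s))) (\<lambda>p. g (p + (0, s)))" if "L2_lim ?Q f g"
    for f and g :: "'a \<times> real \<Rightarrow> 'b::euclidean_space"
    unfolding L2_lim_def
  proof (intro conjI allI)
    have D: "(\<lambda>p. f n p - g p) \<in> L2 ?Q" for n using that by (simp add: L2_lim_def)
    show "(\<lambda>p. f n (p + (0, s)) - g (p + (0, s))) \<in> L2 ?S" for n by (rule sh(1)[OF D])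
    have "\<forall>\<^sub>F n in sequentially. norm (L2_norm ?S (\<lambda>p. f n (p + (0, s)) - g (p + (0, s)))) \<le> L2_norm ?Q (\<lambda>p. f n p - g p)"
      using sh(2)[OF D] by simp
    then show "(\<lambda>n. L2_norm ?S (\<lambda>p. f n (p + (0, s)) - g (p + (0, s)))) \<longlonglongrightarrow> 0"
      by (rule Lim_null_comparison) (use that in \<open>simp add: L2_lim_def\<close>)
  qed
  define w' G' where "w' p = w (p + (0, s))" and "G' p = G (p + (0, s))" for p
  have L': "y \<in> L2 ?S" "D \<in> L2 ?S" "w' \<in> L2 ?S" "G' \<in> L2 ?S"
    using L2_cyl_mono(1)[OF \<Omega>(1) L(1) ab(1,2)] L2_cyl_mono(1)[OF \<Omega>(1) L(2) ab(1,2)] sh(1)[OF wG(1)] sh(1)[OF wG(2)]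
    by (auto simp: w'_def[abs_def] G'_def[abs_def])
  have dS: "has_weak_div_x (cyl \<Omega> a b) y D"
    by (rule has_weak_div_x_subset[OF So Sm Sm cyl_mono[OF ab(1,2)] d])
  note cut = green_cutoff[OF So Sm L' dS smooth_translate[OF \<phi>(1)] lim[OF \<phi>(2), folded w'_def]
      lim[OF \<phi>(3), folded G'_def sgrad_translate[OF \<phi>(1)]]]
  obtain C \<delta>0 where C: "0 < C" "0 < \<delta>0" and H: "\<And>\<delta>. 0 < \<delta> \<Longrightarrow> \<delta> \<le> \<delta>0 \<Longrightarrow>
    (L2_norm (lebesgue_on (cyl (layer \<Omega> \<delta>) 0 T)) w)\<^sup>2 \<le> C * \<delta>\<^sup>2 * (L2_norm (lebesgue_on (cyl (layer \<Omega> (C * \<delta>)) 0 T)) G)\<^sup>2"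
    using hardy_zero_lateral[OF dom T z] by blast
  \<comment> \<open>Chosen such that the layers of width \<open>5 * \<epsilon> n\<close> are within
    the range \<open>\<delta>0\<close> of Hardy's inequality.\<close>
  define \<epsilon> where "\<epsilon> n = \<delta>0 / 5 / real (Suc n)" for n
  have \<epsilon>: "0 < \<epsilon> n" "5 * \<epsilon> n \<le> \<delta>0" for n using C by (auto simp: \<epsilon>_def field_simps)
  have \<epsilon>0: "\<epsilon> \<longlonglongrightarrow> 0" unfolding \<epsilon>_def by (rule LIMSEQ_Suc) real_asymp
  define \<theta> where "\<theta> n = cutoff \<Omega> a b (\<epsilon> n)" for n
  have \<theta>: "\<theta> n \<in> test_functions (cyl \<Omega> a b)" for n unfolding \<theta>_def by (rule cutoff_test[OF \<Omega> \<epsilon>(1)])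
  define K where "K = DIM('a) * (4 * exp 2 * 2 ^ DIM('a \<times> real))"
  have K: "0 \<le> K" by (simp add: K_def)
  have mid: "\<bar>\<integral>p. w' p * (sgrad (\<theta> n) p \<bullet> y p) \<partial>?S\<bar>
      \<le> 5 * sqrt C * K * L2_norm ?S y * L2_norm (lebesgue_on (cyl (layer \<Omega> (C * (5 * \<epsilon> n))) 0 T)) G" for n
  proof -
    let ?E = "cyl (layer \<Omega> (5 * \<epsilon> n)) a b"
    note Em = cyl_layer[OF \<Omega>(1), of "5 * \<epsilon> n"]
    have wE: "w' \<in> L2 (lebesgue_on ?E)" and yE: "y \<in> L2 (lebesgue_on ?E)" "L2_norm (lebesgue_on ?E) y \<le> L2_norm ?S y"
      using L2_restrict[OF L'(3) Sm Em(1,3)] L2_restrict[OF L'(1) Sm Em(1,3)] by auto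
    have sE: "(\<lambda>p. sgrad (\<theta> n) p \<bullet> y p) \<in> L2 (lebesgue_on ?E)"
      by (rule L2_restrict(1)[OF cut(1)[OF \<theta>] Sm Em(1,3)])
    have "L2_norm (lebesgue_on ?E) (\<lambda>p. sgrad (\<theta> n) p \<bullet> y p) \<le> K / \<epsilon> n * L2_norm (lebesgue_on ?E) y"
    proof (rule L2_dominated(2)[OF L2_measurable[OF sE] yE(1)])
      show "0 \<le> K / \<epsilon> n" using K \<epsilon>(1)[of n] by simp
      have "norm (sgrad (\<theta> n) p \<bullet> y p) \<le> K / \<epsilon> n * norm (y p)" for p
        using order_trans[OF Cauchy_Schwarz_ineq2 mult_right_mono[OF sgrad_cutoff_le[OF \<Omega> \<epsilon>(1), of a b n p]]]
        by (simp add: \<theta>_def K_def)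
      then show "AE p in lebesgue_on ?E. norm (sgrad (\<theta> n) p \<bullet> y p) \<le> K / \<epsilon> n * norm (y p)" by simp
    qed
    also have "\<dots> \<le> K / \<epsilon> n * L2_norm ?S y" using yE K \<epsilon>(1)[of n] by (intro mult_left_mono) auto
    finally have n1: "L2_norm (lebesgue_on ?E) (\<lambda>p. sgrad (\<theta> n) p \<bullet> y p) \<le> K / \<epsilon> n * L2_norm ?S y" .
    \<comment> \<open>The shift is undone and the time interval enlarged to \<open>(0, T)\<close>,
      where Hardy's inequality is available.\<close>
    have n2: "L2_norm (lebesgue_on ?E) w' \<le> sqrt C * (5 * \<epsilon> n) * L2_norm (lebesgue_on (cyl (layer \<Omega> (C * (5 * \<epsilon> n))) 0 T)) G"
    proof (rule power2_le_imp_le)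
      let ?l = "layer \<Omega> (5 * \<epsilon> n)"
      have lo: "open ?l" by (rule open_layer[OF \<Omega>(1)])
      have w0: "w \<in> L2 (lebesgue_on (cyl ?l 0 T))" by (rule L2_restrict(1)[OF wG(1) Sm Em(1,3)])
      note w1 = L2_cyl_mono[OF lo w0 ab(3,4)]
      have "L2_norm (lebesgue_on ?E) w' = L2_norm (lebesgue_on (cyl ?l (a + s) (b + s))) w"
        using L2_shift(2)[OF lo w1(1), of s] by (simp add: w'_def[abs_def])
      also have "\<dots> \<le> L2_norm (lebesgue_on (cyl ?l 0 T)) w" by (rule w1(2))
      finally have "(L2_norm (lebesgue_on ?E) w')\<^sup>2 \<le> (L2_norm (lebesgue_on (cyl ?l 0 T)) w)\<^sup>2" by (intro power_mono) auto
      also have "\<dots> \<le> C * (5 * \<epsilon> n)\<^sup>2 * (L2_norm (lebesgue_on (cyl (layer \<Omega> (C * (5 * \<epsilon> n))) 0 T)) G)\<^sup>2"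
        using \<epsilon>[of n] by (intro H) auto
      finally show "(L2_norm (lebesgue_on ?E) w')\<^sup>2 \<le> (sqrt C * (5 * \<epsilon> n) * L2_norm (lebesgue_on (cyl (layer \<Omega> (C * (5 * \<epsilon> n))) 0 T)) G)\<^sup>2"
        using C by (simp add: power_mult_distrib)
    qed (use C \<epsilon>(1)[of n] in simp)
    have "(\<integral>p. w' p * (sgrad (\<theta> n) p \<bullet> y p) \<partial>?S) = (\<integral>p. w' p * (sgrad (\<theta> n) p \<bullet> y p) \<partial>lebesgue_on ?E)"
    proof (rule integral_lebesgue_on_subset[OF Sm Em(1,3)])
      fix p assume "p \<in> cyl \<Omega> a b" "p \<notin> ?E"
      then have "sgrad (\<theta> n) p = 0" unfolding \<theta>_def by (intro sgrad_cutoff_eq_0[OF \<Omega> \<epsilon>(1)]) (auto simp: cyl_def)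
      then show "w' p * (sgrad (\<theta> n) p \<bullet> y p) = 0" by simp
    qed
    then have "\<bar>\<integral>p. w' p * (sgrad (\<theta> n) p \<bullet> y p) \<partial>?S\<bar> \<le> L2_norm (lebesgue_on ?E) w' * L2_norm (lebesgue_on ?E) (\<lambda>p. sgrad (\<theta> n) p \<bullet> y p)"
      using L2_Cauchy_Schwarz_mult[OF wE sE] by simp
    also have "\<dots> \<le> (sqrt C * (5 * \<epsilon> n) * L2_norm (lebesgue_on (cyl (layer \<Omega> (C * (5 * \<epsilon> n))) 0 T)) G) * (K / \<epsilon> n * L2_norm ?S y)"
      using C \<epsilon>(1)[of n] by (intro mult_mono n1 n2) auto
    also have "\<dots> = 5 * sqrt C * K * L2_norm ?S y * L2_norm (lebesgue_on (cyl (layer \<Omega> (C * (5 * \<epsilon> n))) 0 T)) G"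
      using \<epsilon>(1)[of n] by simp
    finally show ?thesis .
  qed
  have "(\<lambda>n. C * (5 * \<epsilon> n)) \<longlonglongrightarrow> C * (5 * 0)" by (intro tendsto_intros \<epsilon>0)
  then have "(\<lambda>n. C * (5 * \<epsilon> n)) \<longlonglongrightarrow> 0" by simp
  from tendsto_mult_right_zero[OF layer_norm_tendsto_0[OF \<Omega>(1) wG(2) this], of "5 * sqrt C * K * L2_norm ?S y"]
  have mid0: "(\<lambda>n. \<integral>p. w' p * (sgrad (\<theta> n) p \<bullet> y p) \<partial>?S) \<longlonglongrightarrow> 0"
    by (rule Lim_null_comparison[rotated]) (use mid in simp)
  have "(\<lambda>n. (\<integral>p. \<theta> n p * (y p \<bullet> G' p) \<partial>?S) + (\<integral>p. w' p * (sgrad (\<theta> n) p \<bullet> y p) \<partial>?S) + (\<integral>p. \<theta> n p * (w' p * D p) \<partial>?S))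
     \<longlonglongrightarrow> (\<integral>p. y p \<bullet> G' p \<partial>?S) + 0 + (\<integral>p. w' p * D p \<partial>?S)"
    unfolding \<theta>_def
    by (intro tendsto_add cutoff_integral_tendsto[OF \<Omega> _ \<epsilon>(1) \<epsilon>0] mid0[unfolded \<theta>_def] L2_inner_integrable L2_mult_integrable L')
  then have "(\<lambda>n. 0) \<longlonglongrightarrow> (\<integral>p. y p \<bullet> G' p \<partial>?S) + 0 + (\<integral>p. w' p * D p \<partial>?S)"
    unfolding cut(2)[OF \<theta>] .
  from LIMSEQ_unique[OF this tendsto_const] show ?thesis
    by (simp add: w'_def G'_def mult.commute)
qed

section \<open>The energy of the spatial gradient as a function of time\<close>

text \<open>Under the integral, a change of the end time matters in the limit only on the hyperplane
  of time \<open>\<tau>\<close>, a null set; dominated convergence does the rest. The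
  \<open>min\<close> extends the function continuously beyond \<open>T\<close>.\<close>

lemma integral_cyl_continuous:
  fixes f :: "'a::euclidean_space \<times> real \<Rightarrow> real"
  assumes \<Omega>: "open \<Omega>" and f: "integrable (lebesgue_on (cyl \<Omega> 0 T)) f"
  shows "continuous_on UNIV (\<lambda>\<tau>. \<integral>p. f p \<partial>lebesgue_on (cyl \<Omega> 0 (min \<tau> T)))"
proof -
  let ?Q = "lebesgue_on (cyl \<Omega> 0 T)"
  have [measurable]: "snd \<in> borel_measurable ?Q" "f \<in> borel_measurable ?Q"
    using f by (auto intro!: continuous_lebesgue_on_measurable continuous_intros)
  have eq: "(\<integral>p. f p \<partial>lebesgue_on (cyl \<Omega> 0 (min \<tau> T))) = (\<integral>p. (if snd p < \<tau> then f p else 0) \<partial>?Q)" for \<tau>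
  proof -
    have "(\<integral>p. (if snd p < \<tau> then f p else 0) \<partial>?Q) = (\<integral>p. (if snd p < \<tau> then f p else 0) \<partial>lebesgue_on (cyl \<Omega> 0 (min \<tau> T)))"
      by (intro integral_lebesgue_on_subset sets_cyl(1)[OF \<Omega>]) (auto simp: cyl_def)
    also have "\<dots> = (\<integral>p. f p \<partial>lebesgue_on (cyl \<Omega> 0 (min \<tau> T)))"
      by (intro Bochner_Integration.integral_cong) (auto simp: cyl_def)
    finally show ?thesis ..
  qed
  have "isCont (\<lambda>\<tau>. \<integral>p. (if snd p < \<tau> then f p else 0) \<partial>?Q) \<tau>" for \<tau>
    unfolding continuous_at_sequentially o_def
  proof (intro allI impI)
    fix \<sigma> :: "nat \<Rightarrow> real" assume \<sigma>: "\<sigma> \<longlonglongrightarrow> \<tau>"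
    show "(\<lambda>n. \<integral>p. (if snd p < \<sigma> n then f p else 0) \<partial>?Q) \<longlonglongrightarrow> (\<integral>p. (if snd p < \<tau> then f p else 0) \<partial>?Q)"
    proof (rule integral_dominated_convergence[where w="\<lambda>p. norm (f p)"])
      have "negligible {p :: 'a \<times> real. (0, 1) \<bullet> p = \<tau>}" by (rule negligible_hyperplane) (simp add: zero_prod_def)
      then have "AE p in lebesgue. p \<notin> {p :: 'a \<times> real. (0, 1) \<bullet> p = \<tau>}"
        by (intro AE_not_in) (simp add: negligible_iff_null_sets)
      then have "AE p :: 'a \<times> real in lebesgue. snd p \<noteq> \<tau>" by (rule eventually_mono) (auto simp: inner_prod_def)
      then have "AE p in ?Q. snd p \<noteq> \<tau>"
        using sets_cyl(1)[OF \<Omega>] by (subst AE_restrict_space_iff) auto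
      then show "AE p in ?Q. (\<lambda>n. if snd p < \<sigma> n then f p else 0) \<longlonglongrightarrow> (if snd p < \<tau> then f p else 0)"
      proof (rule eventually_mono)
        fix p :: "'a \<times> real" assume p: "snd p \<noteq> \<tau>"
        have "\<forall>\<^sub>F n in sequentially. (if snd p < \<tau> then f p else 0) = (if snd p < \<sigma> n then f p else 0)"
        proof (cases "snd p < \<tau>")
          case True
          show ?thesis using order_tendstoD(1)[OF \<sigma> True] by eventually_elim (use True in simp)
        next
          case False
          then have p': "\<tau> < snd p" using p by simp
          show ?thesis using order_tendstoD(2)[OF \<sigma> p'] by eventually_elim (use False in simp)
        qed
        then show "(\<lambda>n. if snd p < \<sigma> n then f p else 0) \<longlonglongrightarrow> (if snd p < \<tau> then f p else 0)"
          by (rule Lim_transform_eventually[OF tendsto_const])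
      qed
    qed (use f in auto)
  qed
  then show ?thesis unfolding eq by (intro continuous_at_imp_continuous_on) auto
qed

text \<open>\<open>f\<close> is only Lebesgue measurable on the product, so an individual slice may
  fail to be measurable; \<open>n\<close> is computed from a Borel version. The equality asks for
  \<open>n t < \<infinity>\<close> because the norm of a slice that is not square-integrable is 0 by
  convention.\<close>

lemma slice_norms:
  fixes f :: "'a::euclidean_space \<times> real \<Rightarrow> 'b::euclidean_space"
  assumes \<Omega>: "open \<Omega>" and f: "f \<in> L2 (lebesgue_on (cyl \<Omega> 0 T))"
  obtains n :: "real \<Rightarrow> ennreal" where "n \<in> borel_measurable borel"
    "AE t in lborel. 0 < t \<and> t < T \<and> n t < \<infinity> \<longrightarrow> n t = ennreal ((L2_norm (lebesgue_on \<Omega>) (\<lambda>x. f (x, t)))\<^sup>2)"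
    "\<And>a b. 0 \<le> a \<Longrightarrow> b \<le> T \<Longrightarrow>
      ennreal ((L2_norm (lebesgue_on (cyl \<Omega> a b)) f)\<^sup>2) = (\<integral>\<^sup>+t. n t * indicator {a<..<b} t \<partial>lborel)"
proof -
  have [measurable]: "\<Omega> \<in> sets borel" "\<And>a b. cyl \<Omega> a b \<in> sets borel" using \<Omega> sets_cyl(2) by auto
  define q where "q p = ennreal ((norm (f p))\<^sup>2) * indicator (cyl \<Omega> 0 T) p" for p
  have "q \<in> borel_measurable lebesgue"
  proof -
    have "(\<lambda>p. ennreal ((norm (f p))\<^sup>2)) \<in> borel_measurable (lebesgue_on (cyl \<Omega> 0 T))" using L2_measurable[OF f] by measurable
    then show ?thesis unfolding q_def[abs_def]
      using sets_cyl(1)[OF \<Omega>] by (subst (asm) borel_measurable_restrict_space_iff_ennreal) auto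
  qed
  from completion_ex_borel_measurable[OF this] obtain F where F[measurable]: "F \<in> borel_measurable lborel" and qF: "AE p in lborel. q p = F p" ..
  then have [measurable]: "F \<in> borel_measurable (lborel \<Otimes>\<^sub>M lborel)" by (simp add: lborel_prod)
  \<comment> \<open>A measurable null set around the exceptional points allows the two
    almost-everywhere quantifiers to be exchanged.\<close>
  obtain N where N: "{p \<in> space lborel. \<not> q p = F p} \<subseteq> N" "N \<in> null_sets lborel" using AE_E3[OF qF] by (metis AE_E null_setsI qF)
  define n where "n t = (\<integral>\<^sup>+x. F (x, t) \<partial>lborel)" for t
  have [measurable]: "n \<in> borel_measurable borel"
    unfolding n_def[abs_def] by measurable
  have "AE p in lborel \<Otimes>\<^sub>M lborel. p \<notin> N" unfolding lborel_prod by (rule AE_not_in[OF N(2)])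
  then have "AE x in lborel. AE t in lborel. (x, t) \<notin> N" by (rule lborel_pair.AE_pair)
  then have "AE t in lborel. AE x in lborel. (x, t) \<notin> N"
  proof (subst (asm) lborel_pair.AE_commute)
    have "N \<in> sets (lborel \<Otimes>\<^sub>M lborel)" using N(2) unfolding lborel_prod null_sets_def by simp
    from sets.compl_sets[OF this]
    show "{x \<in> space (lborel \<Otimes>\<^sub>M lborel). (fst x, snd x) \<notin> N} \<in> sets (lborel \<Otimes>\<^sub>M lborel)"
      by (auto elim!: back_subst[of "\<lambda>A. A \<in> sets _"])
  qed simp
  then have AEs: "AE t in lborel. AE x in lborel. q (x, t) = F (x, t)"
    by (rule eventually_mono) (erule eventually_mono, use N(1) in auto)
  show thesis
  proof (rule that[of n])
    show "AE t in lborel. 0 < t \<and> t < T \<and> n t < \<infinity> \<longrightarrow> n t = ennreal ((L2_norm (lebesgue_on \<Omega>) (\<lambda>x. f (x, t)))\<^sup>2)"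
      using AEs
    proof (rule eventually_mono, intro impI)
      fix t assume ae: "AE x in lborel. q (x, t) = F (x, t)" and t: "0 < t \<and> t < T \<and> n t < \<infinity>"
      define h where "h x = (norm (f (x, t)))\<^sup>2 * indicator \<Omega> x" for x
      have qh: "q (x, t) = ennreal (h x)" for x using t by (simp add: q_def h_def indicator_def)
      have h0: "0 \<le> h x" for x by (simp add: h_def)
      have hm: "h \<in> borel_measurable lebesgue"
      proof (rule borel_measurable_AE)
        show "(\<lambda>x. enn2real (F (x, t))) \<in> borel_measurable lebesgue"
          by (rule measurable_completion) measurable
        have "AE x in lborel. enn2real (F (x, t)) = h x"
          using ae by (rule eventually_mono) (metis qh enn2real_ennreal h0)
        then show "AE x in lebesgue. enn2real (F (x, t)) = h x" by (rule AE_completion)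
      qed
      have "(\<integral>\<^sup>+x. ennreal (h x) \<partial>lebesgue) = n t"
        unfolding n_def nn_integral_completion using ae by (intro nn_integral_cong_AE) (auto simp: qh)
      moreover have "(L2_norm (lebesgue_on \<Omega>) (\<lambda>x. f (x, t)))\<^sup>2 = (\<integral>x. h x \<partial>lebesgue)"
        unfolding L2_norm_square h_def using \<Omega>
        by (subst integral_restrict_space) (auto simp: mult.commute)
      moreover have "(\<integral>x. h x \<partial>lebesgue) = enn2real (\<integral>\<^sup>+x. ennreal (h x) \<partial>lebesgue)"
        by (rule integral_eq_nn_integral[OF hm]) (simp add: h0)
      ultimately show "n t = ennreal ((L2_norm (lebesgue_on \<Omega>) (\<lambda>x. f (x, t)))\<^sup>2)" using t by simp
    qed
    fix a b assume ab: "(0::real) \<le> a" "b \<le> T"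
    have fL: "f \<in> L2 (lebesgue_on (cyl \<Omega> a b))" by (rule L2_cyl_mono(1)[OF \<Omega> f ab])
    have "ennreal ((L2_norm (lebesgue_on (cyl \<Omega> a b)) f)\<^sup>2) = (\<integral>\<^sup>+p. ennreal ((norm (f p))\<^sup>2) * indicator (cyl \<Omega> a b) p \<partial>lborel)"
      unfolding L2_norm_nn_integral[OF fL] nn_integral_lebesgue_on[OF sets_cyl(1)[OF \<Omega>]] ..
    also have "\<dots> = (\<integral>\<^sup>+p. F p * indicator {a<..<b} (snd p) \<partial>lborel)"
      using qF
    proof (intro nn_integral_cong_AE, elim eventually_mono)
      fix p assume "q p = F p"
      then have "F p = ennreal ((norm (f p))\<^sup>2) * indicator (cyl \<Omega> 0 T) p" by (simp add: q_def)
      then show "ennreal ((norm (f p))\<^sup>2) * indicator (cyl \<Omega> a b) p = F p * indicator {a<..<b} (snd p)"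
        using ab by (auto simp: indicator_def cyl_def)
    qed
    also have "\<dots> = (\<integral>\<^sup>+p. F p * indicator {a<..<b} (snd p) \<partial>(lborel \<Otimes>\<^sub>M lborel))" by (simp add: lborel_prod)
    also have "\<dots> = (\<integral>\<^sup>+t. (\<integral>\<^sup>+x. F (x, t) * indicator {a<..<b} t \<partial>lborel) \<partial>lborel)"
      by (subst lborel_pair.nn_integral_snd[symmetric]) auto
    also have "\<dots> = (\<integral>\<^sup>+t. n t * indicator {a<..<b} t \<partial>lborel)"
      unfolding n_def by (intro nn_integral_cong nn_integral_multc) measurable
    finally show "ennreal ((L2_norm (lebesgue_on (cyl \<Omega> a b)) f)\<^sup>2) = (\<integral>\<^sup>+t. n t * indicator {a<..<b} t \<partial>lborel)" .
  qed measurable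
qed

text \<open>Cut to \<open>(0, T)\<close>, the two densities define measures that are finite and
  agree on all half-lines, hence coincide; a finite measure determines its density almost
  everywhere.\<close>

lemma AE_eq_of_interval_integrals:
  fixes n m :: "real \<Rightarrow> ennreal"
  assumes [measurable]: "n \<in> borel_measurable borel" "m \<in> borel_measurable borel"
    and fin: "(\<integral>\<^sup>+t. n t * indicator {0<..<T} t \<partial>lborel) < \<infinity>"
    and eq: "\<And>a. 0 \<le> a \<Longrightarrow> (\<integral>\<^sup>+t. n t * indicator {a<..<T} t \<partial>lborel) = (\<integral>\<^sup>+t. m t * indicator {a<..<T} t \<partial>lborel)"
  shows "AE t in lborel. 0 < t \<and> t < T \<longrightarrow> n t = m t"
proof -
  define n' m' where "n' t = n t * indicator {0<..<T} t" and "m' t = m t * indicator {0<..<T} t" for t :: real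
  have [measurable]: "n' \<in> borel_measurable lborel" "m' \<in> borel_measurable lborel"
    unfolding n'_def[abs_def] m'_def[abs_def] by measurable
  have e: "emeasure (density lborel (\<lambda>t. k t * indicator {0<..<T} t)) {x<..} = (\<integral>\<^sup>+t. k t * indicator {max 0 x<..<T} t \<partial>lborel)"
    if [measurable]: "k \<in> borel_measurable borel" for k :: "real \<Rightarrow> ennreal" and x
    by (subst emeasure_density) (auto intro!: nn_integral_cong simp: indicator_def)
  have "density lborel n' = density lborel m'"
  proof (rule measure_eqI_lessThan)
    fix x :: real
    have "emeasure (density lborel n') {x<..} \<le> (\<integral>\<^sup>+t. n t * indicator {0<..<T} t \<partial>lborel)"
      unfolding n'_def[abs_def] by (subst e) (auto intro!: nn_integral_mono simp: indicator_def)
    then show "emeasure (density lborel n') {x<..} < \<infinity>" using fin by (rule le_less_trans)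
    show "emeasure (density lborel n') {x<..} = emeasure (density lborel m') {x<..}"
      unfolding n'_def[abs_def] m'_def[abs_def] by (simp add: e eq)
  qed auto
  moreover have "integral\<^sup>N lborel n' \<noteq> \<infinity>" using fin by (simp add: n'_def[abs_def] less_top)
  ultimately have "AE t in lborel. n' t = m' t"
    by (subst finite_density_unique[symmetric]) auto
  then show ?thesis by (rule eventually_mono) (auto simp: n'_def m'_def)
qed

text \<open>If the values at \<open>T\<close> differed, the functions would differ on a whole
  interval ending at \<open>T\<close>, which is not a null set. This is the uniqueness behind
  \<open>grad_norm_\<Sigma>T\<close>.\<close>

lemma continuous_AE_unique:
  fixes N M :: "real \<Rightarrow> real"
  assumes T: "0 < T" and c: "continuous_on {0..T} N" "continuous_on {0..T} M"
    and ae: "AE t in lebesgue_on {0<..<T}. N t = M t"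
  shows "N T = M T"
proof (rule ccontr)
  assume ne: "N T \<noteq> M T"
  have "continuous_on {0..T} (\<lambda>t. N t - M t)" by (intro continuous_intros c)
  then have "((\<lambda>t. N t - M t) \<longlongrightarrow> N T - M T) (at T within {0..T})"
    using T by (auto simp: continuous_on_def)
  then have "\<forall>\<^sub>F t in at T within {0..T}. N t - M t \<noteq> 0"
    by (rule tendsto_imp_eventually_ne) (use ne in simp)
  then obtain d where d: "0 < d" "\<And>t. t \<in> {0..T} \<Longrightarrow> t \<noteq> T \<Longrightarrow> dist t T < d \<Longrightarrow> N t \<noteq> M t"
    unfolding eventually_at by auto
  define a where "a = max 0 (T - d)"
  have a: "0 \<le> a" "a < T" using T d(1) by (auto simp: a_def)
  have "AE t in lebesgue. t \<in> {0<..<T} \<longrightarrow> N t = M t"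
    using ae by (subst (asm) AE_restrict_space_iff) auto
  then have "AE t in lebesgue. t \<notin> {a<..<T}"
  proof (rule eventually_mono)
    fix t assume t: "t \<in> {0<..<T} \<longrightarrow> N t = M t"
    show "t \<notin> {a<..<T}"
    proof
      assume "t \<in> {a<..<T}"
      then have "0 < t" "t < T" "T - d < t" by (auto simp: a_def)
      then show False using t d(2)[of t] by (auto simp: dist_real_def)
    qed
  qed
  then have "{a<..<T} \<in> null_sets lebesgue"
    by (subst (asm) AE_iff_null_sets[symmetric]) auto
  then show False using a by (auto simp: null_sets_def)
qed

lemma L2_cong_space:
  assumes "\<And>x. x \<in> space M \<Longrightarrow> f x = g x"
  shows "f \<in> L2 M \<longleftrightarrow> g \<in> L2 M" "L2_norm M f = L2_norm M g"
proof -
  have "f \<in> borel_measurable M \<longleftrightarrow> g \<in> borel_measurable M" using assms by (intro measurable_cong) auto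
  moreover have "integrable M (\<lambda>x. (norm (f x))\<^sup>2) \<longleftrightarrow> integrable M (\<lambda>x. (norm (g x))\<^sup>2)"
    using assms by (intro Bochner_Integration.integrable_cong) auto
  ultimately show "f \<in> L2 M \<longleftrightarrow> g \<in> L2 M" by (simp add: L2_def)
  have "(\<integral>x. (norm (f x))\<^sup>2 \<partial>M) = (\<integral>x. (norm (g x))\<^sup>2 \<partial>M)"
    using assms by (intro Bochner_Integration.integral_cong) auto
  then show "L2_norm M f = L2_norm M g" by (simp add: L2_norm_def)
qed

lemma L2_zero_extension:
  fixes f :: "'e::euclidean_space \<Rightarrow> 'b::euclidean_space"
  assumes f: "f \<in> L2 (lebesgue_on S)" and S: "S \<in> sets lebesgue" "S' \<in> sets lebesgue"
  shows "(\<lambda>p. if p \<in> S then f p else 0) \<in> L2 (lebesgue_on S')"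
proof -
  have "(\<lambda>p. if p \<in> S then f p else 0) \<in> borel_measurable lebesgue"
    using L2_measurable[OF f] S by (simp add: borel_measurable_if)
  moreover have "integrable lebesgue (\<lambda>p. (norm (if p \<in> S then f p else 0))\<^sup>2)"
  proof -
    have "integrable lebesgue (\<lambda>p. indicator S p *\<^sub>R (norm (f p))\<^sup>2)"
      using L2_integrable[OF f] S by (subst (asm) integrable_restrict_space) auto
    moreover have "(\<lambda>p. indicator S p *\<^sub>R (norm (f p))\<^sup>2) = (\<lambda>p. (norm (if p \<in> S then f p else 0))\<^sup>2)"
      by (auto simp: indicator_def)
    ultimately show ?thesis by simp
  qed
  ultimately have "(\<lambda>p. if p \<in> S then f p else 0) \<in> L2 (lebesgue_on UNIV)" by (simp add: L2_def lebesgue_on_UNIV_eq)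
  then show ?thesis by (rule L2_restrict(1)) (use S in auto)
qed

text \<open>Inherited from the additivity of the time integral of the slice norms, for which the
  common end point is null.\<close>

lemma L2_norm_cyl_split:
  fixes f :: "'a::euclidean_space \<times> real \<Rightarrow> 'b::euclidean_space"
  assumes \<Omega>: "open \<Omega>" and f: "f \<in> L2 (lebesgue_on (cyl \<Omega> 0 T))" and a: "0 \<le> a" "a \<le> b" "b \<le> T"
  shows "(L2_norm (lebesgue_on (cyl \<Omega> 0 b)) f)\<^sup>2
    = (L2_norm (lebesgue_on (cyl \<Omega> 0 a)) f)\<^sup>2 + (L2_norm (lebesgue_on (cyl \<Omega> a b)) f)\<^sup>2"
proof -
  obtain n where [measurable]: "n \<in> borel_measurable borel" and n: "\<And>a b. 0 \<le> a \<Longrightarrow> b \<le> T \<Longrightarrow>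
      ennreal ((L2_norm (lebesgue_on (cyl \<Omega> a b)) f)\<^sup>2) = (\<integral>\<^sup>+t. n t * indicator {a<..<b} t \<partial>lborel)"
    using slice_norms[OF \<Omega> f] by metis
  have "(\<integral>\<^sup>+t. n t * indicator {0<..<b} t \<partial>lborel)
      = (\<integral>\<^sup>+t. n t * indicator {0<..<a} t + n t * indicator {a<..<b} t \<partial>lborel)"
    using AE_lborel_singleton[of a]
    by (intro nn_integral_cong_AE, elim eventually_mono) (use a in \<open>auto simp: indicator_def\<close>)
  also have "\<dots> = (\<integral>\<^sup>+t. n t * indicator {0<..<a} t \<partial>lborel) + (\<integral>\<^sup>+t. n t * indicator {a<..<b} t \<partial>lborel)"
    by (rule nn_integral_add) measurable
  finally have "ennreal ((L2_norm (lebesgue_on (cyl \<Omega> 0 b)) f)\<^sup>2)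
      = ennreal ((L2_norm (lebesgue_on (cyl \<Omega> 0 a)) f)\<^sup>2) + ennreal ((L2_norm (lebesgue_on (cyl \<Omega> a b)) f)\<^sup>2)"
    using a by (simp add: n)
  also have "\<dots> = ennreal ((L2_norm (lebesgue_on (cyl \<Omega> 0 a)) f)\<^sup>2 + (L2_norm (lebesgue_on (cyl \<Omega> a b)) f)\<^sup>2)"
    by (rule ennreal_plus[symmetric]) auto
  finally show ?thesis by (subst (asm) ennreal_inj) auto
qed

text \<open>\<open>e\<close>, \<open>g\<close>, \<open>G\<close> and \<open>D\<close> stand for the
  error, its time derivative, spatial gradient and Laplacian. \<open>D\<close> is any weak
  divergence of \<open>G\<close>, and the traces are given by approximating sequences, which frees
  the argument from the representatives picked by the operators.\<close>

locale parabolic_strip = weak_time_strip \<Omega> "0::real" T e g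
  for \<Omega> :: "'a::euclidean_space set" and T e g +
  fixes G :: "'a \<times> real \<Rightarrow> 'a" and D :: "'a \<times> real \<Rightarrow> real"
  assumes dom: "bounded_lipschitz_domain \<Omega>" and lat: "zero_lateral \<Omega> T e G"
    and D: "D \<in> L2 (lebesgue_on (cyl \<Omega> 0 T))" and GD: "has_weak_div_x (cyl \<Omega> 0 T) G D"
    and init: "time_trace \<Omega> 0 T 0 e g (\<lambda>x. 0)"
begin

lemma G: "G \<in> L2 Q"
  using lat by (simp add: zero_lateral_def)

text \<open>Since the initial trace is zero, the extension has a weak time derivative on the strip
  from \<open>- T\<close> to \<open>T\<close>, and backward quotients make sense from time 0
  on.\<close>

definition e0 :: "'a \<times> real \<Rightarrow> real" where "e0 p = (if 0 < snd p then e p else 0)"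

lemma e0_L2: "e0 \<in> L2 (lebesgue_on (cyl \<Omega> (- T) T))"
proof -
  have "(\<lambda>p. if p \<in> cyl \<Omega> 0 T then e p else 0) \<in> L2 (lebesgue_on (cyl \<Omega> (- T) T))"
    by (intro L2_zero_extension w sets_cyl(1)[OF \<Omega>(1)])
  then show ?thesis by (subst L2_cong_space(1)) (auto simp: e0_def cyl_def)
qed

text \<open>A forward quotient of \<open>e0\<close>, compared with the derivative at its later end
  by \<open>\<sigma> = 1\<close> and then shifted by \<open>h\<close>. For \<open>h < T\<close> the
  shifted strip still contains the times \<open>(0, T)\<close>.\<close>

lemma backward_quotient:
  assumes \<epsilon>: "0 < \<epsilon>"
  shows "\<exists>d>0. \<forall>h. 0 < h \<and> h < d \<longrightarrow>
     (\<lambda>p. (e p - e0 (p + (0, - h))) / h - g p) \<in> L2 Q \<and> L2_norm Q (\<lambda>p. (e p - e0 (p + (0, - h))) / h - g p) < \<epsilon>"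
proof -
  define g0 where "g0 p = (if 0 < snd p then g p else 0)" for p
  have "(\<lambda>p. if p \<in> cyl \<Omega> 0 T then g p else 0) \<in> L2 (lebesgue_on (cyl \<Omega> (- T) T))"
    by (intro L2_zero_extension k sets_cyl(1)[OF \<Omega>(1)])
  then have g0: "g0 \<in> L2 (lebesgue_on (cyl \<Omega> (- T) T))"
    by (subst L2_cong_space(1)) (auto simp: g0_def cyl_def)
  interpret X: weak_time_strip \<Omega> "- T" T e0 g0
  proof
    show "has_weak_dt (cyl \<Omega> (- T) T) e0 g0"
      unfolding e0_def[abs_def] g0_def[abs_def] using ab by (intro zero_extension_weak_dt init) auto
  qed (use \<Omega> ab e0_L2 g0 in auto)
  obtain d where d: "0 < d" "\<And>h. 0 < h \<Longrightarrow> h < d \<Longrightarrow>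
     (\<lambda>p. (e0 (p + (0, h)) - e0 p) / h - g0 (p + (0, 1 * h))) \<in> L2 (lebesgue_on (cyl \<Omega> (- T) (T - h))) \<and>
     L2_norm (lebesgue_on (cyl \<Omega> (- T) (T - h))) (\<lambda>p. (e0 (p + (0, h)) - e0 p) / h - g0 (p + (0, 1 * h))) < \<epsilon>"
    using X.difference_quotient[of 1 \<epsilon>] \<epsilon> by auto
  have "(\<lambda>p. (e p - e0 (p + (0, - h))) / h - g p) \<in> L2 Q \<and> L2_norm Q (\<lambda>p. (e p - e0 (p + (0, - h))) / h - g p) < \<epsilon>"
    if h: "0 < h" "h < min d T" for h
  proof -
    define q where "q p = (e0 (p + (0, h)) - e0 p) / h - g0 (p + (0, 1 * h))" for p
    have q: "q \<in> L2 (lebesgue_on (cyl \<Omega> (- T) (T - h)))" "L2_norm (lebesgue_on (cyl \<Omega> (- T) (T - h))) q < \<epsilon>"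
      using d(2)[of h] h by (auto simp: q_def[abs_def])
    have s: "(\<lambda>p. q (p + (0, - h))) \<in> L2 (lebesgue_on (cyl \<Omega> (- T + h) T))"
        "L2_norm (lebesgue_on (cyl \<Omega> (- T + h) T)) (\<lambda>p. q (p + (0, - h))) < \<epsilon>"
      using L2_shift[OF \<Omega>(1) q(1), of "- h"] q(2) by auto
    have s': "(\<lambda>p. q (p + (0, - h))) \<in> L2 Q" "L2_norm Q (\<lambda>p. q (p + (0, - h))) < \<epsilon>"
      using L2_cyl_mono[OF \<Omega>(1) s(1), of 0 T] s(2) h by auto
    have "q (p + (0, - h)) = (e p - e0 (p + (0, - h))) / h - g p" if "p \<in> space Q" for p
      using that by (cases p) (auto simp: q_def e0_def g0_def cyl_def)
    then show ?thesis using s' L2_cong_space[of Q "\<lambda>p. q (p + (0, - h))" "\<lambda>p. (e p - e0 (p + (0, - h))) / h - g p"] by simp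
  qed
  then show ?thesis using d(1) ab by (intro exI[of _ "min d T"]) auto
qed

lemma forward_quotient:
  assumes \<epsilon>: "0 < \<epsilon>"
  shows "\<exists>d>0. \<forall>h. 0 < h \<and> h < d \<longrightarrow>
     (\<lambda>p. (e (p + (0, h)) - e p) / h - g p) \<in> L2 (lebesgue_on (cyl \<Omega> 0 (T - h))) \<and>
     L2_norm (lebesgue_on (cyl \<Omega> 0 (T - h))) (\<lambda>p. (e (p + (0, h)) - e p) / h - g p) < \<epsilon>"
  using difference_quotient[of 0 \<epsilon>] \<epsilon> by (simp add: zero_prod_def[symmetric])

definition E :: "real \<Rightarrow> real" where "E \<tau> = (L2_norm (lebesgue_on (cyl \<Omega> 0 \<tau>)) G)\<^sup>2"

text \<open>Formally half of the squared gradient norm at time \<open>\<tau>\<close>, by Green's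
  formula and the zero initial value, so that \<open>E\<close> should have the derivative
  \<open>2 * P\<close>. This form avoids a gradient of \<open>g\<close>.\<close>

definition P :: "real \<Rightarrow> real" where "P \<tau> = - (\<integral>p. D p * g p \<partial>lebesgue_on (cyl \<Omega> 0 (min \<tau> T)))"

text \<open>Green's formula is used twice for the same field \<open>y\<close>: with \<open>e\<close>
  on \<open>(0, \<tau>)\<close>, and with the shifted \<open>e\<close> on
  \<open>(h, \<tau>)\<close>, where the shifted \<open>e0\<close> does not vanish by construction.
  Substitution then moves the shift to \<open>y\<close>.\<close>

lemma shift_backward:
  assumes y: "y \<in> L2 Q" "Z \<in> L2 Q" "has_weak_div_x (cyl \<Omega> 0 T) y Z" and h: "0 < h" "h \<le> \<tau>" "\<tau> \<le> T"
  shows "(\<lambda>p. e0 (p + (0, - h))) \<in> L2 (lebesgue_on (cyl \<Omega> 0 \<tau>))"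
    "(\<integral>p. Z p * (e p - e0 (p + (0, - h))) \<partial>lebesgue_on (cyl \<Omega> 0 \<tau>))
      = (\<integral>p. y (p + (0, h)) \<bullet> G p \<partial>lebesgue_on (cyl \<Omega> 0 (\<tau> - h))) - (\<integral>p. y p \<bullet> G p \<partial>lebesgue_on (cyl \<Omega> 0 \<tau>))"
proof -
  let ?C = "lebesgue_on (cyl \<Omega> 0 \<tau>)"
  note sub = L2_cyl_mono(1)[OF \<Omega>(1) _ order_refl h(3)]
  have "(\<lambda>p. e0 (p + (0, - h))) \<in> L2 (lebesgue_on (cyl \<Omega> (- T + h) (T + h)))"
    using L2_shift(1)[OF \<Omega>(1) e0_L2, of "- h"] by simp
  then show e0L: "(\<lambda>p. e0 (p + (0, - h))) \<in> L2 ?C"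
    by (rule L2_cyl_mono(1)[OF \<Omega>(1)]) (use h in auto)
  have "(\<integral>p. Z p * (e p - e0 (p + (0, - h))) \<partial>?C) = (\<integral>p. Z p * e p \<partial>?C) - (\<integral>p. Z p * e0 (p + (0, - h)) \<partial>?C)"
    unfolding right_diff_distrib by (intro Bochner_Integration.integral_diff L2_mult_integrable sub y w e0L)
  moreover have "(\<integral>p. Z p * e p \<partial>?C) = - (\<integral>p. y p \<bullet> G p \<partial>?C)"
    using green_shift[OF dom ab lat y, of 0 \<tau> 0] h by (simp add: zero_prod_def[symmetric])
  moreover have "(\<integral>p. Z p * e0 (p + (0, - h)) \<partial>?C) = - (\<integral>p. y (p + (0, h)) \<bullet> G p \<partial>lebesgue_on (cyl \<Omega> 0 (\<tau> - h)))"
  proof -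
    have "(\<integral>p. Z p * e0 (p + (0, - h)) \<partial>?C) = (\<integral>p. Z p * e0 (p + (0, - h)) \<partial>lebesgue_on (cyl \<Omega> h \<tau>))"
      by (intro integral_lebesgue_on_subset sets_cyl(1)[OF \<Omega>(1)] cyl_mono) (use h in \<open>auto simp: e0_def cyl_def\<close>)
    also have "\<dots> = (\<integral>p. Z p * e (p + (0, - h)) \<partial>lebesgue_on (cyl \<Omega> h \<tau>))"
      by (intro Bochner_Integration.integral_cong) (auto simp: e0_def cyl_def)
    also have "\<dots> = - (\<integral>p. y p \<bullet> G (p + (0, - h)) \<partial>lebesgue_on (cyl \<Omega> h \<tau>))"
      by (rule green_shift[OF dom ab lat y]) (use h in auto)
    also have "(\<integral>p. y p \<bullet> G (p + (0, - h)) \<partial>lebesgue_on (cyl \<Omega> h \<tau>))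
        = (\<integral>p. y (p + (0, h)) \<bullet> G (p + (0, h) + (0, - h)) \<partial>lebesgue_on (cyl \<Omega> (h - h) (\<tau> - h)))"
    proof (rule integral_shift[OF \<Omega>(1), symmetric])
      have "y \<in> L2 (lebesgue_on (cyl \<Omega> h \<tau>))" by (rule L2_cyl_mono(1)[OF \<Omega>(1) y(1)]) (use h in auto)
      moreover have "(\<lambda>p. G (p + (0, - h))) \<in> L2 (lebesgue_on (cyl \<Omega> h \<tau>))"
        using L2_cyl_mono(1)[OF \<Omega>(1) L2_shift(1)[OF \<Omega>(1) G, of "- h"], of h \<tau>] h by simp
      ultimately show "(\<lambda>p. y p \<bullet> G (p + (0, - h))) \<in> borel_measurable (lebesgue_on (cyl \<Omega> h \<tau>))"
        by (intro borel_measurable_inner L2_measurable)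
    qed
    finally show ?thesis by (simp add: add.assoc zero_prod_def[symmetric])
  qed
  ultimately show "(\<integral>p. Z p * (e p - e0 (p + (0, - h))) \<partial>?C)
      = (\<integral>p. y (p + (0, h)) \<bullet> G p \<partial>lebesgue_on (cyl \<Omega> 0 (\<tau> - h))) - (\<integral>p. y p \<bullet> G p \<partial>?C)" by simp
qed

text \<open>With its sign, the first integral is \<open>E \<tau>\<close> minus the product of
  \<open>G\<close> with its shift, and the second is that product minus
  \<open>E (\<tau> - h)\<close>. The product cancels, which is why the backward quotient on the
  longer interval is matched with the forward quotient on the shorter one.\<close>

lemma increment:
  assumes h: "0 < h" "h \<le> \<tau>" "\<tau> \<le> T"
  shows "E \<tau> - E (\<tau> - h) = - (\<integral>p. D p * (e p - e0 (p + (0, - h))) \<partial>lebesgue_on (cyl \<Omega> 0 \<tau>))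
     - (\<integral>p. D p * (e (p + (0, h)) - e p) \<partial>lebesgue_on (cyl \<Omega> 0 (\<tau> - h)))"
proof -
  let ?C' = "lebesgue_on (cyl \<Omega> 0 (\<tau> - h))"
  have sub: "f \<in> L2 ?C'" if "f \<in> L2 Q" for f :: "'a \<times> real \<Rightarrow> 'b::euclidean_space"
    by (rule L2_cyl_mono(1)[OF \<Omega>(1) that]) (use h in auto)
  have sh: "(\<lambda>p. e (p + (0, h))) \<in> L2 ?C'"
    by (rule L2_cyl_mono(1)[OF \<Omega>(1) L2_shift(1)[OF \<Omega>(1) w, of h]]) (use h in auto)
  have "(\<integral>p. D p * (e (p + (0, h)) - e p) \<partial>?C') = (\<integral>p. D p * e (p + (0, h)) \<partial>?C') - (\<integral>p. D p * e p \<partial>?C')"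
    unfolding right_diff_distrib by (intro Bochner_Integration.integral_diff L2_mult_integrable sub D w sh)
  moreover have "(\<integral>p. D p * e (p + (0, h)) \<partial>?C') = - (\<integral>p. G p \<bullet> G (p + (0, h)) \<partial>?C')"
    by (rule green_shift[OF dom ab lat G D GD]) (use h in auto)
  moreover have "(\<integral>p. D p * e p \<partial>?C') = - (\<integral>p. G p \<bullet> G p \<partial>?C')"
    using green_shift[OF dom ab lat G D GD, of 0 "\<tau> - h" 0] h by (simp add: zero_prod_def[symmetric])
  ultimately show ?thesis
    using shift_backward(2)[OF G D GD h] by (simp add: E_def L2_norm_square dot_square_norm inner_commute)
qed

text \<open>Both quotients are replaced by \<open>g\<close> with error
  \<open>\<epsilon> / (2 * K)\<close>, and \<open>K\<close> bounds the norm of \<open>D\<close>. One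
  \<open>d\<close> serves all \<open>\<tau>\<close> because the quotients are controlled on the
  whole strip.\<close>

lemma increment_bound:
  assumes \<epsilon>: "0 < \<epsilon>"
  shows "\<exists>d>0. \<forall>h \<tau>. 0 < h \<and> h < d \<and> h \<le> \<tau> \<and> \<tau> \<le> T \<longrightarrow> \<bar>E \<tau> - E (\<tau> - h) - h * (P \<tau> + P (\<tau> - h))\<bar> \<le> \<epsilon> * h"
proof -
  define K where "K = L2_norm Q D + 1"
  have K: "0 < K" by (simp add: K_def add_nonneg_pos)
  have \<epsilon>': "0 < \<epsilon> / (2 * K)" using \<epsilon> K by simp
  obtain d1 where d1: "0 < d1" "\<And>h. 0 < h \<Longrightarrow> h < d1 \<Longrightarrow> (\<lambda>p. (e p - e0 (p + (0, - h))) / h - g p) \<in> L2 Q \<and>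
      L2_norm Q (\<lambda>p. (e p - e0 (p + (0, - h))) / h - g p) < \<epsilon> / (2 * K)"
    using backward_quotient[OF \<epsilon>'] by blast
  obtain d2 where d2: "0 < d2" "\<And>h. 0 < h \<Longrightarrow> h < d2 \<Longrightarrow>
      (\<lambda>p. (e (p + (0, h)) - e p) / h - g p) \<in> L2 (lebesgue_on (cyl \<Omega> 0 (T - h))) \<and>
      L2_norm (lebesgue_on (cyl \<Omega> 0 (T - h))) (\<lambda>p. (e (p + (0, h)) - e p) / h - g p) < \<epsilon> / (2 * K)"
    using forward_quotient[OF \<epsilon>'] by blast
  have est: "\<bar>(\<integral>p. D p * f p \<partial>lebesgue_on (cyl \<Omega> 0 \<sigma>)) - h * (\<integral>p. D p * g p \<partial>lebesgue_on (cyl \<Omega> 0 \<sigma>))\<bar> \<le> \<epsilon> / 2 * h"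
    if h: "0 < h" and q: "(\<lambda>p. f p / h - g p) \<in> L2 (lebesgue_on (cyl \<Omega> 0 \<sigma>'))"
      "L2_norm (lebesgue_on (cyl \<Omega> 0 \<sigma>')) (\<lambda>p. f p / h - g p) < \<epsilon> / (2 * K)" and \<sigma>: "\<sigma> \<le> \<sigma>'" "\<sigma>' \<le> T" for f h \<sigma> \<sigma>'
  proof -
    let ?C = "lebesgue_on (cyl \<Omega> 0 \<sigma>)"
    have DC: "D \<in> L2 ?C" "L2_norm ?C D \<le> K" and gC: "g \<in> L2 ?C"
      using L2_cyl_mono[OF \<Omega>(1) D, of 0 \<sigma>] L2_cyl_mono(1)[OF \<Omega>(1) k, of 0 \<sigma>] \<sigma> by (auto simp: K_def)
    have qC: "(\<lambda>p. f p / h - g p) \<in> L2 ?C" "L2_norm ?C (\<lambda>p. f p / h - g p) \<le> \<epsilon> / (2 * K)"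
      using L2_cyl_mono[OF \<Omega>(1) q(1), of 0 \<sigma>] q(2) \<sigma> by auto
    have "(\<integral>p. D p * f p \<partial>?C) = (\<integral>p. h * (D p * (f p / h - g p)) + h * (D p * g p) \<partial>?C)"
      using h by (intro Bochner_Integration.integral_cong) (auto simp: field_simps)
    also have "\<dots> = h * (\<integral>p. D p * (f p / h - g p) \<partial>?C) + h * (\<integral>p. D p * g p \<partial>?C)"
      by (subst Bochner_Integration.integral_add) (auto intro!: integrable_mult_right L2_mult_integrable DC qC(1) gC)
    finally have "\<bar>(\<integral>p. D p * f p \<partial>?C) - h * (\<integral>p. D p * g p \<partial>?C)\<bar> = h * \<bar>\<integral>p. D p * (f p / h - g p) \<partial>?C\<bar>"
      using h by (simp add: abs_mult)
    also have "\<dots> \<le> h * (K * (\<epsilon> / (2 * K)))"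
      using h K by (intro mult_left_mono order_trans[OF L2_Cauchy_Schwarz_mult[OF DC(1) qC(1)]] mult_mono DC qC) auto
    also have "\<dots> = \<epsilon> / 2 * h" using K by simp
    finally show ?thesis .
  qed
  show ?thesis
  proof (intro exI conjI allI impI; (elim conjE)?)
    show "0 < min d1 d2" using d1 d2 by simp
    fix h \<tau> assume h: "0 < h" "h < min d1 d2" "h \<le> \<tau>" "\<tau> \<le> T"
    have "\<bar>(\<integral>p. D p * (e p - e0 (p + (0, - h))) \<partial>lebesgue_on (cyl \<Omega> 0 \<tau>)) - h * (\<integral>p. D p * g p \<partial>lebesgue_on (cyl \<Omega> 0 \<tau>))\<bar> \<le> \<epsilon> / 2 * h"
      using d1(2)[of h] h by (intro est[of _ _ T]) auto
    moreover have "\<bar>(\<integral>p. D p * (e (p + (0, h)) - e p) \<partial>lebesgue_on (cyl \<Omega> 0 (\<tau> - h))) - h * (\<integral>p. D p * g p \<partial>lebesgue_on (cyl \<Omega> 0 (\<tau> - h)))\<bar> \<le> \<epsilon> / 2 * h"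
      using d2(2)[of h] h by (intro est[of _ _ "T - h"]) auto
    moreover have "P \<tau> = - (\<integral>p. D p * g p \<partial>lebesgue_on (cyl \<Omega> 0 \<tau>))" "P (\<tau> - h) = - (\<integral>p. D p * g p \<partial>lebesgue_on (cyl \<Omega> 0 (\<tau> - h)))"
      using h by (auto simp: P_def)
    moreover have "h * (P \<tau> + P (\<tau> - h)) = h * P \<tau> + h * P (\<tau> - h)" by (rule distrib_left)
    ultimately show "\<bar>E \<tau> - E (\<tau> - h) - h * (P \<tau> + P (\<tau> - h))\<bar> \<le> \<epsilon> * h"
      unfolding increment[OF h(1,3,4)] by (simp only: mult_minus_right)
  qed
qed

lemma P_continuous: "continuous_on UNIV P"
  unfolding P_def[abs_def] by (intro continuous_intros integral_cyl_continuous[OF \<Omega>(1)] L2_mult_integrable D k)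

text \<open>Increments to either side follow from \<open>increment_bound\<close>, taken at the later
  of the two times; continuity of \<open>P\<close> turns \<open>P y + P \<tau>\<close> into
  \<open>2 * P \<tau>\<close>.\<close>

lemma E_derivative:
  assumes \<tau>: "\<tau> \<in> {0..T}"
  shows "(E has_real_derivative 2 * P \<tau>) (at \<tau> within {0..T})"
  unfolding has_field_derivative_def has_derivative_within_alt
proof (intro conjI allI impI)
  show "bounded_linear ((*) (2 * P \<tau>))" by (rule bounded_linear_mult_right)
  fix \<epsilon> :: real assume \<epsilon>: "0 < \<epsilon>"
  then have \<epsilon>2: "0 < \<epsilon> / 2" by simp
  obtain d1 where d1: "0 < d1" "\<And>h \<tau>. 0 < h \<Longrightarrow> h < d1 \<Longrightarrow> h \<le> \<tau> \<Longrightarrow> \<tau> \<le> T \<Longrightarrow> \<bar>E \<tau> - E (\<tau> - h) - h * (P \<tau> + P (\<tau> - h))\<bar> \<le> \<epsilon> / 2 * h"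
    using increment_bound[OF \<epsilon>2] by blast
  obtain d2 where d2: "0 < d2" "\<And>y. \<bar>y - \<tau>\<bar> < d2 \<Longrightarrow> \<bar>P y - P \<tau>\<bar> < \<epsilon> / 2"
    using P_continuous \<epsilon>2 unfolding continuous_on_iff dist_real_def by (metis UNIV_I)
  have "norm (E y - E \<tau> - 2 * P \<tau> * (y - \<tau>)) \<le> \<epsilon> * norm (y - \<tau>)" if y: "y \<in> {0..T}" "norm (y - \<tau>) < min d1 d2" for y
  proof -
    have b: "\<bar>E y - E \<tau> - (y - \<tau>) * (P y + P \<tau>)\<bar> \<le> \<epsilon> / 2 * \<bar>y - \<tau>\<bar>"
    proof (cases y \<tau> rule: linorder_cases)
      case less
      then have "\<bar>E \<tau> - E (\<tau> - (\<tau> - y)) - (\<tau> - y) * (P \<tau> + P (\<tau> - (\<tau> - y)))\<bar> \<le> \<epsilon> / 2 * (\<tau> - y)"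
        using y \<tau> by (intro d1(2)) auto
      then have "\<bar>E \<tau> - E y - (\<tau> - y) * (P \<tau> + P y)\<bar> \<le> \<epsilon> / 2 * \<bar>y - \<tau>\<bar>" using less by simp
      moreover have eq: "E y - E \<tau> - (y - \<tau>) * (P y + P \<tau>) = - (E \<tau> - E y - (\<tau> - y) * (P \<tau> + P y))" by (simp add: algebra_simps)
      ultimately show ?thesis unfolding eq abs_minus_cancel by blast
    next
      case greater
      then have "\<bar>E y - E (y - (y - \<tau>)) - (y - \<tau>) * (P y + P (y - (y - \<tau>)))\<bar> \<le> \<epsilon> / 2 * (y - \<tau>)"
        using y \<tau> by (intro d1(2)) auto
      then show ?thesis using greater by simp
    qed simp
    have c: "\<bar>(y - \<tau>) * (P y - P \<tau>)\<bar> \<le> \<epsilon> / 2 * \<bar>y - \<tau>\<bar>"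
      unfolding abs_mult mult.commute[of "\<epsilon> / 2"] using d2(2)[of y] y by (intro mult_left_mono) auto
    have "E y - E \<tau> - 2 * P \<tau> * (y - \<tau>) = (E y - E \<tau> - (y - \<tau>) * (P y + P \<tau>)) + (y - \<tau>) * (P y - P \<tau>)"
      by (simp add: algebra_simps)
    then have "\<bar>E y - E \<tau> - 2 * P \<tau> * (y - \<tau>)\<bar> \<le> \<epsilon> / 2 * \<bar>y - \<tau>\<bar> + \<epsilon> / 2 * \<bar>y - \<tau>\<bar>"
      using order_trans[OF abs_triangle_ineq add_mono[OF b c]] by simp
    then show ?thesis by simp
  qed
  then show "\<exists>d>0. \<forall>y\<in>{0..T}. norm (y - \<tau>) < d \<longrightarrow> norm (E y - E \<tau> - 2 * P \<tau> * (y - \<tau>)) \<le> \<epsilon> * norm (y - \<tau>)"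
    using d1(1) d2(1) by (intro exI[of _ "min d1 d2"]) auto
qed

lemma E_mono: "0 \<le> \<sigma> \<Longrightarrow> \<sigma> \<le> \<tau> \<Longrightarrow> \<tau> \<le> T \<Longrightarrow> E \<sigma> \<le> E \<tau>"
  unfolding E_def by (intro power_mono L2_cyl_mono(2)[OF \<Omega>(1) L2_cyl_mono(1)[OF \<Omega>(1) G]]) auto

text \<open>A negative value would make the increasing function \<open>E\<close> decrease: the
  tolerance \<open>- P \<tau>\<close> in the definition of the derivative is only half the size of
  the slope \<open>2 * P \<tau>\<close>.\<close>

lemma P_nonneg:
  assumes \<tau>: "\<tau> \<in> {0..T}"
  shows "0 \<le> P \<tau>"
proof (rule ccontr)
  assume "\<not> 0 \<le> P \<tau>"
  then have neg: "0 < - P \<tau>" by simp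
  obtain d where d: "0 < d" "\<And>y. y \<in> {0..T} \<Longrightarrow> \<bar>y - \<tau>\<bar> < d \<Longrightarrow> \<bar>E y - E \<tau> - 2 * P \<tau> * (y - \<tau>)\<bar> \<le> - P \<tau> * \<bar>y - \<tau>\<bar>"
    using E_derivative[OF \<tau>] neg unfolding has_field_derivative_def has_derivative_within_alt real_norm_def by metis
  have "\<exists>y\<in>{0..T}. \<bar>y - \<tau>\<bar> < d \<and> y \<noteq> \<tau>"
  proof (cases "\<tau> < T")
    case True
    then show ?thesis using \<tau> d(1) by (intro bexI[of _ "min T (\<tau> + d / 2)"]) auto
  next
    case False
    then show ?thesis using \<tau> d(1) ab by (intro bexI[of _ "max 0 (\<tau> - d / 2)"]) auto
  qed
  then obtain y where y: "y \<in> {0..T}" "\<bar>y - \<tau>\<bar> < d" "y \<noteq> \<tau>" by blast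
  note b = d(2)[OF y(1,2)]
  show False
  proof (cases "\<tau> < y")
    case True
    then have "E \<tau> \<le> E y" using E_mono \<tau> y by auto
    moreover have "0 < - P \<tau> * (y - \<tau>)" using neg True by (intro mult_pos_pos) auto
    ultimately show False using b True by (simp add: algebra_simps)
  next
    case False
    then have "y < \<tau>" using y by simp
    then have "E y \<le> E \<tau>" using E_mono \<tau> y by auto
    moreover have "0 < - P \<tau> * (\<tau> - y)" using neg \<open>y < \<tau>\<close> by (intro mult_pos_pos) auto
    ultimately show False using b \<open>y < \<tau>\<close> by (simp add: algebra_simps)
  qed
qed

lemma E_integral:
  assumes "0 \<le> a" "a \<le> T"
  shows "((\<lambda>t. 2 * P t) has_integral E T - E a) {a..T}"
proof (rule fundamental_theorem_of_calculus[OF assms(2)])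
  fix t assume "t \<in> {a..T}"
  then have "(E has_real_derivative 2 * P t) (at t within {a..T})"
    using assms by (intro DERIV_subset[OF E_derivative]) auto
  then show "(E has_vector_derivative 2 * P t) (at t within {a..T})"
    by (rule has_real_derivative_iff_has_vector_derivative[THEN iffD1])
qed

text \<open>For every \<open>a\<close>, both sides have the integral \<open>E T - E a\<close> over
  \<open>(a, T)\<close>. Nonnegativity of \<open>P\<close> allows \<open>2 * P\<close> to be treated
  as a density.\<close>

lemma slice_energy:
  "AE t in lebesgue_on {0<..<T}. 2 * P t = (L2_norm (lebesgue_on \<Omega>) (\<lambda>x. G (x, t)))\<^sup>2"
proof -
  obtain n where n: "n \<in> borel_measurable borel"
    "AE t in lborel. 0 < t \<and> t < T \<and> n t < \<infinity> \<longrightarrow> n t = ennreal ((L2_norm (lebesgue_on \<Omega>) (\<lambda>x. G (x, t)))\<^sup>2)"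
    "\<And>a b. 0 \<le> a \<Longrightarrow> b \<le> T \<Longrightarrow>
      ennreal ((L2_norm (lebesgue_on (cyl \<Omega> a b)) G)\<^sup>2) = (\<integral>\<^sup>+t. n t * indicator {a<..<b} t \<partial>lborel)"
    by (rule slice_norms[OF \<Omega>(1) G]) blast
  have "AE t in lborel. 0 < t \<and> t < T \<longrightarrow> n t = ennreal (2 * P t)"
  proof (rule AE_eq_of_interval_integrals[OF n(1)])
    show "(\<lambda>t. ennreal (2 * P t)) \<in> borel_measurable borel"
      using borel_measurable_continuous_onI[OF P_continuous] by measurable
    show "(\<integral>\<^sup>+t. n t * indicator {0<..<T} t \<partial>lborel) < \<infinity>" using n(3)[of 0 T, symmetric] by simp
    fix a :: real assume a: "0 \<le> a"
    show "(\<integral>\<^sup>+t. n t * indicator {a<..<T} t \<partial>lborel) = (\<integral>\<^sup>+t. ennreal (2 * P t) * indicator {a<..<T} t \<partial>lborel)"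
    proof (cases "a \<le> T")
      case True
      have "(\<integral>\<^sup>+t. n t * indicator {a<..<T} t \<partial>lborel) = ennreal (E T - E a)"
        using L2_norm_cyl_split[OF \<Omega>(1) G a True] n(3)[OF a, of T] by (simp add: E_def)
      also have "\<dots> = (\<integral>\<^sup>+t. ennreal (2 * P t) * indicator {a..T} t \<partial>lborel)"
      proof (rule nn_integral_has_integral_lebesgue'[symmetric])
        show "0 \<le> 2 * P t" if "t \<in> {a..T}" for t using P_nonneg[of t] that a by simp
      qed (rule E_integral[OF a True])
      also have "\<dots> = (\<integral>\<^sup>+t. ennreal (2 * P t) * indicator {a<..<T} t \<partial>lborel)"
      proof (rule nn_integral_cong_AE)
        show "AE t in lborel. ennreal (2 * P t) * indicator {a..T} t = ennreal (2 * P t) * indicator {a<..<T} t"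
          using AE_lborel_singleton[of a] AE_lborel_singleton[of T]
          by eventually_elim (auto simp: indicator_def)
      qed
      finally show ?thesis .
    qed (auto intro!: nn_integral_cong simp: indicator_def)
  qed
  with n(2) have "AE t in lborel. t \<in> {0<..<T} \<longrightarrow> 2 * P t = (L2_norm (lebesgue_on \<Omega>) (\<lambda>x. G (x, t)))\<^sup>2"
  proof eventually_elim
    case (elim t)
    show ?case
    proof
      assume t: "t \<in> {0<..<T}"
      then have "ennreal (2 * P t) = ennreal ((L2_norm (lebesgue_on \<Omega>) (\<lambda>x. G (x, t)))\<^sup>2)" using elim by auto
      then show "2 * P t = (L2_norm (lebesgue_on \<Omega>) (\<lambda>x. G (x, t)))\<^sup>2"
        using P_nonneg[of t] t by (subst (asm) ennreal_inj) auto
    qed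
  qed
  from AE_completion[OF this] show ?thesis by (subst AE_restrict_space_iff) auto
qed

text \<open>By \<open>slice_energy\<close> the function \<open>2 * P t\<close> is an admissible
  continuous representative, and \<open>continuous_AE_unique\<close> excludes any other value at
  \<open>T\<close>.\<close>

lemma final_gradient_energy:
  "(THE c. \<exists>N. continuous_on {0..T} N \<and>
     (AE t in lebesgue_on {0<..<T}. N t = (L2_norm (lebesgue_on \<Omega>) (\<lambda>x. G (x, t)))\<^sup>2) \<and> c = N T) = 2 * P T"
proof (rule the_equality)
  have c: "continuous_on {0..T} (\<lambda>t. 2 * P t)"
    by (intro continuous_intros continuous_on_subset[OF P_continuous]) auto
  then show "\<exists>N. continuous_on {0..T} N \<and>
     (AE t in lebesgue_on {0<..<T}. N t = (L2_norm (lebesgue_on \<Omega>) (\<lambda>x. G (x, t)))\<^sup>2) \<and> 2 * P T = N T"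
    using slice_energy by (intro exI[of _ "\<lambda>t. 2 * P t"]) simp
  fix r assume "\<exists>N. continuous_on {0..T} N \<and>
     (AE t in lebesgue_on {0<..<T}. N t = (L2_norm (lebesgue_on \<Omega>) (\<lambda>x. G (x, t)))\<^sup>2) \<and> r = N T"
  then obtain N where N: "continuous_on {0..T} N" "AE t in lebesgue_on {0<..<T}. N t = (L2_norm (lebesgue_on \<Omega>) (\<lambda>x. G (x, t)))\<^sup>2" "r = N T"
    by blast
  have "N T = 2 * P T"
  proof (rule continuous_AE_unique[OF ab N(1) c])
    show "AE t in lebesgue_on {0<..<T}. N t = 2 * P t"
      using N(2) slice_energy by eventually_elim simp
  qed
  then show "r = 2 * P T" using N(3) by simp
qed

end

text \<open>Polarization reduces the product to squared norms of \<open>f\<close>, \<open>g\<close>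
  and their sum.\<close>

lemma integral_inner_cyl_split:
  fixes f g :: "'a::euclidean_space \<times> real \<Rightarrow> 'b::euclidean_space"
  assumes \<Omega>: "open \<Omega>" and L: "f \<in> L2 (lebesgue_on (cyl \<Omega> 0 T))" "g \<in> L2 (lebesgue_on (cyl \<Omega> 0 T))"
    and a: "0 \<le> a" "a \<le> T"
  shows "(\<integral>p. f p \<bullet> g p \<partial>lebesgue_on (cyl \<Omega> 0 T))
    = (\<integral>p. f p \<bullet> g p \<partial>lebesgue_on (cyl \<Omega> 0 a)) + (\<integral>p. f p \<bullet> g p \<partial>lebesgue_on (cyl \<Omega> a T))"
proof -
  have pol: "2 * (\<integral>p. f p \<bullet> g p \<partial>lebesgue_on (cyl \<Omega> c d)) = (L2_norm (lebesgue_on (cyl \<Omega> c d)) (\<lambda>p. f p + g p))\<^sup>2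
      - (L2_norm (lebesgue_on (cyl \<Omega> c d)) f)\<^sup>2 - (L2_norm (lebesgue_on (cyl \<Omega> c d)) g)\<^sup>2" if "0 \<le> c" "d \<le> T" for c d
    using L2_norm_add_square[OF L2_cyl_mono(1)[OF \<Omega> L(1) that] L2_cyl_mono(1)[OF \<Omega> L(2) that]] by simp
  note sp = L2_norm_cyl_split[OF \<Omega> _ a order_refl]
  show ?thesis
    using pol[of 0 T] pol[of 0 a] pol[of a T] a sp[OF L(1)] sp[OF L(2)] sp[OF L2_add[OF L]] by linarith
qed

text \<open>Here \<open>b h\<close> is \<open>T\<close> or \<open>T - h\<close>, and \<open>q h\<close> a difference quotient with step \<open>h\<close>.\<close>

lemma quotient_pairing_tendsto:
  fixes f k :: "'a::euclidean_space \<times> real \<Rightarrow> real" and q :: "real \<Rightarrow> 'a \<times> real \<Rightarrow> real"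
  assumes \<Omega>: "open \<Omega>" and f: "f \<in> L2 (lebesgue_on (cyl \<Omega> 0 T))" and k: "k \<in> L2 (lebesgue_on (cyl \<Omega> 0 T))"
    and q: "\<And>\<epsilon>. 0 < \<epsilon> \<Longrightarrow> \<exists>d>0. \<forall>h. 0 < h \<and> h < d \<longrightarrow>
      (\<lambda>p. q h p - k p) \<in> L2 (lebesgue_on (cyl \<Omega> 0 (b h))) \<and> L2_norm (lebesgue_on (cyl \<Omega> 0 (b h))) (\<lambda>p. q h p - k p) < \<epsilon>"
    and h: "\<And>n. 0 < h n" "h \<longlonglongrightarrow> 0" and b: "\<And>n. b (h n) \<le> T" "(\<lambda>n. b (h n)) \<longlonglongrightarrow> T"
  shows "(\<lambda>n. \<integral>p. f p * q (h n) p \<partial>lebesgue_on (cyl \<Omega> 0 (b (h n)))) \<longlonglongrightarrow> (\<integral>p. f p * k p \<partial>lebesgue_on (cyl \<Omega> 0 T))"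
proof -
  let ?C = "\<lambda>n. lebesgue_on (cyl \<Omega> 0 (b (h n)))"
  \<comment> \<open>The domain varies with the step. The pairing with \<open>k\<close> converges by
    continuity in the end time, the difference from it by Cauchy-Schwarz.\<close>
  define F where "F \<tau> = (\<integral>p. f p * k p \<partial>lebesgue_on (cyl \<Omega> 0 (min \<tau> T)))" for \<tau>
  have "continuous_on UNIV F" unfolding F_def by (intro integral_cyl_continuous[OF \<Omega>] L2_mult_integrable f k)
  then have "isCont F T" by (simp add: continuous_on_eq_continuous_at)
  from isCont_tendsto_compose[OF this b(2)] have 1: "(\<lambda>n. F (b (h n))) \<longlonglongrightarrow> (\<integral>p. f p * k p \<partial>lebesgue_on (cyl \<Omega> 0 T))"
    by (simp add: F_def)
  have F: "F (b (h n)) = (\<integral>p. f p * k p \<partial>?C n)" for n using b(1)[of n] by (simp add: F_def min_absorb1)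
  have "(\<lambda>n. (\<integral>p. f p * q (h n) p \<partial>?C n) - F (b (h n))) \<longlonglongrightarrow> 0"
  proof (rule tendstoI)
    fix r :: real assume r: "0 < r"
    define K where "K = L2_norm (lebesgue_on (cyl \<Omega> 0 T)) f + 1"
    have K: "0 < K" by (simp add: K_def add_nonneg_pos)
    obtain d where d: "0 < d" "\<And>h. 0 < h \<Longrightarrow> h < d \<Longrightarrow> (\<lambda>p. q h p - k p) \<in> L2 (lebesgue_on (cyl \<Omega> 0 (b h))) \<and>
        L2_norm (lebesgue_on (cyl \<Omega> 0 (b h))) (\<lambda>p. q h p - k p) < r / K"
      using q[of "r / K"] r K by auto
    show "\<forall>\<^sub>F n in sequentially. dist ((\<integral>p. f p * q (h n) p \<partial>?C n) - F (b (h n))) 0 < r"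
      using order_tendstoD(2)[OF h(2) d(1)]
    proof eventually_elim
      case (elim n)
      have fC: "f \<in> L2 (?C n)" "L2_norm (?C n) f < K" and kC: "k \<in> L2 (?C n)"
        using L2_cyl_mono[OF \<Omega> f order_refl b(1)[of n]] L2_cyl_mono(1)[OF \<Omega> k order_refl b(1)[of n]] by (auto simp: K_def)
      have qC: "(\<lambda>p. q (h n) p - k p) \<in> L2 (?C n)" "L2_norm (?C n) (\<lambda>p. q (h n) p - k p) < r / K"
        using d(2)[OF h(1) elim] by auto
      have "(\<integral>p. f p * q (h n) p \<partial>?C n) = (\<integral>p. f p * (q (h n) p - k p) + f p * k p \<partial>?C n)"
        by (intro Bochner_Integration.integral_cong) (auto simp: algebra_simps)
      also have "\<dots> = (\<integral>p. f p * (q (h n) p - k p) \<partial>?C n) + F (b (h n))"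
        unfolding F by (intro Bochner_Integration.integral_add L2_mult_integrable fC kC qC)
      finally have "\<bar>(\<integral>p. f p * q (h n) p \<partial>?C n) - F (b (h n))\<bar> \<le> L2_norm (?C n) f * L2_norm (?C n) (\<lambda>p. q (h n) p - k p)"
        using L2_Cauchy_Schwarz_mult[OF fC(1) qC(1)] by simp
      also have "\<dots> < K * (r / K)" by (intro mult_strict_mono fC qC K) auto
      finally show ?case using K by (simp add: dist_real_def)
    qed
  qed
  from tendsto_add[OF this 1] show ?thesis by simp
qed

context parabolic_strip
begin

text \<open>Formally, integration by parts in space and time gives the product of \<open>r\<close>
  and \<open>G\<close> at time \<open>T\<close> minus the integral of
  \<open>S p \<bullet> G p\<close>. The boundary term stays an average over the last
  \<open>h n\<close> and is split by Cauchy-Schwarz: divided by \<open>sqrt (h n)\<close>, the norms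
  of \<open>R\<close> and \<open>G\<close> over this layer converge to the norm of \<open>r\<close>
  and to \<open>sqrt (2 * P T)\<close>.\<close>

lemma residual_bound:
  fixes R S :: "'a \<times> real \<Rightarrow> 'a" and r :: "'a \<Rightarrow> 'a"
  assumes R: "R \<in> L2 Q" and S: "S \<in> L2 Q" and RS: "has_weak_dt (cyl \<Omega> 0 T) R S"
    and Z: "Z \<in> L2 Q" "has_weak_div_x (cyl \<Omega> 0 T) R Z"
    and r: "\<And>i. i \<in> Basis \<Longrightarrow> time_trace \<Omega> 0 T T (\<lambda>p. R p \<bullet> i) (\<lambda>p. S p \<bullet> i) (\<lambda>x. r x \<bullet> i)"
  shows "- (\<integral>p. Z p * g p \<partial>Q) \<le> L2_norm (lebesgue_on \<Omega>) r * sqrt (2 * P T) - (\<integral>p. S p \<bullet> G p \<partial>Q)"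
proof -
  have RSi: "has_weak_dt (cyl \<Omega> 0 T) (\<lambda>p. R p \<bullet> i) (\<lambda>p. S p \<bullet> i)" if "i \<in> Basis" for i
    using RS that has_weak_dt_component[OF open_cyl[OF \<Omega>(1)] R S] by blast
  have rL: "r \<in> L2 (lebesgue_on \<Omega>)"
    unfolding L2_components_iff[of r] using r by (auto simp: time_trace_def)
  define h where "h n = T / real (n + 2)" for n :: nat
  have h: "0 < h n" "h n \<le> T" for n using ab by (auto simp: h_def field_simps)
  have h0: "h \<longlonglongrightarrow> 0" unfolding h_def by real_asymp
  let ?L = "\<lambda>n. lebesgue_on (cyl \<Omega> (T - h n) T)" and ?C = "\<lambda>n. lebesgue_on (cyl \<Omega> 0 (T - h n))"
  have A: "(\<lambda>n. - (\<integral>p. Z p * ((e p - e0 (p + (0, - h n))) / h n) \<partial>Q)) \<longlonglongrightarrow> - (\<integral>p. Z p * g p \<partial>Q)"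
    by (intro tendsto_minus quotient_pairing_tendsto[OF \<Omega>(1) Z(1) k, of "\<lambda>h p. (e p - e0 (p + (0, - h))) / h" "\<lambda>h. T"]
        backward_quotient h h0 order_refl tendsto_const)
  have Bi: "(\<lambda>n. \<integral>p. (G p \<bullet> i) * ((R (p + (0, h n)) \<bullet> i - R p \<bullet> i) / h n) \<partial>?C n) \<longlonglongrightarrow> (\<integral>p. (G p \<bullet> i) * (S p \<bullet> i) \<partial>Q)"
    if i: "i \<in> Basis" for i
  proof -
    interpret X: weak_time_strip \<Omega> 0 T "\<lambda>p. R p \<bullet> i" "\<lambda>p. S p \<bullet> i"
      by unfold_locales (intro \<Omega> ab L2_inner_const R S RSi[OF i])+
    show ?thesis
    proof (rule quotient_pairing_tendsto[OF \<Omega>(1) L2_inner_const[OF G] L2_inner_const[OF S],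
          where q="\<lambda>h p. (R (p + (0, h)) \<bullet> i - R p \<bullet> i) / h" and b="\<lambda>h. T - h" and h=h])
      show "\<exists>d>0. \<forall>h. 0 < h \<and> h < d \<longrightarrow> (\<lambda>p. (R (p + (0, h)) \<bullet> i - R p \<bullet> i) / h - S p \<bullet> i) \<in> L2 (lebesgue_on (cyl \<Omega> 0 (T - h))) \<and>
          L2_norm (lebesgue_on (cyl \<Omega> 0 (T - h))) (\<lambda>p. (R (p + (0, h)) \<bullet> i - R p \<bullet> i) / h - S p \<bullet> i) < \<epsilon>" if "0 < \<epsilon>" for \<epsilon>
        using X.difference_quotient[of 0 \<epsilon>] that by (simp add: zero_prod_def[symmetric])
      have "(\<lambda>n. T - h n) \<longlonglongrightarrow> T - 0" by (intro tendsto_intros h0)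
      then show "(\<lambda>n. T - h n) \<longlonglongrightarrow> T" by simp
    qed (use h h0 in \<open>auto intro: less_imp_le\<close>)
  qed
  have RC: "R \<in> L2 (?C n)" "G \<in> L2 (?C n)" "(\<lambda>p. R (p + (0, h n))) \<in> L2 (?C n)" for n
    using L2_cyl_mono(1)[OF \<Omega>(1) R, of 0 "T - h n"] L2_cyl_mono(1)[OF \<Omega>(1) G, of 0 "T - h n"]
      L2_cyl_mono(1)[OF \<Omega>(1) L2_shift(1)[OF \<Omega>(1) R, of "h n"], of 0 "T - h n"] h(1)[of n] by auto
  define B where "B n = ((\<integral>p. R (p + (0, h n)) \<bullet> G p \<partial>?C n) - (\<integral>p. R p \<bullet> G p \<partial>?C n)) / h n" for n
  have B: "B \<longlonglongrightarrow> (\<integral>p. S p \<bullet> G p \<partial>Q)"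
  proof -
    have 1: "B n = (\<Sum>i\<in>Basis. \<integral>p. (G p \<bullet> i) * ((R (p + (0, h n)) \<bullet> i - R p \<bullet> i) / h n) \<partial>?C n)" for n
    proof -
      have "B n = (\<integral>p. (R (p + (0, h n)) - R p) \<bullet> G p \<partial>?C n) / h n"
        unfolding B_def inner_diff_left by (subst Bochner_Integration.integral_diff) (auto intro!: L2_inner_integrable RC)
      also have "(\<integral>p. (R (p + (0, h n)) - R p) \<bullet> G p \<partial>?C n)
          = (\<Sum>i\<in>Basis. \<integral>p. ((R (p + (0, h n)) - R p) \<bullet> i) * (G p \<bullet> i) \<partial>?C n)"
        by (rule L2_integral_inner_components[OF L2_diff[OF RC(3,1)] RC(2)])
      finally show ?thesis by (simp add: sum_divide_distrib inner_diff_left mult.commute)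
    qed
    have 2: "(\<integral>p. S p \<bullet> G p \<partial>Q) = (\<Sum>i\<in>Basis. \<integral>p. (G p \<bullet> i) * (S p \<bullet> i) \<partial>Q)"
      unfolding L2_integral_inner_components[OF S G] by (simp add: mult.commute)
    show ?thesis unfolding 1 2 by (intro tendsto_sum Bi)
  qed
  have sh: "0 < sqrt (h n)" "sqrt (h n) * sqrt (h n) = h n" for n using h(1)[of n] by auto
  \<comment> \<open>Taken componentwise from \<open>time_trace_average\<close>, whose error is of
    size \<open>h n\<close>; after division a factor \<open>sqrt (h n)\<close> is left.\<close>
  have RN: "(\<lambda>n. L2_norm (?L n) R / sqrt (h n)) \<longlonglongrightarrow> L2_norm (lebesgue_on \<Omega>) r"
  proof -
    have i: "(\<lambda>n. L2_norm (?L n) (\<lambda>p. R p \<bullet> i) / sqrt (h n)) \<longlonglongrightarrow> L2_norm (lebesgue_on \<Omega>) (\<lambda>x. r x \<bullet> i)"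
      if i: "i \<in> Basis" for i
    proof -
      interpret X: weak_time_strip \<Omega> 0 T "\<lambda>p. R p \<bullet> i" "\<lambda>p. S p \<bullet> i"
        by unfold_locales (intro \<Omega> ab L2_inner_const R S RSi[OF i])+
      have "\<bar>L2_norm (?L n) (\<lambda>p. R p \<bullet> i) / sqrt (h n) - L2_norm (lebesgue_on \<Omega>) (\<lambda>x. r x \<bullet> i)\<bar>
          \<le> sqrt (h n) * L2_norm Q (\<lambda>p. S p \<bullet> i)" for n
      proof -
        have "\<bar>L2_norm (?L n) (\<lambda>p. R p \<bullet> i) - sqrt (h n) * L2_norm (lebesgue_on \<Omega>) (\<lambda>x. r x \<bullet> i)\<bar> \<le> h n * L2_norm Q (\<lambda>p. S p \<bullet> i)"
          using h[of n] by (intro X.time_trace_average[OF r[OF i]]) auto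
        then have "\<bar>L2_norm (?L n) (\<lambda>p. R p \<bullet> i) - sqrt (h n) * L2_norm (lebesgue_on \<Omega>) (\<lambda>x. r x \<bullet> i)\<bar> / sqrt (h n)
            \<le> h n * L2_norm Q (\<lambda>p. S p \<bullet> i) / sqrt (h n)"
          using sh(1)[of n] by (intro divide_right_mono) auto
        moreover have "h n * L2_norm Q (\<lambda>p. S p \<bullet> i) / sqrt (h n) = sqrt (h n) * L2_norm Q (\<lambda>p. S p \<bullet> i)"
          using real_div_sqrt[of "h n"] h(1)[of n] by (metis times_divide_eq_left less_imp_le)
        moreover have "\<bar>L2_norm (?L n) (\<lambda>p. R p \<bullet> i) - sqrt (h n) * L2_norm (lebesgue_on \<Omega>) (\<lambda>x. r x \<bullet> i)\<bar> / sqrt (h n)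
            = \<bar>L2_norm (?L n) (\<lambda>p. R p \<bullet> i) / sqrt (h n) - L2_norm (lebesgue_on \<Omega>) (\<lambda>x. r x \<bullet> i)\<bar>"
        proof -
          have "L2_norm (?L n) (\<lambda>p. R p \<bullet> i) / sqrt (h n) - L2_norm (lebesgue_on \<Omega>) (\<lambda>x. r x \<bullet> i)
              = (L2_norm (?L n) (\<lambda>p. R p \<bullet> i) - sqrt (h n) * L2_norm (lebesgue_on \<Omega>) (\<lambda>x. r x \<bullet> i)) / sqrt (h n)"
            using sh(1)[of n] by (simp add: diff_divide_distrib)
          then show ?thesis using sh(1)[of n] by (simp only: abs_divide abs_of_pos)
        qed
        ultimately show ?thesis by simp
      qed
      then have "\<forall>\<^sub>F n in sequentially. norm (L2_norm (?L n) (\<lambda>p. R p \<bullet> i) / sqrt (h n) - L2_norm (lebesgue_on \<Omega>) (\<lambda>x. r x \<bullet> i))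
          \<le> sqrt (h n) * L2_norm Q (\<lambda>p. S p \<bullet> i)" by simp
      moreover have "(\<lambda>n. sqrt (h n) * L2_norm Q (\<lambda>p. S p \<bullet> i)) \<longlonglongrightarrow> sqrt 0 * L2_norm Q (\<lambda>p. S p \<bullet> i)"
        by (intro tendsto_intros h0)
      then have "(\<lambda>n. sqrt (h n) * L2_norm Q (\<lambda>p. S p \<bullet> i)) \<longlonglongrightarrow> 0" by simp
      ultimately have "(\<lambda>n. L2_norm (?L n) (\<lambda>p. R p \<bullet> i) / sqrt (h n) - L2_norm (lebesgue_on \<Omega>) (\<lambda>x. r x \<bullet> i)) \<longlonglongrightarrow> 0"
        by (rule Lim_null_comparison)
      then show ?thesis by (rule LIM_zero_cancel)
    qed
    have "(L2_norm (?L n) R / sqrt (h n))\<^sup>2 = (\<Sum>i\<in>Basis. (L2_norm (?L n) (\<lambda>p. R p \<bullet> i) / sqrt (h n))\<^sup>2)" for n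
    proof -
      have "R \<in> L2 (?L n)" by (rule L2_cyl_mono(1)[OF \<Omega>(1) R]) (use h(2)[of n] in auto)
      then show ?thesis by (simp only: power_divide L2_norm_components sum_divide_distrib)
    qed
    then have "(\<lambda>n. (L2_norm (?L n) R / sqrt (h n))\<^sup>2) \<longlonglongrightarrow> (L2_norm (lebesgue_on \<Omega>) r)\<^sup>2"
      unfolding L2_norm_components[OF rL] by (simp only:) (intro tendsto_sum tendsto_power i)
    from tendsto_real_sqrt[OF this] show ?thesis
      using sh(1) by (simp add: real_sqrt_abs abs_of_nonneg less_imp_le)
  qed
  \<comment> \<open>The squares are difference quotients of \<open>E\<close> at the end point
    \<open>T\<close>, so \<open>E_derivative\<close> gives the limit.\<close>
  have GN: "(\<lambda>n. L2_norm (?L n) G / sqrt (h n)) \<longlonglongrightarrow> sqrt (2 * P T)"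
  proof -
    have "(E has_real_derivative 2 * P T) (at T within {0..T})" by (rule E_derivative) (use ab in simp)
    then have "((\<lambda>y. (E y - E T) / (y - T)) \<longlongrightarrow> 2 * P T) (at T within {0..T})" by (simp add: has_field_derivative_iff)
    moreover have "filterlim (\<lambda>n. T - h n) (at T within {0..T}) sequentially"
      unfolding filterlim_at
    proof
      have "(\<lambda>n. T - h n) \<longlonglongrightarrow> T - 0" by (intro tendsto_intros h0)
      then show "(\<lambda>n. T - h n) \<longlonglongrightarrow> T" by simp
      show "\<forall>\<^sub>F n in sequentially. T - h n \<in> {0..T} \<and> T - h n \<noteq> T" using h by (auto simp: less_imp_le less_imp_neq)
    qed
    ultimately have "(\<lambda>n. (E (T - h n) - E T) / (T - h n - T)) \<longlonglongrightarrow> 2 * P T" by (rule filterlim_compose)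
    moreover have "(E (T - h n) - E T) / (T - h n - T) = (L2_norm (?L n) G / sqrt (h n))\<^sup>2" for n
    proof -
      have "E T = E (T - h n) + (L2_norm (?L n) G)\<^sup>2"
        using L2_norm_cyl_split[OF \<Omega>(1) G, of "T - h n" T] h[of n] by (simp add: E_def)
      then show ?thesis using h(1)[of n] by (simp add: power_divide)
    qed
    ultimately have "(\<lambda>n. (L2_norm (?L n) G / sqrt (h n))\<^sup>2) \<longlonglongrightarrow> 2 * P T" by simp
    from tendsto_real_sqrt[OF this] show ?thesis
      using sh(1) by (simp add: real_sqrt_abs abs_of_nonneg less_imp_le)
  qed
  have le: "- (\<integral>p. Z p * ((e p - e0 (p + (0, - h n))) / h n) \<partial>Q)
      \<le> (L2_norm (?L n) R / sqrt (h n)) * (L2_norm (?L n) G / sqrt (h n)) - B n" for n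
  proof -
    have RL: "R \<in> L2 (?L n)" "G \<in> L2 (?L n)"
      using L2_cyl_mono(1)[OF \<Omega>(1) R, of "T - h n" T] L2_cyl_mono(1)[OF \<Omega>(1) G, of "T - h n" T] h(2)[of n] by auto
    have "- (\<integral>p. Z p * ((e p - e0 (p + (0, - h n))) / h n) \<partial>Q) = - (\<integral>p. Z p * (e p - e0 (p + (0, - h n))) \<partial>Q) / h n"
      by simp
    \<comment> \<open>The integral over \<open>(0, T)\<close> is split at \<open>T - h n\<close>.
      Its last piece is the boundary term; the other joins the shifted product to form a quotient of
      \<open>R\<close>.\<close>
    also have "\<dots> = ((\<integral>p. R p \<bullet> G p \<partial>?L n) + (\<integral>p. R p \<bullet> G p \<partial>?C n) - (\<integral>p. R (p + (0, h n)) \<bullet> G p \<partial>?C n)) / h n"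
      using shift_backward(2)[OF R Z h order_refl, of n] integral_inner_cyl_split[OF \<Omega>(1) R G, of "T - h n"] h[of n] by simp
    also have "\<dots> = (\<integral>p. R p \<bullet> G p \<partial>?L n) / h n - B n" by (simp add: B_def diff_divide_distrib add_divide_distrib)
    also have "(\<integral>p. R p \<bullet> G p \<partial>?L n) / h n \<le> L2_norm (?L n) R * L2_norm (?L n) G / h n"
      using L2_Cauchy_Schwarz[OF RL] h(1)[of n] by (intro divide_right_mono) auto
    also have "L2_norm (?L n) R * L2_norm (?L n) G / h n = (L2_norm (?L n) R / sqrt (h n)) * (L2_norm (?L n) G / sqrt (h n))"
      using sh(2)[of n] by simp
    finally show ?thesis by simp
  qed
  have "(\<lambda>n. (L2_norm (?L n) R / sqrt (h n)) * (L2_norm (?L n) G / sqrt (h n)) - B n)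
      \<longlonglongrightarrow> L2_norm (lebesgue_on \<Omega>) r * sqrt (2 * P T) - (\<integral>p. S p \<bullet> G p \<partial>Q)"
    by (intro tendsto_intros RN GN B)
  from LIMSEQ_le[OF A this] show ?thesis using le by blast
qed

lemma energy:
  assumes "time_trace \<Omega> 0 T T e g gT"
  shows "2 * (\<integral>p. g p * e p \<partial>Q) = (L2_norm (lebesgue_on \<Omega>) gT)\<^sup>2"
  using time_trace_energy[OF init assms] by simp

lemma green:
  assumes "y \<in> L2 Q" "Z \<in> L2 Q" "has_weak_div_x (cyl \<Omega> 0 T) y Z"
  shows "(\<integral>p. Z p * e p \<partial>Q) = - (\<integral>p. y p \<bullet> G p \<partial>Q)"
  using green_shift[OF dom ab lat assms, of 0 T 0] by (simp add: zero_prod_def[symmetric])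

end

section \<open>Mixed derivatives\<close>

text \<open>Integrating the time derivative over a long interval recovers \<open>\<psi>\<close>, and
  \<open>conv\<close> commutes with derivatives in basis directions. Differentiating the recovered
  formula in direction \<open>b\<close> and then in time gives the symmetry.\<close>

lemma dir_deriv_commute:
  fixes \<psi> :: "'a::euclidean_space \<times> real \<Rightarrow> real"
  assumes \<psi>: "smooth \<psi>" "compact K" "supp_in K \<psi>" and b: "b \<in> Basis"
  shows "dir_deriv b (dir_deriv (0, 1) \<psi>) p = dir_deriv (0, 1) (dir_deriv b \<psi>) p"
proof -
  obtain B where B: "0 < B" "\<And>q. q \<in> K \<Longrightarrow> norm q \<le> B"
    using compact_imp_bounded[OF \<psi>(2)] by (auto simp: bounded_pos)
  \<comment> \<open>Large enough for the point shifted back by \<open>s\<close> to lie outside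
    \<open>K\<close>, so that all shifted terms vanish at \<open>p\<close>.\<close>
  define s where "s = B + \<bar>snd p\<bar> + 1"
  have s: "0 \<le> s" using B by (simp add: s_def)
  have out: "p - (0, s) \<notin> K"
  proof
    assume "p - (0, s) \<in> K"
    then have "norm (p - (0, s)) \<le> B" by (rule B(2))
    moreover have "\<bar>snd (p - (0, s))\<bar> \<le> norm (p - (0, s))"
      using norm_snd_le[of "snd p - s" "fst p"] by (cases p) simp
    ultimately show False by (auto simp: s_def)
  qed
  interpret convolution "restrict_space lborel {0..s}" "\<lambda>r. (0::'a, r)" by (rule time_convolution)
  define \<Psi> where "\<Psi> = dir_deriv (0, 1) \<psi>"
  note cl = compact_imp_closed[OF \<psi>(2)]
  have \<Psi>: "smooth \<Psi>" "supp_in K \<Psi>" unfolding \<Psi>_def by (intro smooth_dir_deriv \<psi>, simp) (rule supp_in_dir_deriv[OF \<psi>(3) cl])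
  have \<Psi>b: "smooth (dir_deriv b \<Psi>)" "supp_in K (dir_deriv b \<Psi>)" by (intro smooth_dir_deriv supp_in_dir_deriv \<Psi> b cl)+
  have "conv \<Psi> = dir_deriv (0, 1) (conv \<psi>)" unfolding \<Psi>_def by (rule dir_deriv_conv[OF \<psi>, symmetric]) simp
  also have "\<dots> = (\<lambda>q. \<psi> q - \<psi> (q - (0, s)))"
    using dt_tprim[OF \<psi> s] by (simp add: tprim_conv[OF \<psi> s] fun_eq_iff)
  finally have c: "conv \<Psi> = (\<lambda>q. \<psi> q - \<psi> (q - (0, s)))" .
  have tm: "dir_deriv c (\<lambda>q. \<eta> (q - (0, s))) q = dir_deriv c \<eta> (q - (0, s))"
    if "smooth \<eta>" for \<eta> :: "'a \<times> real \<Rightarrow> real" and c q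
    using dir_deriv_translate[OF that, of c "- (0, s)" q] by (simp only: diff_conv_add_uminus)
  note tr = smooth_translate_minus[OF \<psi>(1), of "(0, s)"]
  have tb: "smooth (dir_deriv b \<psi>)" by (intro smooth_dir_deriv \<psi> b)
  have "conv (dir_deriv b \<Psi>) = dir_deriv b (conv \<Psi>)" by (rule dir_deriv_conv[OF \<Psi>(1) \<psi>(2) \<Psi>(2) b, symmetric])
  also have "\<dots> = (\<lambda>q. dir_deriv b \<psi> q - dir_deriv b \<psi> (q - (0, s)))"
    unfolding c by (intro ext) (simp only: dir_deriv_diff[OF \<psi>(1) tr] tm[OF \<psi>(1)])
  finally have "dir_deriv (0, 1) (conv (dir_deriv b \<Psi>)) p = dir_deriv (0, 1) (\<lambda>q. dir_deriv b \<psi> q - dir_deriv b \<psi> (q - (0, s))) p" by simp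
  also have "\<dots> = dir_deriv (0, 1) (dir_deriv b \<psi>) p - dir_deriv (0, 1) (dir_deriv b \<psi>) (p - (0, s))"
    by (simp only: dir_deriv_diff[OF tb smooth_translate_minus[OF tb]] tm[OF tb])
  also have "dir_deriv (0, 1) (dir_deriv b \<psi>) (p - (0, s)) = 0"
    using supp_in_dir_deriv[OF supp_in_dir_deriv[OF \<psi>(3) cl] cl] out unfolding supp_in_def by blast
  finally have "dir_deriv (0, 1) (conv (dir_deriv b \<Psi>)) p = dir_deriv (0, 1) (dir_deriv b \<psi>) p" by simp
  moreover have "dir_deriv b \<Psi> (p - (0, s)) = 0" using \<Psi>b(2) out unfolding supp_in_def by blast
  ultimately have "dir_deriv b \<Psi> p = dir_deriv (0, 1) (dir_deriv b \<psi>) p"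
    using dt_tprim[OF \<Psi>b(1) \<psi>(2) \<Psi>b(2) s, of p] by (simp add: tprim_conv[OF \<Psi>b(1) \<psi>(2) \<Psi>b(2) s])
  then show ?thesis by (simp add: \<Psi>_def)
qed

text \<open>The two derivatives are exchanged on the test function. Applied to \<open>v\<close>,
  this gives its gradient, and hence the flux residual, a time derivative.\<close>

lemma weak_grad_dt:
  fixes w :: "'a::euclidean_space \<times> real \<Rightarrow> real"
  assumes Q: "open Q" and L: "G \<in> L2 (lebesgue_on Q)" "H \<in> L2 (lebesgue_on Q)"
    and w: "has_weak_dt Q w g" "has_weak_grad_x Q w G" "has_weak_grad_x Q g H"
  shows "has_weak_dt Q G H"
proof -
  have "has_weak_dt Q (\<lambda>p. G p \<bullet> i) (\<lambda>p. H p \<bullet> i)" if i: "i \<in> Basis" for i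
    unfolding has_weak_dt_def
  proof
    fix \<phi> assume \<phi>: "\<phi> \<in> test_functions Q"
    obtain K where K: "smooth \<phi>" "compact K" "supp_in K \<phi>" using \<phi> by (auto simp: test_functions_iff)
    have "(\<integral>p. dir_deriv (0, 1) \<phi> p * (G p \<bullet> i) \<partial>lebesgue_on Q) = - (\<integral>p. dir_deriv (i, 0) (dir_deriv (0, 1) \<phi>) p * w p \<partial>lebesgue_on Q)"
      using w(2) test_functions_dir_deriv[OF \<phi>, of "(0, 1)"] i by (simp add: has_weak_grad_x_def)
    also have "\<dots> = - (\<integral>p. dir_deriv (0, 1) (dir_deriv (i, 0) \<phi>) p *\<^sub>R w p \<partial>lebesgue_on Q)"
      using dir_deriv_commute[OF K, of "(i, 0)"] i by simp
    also have "\<dots> = (\<integral>p. dir_deriv (i, 0) \<phi> p *\<^sub>R g p \<partial>lebesgue_on Q)"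
      using w(1) test_functions_dir_deriv[OF \<phi>, of "(i, 0)"] i unfolding has_weak_dt_def by simp
    also have "\<dots> = - (\<integral>p. \<phi> p * (H p \<bullet> i) \<partial>lebesgue_on Q)"
      using w(3) \<phi> i by (simp add: has_weak_grad_x_def)
    finally show "(\<integral>p. dir_deriv (0, 1) \<phi> p *\<^sub>R (G p \<bullet> i) \<partial>lebesgue_on Q) = - (\<integral>p. \<phi> p *\<^sub>R (H p \<bullet> i) \<partial>lebesgue_on Q)" by simp
  qed
  then show ?thesis using has_weak_dt_component[OF Q L] by blast
qed

section \<open>Traces\<close>

lemma has_time_trace_iff:
  fixes w :: "'a::euclidean_space \<times> real \<Rightarrow> real"
  shows "has_time_trace \<Omega> T s w g \<longleftrightarrow> time_trace \<Omega> 0 T s w (dt (cyl \<Omega> 0 T) w) g"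
  unfolding has_time_trace_def time_trace_def dt_approx_def cylinder_eq_cyl by blast

lemma has_time_trace_component:
  fixes w :: "'a::euclidean_space \<times> real \<Rightarrow> 'b::euclidean_space"
  assumes "has_time_trace \<Omega> T s w g" and i: "i \<in> Basis"
  shows "time_trace \<Omega> 0 T s (\<lambda>p. w p \<bullet> i) (\<lambda>p. dt (cyl \<Omega> 0 T) w p \<bullet> i) (\<lambda>x. g x \<bullet> i)"
proof -
  obtain \<phi> where gL: "g \<in> L2 (lebesgue_on \<Omega>)" and \<phi>: "\<And>n. smooth (\<phi> n)" "L2_lim (lebesgue_on (cyl \<Omega> 0 T)) \<phi> w"
    "L2_lim (lebesgue_on (cyl \<Omega> 0 T)) (\<lambda>n. dir_deriv (0, 1) (\<phi> n)) (dt (cyl \<Omega> 0 T) w)"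
    "L2_lim (lebesgue_on \<Omega>) (\<lambda>n x. \<phi> n (x, s)) g"
    using assms(1) by (auto simp: has_time_trace_def cylinder_eq_cyl)
  have "dir_deriv (0, 1) (\<lambda>p. \<phi> n p \<bullet> i) = (\<lambda>p. dir_deriv (0, 1) (\<phi> n) p \<bullet> i)" for n
    using dir_deriv_linear[OF bounded_linear_inner_left[of i] \<phi>(1)] by blast
  then show ?thesis
    unfolding time_trace_def dt_approx_def
    using L2_lim_components[THEN iffD1, rule_format, OF \<phi>(2) i] L2_lim_components[THEN iffD1, rule_format, OF \<phi>(3) i]
      L2_lim_components[THEN iffD1, rule_format, OF \<phi>(4) i]
    by (intro conjI exI[of _ "\<lambda>n p. \<phi> n p \<bullet> i"] L2_inner_const[OF gL] allI smooth_inner smooth_const \<phi>(1)) simp_all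
qed

text \<open>Final norms refer to a trace selected by \<open>SOME\<close>, which existence makes a
  genuine one. Traces and sequences are chosen for each component and assembled into a vector-valued
  sequence.\<close>

lemma has_time_trace_exists:
  fixes w :: "'a::euclidean_space \<times> real \<Rightarrow> 'b::euclidean_space"
  assumes \<Omega>: "open \<Omega>" "bounded \<Omega>" and T: "0 < T" and w: "w \<in> H_dt (cyl \<Omega> 0 T)" and s: "0 \<le> s" "s \<le> T"
  shows "\<exists>g. has_time_trace \<Omega> T s w g"
proof -
  let ?Q = "lebesgue_on (cyl \<Omega> 0 T)"
  note k = dt_has_weak_dt[OF w]
  have wL: "w \<in> L2 ?Q" using w by (simp add: H_dt_def)
  have "\<forall>i\<in>Basis. \<exists>g\<phi>. fst g\<phi> \<in> L2 (lebesgue_on \<Omega>) \<and> dt_approx \<Omega> 0 T (snd g\<phi>) (\<lambda>p. w p \<bullet> i) (\<lambda>p. dt (cyl \<Omega> 0 T) w p \<bullet> i) \<and>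
      L2_lim (lebesgue_on \<Omega>) (\<lambda>n x. snd g\<phi> n (x, s)) (fst g\<phi>)"
  proof
    fix i :: 'b assume i: "i \<in> Basis"
    interpret X: weak_time_strip \<Omega> 0 T "\<lambda>p. w p \<bullet> i" "\<lambda>p. dt (cyl \<Omega> 0 T) w p \<bullet> i"
    proof
      show "has_weak_dt (cyl \<Omega> 0 T) (\<lambda>p. w p \<bullet> i) (\<lambda>p. dt (cyl \<Omega> 0 T) w p \<bullet> i)"
        using has_weak_dt_component[OF open_cyl[OF \<Omega>(1)] wL k(1)] k(2) i by blast
    qed (intro \<Omega> T L2_inner_const wL k(1))+
    obtain g \<phi> where "g \<in> L2 (lebesgue_on \<Omega>)" "dt_approx \<Omega> 0 T \<phi> (\<lambda>p. w p \<bullet> i) (\<lambda>p. dt (cyl \<Omega> 0 T) w p \<bullet> i)"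
      "L2_lim (lebesgue_on \<Omega>) (\<lambda>n x. \<phi> n (x, s)) g"
      using X.time_trace_exists[OF s] by (auto simp: time_trace_def)
    then show "\<exists>g\<phi>. fst g\<phi> \<in> L2 (lebesgue_on \<Omega>) \<and> dt_approx \<Omega> 0 T (snd g\<phi>) (\<lambda>p. w p \<bullet> i) (\<lambda>p. dt (cyl \<Omega> 0 T) w p \<bullet> i) \<and>
      L2_lim (lebesgue_on \<Omega>) (\<lambda>n x. snd g\<phi> n (x, s)) (fst g\<phi>)" by (intro exI[of _ "(g, \<phi>)"]) simp
  qed
  from bchoice[OF this] obtain g\<phi> where g\<phi>: "\<forall>i\<in>Basis. fst (g\<phi> i) \<in> L2 (lebesgue_on \<Omega>) \<and>
      dt_approx \<Omega> 0 T (snd (g\<phi> i)) (\<lambda>p. w p \<bullet> i) (\<lambda>p. dt (cyl \<Omega> 0 T) w p \<bullet> i) \<and>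
      L2_lim (lebesgue_on \<Omega>) (\<lambda>n x. snd (g\<phi> i) n (x, s)) (fst (g\<phi> i))" ..
  define g where "g x = (\<Sum>i\<in>Basis. fst (g\<phi> i) x *\<^sub>R i)" for x
  define \<phi> where "\<phi> n p = (\<Sum>i\<in>Basis. snd (g\<phi> i) n p *\<^sub>R i)" for n p
  have sm: "smooth (snd (g\<phi> i) n)" if "i \<in> Basis" for i n using g\<phi> that by (auto simp: dt_approx_def)
  have dir: "dir_deriv (0, 1) (\<phi> n) p = (\<Sum>i\<in>Basis. dir_deriv (0, 1) (snd (g\<phi> i) n) p *\<^sub>R i)" for n p
    unfolding \<phi>_def by (subst dir_deriv_sum) (auto intro!: sum.cong smooth_scaleR smooth_const sm dir_deriv_scaleR_const)
  have comp: "(\<Sum>j\<in>Basis. c j *\<^sub>R j) \<bullet> i = c i" if "i \<in> Basis" for c and i :: 'b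
    using that by (simp add: inner_sum_left inner_Basis if_distrib[of "\<lambda>x. _ * x"] cong: if_cong)
  have "has_time_trace \<Omega> T s w g"
    unfolding has_time_trace_def cylinder_eq_cyl
  proof (intro conjI exI[of _ \<phi>] allI)
    show "g \<in> L2 (lebesgue_on \<Omega>)" unfolding L2_components_iff[of g] using g\<phi> by (simp add: g_def comp)
    show "smooth (\<phi> n)" for n unfolding \<phi>_def[abs_def] by (intro smooth_sum smooth_scaleR smooth_const sm)
    show "L2_lim ?Q \<phi> w"
      by (rule L2_lim_components[THEN iffD2]) (use g\<phi> in \<open>simp add: \<phi>_def comp dt_approx_def\<close>)
    show "L2_lim ?Q (\<lambda>n. dir_deriv (0, 1) (\<phi> n)) (dt (cyl \<Omega> 0 T) w)"
      by (rule L2_lim_components[THEN iffD2]) (use g\<phi> in \<open>simp add: dir comp dt_approx_def\<close>)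
    show "L2_lim (lebesgue_on \<Omega>) (\<lambda>n x. \<phi> n (x, s)) g"
      by (rule L2_lim_components[THEN iffD2]) (use g\<phi> in \<open>simp add: \<phi>_def g_def comp\<close>)
  qed
  then show ?thesis by blast
qed

section \<open>The error majorant\<close>

lemma sum_square_weighted:
  fixes x y t :: real
  assumes "0 < t"
  shows "(x + y)\<^sup>2 \<le> (1 + t) * x\<^sup>2 + (1 + 1 / t) * y\<^sup>2"
proof -
  have "0 \<le> (t * x - y)\<^sup>2 / t" using assms by simp
  also have "\<dots> = t * x\<^sup>2 + y\<^sup>2 / t - 2 * x * y"
    using assms by (simp add: power2_eq_square field_simps)
  finally show ?thesis by (simp add: power2_sum algebra_simps)
qed

lemma mult_le_weighted_squares:
  fixes x y t :: real
  assumes "0 < t"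
  shows "2 * (x * y) \<le> x\<^sup>2 / t + t * y\<^sup>2"
proof -
  have "0 \<le> (x - t * y)\<^sup>2 / t" using assms by simp
  also have "\<dots> = x\<^sup>2 / t + t * y\<^sup>2 - 2 * (x * y)"
    using assms by (simp add: power2_eq_square field_simps)
  finally show ?thesis by simp
qed

text \<open>\<open>a\<close>, \<open>b\<close>, \<open>eT\<close> are the norms of gradient, time
  derivative and final trace of the error, \<open>M\<close> is the square of its final gradient
  norm; \<open>\<rho>\<close> belongs to the equation residual and \<open>\<delta>\<close>,
  \<open>\<sigma>\<close>, \<open>r\<close> to the flux residual, its time derivative and its final
  trace. All products with \<open>a\<close> are gathered before Young's inequality, so that one
  weight \<open>\<zeta>\<close> serves the whole gradient term.\<close>

lemma majorant_arithmetic: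
  fixes a b eT M \<rho> \<delta> \<sigma> r C lam mu \<zeta> \<epsilon> \<alpha> \<beta> :: real
  assumes pos: "0 < lam" "0 < mu" "1 / 2 \<le> \<zeta>" "1 \<le> \<epsilon>" "0 < \<alpha>" "0 < \<beta>" "0 \<le> M"
    and le: "lam * (a\<^sup>2 + eT\<^sup>2 / 2) + mu * (b\<^sup>2 + M / 2)
      \<le> lam * (\<rho> * (C * a) + \<delta> * a) + mu * (\<rho> * b + r * sqrt M + \<sigma> * a)"
  shows "(2 - 1 / \<zeta>) * (lam * a\<^sup>2 + mu * b\<^sup>2) + mu * (1 - 1 / \<epsilon>) * M + lam * eT\<^sup>2
    \<le> \<epsilon> * mu * r\<^sup>2 + \<zeta> * (lam * ((1 + \<alpha>) * ((1 + \<beta>) * \<delta>\<^sup>2 + (1 + 1 / \<beta>) * C\<^sup>2 * \<rho>\<^sup>2)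
        + (1 + 1 / \<alpha>) * (mu\<^sup>2 / lam\<^sup>2) * \<sigma>\<^sup>2) + mu * \<rho>\<^sup>2)"
proof -
  have \<zeta>: "0 < \<zeta>" and \<epsilon>: "0 < \<epsilon>" using pos by auto
  \<comment> \<open>The factor of \<open>lam * a\<close>. The part with \<open>\<sigma>\<close>
    comes from testing with \<open>mu\<close> times the time derivative, whence the ratio
    \<open>mu / lam\<close>.\<close>
  define X where "X = (\<delta> + C * \<rho>) + mu / lam * \<sigma>"
  have "X\<^sup>2 \<le> (1 + \<alpha>) * (\<delta> + C * \<rho>)\<^sup>2 + (1 + 1 / \<alpha>) * (mu / lam * \<sigma>)\<^sup>2"
    unfolding X_def by (rule sum_square_weighted[OF pos(5)])
  also have "(\<delta> + C * \<rho>)\<^sup>2 \<le> (1 + \<beta>) * \<delta>\<^sup>2 + (1 + 1 / \<beta>) * (C * \<rho>)\<^sup>2"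
    by (rule sum_square_weighted[OF pos(6)])
  finally have X: "X\<^sup>2 \<le> (1 + \<alpha>) * ((1 + \<beta>) * \<delta>\<^sup>2 + (1 + 1 / \<beta>) * C\<^sup>2 * \<rho>\<^sup>2) + (1 + 1 / \<alpha>) * (mu\<^sup>2 / lam\<^sup>2) * \<sigma>\<^sup>2"
    using pos(5) by (simp add: power_mult_distrib power_divide mult.assoc)
  have "lam * X = lam * (\<delta> + C * \<rho>) + mu * \<sigma>" using pos(1) by (simp add: X_def algebra_simps)
  then have "lam * (\<rho> * (C * a) + \<delta> * a) + mu * (\<rho> * b + r * sqrt M + \<sigma> * a)
      = lam * (a * X) + mu * (b * \<rho>) + mu * (sqrt M * r)" by algebra
  moreover have "lam * (2 * (a * X)) \<le> lam * (a\<^sup>2 / \<zeta> + \<zeta> * X\<^sup>2)"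
    "mu * (2 * (b * \<rho>)) \<le> mu * (b\<^sup>2 / \<zeta> + \<zeta> * \<rho>\<^sup>2)" "mu * (2 * (sqrt M * r)) \<le> mu * ((sqrt M)\<^sup>2 / \<epsilon> + \<epsilon> * r\<^sup>2)"
    by (intro mult_left_mono mult_le_weighted_squares \<zeta> \<epsilon>; use pos in simp)+
  ultimately have "2 * (lam * (a\<^sup>2 + eT\<^sup>2 / 2) + mu * (b\<^sup>2 + M / 2))
      \<le> lam * (a\<^sup>2 / \<zeta> + \<zeta> * X\<^sup>2) + mu * (b\<^sup>2 / \<zeta> + \<zeta> * \<rho>\<^sup>2) + mu * (M / \<epsilon> + \<epsilon> * r\<^sup>2)"
    using le pos(7) by simp
  then have "(2 - 1 / \<zeta>) * (lam * a\<^sup>2 + mu * b\<^sup>2) + mu * (1 - 1 / \<epsilon>) * M + lam * eT\<^sup>2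
      \<le> \<epsilon> * mu * r\<^sup>2 + \<zeta> * (lam * X\<^sup>2 + mu * \<rho>\<^sup>2)"
    by (simp add: algebra_simps)
  also have "\<dots> \<le> \<epsilon> * mu * r\<^sup>2 + \<zeta> * (lam * ((1 + \<alpha>) * ((1 + \<beta>) * \<delta>\<^sup>2 + (1 + 1 / \<beta>) * C\<^sup>2 * \<rho>\<^sup>2)
        + (1 + 1 / \<alpha>) * (mu\<^sup>2 / lam\<^sup>2) * \<sigma>\<^sup>2) + mu * \<rho>\<^sup>2)"
    using \<zeta> pos(1) by (intro add_left_mono mult_left_mono add_right_mono X) auto
  finally show ?thesis .
qed

text \<open>As the operators pick representatives, their linearity holds only almost everywhere, by
  uniqueness of weak derivatives. The approximating sequences of \<open>u\<close> and
  \<open>v\<close> are subtracted, separately for the lateral and the initial trace, and the limits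
  are transferred to the representatives picked for \<open>e\<close>.\<close>

lemma V_laplace_difference:
  fixes u v :: "'a::euclidean_space \<times> real \<Rightarrow> real"
  assumes dom: "bounded_lipschitz_domain \<Omega>" and T: "0 < T" and u: "u \<in> V_laplace \<Omega> T" and v: "v \<in> V_laplace \<Omega> T"
  defines "S \<equiv> cyl \<Omega> 0 T" and "e \<equiv> \<lambda>p. u p - v p"
  shows "AE p in lebesgue_on S. dt S e p = dt S u p - dt S v p"
    and "e \<in> H10_0 \<Omega> T"
    and "parabolic_strip \<Omega> T e (dt S e) (grad_x S e) (\<lambda>p. laplace_x S u p - laplace_x S v p)"
proof -
  have \<Omega>: "open \<Omega>" "bounded \<Omega>" using dom by (auto simp: bounded_lipschitz_domain_def)
  have So: "open S" "bounded S" unfolding S_def by (intro open_cyl bounded_cyl \<Omega>)+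
  let ?Q = "lebesgue_on S"
  have V: "w \<in> H_grad_x S" "w \<in> H_dt S" "w \<in> L2 ?Q" "has_lateral_trace \<Omega> T w (\<lambda>_. 0)" "grad_x S w \<in> H_div_x S"
      "has_time_trace \<Omega> T 0 w (\<lambda>_. 0)" if "w \<in> V_laplace \<Omega> T" for w
    using that by (auto simp: V_laplace_def V1_0_def S_def cylinder_eq_cyl H_dt_def)
  note u' = V[OF u] and v' = V[OF v]
  note dtu = dt_has_weak_dt[OF u'(2)] and dtv = dt_has_weak_dt[OF v'(2)]
    and gu = grad_x_has_weak_grad_x[OF u'(1)] and gv = grad_x_has_weak_grad_x[OF v'(1)]
  note Lu = div_x_has_weak_div_x[OF u'(5), folded laplace_x_def] and Lv = div_x_has_weak_div_x[OF v'(5), folded laplace_x_def]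
  have eL: "e \<in> L2 ?Q" unfolding e_def by (intro L2_diff u' v')
  have dtd: "has_weak_dt S e (\<lambda>p. dt S u p - dt S v p)" "(\<lambda>p. dt S u p - dt S v p) \<in> L2 ?Q"
    unfolding e_def by (rule has_weak_dt_diff[OF So(1) u'(3) v'(3) dtu(1) dtv(1) dtu(2) dtv(2)]) (rule L2_diff[OF dtu(1) dtv(1)])
  have gd: "has_weak_grad_x S e (\<lambda>p. grad_x S u p - grad_x S v p)" "(\<lambda>p. grad_x S u p - grad_x S v p) \<in> L2 ?Q"
    unfolding e_def by (rule has_weak_grad_x_diff[OF So(1) u'(3) v'(3) gu(1) gv(1) gu(2) gv(2)]) (rule L2_diff[OF gu(1) gv(1)])
  have eH: "e \<in> H_dt S" "e \<in> H_grad_x S" using eL dtd gd by (auto simp: H_dt_def H_grad_x_def)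
  note dte = dt_has_weak_dt[OF eH(1)] and ge = grad_x_has_weak_grad_x[OF eH(2)]
  show aedt: "AE p in ?Q. dt S e p = dt S u p - dt S v p"
    by (rule weak_dt_unique[OF So dte(1) dtd(2) dte(2) dtd(1)])
  have aeg: "AE p in ?Q. grad_x S u p - grad_x S v p = grad_x S e p"
    by (rule weak_grad_x_unique[OF So gd(2) ge(1) gd(1) ge(2)])
  have "has_weak_div_x S (\<lambda>p. grad_x S u p - grad_x S v p) (\<lambda>p. laplace_x S u p - laplace_x S v p)"
    by (rule has_weak_div_x_diff[OF So(1) gu(1) gv(1) Lu(1) Lv(1) Lu(2) Lv(2)])
  then have GD: "has_weak_div_x S (grad_x S e) (\<lambda>p. laplace_x S u p - laplace_x S v p)"
    by (rule has_weak_div_x_cong[OF So(1) gd(2) ge(1) _ aeg])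
  obtain \<phi> where \<phi>: "\<And>n. smooth (\<phi> n)" "L2_lim ?Q \<phi> u" "L2_lim ?Q (\<lambda>n. sgrad (\<phi> n)) (grad_x S u)" "L2_lim (surface_measure \<Omega> T) \<phi> (\<lambda>_. 0)"
    using u'(4) unfolding has_lateral_trace_def cylinder_eq_cyl S_def sgrad_def[abs_def] by blast
  obtain \<psi> where \<psi>: "\<And>n. smooth (\<psi> n)" "L2_lim ?Q \<psi> v" "L2_lim ?Q (\<lambda>n. sgrad (\<psi> n)) (grad_x S v)" "L2_lim (surface_measure \<Omega> T) \<psi> (\<lambda>_. 0)"
    using v'(4) unfolding has_lateral_trace_def cylinder_eq_cyl S_def sgrad_def[abs_def] by blast
  define \<eta> where "\<eta> n p = \<phi> n p - \<psi> n p" for n p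
  have \<eta>: "smooth (\<eta> n)" for n unfolding \<eta>_def[abs_def] by (intro smooth_diff \<phi> \<psi>)
  have s\<eta>: "sgrad (\<eta> n) = (\<lambda>p. sgrad (\<phi> n) p - sgrad (\<psi> n) p)" for n
    unfolding sgrad_def[abs_def] \<eta>_def[abs_def] by (simp add: dir_deriv_diff[OF \<phi>(1) \<psi>(1)] scaleR_diff_left sum_subtractf)
  have \<eta>1: "L2_lim ?Q \<eta> e" unfolding \<eta>_def[abs_def] e_def by (rule L2_lim_diff[OF \<phi>(2) \<psi>(2)])
  have "L2_lim ?Q (\<lambda>n. sgrad (\<eta> n)) (\<lambda>p. grad_x S u p - grad_x S v p)" unfolding s\<eta> by (rule L2_lim_diff[OF \<phi>(3) \<psi>(3)])
  then have \<eta>2: "L2_lim ?Q (\<lambda>n. sgrad (\<eta> n)) (grad_x S e)"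
    by (rule L2_lim_cong[OF _ L2_measurable[OF ge(1)] L2_measurable[OF gd(2)] continuous_lebesgue_on_measurable[OF sgrad_continuous[OF \<eta>]] aeg])
  have \<eta>3: "L2_lim (surface_measure \<Omega> T) \<eta> (\<lambda>_. 0)"
    using L2_lim_diff[OF \<phi>(4) \<psi>(4)] by (simp add: \<eta>_def[abs_def])
  have lat: "zero_lateral \<Omega> T e (grad_x S e)"
    unfolding zero_lateral_def S_def[symmetric] using \<eta> \<eta>1 \<eta>2 \<eta>3 eL ge(1) by blast
  show "e \<in> H10_0 \<Omega> T"
    unfolding H10_0_def has_lateral_trace_def cylinder_eq_cyl S_def[symmetric] sgrad_def[symmetric, abs_def]
    using eH(2) \<eta> \<eta>1 \<eta>2[unfolded sgrad_def[abs_def]] \<eta>3 by (auto simp: sgrad_def)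
  obtain \<phi> where \<phi>: "\<And>n. smooth (\<phi> n)" "L2_lim ?Q \<phi> u" "L2_lim ?Q (\<lambda>n. dir_deriv (0, 1) (\<phi> n)) (dt S u)"
      "L2_lim (lebesgue_on \<Omega>) (\<lambda>n x. \<phi> n (x, 0)) (\<lambda>_. 0)"
    using u'(6) unfolding has_time_trace_def cylinder_eq_cyl S_def by blast
  obtain \<psi> where \<psi>: "\<And>n. smooth (\<psi> n)" "L2_lim ?Q \<psi> v" "L2_lim ?Q (\<lambda>n. dir_deriv (0, 1) (\<psi> n)) (dt S v)"
      "L2_lim (lebesgue_on \<Omega>) (\<lambda>n x. \<psi> n (x, 0)) (\<lambda>_. 0)"
    using v'(6) unfolding has_time_trace_def cylinder_eq_cyl S_def by blast
  have d\<eta>: "L2_lim ?Q (\<lambda>n. dir_deriv (0, 1) (\<lambda>p. \<phi> n p - \<psi> n p)) (\<lambda>p. dt S u p - dt S v p)"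
    using L2_lim_diff[OF \<phi>(3) \<psi>(3)] by (simp add: dir_deriv_diff[OF \<phi>(1) \<psi>(1), abs_def])
  have sm: "smooth (\<lambda>p. \<phi> n p - \<psi> n p)" for n by (intro smooth_diff \<phi> \<psi>)
  have "L2_lim ?Q (\<lambda>n. dir_deriv (0, 1) (\<lambda>p. \<phi> n p - \<psi> n p)) (dt S e)"
  proof (rule L2_lim_cong[OF d\<eta> L2_measurable[OF dte(1)] L2_measurable[OF dtd(2)]])
    show "dir_deriv (0, 1) (\<lambda>p. \<phi> n p - \<psi> n p) \<in> borel_measurable ?Q" for n
      by (intro continuous_lebesgue_on_measurable smooth_continuous smooth_dir_deriv sm) simp
    show "AE p in ?Q. dt S u p - dt S v p = dt S e p" using aedt by (rule eventually_mono) simp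
  qed
  then have init: "time_trace \<Omega> 0 T 0 e (dt S e) (\<lambda>x. 0)"
    unfolding time_trace_def dt_approx_def S_def[symmetric]
    using sm L2_lim_diff[OF \<phi>(2) \<psi>(2)] L2_lim_diff[OF \<phi>(4) \<psi>(4)]
    by (intro conjI exI[of _ "\<lambda>n p. \<phi> n p - \<psi> n p"] L2_zero) (simp_all add: e_def)
  show "parabolic_strip \<Omega> T e (dt S e) (grad_x S e) (\<lambda>p. laplace_x S u p - laplace_x S v p)"
    by unfold_locales (use \<Omega> T eL dte dom lat GD init L2_diff[OF Lu(1) Lv(1)] in \<open>simp_all add: S_def\<close>)
qed

theorem theorem2:
  fixes \<Omega> :: "'a::euclidean_space set"
    and T C_F lam mu \<zeta> \<epsilon> \<alpha> \<beta> :: real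
    and f u v e :: "'a \<times> real \<Rightarrow> real"
    and y :: "'a \<times> real \<Rightarrow> 'a"
  defines "Q \<equiv> cylinder \<Omega> T"
  assumes dim: "DIM('a) \<in> {1, 2, 3}"
    and dom: "bounded_lipschitz_domain \<Omega>"
    and T: "0 < T"
    and f: "f \<in> L2 (lebesgue_on Q)"
    and u: "heat_solution \<Omega> T f u"
    and C_F: "friedrichs_constant \<Omega> T C_F"
    and lam: "0 < lam" and mu: "0 < mu"
    and v: "v \<in> V_grad_dt \<Omega> T"
    and y: "y \<in> H_div_1 \<Omega> T"
    and zeta: "1 / 2 \<le> \<zeta>" and eps: "1 \<le> \<epsilon>"
    and alpha: "0 < \<alpha>" and beta: "0 < \<beta>"
    and e: "e = (\<lambda>p. u p - v p)"
  shows "(2 - 1 / \<zeta>) * (lam * (norm_Q \<Omega> T (grad_x Q e))\<^sup>2 + mu * (norm_Q \<Omega> T (dt Q e))\<^sup>2)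
      + mu * (1 - 1 / \<epsilon>) * (grad_norm_\<Sigma>T \<Omega> T e)\<^sup>2 + lam * (norm_\<Sigma>T \<Omega> T e)\<^sup>2
    \<le> \<epsilon> * mu * (norm_\<Sigma>T \<Omega> T (r_d \<Omega> T v y))\<^sup>2
      + \<zeta> * (lam * ((1 + \<alpha>) * majorant \<Omega> T C_F f v y \<beta>
                    + (1 + 1 / \<alpha>) * (mu\<^sup>2 / lam\<^sup>2) * (norm_Q \<Omega> T (dt Q (r_d \<Omega> T v y)))\<^sup>2)
             + mu * (norm_Q \<Omega> T (r_eq \<Omega> T f v y))\<^sup>2)"
proof -
  have QS: "Q = cyl \<Omega> 0 T" by (simp add: Q_def cylinder_eq_cyl)
  have \<Omega>: "open \<Omega>" "bounded \<Omega>" using dom by (auto simp: bounded_lipschitz_domain_def)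
  have So: "open Q" "bounded Q" unfolding QS by (intro open_cyl bounded_cyl \<Omega>)+
  have uV: "u \<in> V_laplace \<Omega> T" and uf: "AE p in lebesgue_on Q. dt Q u p - laplace_x Q u p = f p"
    using u unfolding heat_solution_def Q_def by blast+
  have vV: "v \<in> V_laplace \<Omega> T" and vH: "dt Q v \<in> H_grad_x Q" using v by (auto simp: V_grad_dt_def Q_def)
  have vV': "v \<in> H_grad_x Q" "v \<in> H_dt Q" "grad_x Q v \<in> H_div_x Q"
    using vV by (auto simp: V_laplace_def V1_0_def Q_def)
  have yH: "y \<in> H_div_x Q" "y \<in> H_dt Q" "y \<in> L2 (lebesgue_on Q)" using y by (auto simp: H_div_1_def Q_def H_div_x_def)
  define R where "R p = y p - grad_x Q v p" for p
  define Z where "Z p = div_x Q y p - laplace_x Q v p" for p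
  define g where "g = dt Q e"
  define G where "G = grad_x Q e"
  define D where "D p = laplace_x Q u p - laplace_x Q v p" for p
  define \<rho> where "\<rho> = r_eq \<Omega> T f v y"
  note V = V_laplace_difference[OF dom T uV vV, folded QS e]
  interpret X: parabolic_strip \<Omega> T e g G D
    using V(3) unfolding g_def G_def D_def .
  let ?L = "lebesgue_on Q"
  note eL = X.w[folded QS] and gL = X.k[folded QS] and GL = X.G[folded QS] and DL = X.D[folded QS]
  note dtv = dt_has_weak_dt[OF vV'(2)] and gv = grad_x_has_weak_grad_x[OF vV'(1)] and H = grad_x_has_weak_grad_x[OF vH]
    and Lv = div_x_has_weak_div_x[OF vV'(3), folded laplace_x_def] and dy = div_x_has_weak_div_x[OF yH(1)] and dty = dt_has_weak_dt[OF yH(2)]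
  have RL: "R \<in> L2 ?L" unfolding R_def[abs_def] by (intro L2_diff yH gv)
  have ZL: "Z \<in> L2 ?L" unfolding Z_def[abs_def] by (intro L2_diff dy Lv)
  have RZ: "has_weak_div_x Q R Z"
    unfolding R_def[abs_def] Z_def[abs_def] by (rule has_weak_div_x_diff[OF So(1) yH(3) gv(1) dy(1) Lv(1) dy(2) Lv(2)])
  \<comment> \<open>Here the mixed derivative of \<open>v\<close> enters and gives the flux residual
    a square-integrable time derivative.\<close>
  have "has_weak_dt Q (grad_x Q v) (grad_x Q (dt Q v))"
    by (rule weak_grad_dt[OF So(1) gv(1) H(1) dtv(2) gv(2) H(2)])
  then have "has_weak_dt Q R (\<lambda>p. dt Q y p - grad_x Q (dt Q v) p)"
    unfolding R_def[abs_def] by (rule has_weak_dt_diff[OF So(1) yH(3) gv(1) dty(1) H(1) dty(2)])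
  then have RH: "R \<in> H_dt Q" using RL L2_diff[OF dty(1) H(1)] by (auto simp: H_dt_def)
  define S where "S = dt Q R"
  have S: "S \<in> L2 ?L" "has_weak_dt Q R S" unfolding S_def by (rule dt_has_weak_dt[OF RH])+
  \<comment> \<open>The very trace that \<open>norm_\<Sigma>T\<close> selects; the existence lemma
    shows that the choice yields a trace.\<close>
  define r where "r = (SOME g. has_time_trace \<Omega> T T R g)"
  have "has_time_trace \<Omega> T T R r"
    unfolding r_def by (rule someI_ex[OF has_time_trace_exists[OF \<Omega> T RH[unfolded QS] less_imp_le[OF T] order_refl]])
  then have rt: "time_trace \<Omega> 0 T T (\<lambda>p. R p \<bullet> i) (\<lambda>p. S p \<bullet> i) (\<lambda>x. r x \<bullet> i)" if "i \<in> Basis" for i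
    unfolding S_def QS using that by (rule has_time_trace_component)
  define eT where "eT = (SOME g. has_time_trace \<Omega> T T e g)"
  have eH: "e \<in> H_dt Q" using eL gL X.wk by (auto simp: H_dt_def QS)
  have "has_time_trace \<Omega> T T e eT"
    unfolding eT_def by (rule someI_ex[OF has_time_trace_exists[OF \<Omega> T eH[unfolded QS] less_imp_le[OF T] order_refl]])
  then have eTt: "time_trace \<Omega> 0 T T e g eT" by (simp add: has_time_trace_iff g_def QS)
  have fL: "f \<in> L2 ?L" by (rule f)
  have \<rho>L: "\<rho> \<in> L2 ?L" unfolding \<rho>_def r_eq_def Q_def[symmetric] by (intro L2_add L2_diff fL dtv dy)
  \<comment> \<open>\<open>f\<close> is expressed by \<open>u\<close>; the Laplacian of
    \<open>v\<close> is added to complete \<open>- D p\<close> and subtracted again in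
    \<open>Z p\<close>.\<close>
  have \<rho>: "AE p in ?L. \<rho> p = g p - D p + Z p"
    using V(1) uf by eventually_elim (simp add: \<rho>_def r_eq_def Q_def[symmetric] g_def D_def Z_def)
  have split: "(\<integral>p. \<rho> p * w p \<partial>?L) = (\<integral>p. g p * w p \<partial>?L) - (\<integral>p. D p * w p \<partial>?L) + (\<integral>p. Z p * w p \<partial>?L)"
    if w: "w \<in> L2 ?L" for w
  proof -
    note i = L2_mult_integrable[OF _ w]
    have "(\<integral>p. \<rho> p * w p \<partial>?L) = (\<integral>p. g p * w p - D p * w p + Z p * w p \<partial>?L)"
    proof (rule integral_cong_AE)
      show "AE p in ?L. \<rho> p * w p = g p * w p - D p * w p + Z p * w p"
        using \<rho> by (rule eventually_mono) (simp only: left_diff_distrib distrib_right)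
    qed (intro borel_measurable_integrable i Bochner_Integration.integrable_add Bochner_Integration.integrable_diff \<rho>L gL DL ZL)+
    then show ?thesis by (simp add: i gL DL ZL)
  qed
  have q: "(\<integral>p. G p \<bullet> G p \<partial>?L) = (L2_norm ?L G)\<^sup>2" "(\<integral>p. g p * g p \<partial>?L) = (L2_norm ?L g)\<^sup>2"
    by (simp add: L2_norm_square dot_square_norm) (simp add: L2_norm_square power2_eq_square[of "g _"])
  have PT: "X.P T = - (\<integral>p. D p * g p \<partial>?L)" by (simp add: X.P_def QS)
  have PT0: "0 \<le> X.P T" by (rule X.P_nonneg) (use T in simp)
  have "L2_norm ?L e \<le> C_F * L2_norm ?L G"
    using C_F V(2) by (simp add: friedrichs_constant_def norm_Q_def Q_def[symmetric] G_def)
  then have "L2_norm ?L \<rho> * L2_norm ?L e \<le> L2_norm ?L \<rho> * (C_F * L2_norm ?L G)" by (intro mult_left_mono) auto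
  \<comment> \<open>Test with \<open>e\<close>: the time derivative gives half of the squared final
    norm, and zero lateral values allow \<open>D\<close> and \<open>Z\<close> to be integrated by
    parts.\<close>
  moreover have "(L2_norm ?L G)\<^sup>2 + (L2_norm (lebesgue_on \<Omega>) eT)\<^sup>2 / 2 = (\<integral>p. \<rho> p * e p \<partial>?L) + (\<integral>p. R p \<bullet> G p \<partial>?L)"
    using split[OF eL] X.energy[OF eTt] X.green[OF X.G X.D X.GD] X.green[OF RL[unfolded QS] ZL[unfolded QS] RZ[unfolded QS]] q(1)
    by (simp add: QS)
  ultimately have 1: "(L2_norm ?L G)\<^sup>2 + (L2_norm (lebesgue_on \<Omega>) eT)\<^sup>2 / 2
      \<le> L2_norm ?L \<rho> * (C_F * L2_norm ?L G) + L2_norm ?L R * L2_norm ?L G"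
    using L2_Cauchy_Schwarz_mult[OF \<rho>L eL] L2_Cauchy_Schwarz[OF RL GL] by linarith
  \<comment> \<open>Test with \<open>g\<close>: the term with \<open>D\<close> is
    \<open>X.P T\<close> by definition, half of the squared final gradient norm, and
    \<open>Z\<close> is left to \<open>residual_bound\<close>.\<close>
  have "- (\<integral>p. Z p * g p \<partial>?L) \<le> L2_norm (lebesgue_on \<Omega>) r * sqrt (2 * X.P T) - (\<integral>p. S p \<bullet> G p \<partial>?L)"
    using X.residual_bound[OF RL[unfolded QS] S(1)[unfolded QS] S(2)[unfolded QS] ZL[unfolded QS] RZ[unfolded QS] rt] by (simp add: QS)
  then have 2: "(L2_norm ?L g)\<^sup>2 + 2 * X.P T / 2
      \<le> L2_norm ?L \<rho> * L2_norm ?L g + L2_norm (lebesgue_on \<Omega>) r * sqrt (2 * X.P T) + L2_norm ?L S * L2_norm ?L G"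
    using split[OF gL] q(2) PT L2_Cauchy_Schwarz_mult[OF \<rho>L gL] L2_Cauchy_Schwarz[OF S(1) GL] by linarith
  have "(grad_norm_\<Sigma>T \<Omega> T e)\<^sup>2 = 2 * X.P T"
    using X.final_gradient_energy PT0 by (simp add: grad_norm_\<Sigma>T_def Q_def[symmetric] G_def)
  moreover have "r_d \<Omega> T v y = R" by (simp add: r_d_def R_def[abs_def] Q_def)
  moreover have "lam * ((L2_norm ?L G)\<^sup>2 + (L2_norm (lebesgue_on \<Omega>) eT)\<^sup>2 / 2) + mu * ((L2_norm ?L g)\<^sup>2 + 2 * X.P T / 2)
      \<le> lam * (L2_norm ?L \<rho> * (C_F * L2_norm ?L G) + L2_norm ?L R * L2_norm ?L G)
        + mu * (L2_norm ?L \<rho> * L2_norm ?L g + L2_norm (lebesgue_on \<Omega>) r * sqrt (2 * X.P T) + L2_norm ?L S * L2_norm ?L G)"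
    using lam mu by (intro add_mono mult_left_mono 1 2) auto
  note majorant_arithmetic[OF lam mu zeta eps alpha beta _ this]
  ultimately show ?thesis
    using PT0 unfolding norm_Q_def norm_\<Sigma>T_def majorant_def Q_def[symmetric] G_def[symmetric] g_def[symmetric] \<rho>_def[symmetric] eT_def[symmetric]
    by (simp add: r_def S_def)
qed

end
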